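(* Let $\mathcal{C}$ be a coherent sheaf on $X$, $\mathcal{B}\subset\mathcal{C}$ a coherent subsheaf, and $U$ the short exact sequence $0\to\mathcal{B}\to\mathcal{C}\to\mathcal{C}/\mathcal{B}\to0$. Let $\mathcal{F},\mathcal{G}$ be coherent sheaves on $X$ and $p\ge1$. (1) The obstruction to an extension of the string $\mathbf{R}\in\mathrm{Ext}^p(\mathcal{B},\mathcal{G})$ to a string from $\mathcal{C}$ to $\mathcal{G}$ is $\mathbf{R}\star U\in\mathrm{Ext}^{p+1}(\mathcal{C}/\mathcal{B},\mathcal{G})$; that is, $\mathbf{R}$ lies in the image of the map $\mathrm{Ext}^p(\mathcal{C},\mathcal{G})\to\mathrm{Ext}^p(\mathcal{B},\mathcal{G})$ induced by the inclusion $\mathcal{B}\to\mathcal{C}$ if and only if $\mathbf{R}\star U=0$. (2) The obstruction to a lift of the string $\mathbf{T}\in\mathrm{Ext}^p(\mathcal{F},\mathcal{C}/\mathcal{B})$ to a string from $\mathcal{F}$ to $\mathcal{C}$ is $U\star\mathbf{T}\in\mathrm{Ext}^{p+1}(\mathcal{F},\mathcal{B})$; that is, $\mathbf{T}$ lies in the image of the map $\mathrm{Ext}^p(\mathcal{F},\mathcal{C})\to\mathrm{Ext}^p(\mathcal{F},\mathcal{C}/\mathcal{B})$ induced by the projection $\mathcal{C}\to\mathcal{C}/\mathcal{B}$ if and only if $U\star\mathbf{T}=0$.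
   Context: $X$ is a compact Kähler manifold, and $\mathfrak{Coh}(X)$ is the abelian category of coherent sheaves on $X$. A $p$-extension of $\mathcal{G}$ by $\mathcal{F}$ is an exact sequence $\mathbf{S}:0\to\mathcal{G}\to\mathcal{H}_{p-1}\to\dots\to\mathcal{H}_0\to\mathcal{F}\to0$ in $\mathfrak{Coh}(X)$. The Yoneda composite $\star$ of an extension ending at $\mathcal{K}$ on the right with one starting at $\mathcal{K}$ on the left is obtained by splicing the two exact sequences at $\mathcal{K}$; every $p$-extension is a composite $S_p\star\dots\star S_1$ of short exact sequences. For a short extension $S$ of $\mathcal{G}$ by $\mathcal{F}$, $\alpha:\mathcal{G}\to\mathcal{G}'$ and $\gamma:\mathcal{F}'\to\mathcal{F}$, $\alpha S$ is the pushout extension and $S\gamma$ the pullback extension; for longer extensions $\alpha\mathbf{S}=(\alpha S_p)\star\dots\star S_1$ and $\mathbf{S}\gamma=S_p\star\dots\star(S_1\gamma)$, and these give the induced maps on Ext groups. $\mathrm{Ext}^p(\mathcal{F},\mathcal{G})$ is the Yoneda group of $p$-extensions of $\mathcal{G}$ by $\mathcal{F}$ modulo the equivalence relation generated by isomorphism of short exact sequences with identity on the ends and the switches between $(S\beta)\star S'$ and $S\star(\beta S')$. *)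

theory Defs
  imports "HOL-Analysis.Analysis" "HOL-Algebra.Module"
begin

section \<open>Complex manifolds\<close>

text \<open>The space of complex \<open>n\<close>-tuples, for a number \<open>n\<close> (possibly \<open>0\<close>), is modelled by
  the sequences supported on \<open>{..<n}\<close>; the subspace topology of the product topology is the usual one.\<close>

definition cspace :: "nat \<Rightarrow> (nat \<Rightarrow> complex) set" where
  "cspace n = {z. \<forall>i\<ge>n. z i = 0}"

definition holo_on :: "nat \<Rightarrow> (nat \<Rightarrow> complex) set \<Rightarrow> ((nat \<Rightarrow> complex) \<Rightarrow> complex) \<Rightarrow> bool" where
  "holo_on n W f \<longleftrightarrow>
     openin (top_of_set (cspace n)) W \<and> continuous_on W f \<and>
     (\<forall>z\<in>W. \<forall>i<n. (\<lambda>w. f (z(i := w))) field_differentiable (at (z i)))"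

text \<open>Functions of class $C^k$ in the \<open>2 * n\<close> real coordinates: the partial derivative in the
  direction \<open>d = 1\<close> (resp. \<open>d = \<i>\<close>) at the index \<open>i\<close> is the derivative with respect to the real
  (resp. imaginary) part of the \<open>i\<close>-th coordinate.\<close>

primrec Ck_on :: "nat \<Rightarrow> nat \<Rightarrow> (nat \<Rightarrow> complex) set \<Rightarrow> ((nat \<Rightarrow> complex) \<Rightarrow> complex) \<Rightarrow> bool" where
  "Ck_on 0 n W f \<longleftrightarrow> continuous_on W f"
| "Ck_on (Suc k) n W f \<longleftrightarrow>
     continuous_on W f \<and>
     (\<forall>i<n. \<forall>d\<in>{1, \<i>}. \<exists>g.
        (\<forall>z\<in>W. ((\<lambda>t. f (z(i := z i + of_real t * d))) has_vector_derivative g z) (at 0)) \<and>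
        Ck_on k n W g)"

definition smooth_on :: "nat \<Rightarrow> (nat \<Rightarrow> complex) set \<Rightarrow> ((nat \<Rightarrow> complex) \<Rightarrow> complex) \<Rightarrow> bool" where
  "smooth_on n W f \<longleftrightarrow> (\<forall>k. Ck_on k n W f)"

type_synonym 'x chart = "'x set \<times> ('x \<Rightarrow> nat \<Rightarrow> complex)"

definition complex_manifold :: "'x topology \<Rightarrow> nat \<Rightarrow> 'x chart set \<Rightarrow> bool" where
  "complex_manifold M n \<A> \<longleftrightarrow>
     Hausdorff_space M \<and> second_countable M \<and>
     (\<Union>(U, \<phi>)\<in>\<A>. U) = topspace M \<and>
     (\<forall>(U, \<phi>)\<in>\<A>. openin M U \<and> openin (top_of_set (cspace n)) (\<phi> ` U) \<and>
        homeomorphic_map (subtopology M U) (top_of_set (\<phi> ` U)) \<phi>) \<and>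
     (\<forall>(U, \<phi>)\<in>\<A>. \<forall>(V, \<psi>)\<in>\<A>. \<forall>k<n.
        holo_on n (\<phi> ` (U \<inter> V)) (\<lambda>z. \<psi> (inv_into U \<phi> z) k))"

subsection \<open>Kaehler metrics\<close>

definition sesq :: "nat \<Rightarrow> (nat \<Rightarrow> nat \<Rightarrow> complex) \<Rightarrow> (nat \<Rightarrow> complex) \<Rightarrow> (nat \<Rightarrow> complex) \<Rightarrow> complex" where
  "sesq n h u v = (\<Sum>j<n. \<Sum>k<n. h j k * u j * cnj (v k))"

definition transition_deriv ::
    "nat \<Rightarrow> 'x chart \<Rightarrow> 'x chart \<Rightarrow> (nat \<Rightarrow> complex) \<Rightarrow> (nat \<Rightarrow> complex) \<Rightarrow> nat \<Rightarrow> complex" where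
  "transition_deriv n = (\<lambda>(U, \<phi>) (V, \<psi>) z u k.
     \<Sum>i<n. deriv (\<lambda>w. \<psi> (inv_into U \<phi> (z(i := w))) k) (z i) * u i)"

definition hermitian_metric ::
    "'x topology \<Rightarrow> nat \<Rightarrow> 'x chart set \<Rightarrow> ('x chart \<Rightarrow> (nat \<Rightarrow> complex) \<Rightarrow> nat \<Rightarrow> nat \<Rightarrow> complex) \<Rightarrow> bool" where
  "hermitian_metric M n \<A> h \<longleftrightarrow>
     (\<forall>(U, \<phi>)\<in>\<A>.
        (\<forall>j<n. \<forall>k<n. smooth_on n (\<phi> ` U) (\<lambda>z. h (U, \<phi>) z j k)) \<and>
        (\<forall>z\<in>\<phi> ` U.
           (\<forall>j<n. \<forall>k<n. h (U, \<phi>) z k j = cnj (h (U, \<phi>) z j k)) \<and>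
           (\<forall>u\<in>cspace n. u \<noteq> (\<lambda>_. 0) \<longrightarrow> Re (sesq n (h (U, \<phi>) z) u u) > 0))) \<and>
     (\<forall>(U, \<phi>)\<in>\<A>. \<forall>(V, \<psi>)\<in>\<A>. \<forall>x\<in>U \<inter> V. \<forall>u\<in>cspace n. \<forall>v\<in>cspace n.
        sesq n (h (U, \<phi>) (\<phi> x)) u v =
        sesq n (h (V, \<psi>) (\<psi> x))
          (transition_deriv n (U, \<phi>) (V, \<psi>) (\<phi> x) u)
          (transition_deriv n (U, \<phi>) (V, \<psi>) (\<phi> x) v))"

definition fundamental_form ::
    "nat \<Rightarrow> ((nat \<Rightarrow> complex) \<Rightarrow> nat \<Rightarrow> nat \<Rightarrow> complex) \<Rightarrow>
     (nat \<Rightarrow> complex) \<Rightarrow> (nat \<Rightarrow> complex) \<Rightarrow> (nat \<Rightarrow> complex) \<Rightarrow> real" where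
  "fundamental_form n h z u v = - Im (sesq n (h z) u v)"

text \<open>The exterior derivative of a 2-form, evaluated on constant vector fields (whose Lie brackets
  vanish).\<close>

definition ext_deriv ::
    "((nat \<Rightarrow> complex) \<Rightarrow> (nat \<Rightarrow> complex) \<Rightarrow> (nat \<Rightarrow> complex) \<Rightarrow> real) \<Rightarrow>
     (nat \<Rightarrow> complex) \<Rightarrow> (nat \<Rightarrow> complex) \<Rightarrow> (nat \<Rightarrow> complex) \<Rightarrow> (nat \<Rightarrow> complex) \<Rightarrow> real" where
  "ext_deriv \<omega> z u v w =
     (let D = (\<lambda>u v w. deriv (\<lambda>t. \<omega> (\<lambda>i. z i + of_real t * u i) v w) 0)
      in D u v w + D v w u + D w u v)"

definition kaehler_manifold :: "'x topology \<Rightarrow> nat \<Rightarrow> 'x chart set \<Rightarrow> bool" where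
  "kaehler_manifold M n \<A> \<longleftrightarrow>
     complex_manifold M n \<A> \<and>
     (\<exists>h. hermitian_metric M n \<A> h \<and>
        (\<forall>(U, \<phi>)\<in>\<A>. \<forall>z\<in>\<phi> ` U. \<forall>u\<in>cspace n. \<forall>v\<in>cspace n. \<forall>w\<in>cspace n.
           ext_deriv (fundamental_form n (h (U, \<phi>))) z u v w = 0))"

definition compact_kaehler_manifold :: "'x topology \<Rightarrow> nat \<Rightarrow> 'x chart set \<Rightarrow> bool" where
  "compact_kaehler_manifold M n \<A> \<longleftrightarrow> kaehler_manifold M n \<A> \<and> compact_space M"

section \<open>Ringed spaces and the structure sheaf\<close>

text \<open>A sheaf is given by its \'etal\'e space: the family of its stalks together with a topology on
  their disjoint union, for which the projection to the base is a local homeomorphism.\<close>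

record ('x, 'r) ringed_space =
  base :: "'x topology"
  ostalk :: "'x \<Rightarrow> 'r ring"
  oetale :: "('x \<times> 'r) topology"

definition holomorphic_fun :: "'x topology \<Rightarrow> nat \<Rightarrow> 'x chart set \<Rightarrow> 'x set \<Rightarrow> ('x \<Rightarrow> complex) \<Rightarrow> bool" where
  "holomorphic_fun M n \<A> W f \<longleftrightarrow>
     openin M W \<and> (\<forall>(U, \<phi>)\<in>\<A>. holo_on n (\<phi> ` (U \<inter> W)) (\<lambda>z. f (inv_into U \<phi> z)))"

text \<open>A germ at \<open>x\<close> is represented by the set of all total functions that agree near \<open>x\<close>.\<close>

definition germ :: "'x topology \<Rightarrow> 'x \<Rightarrow> ('x \<Rightarrow> complex) \<Rightarrow> ('x \<Rightarrow> complex) set" where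
  "germ M x f = {g. \<exists>W. openin M W \<and> x \<in> W \<and> (\<forall>y\<in>W. g y = f y)}"

definition germ_ring :: "'x topology \<Rightarrow> nat \<Rightarrow> 'x chart set \<Rightarrow> 'x \<Rightarrow> ('x \<Rightarrow> complex) set ring" where
  "germ_ring M n \<A> x =
     \<lparr> carrier = {germ M x f | f. \<exists>W. x \<in> W \<and> holomorphic_fun M n \<A> W f},
       mult = (\<lambda>a b. \<Union>f\<in>a. \<Union>g\<in>b. germ M x (\<lambda>y. f y * g y)),
       one = germ M x (\<lambda>_. 1),
       zero = germ M x (\<lambda>_. 0),
       add = (\<lambda>a b. \<Union>f\<in>a. \<Union>g\<in>b. germ M x (\<lambda>y. f y + g y)) \<rparr>"

definition manifold_space ::
    "'x topology \<Rightarrow> nat \<Rightarrow> 'x chart set \<Rightarrow> ('x, ('x \<Rightarrow> complex) set) ringed_space" where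
  "manifold_space M n \<A> =
     \<lparr> base = M,
       ostalk = germ_ring M n \<A>,
       oetale = topology_generated_by
         {(\<lambda>y. (y, germ M y f)) ` W | W f. holomorphic_fun M n \<A> W f} \<rparr>"

section \<open>Sheaves of modules and coherent sheaves\<close>

text \<open>The multiplication and unit fields that \<^typ>\<open>('r, 'u) module\<close> inherits from rings carry no
  meaning for a stalk.\<close>

record ('x, 'r, 'u) osheaf =
  stalk :: "'x \<Rightarrow> ('r, 'u) module"
  etale :: "('x \<times> 'u) topology"

definition etale_space :: "'x topology \<Rightarrow> ('x \<Rightarrow> 'u set) \<Rightarrow> ('x \<times> 'u) topology \<Rightarrow> bool" where
  "etale_space M S E \<longleftrightarrow>
     topspace E = Sigma (topspace M) S \<and>
     (\<forall>e\<in>topspace E. \<exists>V. openin E V \<and> e \<in> V \<and> openin M (fst ` V) \<and>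
        homeomorphic_map (subtopology E V) (subtopology M (fst ` V)) fst)"

definition module_sheaf :: "('x, 'r) ringed_space \<Rightarrow> ('x, 'r, 'u) osheaf \<Rightarrow> bool" where
  "module_sheaf X A \<longleftrightarrow>
     etale_space (base X) (\<lambda>x. carrier (stalk A x)) (etale A) \<and>
     (\<forall>x\<in>topspace (base X). module (ostalk X x) (stalk A x)) \<and>
     continuous_map
       (subtopology (prod_topology (etale A) (etale A)) {(a, b). fst a = fst b}) (etale A)
       (\<lambda>((x, a), (_, b)). (x, a \<oplus>\<^bsub>stalk A x\<^esub> b)) \<and>
     continuous_map
       (subtopology (prod_topology (oetale X) (etale A)) {(r, b). fst r = fst b}) (etale A)
       (\<lambda>((x, r), (_, b)). (x, r \<odot>\<^bsub>stalk A x\<^esub> b))"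

text \<open>Sections over \<open>U\<close>; their values outside \<open>U\<close> are irrelevant.\<close>

definition sections :: "'x topology \<Rightarrow> ('x \<times> 'u) topology \<Rightarrow> 'x set \<Rightarrow> ('x \<Rightarrow> 'u) set" where
  "sections M E U = {s. continuous_map (subtopology M U) E (\<lambda>x. (x, s x))}"

definition finite_type :: "('x, 'r) ringed_space \<Rightarrow> ('x, 'r, 'u) osheaf \<Rightarrow> bool" where
  "finite_type X A \<longleftrightarrow>
     (\<forall>x\<in>topspace (base X). \<exists>U (k::nat) s.
        openin (base X) U \<and> x \<in> U \<and> (\<forall>i<k. s i \<in> sections (base X) (etale A) U) \<and>
        (\<forall>y\<in>U. carrier (stalk A y) =
           {(\<Oplus>\<^bsub>stalk A y\<^esub> i\<in>{..<k}. a i \<odot>\<^bsub>stalk A y\<^esub> s i y) | a.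
              a \<in> {..<k} \<rightarrow> carrier (ostalk X y)}))"

text \<open>For all finitely many sections over an open set, the sheaf of relations between them is of
  finite type.\<close>

definition relations_finite_type :: "('x, 'r) ringed_space \<Rightarrow> ('x, 'r, 'u) osheaf \<Rightarrow> bool" where
  "relations_finite_type X A \<longleftrightarrow>
     (\<forall>U (k::nat) s. openin (base X) U \<and> (\<forall>i<k. s i \<in> sections (base X) (etale A) U) \<longrightarrow>
        (\<forall>x\<in>U. \<exists>V (m::nat) r.
           openin (base X) V \<and> x \<in> V \<and> V \<subseteq> U \<and>
           (\<forall>j<m. \<forall>i<k. r j i \<in> sections (base X) (oetale X) V) \<and>
           (\<forall>y\<in>V.
              {g \<in> {..<k} \<rightarrow>\<^sub>E carrier (ostalk X y).
                 (\<Oplus>\<^bsub>stalk A y\<^esub> i\<in>{..<k}. g i \<odot>\<^bsub>stalk A y\<^esub> s i y) = \<zero>\<^bsub>stalk A y\<^esub>} =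
              {(\<lambda>i\<in>{..<k}. \<Oplus>\<^bsub>ostalk X y\<^esub> j\<in>{..<m}. b j \<otimes>\<^bsub>ostalk X y\<^esub> r j i y) | b.
                 b \<in> {..<m} \<rightarrow> carrier (ostalk X y)})))"

definition coherent :: "('x, 'r) ringed_space \<Rightarrow> ('x, 'r, 'u) osheaf \<Rightarrow> bool" where
  "coherent X A \<longleftrightarrow> module_sheaf X A \<and> finite_type X A \<and> relations_finite_type X A"

subsection \<open>Morphisms\<close>

text \<open>A morphism is its family of stalk maps, taken to be \<^const>\<open>undefined\<close> off the stalks, so
  that equality of morphisms is equality in HOL.\<close>

type_synonym ('x, 'u) smap = "'x \<Rightarrow> 'u \<Rightarrow> 'u"

definition sheaf_hom ::
    "('x, 'r) ringed_space \<Rightarrow> ('x, 'r, 'u) osheaf \<Rightarrow> ('x, 'r, 'u) osheaf \<Rightarrow> ('x, 'u) smap set" where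
  "sheaf_hom X A B =
     {f \<in> (\<Pi>\<^sub>E x\<in>topspace (base X). carrier (stalk A x) \<rightarrow>\<^sub>E carrier (stalk B x)).
        continuous_map (etale A) (etale B) (\<lambda>(x, a). (x, f x a)) \<and>
        (\<forall>x\<in>topspace (base X).
           (\<forall>a\<in>carrier (stalk A x). \<forall>b\<in>carrier (stalk A x).
              f x (a \<oplus>\<^bsub>stalk A x\<^esub> b) = f x a \<oplus>\<^bsub>stalk B x\<^esub> f x b) \<and>
           (\<forall>r\<in>carrier (ostalk X x). \<forall>a\<in>carrier (stalk A x).
              f x (r \<odot>\<^bsub>stalk A x\<^esub> a) = r \<odot>\<^bsub>stalk B x\<^esub> f x a))}"

definition sheaf_id :: "('x, 'r) ringed_space \<Rightarrow> ('x, 'r, 'u) osheaf \<Rightarrow> ('x, 'u) smap" where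
  "sheaf_id X A = (\<lambda>x\<in>topspace (base X). \<lambda>a\<in>carrier (stalk A x). a)"

definition sheaf_comp ::
    "('x, 'r) ringed_space \<Rightarrow> ('x, 'r, 'u) osheaf \<Rightarrow> ('x, 'u) smap \<Rightarrow> ('x, 'u) smap \<Rightarrow> ('x, 'u) smap" where
  "sheaf_comp X A g f = (\<lambda>x\<in>topspace (base X). compose (carrier (stalk A x)) (g x) (f x))"

definition zero_hom ::
    "('x, 'r) ringed_space \<Rightarrow> ('x, 'r, 'u) osheaf \<Rightarrow> ('x, 'r, 'u) osheaf \<Rightarrow> ('x, 'u) smap" where
  "zero_hom X A B = (\<lambda>x\<in>topspace (base X). \<lambda>a\<in>carrier (stalk A x). \<zero>\<^bsub>stalk B x\<^esub>)"

definition zero_sheaf :: "('x, 'r) ringed_space \<Rightarrow> ('x, 'r, 'u) osheaf" where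
  "zero_sheaf X =
     \<lparr> stalk = (\<lambda>_. \<lparr> carrier = {undefined}, mult = (\<lambda>_ _. undefined), one = undefined,
                     zero = undefined, add = (\<lambda>_ _. undefined), smult = (\<lambda>_ _. undefined) \<rparr>),
       etale = pullback_topology (topspace (base X) \<times> {undefined}) fst (base X) \<rparr>"

definition sheaf_ker :: "('x, 'r, 'u) osheaf \<Rightarrow> ('x, 'r, 'u) osheaf \<Rightarrow> ('x, 'u) smap \<Rightarrow> 'x \<Rightarrow> 'u set" where
  "sheaf_ker A B f x = {a \<in> carrier (stalk A x). f x a = \<zero>\<^bsub>stalk B x\<^esub>}"

definition sheaf_iso ::
    "('x, 'r) ringed_space \<Rightarrow> ('x, 'r, 'u) osheaf \<Rightarrow> ('x, 'r, 'u) osheaf \<Rightarrow> ('x, 'u) smap \<Rightarrow> bool" where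
  "sheaf_iso X A B f \<longleftrightarrow>
     f \<in> sheaf_hom X A B \<and>
     (\<exists>g\<in>sheaf_hom X B A. sheaf_comp X A g f = sheaf_id X A \<and> sheaf_comp X B f g = sheaf_id X B)"

text \<open>If the stalks of \<open>B\<close> are subsets of those of \<open>C\<close>, the inclusion of \<open>B\<close> into \<open>C\<close> is
  \<^term>\<open>sheaf_id X B\<close>.\<close>

definition subsheaf :: "('x, 'r) ringed_space \<Rightarrow> ('x, 'r, 'u) osheaf \<Rightarrow> ('x, 'r, 'u) osheaf \<Rightarrow> bool" where
  "subsheaf X B C \<longleftrightarrow>
     (\<forall>x\<in>topspace (base X). carrier (stalk B x) \<subseteq> carrier (stalk C x)) \<and>
     sheaf_id X B \<in> sheaf_hom X B C"

text \<open>The sheaf \<open>Q\<close> with the projection \<open>\<pi>\<close> is a quotient of \<open>C\<close> by the subsheaf \<open>B\<close>; this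
  determines \<open>(Q, \<pi>)\<close> up to a unique isomorphism.\<close>

definition quotient_sheaf ::
    "('x, 'r) ringed_space \<Rightarrow> ('x, 'r, 'u) osheaf \<Rightarrow> ('x, 'r, 'u) osheaf \<Rightarrow>
     ('x, 'r, 'u) osheaf \<Rightarrow> ('x, 'u) smap \<Rightarrow> bool" where
  "quotient_sheaf X C B Q \<pi> \<longleftrightarrow>
     module_sheaf X Q \<and> \<pi> \<in> sheaf_hom X C Q \<and>
     (\<forall>x\<in>topspace (base X).
        \<pi> x ` carrier (stalk C x) = carrier (stalk Q x) \<and>
        sheaf_ker C Q \<pi> x = carrier (stalk B x))"

definition pullback_square ::
    "('x, 'r) ringed_space \<Rightarrow> ('x, 'r, 'u) osheaf \<Rightarrow> ('x, 'r, 'u) osheaf \<Rightarrow> ('x, 'r, 'u) osheaf \<Rightarrow>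
     ('x, 'u) smap \<Rightarrow> ('x, 'u) smap \<Rightarrow> ('x, 'r, 'u) osheaf \<Rightarrow> ('x, 'u) smap \<Rightarrow> ('x, 'u) smap \<Rightarrow> bool" where
  "pullback_square X A A' D f f' P p p' \<longleftrightarrow>
     coherent X P \<and> p \<in> sheaf_hom X P A \<and> p' \<in> sheaf_hom X P A' \<and>
     sheaf_comp X P f p = sheaf_comp X P f' p' \<and>
     (\<forall>T a a'. coherent X T \<and> a \<in> sheaf_hom X T A \<and> a' \<in> sheaf_hom X T A' \<and>
        sheaf_comp X T f a = sheaf_comp X T f' a' \<longrightarrow>
        (\<exists>!h. h \<in> sheaf_hom X T P \<and> sheaf_comp X T p h = a \<and> sheaf_comp X T p' h = a'))"

definition pushout_square ::
    "('x, 'r) ringed_space \<Rightarrow> ('x, 'r, 'u) osheaf \<Rightarrow> ('x, 'r, 'u) osheaf \<Rightarrow> ('x, 'r, 'u) osheaf \<Rightarrow>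
     ('x, 'u) smap \<Rightarrow> ('x, 'u) smap \<Rightarrow> ('x, 'r, 'u) osheaf \<Rightarrow> ('x, 'u) smap \<Rightarrow> ('x, 'u) smap \<Rightarrow> bool" where
  "pushout_square X D A A' f f' P p p' \<longleftrightarrow>
     coherent X P \<and> p \<in> sheaf_hom X A P \<and> p' \<in> sheaf_hom X A' P \<and>
     sheaf_comp X D p f = sheaf_comp X D p' f' \<and>
     (\<forall>T a a'. coherent X T \<and> a \<in> sheaf_hom X A T \<and> a' \<in> sheaf_hom X A' T \<and>
        sheaf_comp X D a f = sheaf_comp X D a' f' \<longrightarrow>
        (\<exists>!h. h \<in> sheaf_hom X P T \<and> sheaf_comp X A h p = a \<and> sheaf_comp X A' h p' = a'))"

section \<open>Extensions\<close>

text \<open>An exact sequence $0 \to G \to H_{p-1} \to \dots \to H_0 \to F \to 0$ is recorded by its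
  objects $[G, H_{p-1}, \dots, H_0, F]$ and the maps between consecutive objects, read from left to
  right.\<close>

record ('x, 'r, 'u) extn =
  objs :: "('x, 'r, 'u) osheaf list"
  maps :: "('x, 'u) smap list"

definition is_extn ::
    "('x, 'r) ringed_space \<Rightarrow> nat \<Rightarrow> ('x, 'r, 'u) osheaf \<Rightarrow> ('x, 'r, 'u) osheaf \<Rightarrow> ('x, 'r, 'u) extn \<Rightarrow> bool" where
  "is_extn X p F G E \<longleftrightarrow>
     p \<ge> 1 \<and> length (objs E) = p + 2 \<and> length (maps E) = p + 1 \<and>
     hd (objs E) = G \<and> last (objs E) = F \<and>
     (\<forall>A\<in>set (objs E). coherent X A) \<and>
     (\<forall>i\<le>p. maps E ! i \<in> sheaf_hom X (objs E ! i) (objs E ! Suc i)) \<and>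
     (\<forall>x\<in>topspace (base X).
        inj_on (hd (maps E) x) (carrier (stalk G x)) \<and>
        (\<forall>i<p. (maps E ! i) x ` carrier (stalk (objs E ! i) x) =
                 sheaf_ker (objs E ! Suc i) (objs E ! Suc (Suc i)) (maps E ! Suc i) x) \<and>
        last (maps E) x ` carrier (stalk (objs E ! p) x) = carrier (stalk F x))"

abbreviation short :: "('x, 'r, 'u) osheaf \<Rightarrow> ('x, 'u) smap \<Rightarrow> ('x, 'r, 'u) osheaf \<Rightarrow> ('x, 'u) smap \<Rightarrow>
    ('x, 'r, 'u) osheaf \<Rightarrow> ('x, 'r, 'u) extn" where
  "short G i H q F \<equiv> \<lparr> objs = [G, H, F], maps = [i, q] \<rparr>"

text \<open>For \<open>S\<close> ending at \<open>K\<close> and \<open>T\<close> starting at \<open>K\<close>, the object \<open>K\<close> is removed and the two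
  adjacent maps are composed.\<close>

definition yoneda :: "('x, 'r) ringed_space \<Rightarrow> ('x, 'r, 'u) extn \<Rightarrow> ('x, 'r, 'u) extn \<Rightarrow> ('x, 'r, 'u) extn" where
  "yoneda X S T =
     \<lparr> objs = butlast (objs S) @ tl (objs T),
       maps = butlast (maps S) @
              [sheaf_comp X (last (butlast (objs S))) (hd (maps T)) (last (maps S))] @
              tl (maps T) \<rparr>"

definition short_iso :: "('x, 'r) ringed_space \<Rightarrow> ('x, 'r, 'u) extn \<Rightarrow> ('x, 'r, 'u) extn \<Rightarrow> bool" where
  "short_iso X S S' \<longleftrightarrow>
     (\<exists>G i H q F i' H' q' m.
        S = short G i H q F \<and> S' = short G i' H' q' F \<and>
        is_extn X 1 F G S \<and> is_extn X 1 F G S' \<and>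
        sheaf_iso X H H' m \<and> sheaf_comp X G m i = i' \<and> sheaf_comp X H q' m = q)"

text \<open>\<open>pushout_short X \<alpha> G' S S'\<close>: for \<open>\<alpha> : G \<rightarrow> G'\<close>, \<open>S'\<close> is a pushout extension \<open>\<alpha> S\<close>.
  Pushouts being determined only up to isomorphism, this is a relation.\<close>

definition pushout_short ::
    "('x, 'r) ringed_space \<Rightarrow> ('x, 'u) smap \<Rightarrow> ('x, 'r, 'u) osheaf \<Rightarrow>
     ('x, 'r, 'u) extn \<Rightarrow> ('x, 'r, 'u) extn \<Rightarrow> bool" where
  "pushout_short X \<alpha> G' S S' \<longleftrightarrow>
     (\<exists>G i H q F i' H' q' m.
        S = short G i H q F \<and> S' = short G' i' H' q' F \<and>
        is_extn X 1 F G S \<and> is_extn X 1 F G' S' \<and> \<alpha> \<in> sheaf_hom X G G' \<and>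
        pushout_square X G H G' i \<alpha> H' m i' \<and> sheaf_comp X H q' m = q)"

definition pullback_short ::
    "('x, 'r) ringed_space \<Rightarrow> ('x, 'u) smap \<Rightarrow> ('x, 'r, 'u) osheaf \<Rightarrow>
     ('x, 'r, 'u) extn \<Rightarrow> ('x, 'r, 'u) extn \<Rightarrow> bool" where
  "pullback_short X \<gamma> F' S S' \<longleftrightarrow>
     (\<exists>G i H q F i' H' q' m.
        S = short G i H q F \<and> S' = short G i' H' q' F' \<and>
        is_extn X 1 F G S \<and> is_extn X 1 F' G S' \<and> \<gamma> \<in> sheaf_hom X F' F \<and>
        pullback_square X H F' F q \<gamma> H' m q' \<and> sheaf_comp X G m i' = i)"

definition pushout_extn ::
    "('x, 'r) ringed_space \<Rightarrow> ('x, 'u) smap \<Rightarrow> ('x, 'r, 'u) osheaf \<Rightarrow>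
     ('x, 'r, 'u) extn \<Rightarrow> ('x, 'r, 'u) extn \<Rightarrow> bool" where
  "pushout_extn X \<alpha> G' E E' \<longleftrightarrow>
     pushout_short X \<alpha> G' E E' \<or>
     (\<exists>G K F q S S' T. is_extn X 1 K G S \<and> is_extn X q F K T \<and>
        pushout_short X \<alpha> G' S S' \<and> E = yoneda X S T \<and> E' = yoneda X S' T)"

definition pullback_extn ::
    "('x, 'r) ringed_space \<Rightarrow> ('x, 'u) smap \<Rightarrow> ('x, 'r, 'u) osheaf \<Rightarrow>
     ('x, 'r, 'u) extn \<Rightarrow> ('x, 'r, 'u) extn \<Rightarrow> bool" where
  "pullback_extn X \<gamma> F' E E' \<longleftrightarrow>
     pullback_short X \<gamma> F' E E' \<or>
     (\<exists>G K F q S S' T. is_extn X 1 F K S \<and> is_extn X q K G T \<and>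
        pullback_short X \<gamma> F' S S' \<and> E = yoneda X T S \<and> E' = yoneda X T S')"

section \<open>Yoneda Ext\<close>

inductive extn_step :: "('x, 'r) ringed_space \<Rightarrow> ('x, 'r, 'u) extn \<Rightarrow> ('x, 'r, 'u) extn \<Rightarrow> bool"
  for X where
  iso: "short_iso X S S' \<Longrightarrow> extn_step X S S'"
| switch: "\<lbrakk>is_extn X 1 K G S; is_extn X 1 F K' S'; \<beta> \<in> sheaf_hom X K' K;
            pullback_short X \<beta> K' S S\<beta>; pushout_short X \<beta> K S' \<beta>S'\<rbrakk>
           \<Longrightarrow> extn_step X (yoneda X S\<beta> S') (yoneda X S \<beta>S')"
| left: "\<lbrakk>extn_step X E E'; is_extn X q F K E; is_extn X q F K E'; is_extn X p K G T\<rbrakk>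
         \<Longrightarrow> extn_step X (yoneda X T E) (yoneda X T E')"
| right: "\<lbrakk>extn_step X E E'; is_extn X q K G E; is_extn X q K G E'; is_extn X p F K T\<rbrakk>
          \<Longrightarrow> extn_step X (yoneda X E T) (yoneda X E' T)"

definition ext_class :: "('x, 'r) ringed_space \<Rightarrow> ('x, 'r, 'u) extn \<Rightarrow> ('x, 'r, 'u) extn set" where
  "ext_class X E = {E'. equivclp (extn_step X) E E'}"

definition Ext ::
    "('x, 'r) ringed_space \<Rightarrow> nat \<Rightarrow> ('x, 'r, 'u) osheaf \<Rightarrow> ('x, 'r, 'u) osheaf \<Rightarrow> ('x, 'r, 'u) extn set set" where
  "Ext X p F G = ext_class X ` {E. is_extn X p F G E}"

text \<open>The operations on classes are defined as unions over all representatives and all choices of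
  pushouts and pullbacks; such a union is a class exactly if the operation is well defined.\<close>

definition ext_star ::
    "('x, 'r) ringed_space \<Rightarrow> ('x, 'r, 'u) extn set \<Rightarrow> ('x, 'r, 'u) extn set \<Rightarrow> ('x, 'r, 'u) extn set" where
  "ext_star X \<xi> \<eta> = (\<Union>S\<in>\<xi>. \<Union>T\<in>\<eta>. ext_class X (yoneda X S T))"

definition ext_push ::
    "('x, 'r) ringed_space \<Rightarrow> ('x, 'u) smap \<Rightarrow> ('x, 'r, 'u) osheaf \<Rightarrow>
     ('x, 'r, 'u) extn set \<Rightarrow> ('x, 'r, 'u) extn set" where
  "ext_push X \<alpha> G' \<xi> = (\<Union>E\<in>\<xi>. \<Union>E'\<in>{E'. pushout_extn X \<alpha> G' E E'}. ext_class X E')"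

definition ext_pull ::
    "('x, 'r) ringed_space \<Rightarrow> ('x, 'u) smap \<Rightarrow> ('x, 'r, 'u) osheaf \<Rightarrow>
     ('x, 'r, 'u) extn set \<Rightarrow> ('x, 'r, 'u) extn set" where
  "ext_pull X \<gamma> F' \<xi> = (\<Union>E\<in>\<xi>. \<Union>E'\<in>{E'. pullback_extn X \<gamma> F' E E'}. ext_class X E')"

text \<open>The neutral element of the Baer sum on \<^term>\<open>Ext X p F G\<close> is the class of the split short
  exact sequences if \<open>p = 1\<close>, and the class of
  $0 \to G = G \to 0 \to \dots \to 0 \to F = F \to 0$ if \<open>p \<ge> 2\<close>.\<close>

definition trivial_extn ::
    "('x, 'r) ringed_space \<Rightarrow> nat \<Rightarrow> ('x, 'r, 'u) osheaf \<Rightarrow> ('x, 'r, 'u) osheaf \<Rightarrow> ('x, 'r, 'u) extn \<Rightarrow> bool" where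
  "trivial_extn X p F G E \<longleftrightarrow>
     (if p = 1
      then \<exists>i H q s. E = short G i H q F \<and> is_extn X 1 F G E \<and>
             s \<in> sheaf_hom X F H \<and> sheaf_comp X F q s = sheaf_id X F
      else let Hs = [G] @ replicate (p - 2) (zero_sheaf X) @ [F]
           in E = \<lparr> objs = [G] @ Hs @ [F],
                    maps = [sheaf_id X G] @ map2 (zero_hom X) Hs (tl Hs) @ [sheaf_id X F] \<rparr>)"

definition ext_zero ::
    "('x, 'r) ringed_space \<Rightarrow> nat \<Rightarrow> ('x, 'r, 'u) osheaf \<Rightarrow> ('x, 'r, 'u) osheaf \<Rightarrow> ('x, 'r, 'u) extn set" where
  "ext_zero X p F G = (\<Union>E\<in>{E. trivial_extn X p F G E}. ext_class X E)"

end

theory Submission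
  imports Defs
begin

text \<open>A word is a composable list of short exact sequences, and a morphism of words is a chain of ladders
  sharing their outer rungs. Two words are Yoneda equivalent if and only if they are linked by a zigzag of
  morphisms which are the identity at both ends, since such a ladder factors, one sequence at a time,
  through pullbacks and pushouts.

  If \<open>R\<close> extends along \<open>i : B \<rightarrow> C\<close> to \<open>R'\<close>, then \<open>R \<star> U\<close> is equivalent to \<open>R' \<star> (i U)\<close>, and the
  pushout \<open>i U\<close> splits. For the converse, consider the words that receive a morphism, the identity at both
  ends, from a word whose first map splits. The trivial word is one of them, and the property is invariant
  under equivalence: one direction is composition of morphisms, and for the other one trades a split first
  map for a split last map, which behaves dually. So some word \<open>W \<star> V\<close> with \<open>W\<close> split at its first map lies
  over \<open>R \<star> U\<close>, with \<open>V\<close> lying over \<open>U\<close>; gluing the sequences of \<open>R\<close> to \<open>C\<close> along this ladder, and at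
  the first sequence pushing out along the retraction, extends \<open>R\<close> to \<open>C\<close>. The second part is
  the first one in the opposite category.

  Coherent sheaves on a ringed space satisfy the axioms used here, as subsheaves and quotients of direct
  sums provide pullbacks and pushouts. Every Yoneda extension is the splice of a word, obtained by cutting
  it at the images of its maps, and this word is unique up to morphisms that are the identity at the ends.\<close>

section \<open>Words in a category with short exact sequences\<close>

text \<open>A spliced sequence has forgotten the objects at which it was glued, while a word
  remembers them; the arguments therefore run on words, and only afterwards are words compared with
  sequences. The obstacle is that a vanishing class provides no more than a zigzag of unknown length
  in which half of the arrows point the wrong way, and a split first map of the target says nothing
  about the source of an arrow. The trade of a split first map for a split last map, which overcomes
  this, is itself an instance of the extension problem, for a word shorter by one, and
  \<open>extend_word\<close> solves that problem by induction on the length for an arbitrary ladder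
  in place of \<open>U\<close>. The axioms speak of short exact sequences and ladders without any
  addition, so that reversing all arrows merely permutes them; sums and differences are met only
  when the axioms are verified for sheaves.\<close>

definition ladder :: "('o \<Rightarrow> 'o \<Rightarrow> 'm set) \<Rightarrow> ('m \<Rightarrow> 'm \<Rightarrow> 'm) \<Rightarrow> 'm \<Rightarrow> 'm \<Rightarrow> 'm \<Rightarrow>
    'o \<times> 'm \<times> 'o \<times> 'm \<times> 'o \<Rightarrow> 'o \<times> 'm \<times> 'o \<times> 'm \<times> 'o \<Rightarrow> bool" where
  "ladder Hom cmp \<alpha> m \<gamma> = (\<lambda>(G, i, H, q, F) (G', i', H', q', F').
     \<alpha> \<in> Hom G G' \<and> m \<in> Hom H H' \<and> \<gamma> \<in> Hom F F' \<and> cmp m i = cmp i' \<alpha> \<and> cmp q' m = cmp \<gamma> q)"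

text \<open>Exactness enters through closure properties of ladders. By
  \<open>pullback_factor\<close> a ladder with the identity on the left end is universal among the
  ladders with the same right rung; \<open>pushout_factor\<close> is the dual. In an abelian
  category \<open>mono_glue\<close> holds with \<open>P = H + W\<close>,
  \<open>n = (m, v q')\<close>, \<open>d = i q - c\<close> and \<open>h\<close> the inclusion of
  \<open>H\<close>: the first ladder makes \<open>M\<close> the fibre product of \<open>H\<close>
  and \<open>K\<close> over \<open>B\<close>, the second makes \<open>C\<close> the amalgamated sum
  of \<open>B\<close> and \<open>W\<close> over \<open>K\<close>. \<open>epi_glue\<close> is
  \<open>mono_glue\<close> with all arrows reversed. Hom sets and composition are parameters of
  \<open>ladder\<close>, so the same axioms can be stated for the opposite category.\<close>

locale exact_cat =
  fixes obj :: "'o \<Rightarrow> bool"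
    and hom :: "'o \<Rightarrow> 'o \<Rightarrow> 'm set"
    and cmp :: "'m \<Rightarrow> 'm \<Rightarrow> 'm"  (infixr "\<cdot>" 70)
    and idm :: "'o \<Rightarrow> 'm"
    and Z :: 'o
    and zt zf :: "'o \<Rightarrow> 'm"
    and ses :: "'o \<times> 'm \<times> 'o \<times> 'm \<times> 'o \<Rightarrow> bool"
  assumes hom_obj: "f \<in> hom A B \<Longrightarrow> obj A \<and> obj B"
    and cmp_hom: "f \<in> hom A B \<Longrightarrow> g \<in> hom B C \<Longrightarrow> g \<cdot> f \<in> hom A C"
    and cmp_assoc: "f \<in> hom A B \<Longrightarrow> g \<in> hom B C \<Longrightarrow> h \<in> hom C D \<Longrightarrow> (h \<cdot> g) \<cdot> f = h \<cdot> g \<cdot> f"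
    and idm_hom: "obj A \<Longrightarrow> idm A \<in> hom A A"
    and cmp_idm: "f \<in> hom A B \<Longrightarrow> f \<cdot> idm A = f"
    and idm_cmp: "f \<in> hom A B \<Longrightarrow> idm B \<cdot> f = f"
    and Z_obj: "obj Z"
    and zt_hom: "obj A \<Longrightarrow> zt A \<in> hom A Z"
    and zf_hom: "obj A \<Longrightarrow> zf A \<in> hom Z A"
    and zt_unique: "f \<in> hom A Z \<Longrightarrow> f = zt A"
    and zf_unique: "f \<in> hom Z A \<Longrightarrow> f = zf A"
    and ses_hom: "ses (G, i, H, q, F) \<Longrightarrow> i \<in> hom G H \<and> q \<in> hom H F \<and> q \<cdot> i = zf F \<cdot> zt G"
    and ses_idm_zt: "obj A \<Longrightarrow> ses (A, idm A, A, zt A, Z)"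
    and ses_zf_idm: "obj A \<Longrightarrow> ses (Z, zf A, A, idm A, A)"
    and pullback_ex: "ses (G, i, H, q, F) \<Longrightarrow> k \<in> hom K F \<Longrightarrow>
      \<exists>i' M q' m. ses (G, i', M, q', K) \<and> ladder hom (\<cdot>) (idm G) m k (G, i', M, q', K) (G, i, H, q, F)"
    and pullback_factor: "ses (G, i, H, q, F) \<Longrightarrow> ses (G, i', M, q', K) \<Longrightarrow>
      ladder hom (\<cdot>) (idm G) m k (G, i', M, q', K) (G, i, H, q, F) \<Longrightarrow>
      ses (A, t, L, l, K) \<Longrightarrow> ladder hom (\<cdot>) a x k (A, t, L, l, K) (G, i, H, q, F) \<Longrightarrow>
      \<exists>u. ladder hom (\<cdot>) a u (idm K) (A, t, L, l, K) (G, i', M, q', K) \<and> m \<cdot> u = x"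
    and pushout_ex: "ses (F, q, H, i, G) \<Longrightarrow> k \<in> hom F K \<Longrightarrow>
      \<exists>i' M q' m. ses (K, q', M, i', G) \<and> ladder hom (\<cdot>) k m (idm G) (F, q, H, i, G) (K, q', M, i', G)"
    and pushout_factor: "ses (F, q, H, i, G) \<Longrightarrow> ses (K, q', M, i', G) \<Longrightarrow>
      ladder hom (\<cdot>) k m (idm G) (F, q, H, i, G) (K, q', M, i', G) \<Longrightarrow>
      ses (K, l, L, t, A) \<Longrightarrow> ladder hom (\<cdot>) k x a (F, q, H, i, G) (K, l, L, t, A) \<Longrightarrow>
      \<exists>u. ladder hom (\<cdot>) (idm K) u a (K, q', M, i', G) (K, l, L, t, A) \<and> u \<cdot> m = x"
    and mono_glue: "ses (A, a, H, q, B) \<Longrightarrow> ses (A, a', M, q', K) \<Longrightarrow>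
      ladder hom (\<cdot>) (idm A) m k (A, a', M, q', K) (A, a, H, q, B) \<Longrightarrow>
      ses (K, v, W, w, Q) \<Longrightarrow> ses (B, i, C, p, Q) \<Longrightarrow>
      ladder hom (\<cdot>) k c (idm Q) (K, v, W, w, Q) (B, i, C, p, Q) \<Longrightarrow>
      \<exists>n P d h. ses (M, n, P, d, C) \<and> ladder hom (\<cdot>) a' h i (A, a, H, q, B) (M, n, P, d, C)"
    and epi_glue: "ses (B, q, H, a, A) \<Longrightarrow> ses (K, q', M, a', A) \<Longrightarrow>
      ladder hom (\<cdot>) k m (idm A) (B, q, H, a, A) (K, q', M, a', A) \<Longrightarrow>
      ses (Q, w, W, v, K) \<Longrightarrow> ses (Q, p, C, i, B) \<Longrightarrow>
      ladder hom (\<cdot>) (idm Q) c k (Q, p, C, i, B) (Q, w, W, v, K) \<Longrightarrow>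
      \<exists>n P d h. ses (C, d, P, n, M) \<and> ladder hom (\<cdot>) i h a' (C, d, P, n, M) (B, q, H, a, A)"
begin

abbreviation "lad \<equiv> ladder hom (\<cdot>)"

lemma ses_obj: "ses (G, i, H, q, F) \<Longrightarrow> obj G \<and> obj H \<and> obj F"
  using ses_hom hom_obj by blast

text \<open>The end points are ordered as in Ext: \<open>F\<close> is the right end and
  \<open>G\<close> the left end.\<close>

inductive word :: "'o \<Rightarrow> 'o \<Rightarrow> ('o \<times> 'm \<times> 'o \<times> 'm \<times> 'o) list \<Rightarrow> bool" where
  single: "ses (G, i, H, q, F) \<Longrightarrow> word F G [(G, i, H, q, F)]"
| cons: "ses (G, i, H, q, K) \<Longrightarrow> word F K w \<Longrightarrow> word F G ((G, i, H, q, K) # w)"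

text \<open>Only the two outer rungs are parameters. The shared inner rungs are hidden, and cutting
  a morphism of words in two brings one of them to light.\<close>

inductive wmor :: "'m \<Rightarrow> 'm \<Rightarrow> ('o \<times> 'm \<times> 'o \<times> 'm \<times> 'o) list \<Rightarrow> ('o \<times> 'm \<times> 'o \<times> 'm \<times> 'o) list \<Rightarrow> bool" where
  single: "lad a m c (G, i, H, q, F) (G', i', H', q', F') \<Longrightarrow>
    wmor a c [(G, i, H, q, F)] [(G', i', H', q', F')]"
| cons: "lad a m k (G, i, H, q, F) (G', i', H', q', F') \<Longrightarrow> wmor k c w w' \<Longrightarrow>
    wmor a c ((G, i, H, q, F) # w) ((G', i', H', q', F') # w')"

text \<open>The generators of the Yoneda equivalence, mirroring \<^term>\<open>extn_step\<close>: a short ladder which is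
  the identity on one end exhibits a pullback or a pushout.\<close>

inductive wstep :: "('o \<times> 'm \<times> 'o \<times> 'm \<times> 'o) list \<Rightarrow> ('o \<times> 'm \<times> 'o \<times> 'm \<times> 'o) list \<Rightarrow> bool" where
  iso: "ses (G, i, H, q, F) \<Longrightarrow> ses (G, i', H', q', F) \<Longrightarrow>
    lad (idm G) m (idm F) (G, i, H, q, F) (G, i', H', q', F) \<Longrightarrow>
    wstep [(G, i, H, q, F)] [(G, i', H', q', F)]"
| switch: "ses (G, i', H', q', K') \<Longrightarrow> ses (G, i, H, q, K) \<Longrightarrow>
    lad (idm G) m b (G, i', H', q', K') (G, i, H, q, K) \<Longrightarrow>
    ses (K', j', L', l', F) \<Longrightarrow> ses (K, j, L, l, F) \<Longrightarrow>
    lad b n (idm F) (K', j', L', l', F) (K, j, L, l, F) \<Longrightarrow>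
    wstep [(G, i', H', q', K'), (K', j', L', l', F)] [(G, i, H, q, K), (K, j, L, l, F)]"
| left: "wstep w w' \<Longrightarrow> word F K w \<Longrightarrow> word F K w' \<Longrightarrow> word K G v \<Longrightarrow> wstep (v @ w) (v @ w')"
| right: "wstep v v' \<Longrightarrow> word K G v \<Longrightarrow> word K G v' \<Longrightarrow> word F K w \<Longrightarrow> wstep (v @ w) (v' @ w)"

section \<open>Concatenating and cutting words and their morphisms\<close>

lemma word_nonempty: "word F G w \<Longrightarrow> w \<noteq> []"
  by (induction rule: word.induct) auto

lemma not_word_Nil: "\<not> word F G []"
  using word_nonempty by blast

lemma word_single_iff: "word F G [(G', i, H, q, F')] \<longleftrightarrow> ses (G', i, H, q, F') \<and> G' = G \<and> F' = F"
  by (rule iffI, erule word.cases) (auto intro: word.single simp: not_word_Nil)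

lemma word_cons_iff:
  "w \<noteq> [] \<Longrightarrow> word F G ((G', i, H, q, K) # w) \<longleftrightarrow> ses (G', i, H, q, K) \<and> G' = G \<and> word F K w"
  by (rule iffI, erule word.cases) (auto intro: word.cons)

lemma word_obj: "word F G w \<Longrightarrow> obj F \<and> obj G"
  by (induction rule: word.induct) (auto dest: ses_obj)

lemma word_unique: "word F G w \<Longrightarrow> word F' G' w \<Longrightarrow> F = F' \<and> G = G'"
proof (induction arbitrary: F' G' rule: word.induct)
  case (single G i H q F)
  then show ?case by (simp add: word_single_iff)
next
  case (cons G i H q K F w)
  then show ?case using word_cons_iff[OF word_nonempty[OF cons.hyps(2)]] by metis
qed

lemma word_append: "word K G v \<Longrightarrow> word F K w \<Longrightarrow> word F G (v @ w)"
  by (induction rule: word.induct) (simp_all add: word.cons)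

lemma word_appendE:
  assumes "word F G (v @ w)" "v \<noteq> []" "w \<noteq> []"
  obtains K where "word K G v" "word F K w"
  using assms
proof (induction v arbitrary: G thesis)
  case (Cons s v)
  obtain G' i H q K where s: "s = (G', i, H, q, K)" by (cases s) auto
  have *: "ses (G', i, H, q, K)" "G' = G" "word F K (v @ w)"
    using Cons.prems by (auto simp: s word_cons_iff)
  show ?case
  proof (cases "v = []")
    case True
    show ?thesis by (rule Cons.prems(1)[of K]) (use * True in \<open>simp_all add: s word_single_iff\<close>)
  next
    case False
    obtain K' where K': "word K' K v" "word F K' w" by (rule Cons.IH[OF _ *(3) False Cons.prems(4)])
    show ?thesis by (rule Cons.prems(1)[OF _ K'(2)]) (use * K'(1) in \<open>auto simp: s intro: word.cons\<close>)
  qed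
qed simp

lemma lad_comp:
  assumes "ses (G, i, H, q, F)" "ses (G', i', H', q', F')" "ses (G'', i'', H'', q'', F'')"
    and "lad a m c (G, i, H, q, F) (G', i', H', q', F')"
    and "lad a' m' c' (G', i', H', q', F') (G'', i'', H'', q'', F'')"
  shows "lad (a' \<cdot> a) (m' \<cdot> m) (c' \<cdot> c) (G, i, H, q, F) (G'', i'', H'', q'', F'')"
proof -
  have h: "i \<in> hom G H" "q \<in> hom H F" "i' \<in> hom G' H'" "q' \<in> hom H' F'" "i'' \<in> hom G'' H''" "q'' \<in> hom H'' F''"
    using assms(1-3) ses_hom by blast+
  have l: "a \<in> hom G G'" "m \<in> hom H H'" "c \<in> hom F F'" "m \<cdot> i = i' \<cdot> a" "q' \<cdot> m = c \<cdot> q"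
    "a' \<in> hom G' G''" "m' \<in> hom H' H''" "c' \<in> hom F' F''" "m' \<cdot> i' = i'' \<cdot> a'" "q'' \<cdot> m' = c' \<cdot> q'"
    using assms(4,5) by (auto simp: ladder_def)
  have "(m' \<cdot> m) \<cdot> i = i'' \<cdot> a' \<cdot> a"
    using cmp_assoc[OF h(1) l(2,7)] cmp_assoc[OF l(1) h(3) l(7)] cmp_assoc[OF l(1,6) h(5)] l(4,9) by simp
  moreover have "q'' \<cdot> m' \<cdot> m = (c' \<cdot> c) \<cdot> q"
    using cmp_assoc[OF l(2,7) h(6)] cmp_assoc[OF l(2) h(4) l(8)] cmp_assoc[OF h(2) l(3,8)] l(5,10) by simp
  ultimately show ?thesis using l by (auto simp: ladder_def intro: cmp_hom)
qed

lemma lad_idm: "ses (G, i, H, q, F) \<Longrightarrow> lad (idm G) (idm H) (idm F) (G, i, H, q, F) (G, i, H, q, F)"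
  using ses_hom[of G i H q F] ses_obj[of G i H q F]
  by (auto simp: ladder_def idm_hom cmp_idm idm_cmp)

lemma wmor_lengths: "wmor a c w w' \<Longrightarrow> length w = length w'"
  by (induction rule: wmor.induct) auto

lemma wmor_nonempty: "wmor a c w w' \<Longrightarrow> w \<noteq> [] \<and> w' \<noteq> []"
  by (induction rule: wmor.induct) auto

lemma not_wmor_Nil: "\<not> wmor a c [] w" "\<not> wmor a c w []"
  using wmor_nonempty by blast+

lemma wmor_single_iff:
  "wmor a c [(G, i, H, q, F)] [(G', i', H', q', F')] \<longleftrightarrow>
    (\<exists>m. lad a m c (G, i, H, q, F) (G', i', H', q', F'))"
  by (rule iffI, erule wmor.cases) (auto intro: wmor.single simp: not_wmor_Nil)

lemma length_one_seqE:
  assumes "length w = Suc 0"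
  obtains G i H q F where "w = [(G :: 'o, i :: 'm, H :: 'o, q :: 'm, F :: 'o)]"
  using assms by (metis length_0_conv length_Suc_conv prod_cases5)

lemma length_Suc_seqE:
  assumes "length w = Suc n"
  obtains G i H q F v where "w = (G :: 'o, i :: 'm, H :: 'o, q :: 'm, F :: 'o) # v" "length v = n"
  using assms by (metis length_Suc_conv prod_cases5)

lemma wmor_cons_iff:
  "w \<noteq> [] \<Longrightarrow> wmor a c ((G, i, H, q, F) # w) ((G', i', H', q', F') # w') \<longleftrightarrow>
    (\<exists>m k. lad a m k (G, i, H, q, F) (G', i', H', q', F') \<and> wmor k c w w')"
  by (rule iffI, erule wmor.cases) (auto intro: wmor.intros)

lemma wmor_hom: "wmor a c w w' \<Longrightarrow> word F G w \<Longrightarrow> word F' G' w' \<Longrightarrow> a \<in> hom G G' \<and> c \<in> hom F F'"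
proof (induction arbitrary: G G' rule: wmor.induct)
  case (single a m c G1 i H q F1 G1' i' H' q' F1')
  then show ?case by (simp add: word_single_iff ladder_def)
next
  case (cons a m k G1 i H q F1 G1' i' H' q' F1' c w w')
  have "w \<noteq> []" "w' \<noteq> []" using cons.hyps(2) wmor_nonempty by auto
  then show ?case using cons by (auto simp: word_cons_iff ladder_def)
qed

lemma wmor_idm: "word F G w \<Longrightarrow> wmor (idm G) (idm F) w w"
  by (induction rule: word.induct) (blast intro: wmor.intros lad_idm)+

lemma wmor_comp:
  "wmor a c w w' \<Longrightarrow> wmor a' c' w' w'' \<Longrightarrow> word F G w \<Longrightarrow> word F' G' w' \<Longrightarrow> word F'' G'' w'' \<Longrightarrow>
    wmor (a' \<cdot> a) (c' \<cdot> c) w w''"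
proof (induction arbitrary: a' c' w'' G G' G'' rule: wmor.induct)
  case (single a m c G1 i H q F1 G1' i' H' q' F1')
  obtain G2 i2 H2 q2 F2 where w'': "w'' = [(G2, i2, H2, q2, F2)]"
    by (rule length_one_seqE[of w'']) (use wmor_lengths[OF single(2)] in auto)
  show ?case using single unfolding w'' wmor_single_iff word_single_iff by (blast intro: lad_comp)
next
  case (cons a m k G1 i H q F1 G1' i' H' q' F1' c w w')
  have ne: "w \<noteq> []" "w' \<noteq> []" using cons.hyps(2) wmor_nonempty by auto
  obtain G2 i2 H2 q2 F2 v where w'': "w'' = (G2, i2, H2, q2, F2) # v" and "length v = length w'"
    using wmor_lengths[OF cons.prems(1)] length_Suc_seqE[of w''] by (metis length_Cons)
  with ne have nv: "v \<noteq> []" by auto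
  obtain m' k' where *: "lad a' m' k' (G1', i', H', q', F1') (G2, i2, H2, q2, F2)" "wmor k' c' w' v"
    using cons.prems(1) ne by (auto simp: w'' wmor_cons_iff)
  show ?case
    using cons * ne nv unfolding w'' word_cons_iff[OF ne(1)] word_cons_iff[OF ne(2)] word_cons_iff[OF nv]
    by (meson lad_comp wmor.cons)
qed

lemma wmor_append: "wmor a k v v' \<Longrightarrow> wmor k c w w' \<Longrightarrow> wmor a c (v @ w) (v' @ w')"
  by (induction rule: wmor.induct) (auto intro: wmor.intros)

lemma wmor_appendE:
  assumes "wmor a c (v @ w) u" "v \<noteq> []" "w \<noteq> []"
  obtains k v' w' where "u = v' @ w'" "wmor a k v v'" "wmor k c w w'"
  using assms
proof (induction v arbitrary: a u thesis)
  case (Cons s v)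
  obtain G i H q F where s: "s = (G, i, H, q, F)" by (cases s) auto
  obtain G' i' H' q' F' u' where u: "u = (G', i', H', q', F') # u'"
    using wmor_nonempty[OF Cons.prems(2)] by (metis neq_Nil_conv prod_cases5)
  obtain m k where *: "lad a m k (G, i, H, q, F) (G', i', H', q', F')" "wmor k c (v @ w) u'"
    using Cons.prems by (auto simp: s u wmor_cons_iff)
  show ?case
  proof (cases "v = []")
    case True
    show ?thesis
      by (rule Cons.prems(1)[of "[(G', i', H', q', F')]" u' k])
         (use * True in \<open>auto simp: s u intro: wmor.single\<close>)
  next
    case False
    obtain k' v' w' where v': "u' = v' @ w'" "wmor k k' v v'" "wmor k' c w w'"
      by (rule Cons.IH[OF _ *(2) False Cons.prems(4)])
    show ?thesis
      by (rule Cons.prems(1)[of "(G', i', H', q', F') # v'" w' k'])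
         (use * v' in \<open>auto simp: s u intro: wmor.cons\<close>)
  qed
qed simp

lemma wmor_snocE:
  assumes "wmor a c (v @ [(G, i, H, q, F)]) u" "v \<noteq> []"
  obtains k v' G' i' H' q' F' m where "u = v' @ [(G', i', H', q', F')]" "wmor a k v v'"
    "lad k m c (G, i, H, q, F) (G', i', H', q', F')"
proof -
  obtain k v' w' where *: "u = v' @ w'" "wmor a k v v'" "wmor k c [(G, i, H, q, F)] w'"
    using wmor_appendE[OF assms] by blast
  from *(3) obtain G' i' H' q' F' m where "w' = [(G', i', H', q', F')]" "lad k m c (G, i, H, q, F) (G', i', H', q', F')"
    by cases (auto dest: wmor_nonempty)
  with * that show ?thesis by blast
qed

text \<open>Well-formedness of both words is part of the generating relation. It is therefore
  constant along a zigzag, although \<open>weq\<close> is reflexive on all lists.\<close>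

definition weq :: "'o \<Rightarrow> 'o \<Rightarrow> ('o \<times> 'm \<times> 'o \<times> 'm \<times> 'o) list \<Rightarrow> ('o \<times> 'm \<times> 'o \<times> 'm \<times> 'o) list \<Rightarrow> bool" where
  "weq F G = equivclp (\<lambda>w w'. word F G w \<and> word F G w' \<and> wmor (idm G) (idm F) w w')"

definition fsplit :: "('o \<times> 'm \<times> 'o \<times> 'm \<times> 'o) list \<Rightarrow> bool" where
  "fsplit w \<longleftrightarrow> (\<exists>G i H q F v r. w = (G, i, H, q, F) # v \<and> r \<in> hom H G \<and> r \<cdot> i = idm G)"

definition lsplit :: "('o \<times> 'm \<times> 'o \<times> 'm \<times> 'o) list \<Rightarrow> bool" where
  "lsplit w \<longleftrightarrow> (\<exists>G i H q F v s. w = v @ [(G, i, H, q, F)] \<and> s \<in> hom F H \<and> q \<cdot> s = idm F)"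

text \<open>The zero class in degree \<open>n + 2\<close>.\<close>

definition wtriv :: "nat \<Rightarrow> 'o \<Rightarrow> 'o \<Rightarrow> ('o \<times> 'm \<times> 'o \<times> 'm \<times> 'o) list" where
  "wtriv n F G = (G, idm G, G, zt G, Z) # replicate n (Z, zf Z, Z, zt Z, Z) @ [(Z, zf F, F, idm F, F)]"

lemma zf_Z: "zf Z = idm Z" and zt_Z: "zt Z = idm Z"
  using zf_unique[of "idm Z" Z] zt_unique[of "idm Z" Z] idm_hom[OF Z_obj] by auto

text \<open>The base step pushes the glued sequence out along the retraction; in the inductive step the
  pullback of the last sequence plays the role of the sequence along which the shorter word extends.\<close>

lemma extend_word:
  assumes "word K G w'" "word B G w" "wmor (idm G) k w' w" "fsplit w'"
    "ses (K, v, W, y, Q)" "ses (B, i, C, p, Q)" "lad k c (idm Q) (K, v, W, y, Q) (B, i, C, p, Q)"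
  shows "\<exists>w0. word C G w0 \<and> wmor (idm G) i w w0"
  using assms
proof (induction w' arbitrary: w K B k v W y Q i C p c rule: rev_induct)
  case Nil
  then show ?case using word_nonempty by blast
next
  case (snoc s' t')
  obtain A' b H' r' K' where s': "s' = (A', b, H', r', K')" by (cases s') auto
  show ?case
  proof (cases "t' = []")
    case True
    have 1: "ses (A', b, H', r', K')" "A' = G" "K' = K"
      using snoc.prems(1) True by (auto simp: s' word_single_iff)
    obtain A a H q B' where w: "w = [(A, a, H, q, B')]"
      by (rule length_one_seqE[of w]) (use wmor_lengths[OF snoc.prems(3)] True in auto)
    have 2: "ses (A, a, H, q, B')" "A = G" "B' = B"
      using snoc.prems(2) by (auto simp: w word_single_iff)
    obtain x where x: "lad (idm G) x k (G, b, H', r', K) (G, a, H, q, B)"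
      using snoc.prems(3) 1 2 by (auto simp: s' w True wmor_single_iff)
    obtain a' M q' m where M: "ses (G, a', M, q', K)" "lad (idm G) m k (G, a', M, q', K) (G, a, H, q, B)"
      using pullback_ex[of G a H q B k K] 1 2 x by (auto simp: ladder_def)
    \<comment> \<open>The given ladder is the identity on \<open>G\<close>, hence also a pullback
      along \<open>k\<close>, so the chosen pullback maps to its source. The retraction
      \<open>r\<close> of \<open>b\<close> thus becomes the retraction \<open>r u\<close> of
      \<open>a'\<close>.\<close>
    obtain u where u: "lad (idm G) u (idm K) (G, a', M, q', K) (G, b, H', r', K)"
      using pullback_factor[of G a H q B b H' r' K x k G a' M q' "idm G" m] 1 2 x M by blast
    obtain r where r: "r \<in> hom H' G" "r \<cdot> b = idm G"
      using snoc.prems(4) 1 by (auto simp: s' True fsplit_def)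
    have oG: "obj G" using ses_obj M by blast
    have r': "r \<cdot> u \<in> hom M G" "(r \<cdot> u) \<cdot> a' = idm G"
      using u r M(1) 1 ses_hom[of G a' M q' K] ses_hom[of G b H' r' K] oG
      by (auto simp: ladder_def intro: cmp_hom) (metis cmp_assoc cmp_idm)
    obtain n P d h where N: "ses (M, n, P, d, C)" "lad a' h i (G, a, H, q, B) (M, n, P, d, C)"
      using mono_glue[of G a H q B a' M q' K m k v W y Q i C p c] 2 M snoc.prems(5-7) by blast
    \<comment> \<open>The glued sequence starts at \<open>M\<close>. Pushing it out along the
      retraction lets it start at \<open>G\<close> again, and the left rung \<open>r u a'\<close> of
      the composite ladder is the identity.\<close>
    obtain n' P' d' z where E: "ses (G, n', P', d', C)" "lad (r \<cdot> u) z (idm C) (M, n, P, d, C) (G, n', P', d', C)"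
      using pushout_ex[OF N(1) r'(1)] by blast
    have "lad ((r \<cdot> u) \<cdot> a') (z \<cdot> h) (idm C \<cdot> i) (G, a, H, q, B) (G, n', P', d', C)"
      by (rule lad_comp) (use 2 N E in auto)
    then have "lad (idm G) (z \<cdot> h) i (G, a, H, q, B) (G, n', P', d', C)"
      using r' idm_cmp[of i B C] ses_hom[OF snoc.prems(6)] by simp
    then show ?thesis using E(1) 2 by (auto simp: w intro!: exI[of _ "[(G, n', P', d', C)]"] word.intros wmor.intros)
  next
    case False
    obtain A2 where t': "word A2 G t'" "word K A2 [(A', b, H', r', K')]"
      using word_appendE[OF snoc.prems(1) False] s' by auto
    have 1: "ses (A', b, H', r', K')" "A2 = A'" "K' = K"
      using t' by (auto simp: word_single_iff)
    obtain al t A a H q B' x where w: "w = t @ [(A, a, H, q, B')]" "wmor (idm G) al t' t"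
        "lad al x k (A', b, H', r', K') (A, a, H, q, B')"
      using wmor_snocE[OF snoc.prems(3)[unfolded s'] False] by metis
    have tne: "t \<noteq> []" using w(2) wmor_nonempty by blast
    obtain A3 where "word A3 G t" "word B A3 [(A, a, H, q, B')]"
      using word_appendE[OF snoc.prems(2)[unfolded w(1)] tne] by auto
    then have 2: "word A G t" "ses (A, a, H, q, B)" "B' = B" by (auto simp: word_single_iff)
    have k: "k \<in> hom K B" using w(3) 1 2 by (auto simp: ladder_def)
    obtain a' M q' m where M: "ses (A, a', M, q', K)" "lad (idm A) m k (A, a', M, q', K) (A, a, H, q, B)"
      using pullback_ex[OF 2(2) k] by blast
    obtain u where u: "lad al u (idm K) (A', b, H', r', K) (A, a', M, q', K)"
      using pullback_factor[OF 2(2) M, of A' b H' r' al x] 1 2 w(3) by blast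
    have fs: "fsplit t'" using snoc.prems(4) False by (cases t') (auto simp: fsplit_def)
    \<comment> \<open>The ladder with rungs \<open>al\<close>, \<open>u\<close> and the identity of
      \<open>K\<close> ends in the pulled back sequence, whose injection is \<open>a'\<close>, so
      the shorter word \<open>t\<close> extends along \<open>a'\<close>. The sequence glued next has
      the same \<open>a'\<close> as left rung and fits to the right of this extension.\<close>
    obtain t0 where t0: "word M G t0" "wmor (idm G) a' t t0"
      using snoc.IH[of A' A t al b H' r' K a' M q' u] t' 1 2(1) w(2) fs M(1) u by auto
    obtain n P d h where N: "ses (M, n, P, d, C)" "lad a' h i (A, a, H, q, B) (M, n, P, d, C)"
      using mono_glue[OF 2(2) M snoc.prems(5-7)] by blast
    have "word C G (t0 @ [(M, n, P, d, C)])" using word_append t0(1) N(1) word.single by blast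
    moreover have "wmor (idm G) i (t @ [(A, a, H, q, B)]) (t0 @ [(M, n, P, d, C)])"
      using wmor_append[OF t0(2)] N(2) wmor.single by blast
    ultimately show ?thesis using w(1) 2(3) by blast
  qed
qed

section \<open>Split ends and the trivial word\<close>

lemma word_wtriv:
  assumes "obj F" "obj G"
  shows "word F G (wtriv n F G)"
proof -
  have *: "word F Z (replicate n (Z, zf Z, Z, zt Z, Z) @ [(Z, zf F, F, idm F, F)])"
  proof (induction n)
    case 0
    then show ?case using ses_zf_idm[OF assms(1)] word.single by simp
  next
    case (Suc n)
    then show ?case using ses_zf_idm[OF Z_obj] by (auto simp: zf_Z zt_Z intro!: word.cons)
  qed
  show ?thesis unfolding wtriv_def using word.cons[OF ses_idm_zt[OF assms(2)] *] .
qed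

lemma fsplit_wtriv: "obj G \<Longrightarrow> fsplit (wtriv n F G)"
  unfolding fsplit_def wtriv_def using idm_hom cmp_idm by blast

text \<open>A retraction is a ladder from the sequence to \<open>G = G -> 0\<close>, and this ladder
  exhibits the sequence as a pullback along \<open>F -> 0\<close>. The sequence
  \<open>0 -> F = F\<close> maps to \<open>G = G -> 0\<close> by zero with the same right rung; its
  factorization through the pullback is the section. This replaces the subtraction
  \<open>id - i r\<close>.\<close>

lemma retraction_imp_section:
  assumes "ses (G, i, H, q, F)" "r \<in> hom H G" "r \<cdot> i = idm G"
  shows "\<exists>s\<in>hom F H. q \<cdot> s = idm F"
proof -
  have o: "obj G" "obj H" "obj F" using assms(1) ses_obj by blast+
  have h: "i \<in> hom G H" "q \<in> hom H F" using assms(1) ses_hom by blast+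
  have "lad (idm G) r (zt F) (G, i, H, q, F) (G, idm G, G, zt G, Z)"
  proof -
    have "zt G \<cdot> r = zt H" "zt F \<cdot> q = zt H"
      using zt_unique[OF cmp_hom[OF assms(2) zt_hom[OF o(1)]]] zt_unique[OF cmp_hom[OF h(2) zt_hom[OF o(3)]]]
      by simp_all
    then show ?thesis using assms(2,3) idm_hom[OF o(1)] zt_hom[OF o(3)] cmp_idm[OF idm_hom[OF o(1)]]
      by (simp add: ladder_def)
  qed
  moreover have "lad (zf G) (zf G \<cdot> zt F) (zt F) (Z, zf F, F, idm F, F) (G, idm G, G, zt G, Z)"
  proof -
    have "(zf G \<cdot> zt F) \<cdot> zf F = zf G"
      by (rule zf_unique[OF cmp_hom[OF zf_hom[OF o(3)] cmp_hom[OF zt_hom[OF o(3)] zf_hom[OF o(1)]]]])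
    moreover have "zt G \<cdot> zf G \<cdot> zt F = zt F"
      by (rule zt_unique[OF cmp_hom[OF cmp_hom[OF zt_hom[OF o(3)] zf_hom[OF o(1)]] zt_hom[OF o(1)]]])
    ultimately show ?thesis
      using zf_hom[OF o(1)] zt_hom[OF o(3)] cmp_hom[OF zt_hom[OF o(3)] zf_hom[OF o(1)]]
        cmp_idm[OF zt_hom[OF o(3)]] idm_cmp[OF zf_hom[OF o(1)]]
      by (simp add: ladder_def)
  qed
  ultimately obtain u where "lad (zf G) u (idm F) (Z, zf F, F, idm F, F) (G, i, H, q, F)"
    using pullback_factor[OF ses_idm_zt[OF o(1)] assms(1)] ses_zf_idm[OF o(3)] by blast
  then show ?thesis using cmp_idm[OF idm_hom[OF o(3)]] unfolding ladder_def by auto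
qed

text \<open>All rungs except the outermost can be zero. On the left the identity of \<open>G\<close>
  is followed by \<open>i\<close>, whose composite with the projection vanishes; on the right the
  section is what makes the identity of \<open>F\<close> possible.\<close>

lemma wmor_wtriv_lsplit:
  assumes "word F G w" "lsplit w" "length w = n + 2"
  shows "wmor (idm G) (idm F) (wtriv n F G) w"
proof -
  obtain G' i H q K w1 where w: "w = (G', i, H, q, K) # w1" "length w1 = n + 1"
    by (rule length_Suc_seqE[of w "n + 1"]) (use assms(3) in auto)
  then have ne: "w1 \<noteq> []" by auto
  have w1: "word F K w1" "ses (G, i, H, q, K)" "G' = G"
    using assms(1) w word_cons_iff[OF ne, of F G G' i H q K] by auto
  have ls: "lsplit w1"
    using assms(2) w ne by (auto simp: lsplit_def Cons_eq_append_conv)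
  \<comment> \<open>The tail of the trivial word is compared with a zero left rung, a form that
    passes through the induction on the word.\<close>
  have *: "wmor (zf K) (idm F) (replicate n (Z, zf Z, Z, zt Z, Z) @ [(Z, zf F, F, idm F, F)]) w1"
    using w1(1) ls w(2)
  proof (induction arbitrary: n rule: word.induct)
    case (single G i H q F)
    have o: "obj G" "obj H" "obj F" using single(1) ses_obj by blast+
    obtain s where s: "s \<in> hom F H" "q \<cdot> s = idm F" using single(2) by (auto simp: lsplit_def)
    have "lad (zf G) s (idm F) (Z, zf F, F, idm F, F) (G, i, H, q, F)"
    proof -
      have "s \<cdot> zf F = zf H" "i \<cdot> zf G = zf H"
        by (rule zf_unique[OF cmp_hom[OF zf_hom[OF o(3)] s(1)]],
            rule zf_unique[OF cmp_hom[OF zf_hom[OF o(1)] conjunct1[OF ses_hom[OF single(1)]]]])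
      then show ?thesis using s zf_hom[OF o(1)] idm_hom[OF o(3)] cmp_idm[OF idm_hom[OF o(3)]]
        by (simp add: ladder_def)
    qed
    then show ?case using single by (auto intro: wmor.intros)
  next
    case (cons G i H q K F w)
    have o: "obj G" "obj H" "obj K" using cons.hyps(1) ses_obj by blast+
    obtain n' where n: "n = Suc n'" using cons.prems word_nonempty[OF cons.hyps(2)] by (cases n) auto
    have lw: "lsplit w" using cons.prems(1) word_nonempty[OF cons.hyps(2)]
      by (auto simp: lsplit_def Cons_eq_append_conv)
    have "lad (zf G) (zf H) (zf K) (Z, zf Z, Z, zt Z, Z) (G, i, H, q, K)"
    proof -
      have "i \<cdot> zf G = zf H" "q \<cdot> zf H = zf K"
        using ses_hom[OF cons.hyps(1)]
        by (auto intro: zf_unique[OF cmp_hom[OF zf_hom[OF o(1)]]] zf_unique[OF cmp_hom[OF zf_hom[OF o(2)]]])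
      then show ?thesis using zf_hom o cmp_idm[OF zf_hom[OF o(3)]] cmp_idm[OF zf_hom[OF o(2)]]
        by (simp add: ladder_def zf_Z zt_Z)
    qed
    then show ?case using cons.IH[OF lw, of n'] cons.prems by (auto simp: n intro: wmor.intros)
  qed
  have o: "obj G" "obj H" "obj K" using w1(2) ses_obj by blast+
  have "lad (idm G) i (zf K) (G, idm G, G, zt G, Z) (G, i, H, q, K)"
    using o idm_hom zf_hom ses_hom[OF w1(2)] by (auto simp: ladder_def)
  then show ?thesis using * w1 unfolding wtriv_def w(1) by (blast intro: wmor.cons)
qed

section \<open>Equivalence of words and concatenation\<close>

lemma weq_step: "word F G w \<Longrightarrow> word F G w' \<Longrightarrow> wmor (idm G) (idm F) w w' \<Longrightarrow> weq F G w w'"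
  unfolding weq_def by (rule r_into_equivclp) simp

lemma weq_trans: "weq F G u v \<Longrightarrow> weq F G v w \<Longrightarrow> weq F G u w"
  unfolding weq_def by (rule equivclp_trans)

lemma weq_sym: "weq F G u v \<Longrightarrow> weq F G v u"
  unfolding weq_def by (rule equivclp_sym)

lemma weq_word: "weq F G w w' \<Longrightarrow> word F G w \<longleftrightarrow> word F G w'"
  unfolding weq_def by (induction rule: equivclp_induct) auto

lemma weq_length: "weq F G w w' \<Longrightarrow> length w = length w'"
  unfolding weq_def by (induction rule: equivclp_induct) (auto dest: wmor_lengths)

text \<open>Every operation that turns morphisms with identities at the ends into such morphisms
  maps a zigzag to a zigzag; concatenation with a fixed word on either side is of this kind.\<close>

lemma weq_map:
  assumes "\<And>w w'. word F G w \<Longrightarrow> word F G w' \<Longrightarrow> wmor (idm G) (idm F) w w' \<Longrightarrow>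
      word F' G' (f w) \<and> word F' G' (f w') \<and> wmor (idm G') (idm F') (f w) (f w')"
    and "weq F G w w'"
  shows "weq F' G' (f w) (f w')"
proof -
  let ?R = "\<lambda>w w'. word F' G' w \<and> word F' G' w' \<and> wmor (idm G') (idm F') w w'"
  show ?thesis
    using assms(2) unfolding weq_def[of F G]
  proof (induction rule: equivclp_induct)
    case base
    show ?case by (simp add: weq_def)
  next
    case (step y z)
    have "?R (f y) (f z) \<or> ?R (f z) (f y)"
      using step(2) by (elim disjE conjE) (simp_all add: assms(1))
    then have "equivclp ?R (f y) (f z)" by (elim disjE) (rule r_into_equivclp converse_r_into_equivclp; assumption)+
    then show ?case using step(3) unfolding weq_def by (rule equivclp_trans[rotated])
  qed
qed

lemma weq_append_left: "weq F K w w' \<Longrightarrow> word K G v \<Longrightarrow> weq F G (v @ w) (v @ w')"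
  by (rule weq_map[where f = "\<lambda>w. v @ w"]) (blast intro: word_append wmor_append wmor_idm)+

lemma weq_append_right: "weq K G v v' \<Longrightarrow> word F K w \<Longrightarrow> weq F G (v @ w) (v' @ w)"
  by (rule weq_map[where f = "\<lambda>v. v @ w"]) (blast intro: word_append wmor_append wmor_idm)+

section \<open>Pullback of words along a map into the right end\<close>

lemma wmor_comp_idm:
  assumes "wmor (idm G) c w w'" "wmor (idm G) c' w' w''" "word F G w" "word F' G w'" "word F'' G w''"
  shows "wmor (idm G) (c' \<cdot> c) w w''"
  using wmor_comp[OF assms] cmp_idm[OF idm_hom] word_obj[OF assms(3)] by simp

text \<open>Only the last sequence has to be pulled back. The third property makes the result
  terminal among the words over \<open>w\<close> with right rung \<open>c\<close>: in a morphism
  from such a word the last ladder factors through the pullback and the other ladders are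
  kept.\<close>

lemma pullback_word:
  assumes "word F G w" "c \<in> hom F' F"
  obtains v where "word F' G v" "wmor (idm G) c v w"
    "\<And>u. word F' G u \<Longrightarrow> wmor (idm G) c u w \<Longrightarrow> wmor (idm G) (idm F') u v"
proof -
  obtain t s where w: "w = t @ [s]" using word_nonempty[OF assms(1)] by (metis rev_exhaust)
  obtain K i H q F1 where s: "s = (K, i, H, q, F1)" by (cases s) auto
  have S: "ses (K, i, H, q, F)" "F1 = F"
    using assms(1) word_appendE[of F G t "[s]"] unfolding w
    by (cases "t = []"; auto simp: s word_single_iff)+
  obtain i' M q' m where M: "ses (K, i', M, q', F')" "lad (idm K) m c (K, i', M, q', F') (K, i, H, q, F)"
    using pullback_ex[OF S(1) assms(2)] by blast
  show thesis
  proof (cases "t = []")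
    case True
    then have K: "K = G" using assms(1) by (auto simp: w s word_single_iff)
    show ?thesis
    proof (rule that[of "[(K, i', M, q', F')]"])
      show "word F' G [(K, i', M, q', F')]" using M K by (auto simp: word_single_iff)
      show "wmor (idm G) c [(K, i', M, q', F')] w" using M K S True by (auto simp: w s wmor_single_iff)
      fix u assume u: "word F' G u" "wmor (idm G) c u w"
      obtain G1 j L l F1 where u': "u = [(G1, j, L, l, F1)]"
        by (rule length_one_seqE[of u]) (use wmor_lengths[OF u(2)] True in \<open>auto simp: w\<close>)
      have "ses (G, j, L, l, F')" "G1 = G" "F1 = F'" using u(1) by (auto simp: u' word_single_iff)
      moreover obtain x where "lad (idm G) x c (G1, j, L, l, F1) (K, i, H, q, F)"
        using u(2) S True by (auto simp: u' w s wmor_single_iff)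
      ultimately show "wmor (idm G) (idm F') u [(K, i', M, q', F')]"
        using pullback_factor[OF S(1) M, of G j L l "idm G" x] K by (auto simp: u' wmor_single_iff)
    qed
  next
    case False
    then have t: "word K G t"
      using assms(1) word_appendE[of F G t "[s]"] unfolding w by (auto simp: s word_single_iff)
    show ?thesis
    proof (rule that[of "t @ [(K, i', M, q', F')]"])
      show "word F' G (t @ [(K, i', M, q', F')])" using M t word_append word.single by blast
      show "wmor (idm G) c (t @ [(K, i', M, q', F')]) w"
        unfolding w s S(2) using wmor_append[OF wmor_idm[OF t]] M(2) wmor.single by blast
      fix u assume u: "word F' G u" "wmor (idm G) c u w"
      obtain u1 s1 where us: "u = u1 @ [s1]" using wmor_nonempty[OF u(2)] by (metis rev_exhaust)
      obtain G1 j L l F1 where "s1 = (G1, j, L, l, F1)" by (rule prod_cases5)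
      with us have u': "u = u1 @ [(G1, j, L, l, F1)]" "u1 \<noteq> []"
        using wmor_lengths[OF u(2)] False by (auto simp: w)
      have u1: "word G1 G u1" "ses (G1, j, L, l, F')" "F1 = F'"
        using word_appendE[OF u(1)[unfolded u'(1)] u'(2)] by (auto simp: word_single_iff)
      obtain k v' G2 i2 H2 q2 F2 x where *: "w = v' @ [(G2, i2, H2, q2, F2)]" "wmor (idm G) k u1 v'"
          "lad k x c (G1, j, L, l, F1) (G2, i2, H2, q2, F2)"
        using wmor_snocE[OF u(2)[unfolded u'(1)] u'(2)] by metis
      then obtain y where "lad k y (idm F') (G1, j, L, l, F') (K, i', M, q', F')"
        using pullback_factor[OF S(1) M u1(2), of k x] u1(3) S(2) by (auto simp: w s)
      then show "wmor (idm G) (idm F') u (t @ [(K, i', M, q', F')])"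
        unfolding u'(1) u1(3) using * wmor_append wmor.single by (auto simp: w)
    qed
  qed
qed

text \<open>Both words map to the terminal one constructed in \<open>pullback_word\<close>.\<close>

lemma pullback_weq_same:
  assumes "word F G w0" "word F' G w" "wmor (idm G) c w w0" "word F' G w'" "wmor (idm G) c w' w0"
  shows "weq F' G w w'"
proof -
  have c: "c \<in> hom F' F" using wmor_hom[OF assms(3,2,1)] by simp
  obtain v where v: "word F' G v" "\<And>u. word F' G u \<Longrightarrow> wmor (idm G) c u w0 \<Longrightarrow> wmor (idm G) (idm F') u v"
    using pullback_word[OF assms(1) c] by metis
  have "weq F' G w v" "weq F' G w' v" using v assms weq_step by auto
  then show ?thesis using weq_sym weq_trans by blast
qed

text \<open>The zigzag below is followed step by step. Along an arrow from \<open>y\<close> to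
  \<open>z\<close> a pullback of \<open>y\<close> lies over \<open>z\<close> too; against an arrow
  from \<open>z\<close> to \<open>y\<close> a word over \<open>z\<close> already lies over
  \<open>y\<close> by composition.\<close>

lemma pullback_weq:
  assumes "weq F G w0 w0'" "word F G w0" "word F' G w" "wmor (idm G) c w w0"
    "word F' G w'" "wmor (idm G) c w' w0'"
  shows "weq F' G w w'"
  using assms(1,5,6) unfolding weq_def[of F G]
proof (induction arbitrary: w' rule: equivclp_induct)
  case base
  then show ?case using pullback_weq_same assms(2-4) by blast
next
  case (step y z)
  have c: "c \<in> hom F' F" using wmor_hom[OF assms(4,3,2)] by simp
  from step(2) show ?case
  proof
    assume yz: "word F G y \<and> word F G z \<and> wmor (idm G) (idm F) y z"
    obtain v where v: "word F' G v" "wmor (idm G) c v y" using pullback_word[OF _ c] yz by metis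
    have "wmor (idm G) c v z" using wmor_comp_idm[of G c v y "idm F" z F' F F] v yz idm_cmp[OF c] by simp
    then have "weq F' G v w'" using pullback_weq_same yz v(1) step(4,5) by blast
    then show ?thesis using step(3)[OF v] weq_trans by blast
  next
    assume yz: "word F G z \<and> word F G y \<and> wmor (idm G) (idm F) z y"
    have "wmor (idm G) c w' y" using wmor_comp_idm[of G c w' z "idm F" y F' F F] step(4,5) yz idm_cmp[OF c] by simp
    then show ?thesis using step(3)[of w'] step(4) by simp
  qed
qed

section \<open>Factorization of word morphisms into elementary steps\<close>

lemma wstep_word: "wstep w w' \<Longrightarrow> \<exists>F G. word F G w \<and> word F G w'"
proof (induction rule: wstep.induct)
  case (iso G i H q F i' H' q' m)
  then have "word F G [(G, i, H, q, F)]" "word F G [(G, i', H', q', F)]" by (auto simp: word_single_iff)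
  then show ?case by blast
next
  case (switch G i' H' q' K' i H q K m b j' L' l' F j L l n)
  then have "word F G [(G, i', H', q', K'), (K', j', L', l', F)]" "word F G [(G, i, H, q, K), (K, j, L, l, F)]"
    by (auto simp: word_single_iff word_cons_iff)
  then show ?case by blast
next
  case (left w w' F1 K G1 v)
  then have "word F1 G1 (v @ w)" "word F1 G1 (v @ w')" by (simp_all add: word_append)
  then show ?case by blast
next
  case (right v v' K G1 F1 w)
  then have "word F1 G1 (v @ w)" "word F1 G1 (v' @ w)" by (simp_all add: word_append)
  then show ?case by blast
qed

text \<open>The relation \<open>wstep\<close> does not mention end points, whereas its rule
  \<open>left\<close> asks for common ones. The ends of a word are unique, hence constant along the
  zigzag, so the rule applies to each step.\<close>

lemma wstep_cons:
  assumes "equivclp wstep v v'" "word F K v" "ses (G, i, H, q, K)"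
  shows "equivclp wstep ((G, i, H, q, K) # v) ((G, i, H, q, K) # v') \<and> word F K v'"
proof -
  have wd: "word F K u'" if "wstep u u' \<or> wstep u' u" "word F K u" for u u'
    using that(1) wstep_word word_unique[OF that(2)] by metis
  from assms(1) show ?thesis
  proof (induction rule: equivclp_induct)
    case base
    then show ?case using assms(2) by simp
  next
    case (step y z)
    then have z: "word F K z" using wd by blast
    let ?s = "(G, i, H, q, K)"
    have s: "word K G [?s]" using assms(3) word.single by blast
    have "wstep (?s # y) (?s # z) \<or> wstep (?s # z) (?s # y)"
      using step(2) wstep.left[OF _ conjunct2[OF step(3)] z s] wstep.left[OF _ z conjunct2[OF step(3)] s]
      by auto
    then show ?case using equivclp_into_equivclp[OF conjunct1[OF step(3)]] z by simp
  qed
qed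

text \<open>A ladder of long words is cut into its short ladders, each of which factors through a pullback
  or a pushout.\<close>

lemma wmor_pushout_head:
  assumes "wmor a (idm F) w w'" "word F G w" "word F G' w'" "w = (G, i, H, q, K) # v"
    "ses (G', j, L, l, K)" "lad a x (idm K) (G, i, H, q, K) (G', j, L, l, K)"
  shows "equivclp wstep ((G', j, L, l, K) # v) w'"
  using assms
proof (induction a c\<equiv>"idm F" w w' arbitrary: G G' i H q K v j L l x rule: wmor.induct)
  case (single a m G1 i1 H1 q1 F1 G1' i1' H1' q1' F1')
  then have e: "F1 = F" "F1' = F" "G1' = G'" "G1 = G" "K = F" "i1 = i" "q1 = q" "H1 = H" "v = []"
    and s: "ses (G', i1', H1', q1', F)" "ses (G, i, H, q, F)"
    by (auto simp: word_single_iff)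
  \<comment> \<open>At the last sequence the factorization through the pushout is the identity on
    both ends, which is an instance of the rule \<open>iso\<close>.\<close>
  obtain u where "lad (idm G') u (idm F) (G', j, L, l, F) (G', i1', H1', q1', F)"
    using pushout_factor[OF s(2) single.prems(4)[unfolded e] single.prems(5)[unfolded e] s(1) single(1)[unfolded e]]
    by blast
  then show ?case unfolding e using wstep.iso s single.prems(4) e r_into_equivclp by metis
next
  case (cons a m k G1 i1 H1 q1 F1 G1' i1' H1' q1' F1' w w')
  have ne: "w \<noteq> []" "w' \<noteq> []" using cons.hyps(2) wmor_nonempty by auto
  have e: "v = w" "G1' = G'" "G1 = G" "K = F1" "i1 = i" "q1 = q" "H1 = H"
    and s: "ses (G', i1', H1', q1', F1')" "ses (G, i, H, q, F1)" "word F F1 w" "word F F1' w'"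
    using cons.prems ne by (auto simp: word_cons_iff)
  have S': "ses (G', j, L, l, F1)" using cons.prems(4) e by simp
  have k: "k \<in> hom F1 F1'" using cons.hyps(1) by (auto simp: ladder_def)
  obtain t w2 where w: "w = t # w2" using ne by (cases w) auto
  obtain A b T d A' where t: "t = (A, b, T, d, A')" by (cases t) auto
  have A: "ses (F1, b, T, d, A')" "A = F1"
    using s(3) unfolding w t by (cases "w2 = []"; auto simp: word_single_iff word_cons_iff)+
  \<comment> \<open>The rung \<open>k\<close> is realized by a pushout of the next sequence. This
    turns the rest of the morphism into an instance of the induction hypothesis.\<close>
  obtain b' T' d' y where B: "ses (F1', b', T', d', A')" "lad k y (idm A') (F1, b, T, d, A') (F1', b', T', d', A')"
    using pushout_ex[OF A(1) k] by blast
  have wd: "word F F1' ((F1', b', T', d', A') # w2)"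
    using s(3) B unfolding w t by (cases "w2 = []") (auto simp: word_single_iff word_cons_iff)
  have IH: "equivclp wstep ((F1', b', T', d', A') # w2) w'"
    using cons.hyps(3)[OF s(3,4) _ B] w t A(2) by simp
  \<comment> \<open>What remains of the first ladder is the identity on \<open>G'\<close> with right
    rung \<open>k\<close>, hence a pullback. Together with the pushout just made it is a switch
    along \<open>k\<close>.\<close>
  obtain u where u: "lad (idm G') u k (G', j, L, l, F1) (G', i1', H1', q1', F1')"
    using pushout_factor[OF s(2) S' cons.prems(5)[unfolded e] s(1), of m k] cons.hyps(1) unfolding e by blast
  have sw: "wstep [(G', j, L, l, F1), (F1, b, T, d, A')] [(G', i1', H1', q1', F1'), (F1', b', T', d', A')]"
    using wstep.switch[OF S' s(1) u A(1) B] .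
  have "wstep ((G', j, L, l, F1) # w) ((G', i1', H1', q1', F1') # (F1', b', T', d', A') # w2)"
  proof (cases "w2 = []")
    case True
    then show ?thesis using sw by (simp add: w t A)
  next
    case False
    then have "word F A' w2" using s(3) by (auto simp: w t word_cons_iff)
    from wstep.right[OF sw _ _ this, of G'] show ?thesis
      using S' A s(1) B by (simp add: w t word_single_iff word_cons_iff)
  qed
  moreover have "equivclp wstep ((G', i1', H1', q1', F1') # (F1', b', T', d', A') # w2) ((G', i1', H1', q1', F1') # w')"
    using wstep_cons[OF IH wd s(1)] by blast
  ultimately show ?case unfolding e by (rule equivclp_trans[OF r_into_equivclp])
qed

lemma weq_imp_wstep:
  assumes "weq F G w w'"
  shows "equivclp wstep w w'"
proof -
  have *: "equivclp wstep u u'" if u: "word F G u" "word F G u'" "wmor (idm G) (idm F) u u'" for u u'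
  proof -
    obtain s v where w: "u = s # v" using word_nonempty[OF u(1)] by (cases u) auto
    obtain G1 i H q K where s: "s = (G1, i, H, q, K)" by (cases s) auto
    have "G1 = G" "ses (G, i, H, q, K)"
      using u(1) unfolding w s by (cases "v = []"; auto simp: word_single_iff word_cons_iff)+
    \<comment> \<open>The identity ladder plays the pushout of the first sequence.\<close>
    then show ?thesis using wmor_pushout_head[OF u(3,1,2), of i H q K v i H q "idm H"] lad_idm by (auto simp: w s)
  qed
  from assms show ?thesis unfolding weq_def
  proof (induction rule: equivclp_induct)
    case base
    then show ?case by simp
  next
    case (step y z)
    have "equivclp wstep y z" using step(2) by (elim disjE conjE) (blast intro: * equivclp_sym)+
    then show ?case by (rule equivclp_trans[OF step(3)])
  qed
qed

end

section \<open>The opposite category\<close>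

definition flip :: "'o \<times> 'm \<times> 'o \<times> 'm \<times> 'o \<Rightarrow> 'o \<times> 'm \<times> 'o \<times> 'm \<times> 'o" where
  "flip = (\<lambda>(G, i, H, q, F). (F, q, H, i, G))"

definition flips :: "('o \<times> 'm \<times> 'o \<times> 'm \<times> 'o) list \<Rightarrow> ('o \<times> 'm \<times> 'o \<times> 'm \<times> 'o) list" where
  "flips w = rev (map flip w)"

lemma flip_simp: "flip (G, i, H, q, F) = (F, q, H, i, G)"
  by (simp add: flip_def)

lemma flips_flips: "flips (flips w) = w"
  by (simp add: flips_def rev_map comp_def flip_def case_prod_beta)

lemma flips_append: "flips (v @ w) = flips w @ flips v"
  by (simp add: flips_def)

lemma flips_single: "flips [(G, i, H, q, F)] = [(F, q, H, i, G)]"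
  by (simp add: flips_def flip_def)

lemma flips_cons: "flips ((G, i, H, q, F) # w) = flips w @ [(F, q, H, i, G)]"
  by (simp add: flips_def flip_def)

lemma length_flips: "length (flips w) = length w"
  by (simp add: flips_def)

lemma ladder_flip:
  "ladder (\<lambda>A B. Hom B A) (\<lambda>g f. cmp f g) c m a (F', q', H', i', G') (F, q, H, i, G) \<longleftrightarrow>
   ladder Hom cmp a m c (G, i, H, q, F) (G', i', H', q', F')"
  by (auto simp: ladder_def)

text \<open>The axioms are exchanged in pairs: the two unit laws, the two families of maps of the
  zero object, pullbacks with pushouts, and the two gluings. Each goal is the partner of its
  axiom.\<close>

lemma exact_cat_dual:
  assumes "exact_cat obj Hom cmp idm Z zt zf ses"
  shows "exact_cat obj (\<lambda>A B. Hom B A) (\<lambda>g f. cmp f g) idm Z zf zt (\<lambda>s. ses (flip s))"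
proof -
  interpret exact_cat obj Hom cmp idm Z zt zf ses by (rule assms)
  show ?thesis
  proof (rule exact_cat.intro, unfold flip_simp ladder_flip[of Hom cmp], goal_cases)
    case (1 f A B)
    then show ?case using hom_obj by blast
  next
    case 2
    then show ?case by (rule cmp_hom[rotated])
  next
    case (3 f A B g C h D)
    then show ?case by (simp add: cmp_assoc)
  next
    case 4
    then show ?case by (rule idm_hom)
  next
    case 5
    then show ?case by (rule idm_cmp)
  next
    case 6
    then show ?case by (rule cmp_idm)
  next
    case 7
    then show ?case by (rule Z_obj)
  next
    case 8
    then show ?case by (rule zf_hom)
  next
    case 9
    then show ?case by (rule zt_hom)
  next
    case 10
    then show ?case by (rule zf_unique)
  next
    case 11
    then show ?case by (rule zt_unique)
  next
    case (12 G i H q F)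
    then show ?case using ses_hom by blast
  next
    case 13
    then show ?case by (rule ses_zf_idm)
  next
    case 14
    then show ?case by (rule ses_idm_zt)
  next
    case 15
    then show ?case by (rule pushout_ex)
  next
    case 16
    then show ?case by (rule pushout_factor)
  next
    case 17
    then show ?case by (rule pullback_ex)
  next
    case 18
    then show ?case by (rule pullback_factor)
  next
    case 19
    then show ?case by (rule epi_glue)
  next
    case 20
    then show ?case by (rule mono_glue)
  qed
qed

section \<open>The criterion for extending a word\<close>

context exact_cat begin

text \<open>By \<open>extend_word\<close>, the part of \<open>w\<close> before its last sequence
  extends along the injection \<open>i\<close> of that sequence. The last sequence itself can then
  be pushed out along its own injection, and such a pushout splits; the extended part followed by
  this pushout is the desired target.\<close>

lemma fsplit_to_lsplit:
  assumes "word F G w" "length w \<ge> 2" "word F G w'" "wmor (idm G) (idm F) w' w" "fsplit w'"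
  shows "\<exists>v. word F G v \<and> wmor (idm G) (idm F) w v \<and> lsplit v"
proof -
  obtain w1' sV where w': "w' = w1' @ [sV]" using word_nonempty[OF assms(3)] by (metis rev_exhaust)
  obtain K v W y F1 where V: "sV = (K, v, W, y, F1)" by (rule prod_cases5)
  have ne: "w1' \<noteq> []" using wmor_lengths[OF assms(4)] assms(2) w' by auto
  obtain k w1 B i C p Q c where w: "w = w1 @ [(B, i, C, p, Q)]" "wmor (idm G) k w1' w1"
    "lad k c (idm F) (K, v, W, y, F1) (B, i, C, p, Q)"
    using wmor_snocE[OF assms(4)[unfolded w' V] ne] by metis
  have ne': "w1 \<noteq> []" using w(2) wmor_nonempty by blast
  have a: "word K G w1'" "ses (K, v, W, y, F)" "F1 = F"
    using word_appendE[OF assms(3)[unfolded w' V] ne] by (auto simp: word_single_iff)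
  have b: "word B G w1" "ses (B, i, C, p, F)" "Q = F"
    using word_appendE[OF assms(1)[unfolded w(1)] ne'] by (auto simp: word_single_iff)
  have "fsplit w1'" using assms(5) ne by (cases w1') (auto simp: fsplit_def w')
  then obtain w0 where w0: "word C G w0" "wmor (idm G) i w1 w0"
    using extend_word[OF a(1) b(1) w(2) _ a(2) b(2)] w(3) a(3) b(3) by blast
  have h: "i \<in> hom B C" "p \<in> hom C F" and o: "obj C" "obj F"
    using ses_hom[OF b(2)] ses_obj[OF b(2)] by auto
  obtain j D d x where D: "ses (C, j, D, d, F)" "lad i x (idm F) (B, i, C, p, F) (C, j, D, d, F)"
    using pushout_ex[OF b(2) h(1)] by blast
  have "zt C = zt F \<cdot> p" by (rule zt_unique[symmetric, OF cmp_hom[OF h(2) zt_hom[OF o(2)]]])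
  \<comment> \<open>A pushout along \<open>i\<close> splits because the identity of \<open>C\<close>
    extends \<open>i\<close>: this ladder to \<open>C = C -> 0\<close> factors through the pushout,
    and the factor is a retraction.\<close>
  then have "lad i (idm C) (zt F) (B, i, C, p, F) (C, idm C, C, zt C, Z)"
    using h zt_hom[OF o(2)] idm_hom[OF o(1)] cmp_idm[OF zt_hom[OF o(1)]] by (simp add: ladder_def)
  then obtain u where "lad (idm C) u (zt F) (C, j, D, d, F) (C, idm C, C, zt C, Z)"
    using pushout_factor[OF b(2) D ses_idm_zt[OF o(1)]] by blast
  then have "u \<in> hom D C" "u \<cdot> j = idm C" using cmp_idm[OF idm_hom[OF o(1)]] by (auto simp: ladder_def)
  then obtain s where "s \<in> hom F D" "d \<cdot> s = idm F" using retraction_imp_section[OF D(1)] by blast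
  then have "lsplit (w0 @ [(C, j, D, d, F)])" unfolding lsplit_def by blast
  moreover have "word F G (w0 @ [(C, j, D, d, F)])" using word_append[OF w0(1)] D(1) word.single by blast
  moreover have "wmor (idm G) (idm F) w (w0 @ [(C, j, D, d, F)])"
    unfolding w(1) b(3) using wmor_append[OF w0(2)] D(2) wmor.single by blast
  ultimately show ?thesis by blast
qed

lemma wtriv_if_extends:
  assumes "word B G w" "ses (B, i, C, p, Q)" "word C G w0" "wmor (idm G) i w w0"
  shows "weq Q G (w @ [(B, i, C, p, Q)]) (wtriv (length w - 1) Q G)"
proof -
  have h: "i \<in> hom B C" "p \<in> hom C Q" and o: "obj C" "obj Q" "obj G"
    using ses_hom[OF assms(2)] ses_obj[OF assms(2)] word_obj[OF assms(1)] by auto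
  obtain j D d x where D: "ses (C, j, D, d, Q)" "lad i x (idm Q) (B, i, C, p, Q) (C, j, D, d, Q)"
    using pushout_ex[OF assms(2) h(1)] by blast
  have "zt C = zt Q \<cdot> p" by (rule zt_unique[symmetric, OF cmp_hom[OF h(2) zt_hom[OF o(2)]]])
  then have "lad i (idm C) (zt Q) (B, i, C, p, Q) (C, idm C, C, zt C, Z)"
    using h zt_hom[OF o(2)] idm_hom[OF o(1)] cmp_idm[OF zt_hom[OF o(1)]] by (simp add: ladder_def)
  then obtain u where "lad (idm C) u (zt Q) (C, j, D, d, Q) (C, idm C, C, zt C, Z)"
    using pushout_factor[OF assms(2) D ses_idm_zt[OF o(1)]] by blast
  then have "u \<in> hom D C" "u \<cdot> j = idm C" using cmp_idm[OF idm_hom[OF o(1)]] by (auto simp: ladder_def)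
  then obtain s where "s \<in> hom Q D" "d \<cdot> s = idm Q" using retraction_imp_section[OF D(1)] by blast
  then have ls: "lsplit (w0 @ [(C, j, D, d, Q)])" unfolding lsplit_def by blast
  have wd: "word Q G (w0 @ [(C, j, D, d, Q)])" "word Q G (w @ [(B, i, C, p, Q)])"
    using word_append[OF assms(3)] word_append[OF assms(1)] D(1) assms(2) word.single by blast+
  have "wmor (idm G) (idm Q) (w @ [(B, i, C, p, Q)]) (w0 @ [(C, j, D, d, Q)])"
    using wmor_append[OF assms(4)] D(2) wmor.single by blast
  then have 1: "weq Q G (w @ [(B, i, C, p, Q)]) (w0 @ [(C, j, D, d, Q)])" using weq_step wd by blast
  \<comment> \<open>The index of the trivial word: appending one sequence to \<open>w\<close> gives
    length \<open>length w + 1\<close>, and \<open>wtriv n\<close> has length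
    \<open>n + 2\<close>.\<close>
  have "length (w0 @ [(C, j, D, d, Q)]) = (length w - 1) + 2"
    using wmor_lengths[OF assms(4)] word_nonempty[OF assms(3)] by (cases w0) auto
  then have "weq Q G (wtriv (length w - 1) Q G) (w0 @ [(C, j, D, d, Q)])"
    using wmor_wtriv_lsplit[OF wd(1) ls] weq_step wd(1) word_wtriv o by blast
  then show ?thesis using 1 weq_sym weq_trans by blast
qed

end

text \<open>The opposite category is attached to a copy of the locale. Attached to
  \<open>exact_cat\<close> itself it would receive an opposite of its own, and so on without
  end.\<close>

locale exact_cat_dual = exact_cat
begin

sublocale op: exact_cat obj "\<lambda>A B. hom B A" "\<lambda>g f. f \<cdot> g" idm Z zf zt "\<lambda>s. ses (flip s)"
  by (rule exact_cat_dual[OF exact_cat_axioms])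

lemma word_flips: "word F G w \<Longrightarrow> op.word G F (flips w)"
proof (induction rule: word.induct)
  case (single G i H q F)
  then show ?case by (auto simp: flips_single flip_simp intro: op.word.single)
next
  case (cons G i H q K F w)
  then show ?case unfolding flips_cons
    by - (rule op.word_append, simp_all add: flip_simp op.word_single_iff)
qed

lemma op_word_flips: "op.word G F w \<Longrightarrow> word F G (flips w)"
proof (induction rule: op.word.induct)
  case (single G i H q F)
  then show ?case by (auto simp: flips_single flip_simp intro: word.single)
next
  case (cons G i H q K F w)
  then show ?case unfolding flips_cons
    by - (rule word_append, simp_all add: word_single_iff flip_simp)
qed

lemma wmor_flips: "wmor a c w w' \<Longrightarrow> op.wmor c a (flips w') (flips w)"
proof (induction rule: wmor.induct)
  case (single a m c G i H q F G' i' H' q' F')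
  then show ?case unfolding flips_single by (intro op.wmor.single) (simp add: ladder_flip[of hom "(\<cdot>)"])
next
  case (cons a m k G i H q F G' i' H' q' F' c w w')
  then show ?case unfolding flips_cons
    by - (rule op.wmor_append, auto simp: ladder_flip[of hom "(\<cdot>)"] op.wmor_single_iff)
qed

lemma op_wmor_flips: "op.wmor c a w' w \<Longrightarrow> wmor a c (flips w) (flips w')"
proof (induction rule: op.wmor.induct)
  case (single a m c G i H q F G' i' H' q' F')
  then show ?case unfolding flips_single by (intro wmor.single) (simp add: ladder_flip[of hom "(\<cdot>)"])
next
  case (cons a m k G i H q F G' i' H' q' F' c w w')
  then show ?case unfolding flips_cons
    by - (rule wmor_append, auto simp: ladder_flip[of hom "(\<cdot>)"] wmor_single_iff)
qed

lemma weq_flips: "weq F G w w' \<Longrightarrow> op.weq G F (flips w) (flips w')"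
  unfolding weq_def
proof (induction rule: equivclp_induct)
  case base
  then show ?case by (simp add: op.weq_def)
next
  case (step y z)
  from step(2) have "op.weq G F (flips y) (flips z)"
    by (elim disjE conjE) (blast intro: op.weq_step op.weq_sym word_flips wmor_flips)+
  with step(3) show ?case by (rule op.weq_trans)
qed

lemma op_weq_flips: "op.weq G F w w' \<Longrightarrow> weq F G (flips w) (flips w')"
  unfolding op.weq_def
proof (induction rule: equivclp_induct)
  case base
  then show ?case by (simp add: weq_def)
next
  case (step y z)
  from step(2) have "weq F G (flips y) (flips z)"
    by (elim disjE conjE) (blast intro: weq_step weq_sym op_word_flips op_wmor_flips)+
  with step(3) show ?case by (rule weq_trans)
qed

lemma fsplit_flips: "op.fsplit (flips w) \<longleftrightarrow> lsplit w"
proof -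
  have "op.fsplit (flips w) \<longleftrightarrow> (\<exists>G i H q F v r. flips w = (F, q, H, i, G) # flips v \<and> r \<in> hom F H \<and> q \<cdot> r = idm F)"
    unfolding op.fsplit_def by (metis flips_flips)
  also have "\<dots> \<longleftrightarrow> lsplit w"
    unfolding lsplit_def by (metis flips_append flips_single flips_flips append_Cons append_Nil)
  finally show ?thesis .
qed

lemma lsplit_flips: "op.lsplit (flips w) \<longleftrightarrow> fsplit w"
proof -
  have "op.lsplit (flips w) \<longleftrightarrow> (\<exists>G i H q F v r. flips w = flips v @ [(F, q, H, i, G)] \<and> r \<in> hom H G \<and> r \<cdot> i = idm G)"
    unfolding op.lsplit_def by (metis flips_flips)
  also have "\<dots> \<longleftrightarrow> fsplit w"
    unfolding fsplit_def by (metis flips_cons flips_flips)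
  finally show ?thesis .
qed

lemma flips_wtriv: "flips (wtriv n F G) = op.wtriv n G F"
  by (simp add: wtriv_def op.wtriv_def flips_def flip_def zf_Z zt_Z)

lemma lsplit_to_fsplit:
  assumes "word F G w" "length w \<ge> 2" "word F G v" "wmor (idm G) (idm F) w v" "lsplit v"
  shows "\<exists>w'. word F G w' \<and> wmor (idm G) (idm F) w' w \<and> fsplit w'"
proof -
  obtain u where "op.word G F u" "op.wmor (idm F) (idm G) (flips w) u" "op.lsplit u"
    using op.fsplit_to_lsplit[OF word_flips[OF assms(1)] _ word_flips[OF assms(3)] wmor_flips[OF assms(4)]]
      assms(2,5) by (auto simp: length_flips fsplit_flips)
  then show ?thesis using op_word_flips op_wmor_flips[of "idm F" "idm G" "flips w" u] lsplit_flips[of "flips u"]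
    by (metis flips_flips)
qed

text \<open>Being the target of a morphism from a word with split first map is trivially stable under
  morphisms in one direction; trading a split first map for a split last map gives the other one.\<close>

lemma fsplit_weq:
  assumes "weq F G w w'" "length w \<ge> 2" "word F G w" "\<exists>v. word F G v \<and> wmor (idm G) (idm F) v w \<and> fsplit v"
  shows "\<exists>v. word F G v \<and> wmor (idm G) (idm F) v w' \<and> fsplit v"
  using assms(1) unfolding weq_def
proof (induction rule: equivclp_induct)
  case base
  then show ?case using assms(4) .
next
  case (step y z)
  have l: "length y \<ge> 2" using weq_length[of F G w y] step(1) assms(2) by (simp add: weq_def)
  obtain v where v: "word F G v" "wmor (idm G) (idm F) v y" "fsplit v" using step(3) by blast
  have o: "obj F" "obj G" using word_obj[OF assms(3)] by auto
  note c = wmor_comp_idm[of G "idm F" _ _ "idm F" _ F F F, unfolded cmp_idm[OF idm_hom[OF o(1)]]]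
  from step(2) show ?case
  proof (elim disjE conjE)
    assume "word F G y" "word F G z" "wmor (idm G) (idm F) y z"
    then show ?thesis using c v by blast
  next
    assume yz: "word F G z" "word F G y" "wmor (idm G) (idm F) z y"
    \<comment> \<open>A word with split last map that receives \<open>y\<close> also receives
      \<open>z\<close>, by composition, and can then be traded back into a word with split first map
      that maps to \<open>z\<close>.\<close>
    obtain u where u: "word F G u" "wmor (idm G) (idm F) y u" "lsplit u"
      using fsplit_to_lsplit[OF yz(2) l v] by blast
    have "wmor (idm G) (idm F) z u" using c[OF yz(3) u(2) yz(1,2) u(1)] .
    moreover have "length z \<ge> 2" using l wmor_lengths[OF yz(3)] by simp
    ultimately show ?thesis using lsplit_to_fsplit yz(1) u by blast
  qed
qed

theorem extends_iff:
  assumes "word B G w" "ses (B, i, C, p, Q)"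
  shows "(\<exists>w0. word C G w0 \<and> wmor (idm G) i w w0) \<longleftrightarrow>
    weq Q G (w @ [(B, i, C, p, Q)]) (wtriv (length w - 1) Q G)"
proof
  assume "\<exists>w0. word C G w0 \<and> wmor (idm G) i w w0"
  then show "weq Q G (w @ [(B, i, C, p, Q)]) (wtriv (length w - 1) Q G)"
    using wtriv_if_extends[OF assms] by blast
next
  assume e: "weq Q G (w @ [(B, i, C, p, Q)]) (wtriv (length w - 1) Q G)"
  have ne: "w \<noteq> []" using word_nonempty[OF assms(1)] .
  have wd: "word Q G (wtriv (length w - 1) Q G)" and o: "obj G"
    using word_wtriv ses_obj[OF assms(2)] word_obj[OF assms(1)] by auto
  \<comment> \<open>The trivial word maps to itself by the identity and has a split first map; the
    zigzag carries this property to its other end.\<close>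
  obtain v where v: "word Q G v" "wmor (idm G) (idm Q) v (w @ [(B, i, C, p, Q)])" "fsplit v"
    using fsplit_weq[OF weq_sym[OF e] _ wd] wd wmor_idm[OF wd] fsplit_wtriv[OF o] by (auto simp: wtriv_def)
  obtain w' t where v': "v = w' @ [t]" using word_nonempty[OF v(1)] by (metis rev_exhaust)
  obtain K a W y F1 where t: "t = (K, a, W, y, F1)" by (rule prod_cases5)
  have ne': "w' \<noteq> []" using wmor_lengths[OF v(2)] ne by (auto simp: v')
  obtain k w1 B' i' C' p' Q' c where *: "w @ [(B, i, C, p, Q)] = w1 @ [(B', i', C', p', Q')]"
    "wmor (idm G) k w' w1" "lad k c (idm Q) (K, a, W, y, F1) (B', i', C', p', Q')"
    using wmor_snocE[OF v(2)[unfolded v' t] ne'] by metis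
  have "word K G w'" "ses (K, a, W, y, Q)" "F1 = Q"
    using word_appendE[OF v(1)[unfolded v' t] ne'] by (auto simp: word_single_iff)
  \<comment> \<open>The word \<open>v\<close> has at least two sequences, so its first one survives
    the removal of the last.\<close>
  moreover have "fsplit w'" using v(3) ne' by (cases w') (auto simp: fsplit_def v')
  ultimately show "\<exists>w0. word C G w0 \<and> wmor (idm G) i w w0"
    using extend_word[of K G w' B w k a W y Q i C p c] assms * by auto
qed

end

section \<open>Lifting as extension in the opposite category\<close>

context exact_cat_dual begin

theorem lifts_iff:
  assumes "word F Q w" "ses (B, i, C, p, Q)"
  shows "(\<exists>w0. word F C w0 \<and> wmor p (idm F) w0 w) \<longleftrightarrow>
    weq F B ((B, i, C, p, Q) # w) (wtriv (length w - 1) F B)"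
proof -
  \<comment> \<open>The proof of \<open>extends_iff\<close> uses an opposite category, so the
    opposite has to be made an instance of \<open>exact_cat_dual\<close> here; \<open>op\<close> is
    one of \<open>exact_cat\<close> only.\<close>
  interpret opp: exact_cat_dual obj "\<lambda>A B. hom B A" "\<lambda>g f. f \<cdot> g" idm Z zf zt "\<lambda>s. ses (flip s)" ..
  have "(\<exists>w0. word F C w0 \<and> wmor p (idm F) w0 w) \<longleftrightarrow>
      (\<exists>w0. op.word C F w0 \<and> op.wmor (idm F) p (flips w) w0)"
    using word_flips op_word_flips wmor_flips op_wmor_flips by (metis flips_flips)
  also have "\<dots> \<longleftrightarrow> op.weq B F (flips w @ [(Q, p, C, i, B)]) (op.wtriv (length w - 1) B F)"
    using opp.extends_iff[OF word_flips[OF assms(1)], of p C i B] assms(2) by (simp add: flip_simp length_flips)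
  also have "\<dots> \<longleftrightarrow> weq F B ((B, i, C, p, Q) # w) (wtriv (length w - 1) F B)"
    using weq_flips[of F B "(B, i, C, p, Q) # w" "wtriv (length w - 1) F B"]
      op_weq_flips[of B F "flips w @ [(Q, p, C, i, B)]" "op.wtriv (length w - 1) B F"]
    by (metis flips_cons flips_wtriv flips_flips)
  finally show ?thesis .
qed

end

section \<open>\'Etal\'e spaces and their sections\<close>

lemma etale_space_topspace: "etale_space M S E \<Longrightarrow> topspace E = Sigma (topspace M) S"
  by (simp add: etale_space_def)

lemma etale_section_through:
  assumes "etale_space M S E" "x \<in> topspace M" "a \<in> S x"
  obtains U s where "openin M U" "x \<in> U" "s \<in> sections M E U" "s x = a"
proof -
  have "(x, a) \<in> topspace E" using assms by (simp add: etale_space_def)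
  then obtain V where V: "openin E V" "(x, a) \<in> V" "openin M (fst ` V)"
      "homeomorphic_map (subtopology E V) (subtopology M (fst ` V)) fst"
    using assms(1) unfolding etale_space_def by blast
  obtain g where g: "homeomorphic_maps (subtopology E V) (subtopology M (fst ` V)) fst g"
    using V(4) homeomorphic_map_maps by blast
  have tV: "topspace (subtopology E V) = V" "topspace (subtopology M (fst ` V)) = fst ` V"
    using openin_subset[OF V(1)] openin_subset[OF V(3)] by (auto simp: topspace_subtopology)
  have gc: "continuous_map (subtopology M (fst ` V)) (subtopology E V) g"
    and gf: "\<And>e. e \<in> V \<Longrightarrow> g (fst e) = e" and fg: "\<And>y. y \<in> fst ` V \<Longrightarrow> fst (g y) = y"
    using g tV unfolding homeomorphic_maps_def by auto
  have "(\<lambda>y. snd (g y)) \<in> sections M E (fst ` V)"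
    unfolding sections_def mem_Collect_eq
  proof (rule continuous_map_eq[where f = g])
    show "continuous_map (subtopology M (fst ` V)) E g"
      using gc continuous_map_into_fulltopology by blast
    show "g y = (y, snd (g y))" if "y \<in> topspace (subtopology M (fst ` V))" for y
      using that fg tV by (metis prod.collapse)
  qed
  moreover have "snd (g x) = a" using gf[OF V(2)] by simp
  moreover have "x \<in> fst ` V" using V(2) by force
  ultimately show thesis using that V(3) by blast
qed

lemma sections_iff:
  assumes "openin M U"
  shows "s \<in> sections M E U \<longleftrightarrow>
    (\<forall>y\<in>U. (y, s y) \<in> topspace E) \<and> (\<forall>V. openin E V \<longrightarrow> openin M {y \<in> U. (y, s y) \<in> V})"
proof -
  have t: "topspace (subtopology M U) = U" using openin_subset[OF assms] by auto
  show ?thesis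
    unfolding sections_def mem_Collect_eq continuous_map_def t openin_open_subtopology[OF assms]
    by (auto simp: Pi_iff)
qed

lemma sections_nbhd:
  assumes "openin M U" "s \<in> sections M E U" "openin E V" "x \<in> U" "(x, s x) \<in> V"
  obtains W where "openin M W" "x \<in> W" "W \<subseteq> U" "\<And>y. y \<in> W \<Longrightarrow> (y, s y) \<in> V"
proof (rule that[of "{y \<in> U. (y, s y) \<in> V}"])
  show "openin M {y \<in> U. (y, s y) \<in> V}" using assms(2,3) sections_iff[OF assms(1)] by blast
qed (use assms in auto)

lemma sectionsI:
  assumes "openin M U" "\<And>y. y \<in> U \<Longrightarrow> (y, s y) \<in> topspace E"
    and "\<And>x V. x \<in> U \<Longrightarrow> openin E V \<Longrightarrow> (x, s x) \<in> V \<Longrightarrow>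
      \<exists>W. openin M W \<and> x \<in> W \<and> (\<forall>y\<in>W \<inter> U. (y, s y) \<in> V)"
  shows "s \<in> sections M E U"
  unfolding sections_iff[OF assms(1)]
proof (intro conjI ballI allI impI)
  fix V assume V: "openin E V"
  show "openin M {y \<in> U. (y, s y) \<in> V}"
    unfolding openin_subopen[of _ "{y \<in> U. (y, s y) \<in> V}"]
  proof
    fix x assume x: "x \<in> {y \<in> U. (y, s y) \<in> V}"
    then obtain W where "openin M W" "x \<in> W" "\<forall>y\<in>W \<inter> U. (y, s y) \<in> V"
      using assms(3)[of x V] V by blast
    then show "\<exists>T. openin M T \<and> x \<in> T \<and> T \<subseteq> {y \<in> U. (y, s y) \<in> V}"
      using x assms(1) by (intro exI[of _ "W \<inter> U"]) auto
  qed
qed (use assms(2) in blast)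

lemma sections_mem:
  assumes "etale_space M S E" "openin M U" "s \<in> sections M E U" "y \<in> U"
  shows "s y \<in> S y"
  using assms(3,4) unfolding sections_iff[OF assms(2)] etale_space_topspace[OF assms(1)] by blast

lemma sections_restrict: "s \<in> sections M E U \<Longrightarrow> V \<subseteq> U \<Longrightarrow> s \<in> sections M E V"
  unfolding sections_def by (auto intro: continuous_map_from_subtopology_mono)

lemma sections_cong:
  assumes "openin M U" "s \<in> sections M E U" "\<And>y. y \<in> U \<Longrightarrow> s y = t y"
  shows "t \<in> sections M E U"
proof -
  have "{y \<in> U. (y, t y) \<in> V} = {y \<in> U. (y, s y) \<in> V}" for V using assms(3) by auto
  then show ?thesis using assms(2,3) unfolding sections_iff[OF assms(1)] by auto
qed

lemma sections_local:
  assumes "openin M U" "\<And>x. x \<in> U \<Longrightarrow> \<exists>V. openin M V \<and> x \<in> V \<and> s \<in> sections M E V"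
  shows "s \<in> sections M E U"
proof (rule sectionsI[OF assms(1)])
  fix y assume "y \<in> U"
  then obtain V where V: "openin M V" "y \<in> V" "s \<in> sections M E V" using assms(2) by blast
  then show "(y, s y) \<in> topspace E" using sections_iff[OF V(1)] by blast
next
  fix x V assume x: "x \<in> U" "openin E V" "(x, s x) \<in> V"
  then obtain W where W: "openin M W" "x \<in> W" "s \<in> sections M E W" using assms(2) by blast
  then show "\<exists>W. openin M W \<and> x \<in> W \<and> (\<forall>y\<in>W \<inter> U. (y, s y) \<in> V)"
    using sections_nbhd[OF W(1,3) x(2) W(2) x(3)] by (metis IntD1)
qed

lemma etale_nbhd:
  assumes "etale_space M S E" "e \<in> topspace E"
  obtains V where "openin E V" "e \<in> V" "inj_on fst V" "\<And>W. openin M W \<Longrightarrow> openin E {d \<in> V. fst d \<in> W}"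
proof -
  obtain V where V: "openin E V" "e \<in> V" "openin M (fst ` V)"
      "homeomorphic_map (subtopology E V) (subtopology M (fst ` V)) fst"
    using assms unfolding etale_space_def by blast
  have tV: "topspace (subtopology E V) = V" "topspace (subtopology M (fst ` V)) = fst ` V"
    using openin_subset[OF V(1)] openin_subset[OF V(3)] by auto
  have "inj_on fst V" using homeomorphic_imp_injective_map[OF V(4)] tV by simp
  moreover have "openin E {d \<in> V. fst d \<in> W}" if "openin M W" for W
  proof -
    have "continuous_map (subtopology E V) M fst"
      using homeomorphic_imp_continuous_map[OF V(4)] continuous_map_into_fulltopology by blast
    then have "openin (subtopology E V) {d \<in> V. fst d \<in> W}"
      using that unfolding continuous_map_def tV(1) by blast
    then show ?thesis using V(1) openin_trans_full by blast
  qed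
  ultimately show thesis using that V by blast
qed

text \<open>The projection is injective on a neighbourhood of the common value, and near
  \<open>x\<close> both sections stay inside that neighbourhood.\<close>

lemma sections_agree:
  assumes "etale_space M S E" "openin M U" "s \<in> sections M E U" "openin M V" "t \<in> sections M E V"
    "x \<in> U" "x \<in> V" "s x = t x"
  obtains W where "openin M W" "x \<in> W" "W \<subseteq> U \<inter> V" "\<And>y. y \<in> W \<Longrightarrow> s y = t y"
proof -
  have "(x, s x) \<in> topspace E" using assms(3,6) sections_iff[OF assms(2)] by blast
  then obtain N where N: "openin E N" "(x, s x) \<in> N" "inj_on fst N"
    using etale_nbhd[OF assms(1)] by metis
  obtain W1 where W1: "openin M W1" "x \<in> W1" "W1 \<subseteq> U" "\<And>y. y \<in> W1 \<Longrightarrow> (y, s y) \<in> N"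
    using sections_nbhd[OF assms(2,3) N(1) assms(6) N(2)] by metis
  obtain W2 where W2: "openin M W2" "x \<in> W2" "W2 \<subseteq> V" "\<And>y. y \<in> W2 \<Longrightarrow> (y, t y) \<in> N"
    using sections_nbhd[OF assms(4,5) N(1) assms(7)] N(2) assms(8) by metis
  show thesis
  proof (rule that[of "W1 \<inter> W2"])
    fix y assume "y \<in> W1 \<inter> W2"
    then show "s y = t y" using inj_onD[OF N(3), of "(y, s y)" "(y, t y)"] W1(4) W2(4) by simp
  qed (use W1 W2 in auto)
qed

lemma section_image_open:
  assumes "etale_space M S E" "openin M U" "s \<in> sections M E U"
  shows "openin E ((\<lambda>y. (y, s y)) ` U)"
  unfolding openin_subopen[of _ "(\<lambda>y. (y, s y)) ` U"]
proof
  fix e assume "e \<in> (\<lambda>y. (y, s y)) ` U"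
  then obtain x where x: "x \<in> U" "e = (x, s x)" by blast
  then have "e \<in> topspace E" using assms(3) sections_iff[OF assms(2)] by blast
  then obtain N where N: "openin E N" "e \<in> N" "inj_on fst N"
      "\<And>W. openin M W \<Longrightarrow> openin E {d \<in> N. fst d \<in> W}"
    using etale_nbhd[OF assms(1)] by metis
  obtain W where W: "openin M W" "x \<in> W" "W \<subseteq> U" "\<And>y. y \<in> W \<Longrightarrow> (y, s y) \<in> N"
    using sections_nbhd[OF assms(2,3) N(1) x(1)] N(2) x(2) by metis
  have "{d \<in> N. fst d \<in> W} \<subseteq> (\<lambda>y. (y, s y)) ` U"
  proof clarify
    fix y b assume y: "(y, b) \<in> N" "fst (y, b) \<in> W"
    then have "(y, b) = (y, s y)" using inj_onD[OF N(3), of "(y, b)" "(y, s y)"] W(4)[of y] by simp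
    then show "(y, b) \<in> (\<lambda>y. (y, s y)) ` U" using y W(3) by auto
  qed
  moreover have "e \<in> {d \<in> N. fst d \<in> W}" using N(2) x W(2) by simp
  ultimately show "\<exists>T. openin E T \<and> e \<in> T \<and> T \<subseteq> (\<lambda>y. (y, s y)) ` U" using N(4)[OF W(1)] by blast
qed

lemma stalkmap_section:
  assumes "continuous_map E E' (\<lambda>(x, a). (x, f x a))" "s \<in> sections M E U"
  shows "(\<lambda>y. f y (s y)) \<in> sections M E' U"
  using continuous_map_compose[of "subtopology M U" E "\<lambda>y. (y, s y)" E' "\<lambda>(x, a). (x, f x a)"] assms
  by (simp add: sections_def comp_def)

text \<open>Images of sections are open, so continuity at a germ can be tested along a single
  section through it.\<close>

lemma stalkmap_continuous:
  assumes "etale_space M S E"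
    and "\<And>x a. x \<in> topspace M \<Longrightarrow> a \<in> S x \<Longrightarrow> \<exists>U s. openin M U \<and> x \<in> U \<and> s \<in> sections M E U \<and> s x = a \<and>
      (\<lambda>y. f y (s y)) \<in> sections M E' U"
  shows "continuous_map E E' (\<lambda>(x, a). (x, f x a))"
  unfolding continuous_map_def
proof (intro conjI allI impI)
  have *: "\<exists>U s. openin M U \<and> x \<in> U \<and> s \<in> sections M E U \<and> s x = a \<and> (\<lambda>y. f y (s y)) \<in> sections M E' U"
    if "(x, a) \<in> topspace E" for x a
    using that assms(2) etale_space_topspace[OF assms(1)] by auto
  show "(\<lambda>(x, a). (x, f x a)) \<in> topspace E \<rightarrow> topspace E'"
  proof (clarsimp)
    fix x a assume "(x, a) \<in> topspace E"
    then obtain U s where U: "openin M U" "x \<in> U" "s x = a" "(\<lambda>y. f y (s y)) \<in> sections M E' U"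
      using * by blast
    then show "(x, f x a) \<in> topspace E'" using sections_iff[OF U(1), of "\<lambda>y. f y (s y)" E'] by auto
  qed
  fix V assume V: "openin E' V"
  show "openin E {e \<in> topspace E. (case e of (x, a) \<Rightarrow> (x, f x a)) \<in> V}" (is "openin E ?P")
    unfolding openin_subopen[of _ ?P]
  proof clarify
    fix x a assume e: "(x, a) \<in> topspace E" "(x, f x a) \<in> V"
    then obtain U s where U: "openin M U" "x \<in> U" "s \<in> sections M E U" "s x = a"
        "(\<lambda>y. f y (s y)) \<in> sections M E' U"
      using * by blast
    obtain W where W: "openin M W" "x \<in> W" "W \<subseteq> U" "\<And>y. y \<in> W \<Longrightarrow> (y, f y (s y)) \<in> V"
      using sections_nbhd[OF U(1,5) V U(2)] U(4) e(2) by blast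
    have sW: "s \<in> sections M E W" using sections_restrict U(3) W(3) by blast
    have "openin E ((\<lambda>y. (y, s y)) ` W)" by (rule section_image_open[OF assms(1) W(1) sW])
    moreover have "(\<lambda>y. (y, s y)) ` W \<subseteq> ?P"
      using W(4) sW sections_iff[OF W(1), of s E] by auto
    moreover have "(x, a) \<in> (\<lambda>y. (y, s y)) ` W" using W(2) U(4) by auto
    ultimately show "\<exists>T. openin E T \<and> (x, a) \<in> T \<and> T \<subseteq> ?P" by blast
  qed
qed

lemma stalkop_section:
  assumes "continuous_map (subtopology (prod_topology E1 E2) {(a, b). fst a = fst b}) E3
      (\<lambda>((x, a), (_, b)). (x, g x a b))"
    and "s \<in> sections M E1 U" "t \<in> sections M E2 U"
  shows "(\<lambda>y. g y (s y) (t y)) \<in> sections M E3 U"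
proof -
  have "continuous_map (subtopology M U) (subtopology (prod_topology E1 E2) {(a, b). fst a = fst b})
      (\<lambda>y. ((y, s y), (y, t y)))"
    using assms(2,3) unfolding sections_def
    by (auto simp: continuous_map_in_subtopology continuous_map_pairedI)
  from continuous_map_compose[OF this assms(1)] show ?thesis
    by (simp add: sections_def comp_def)
qed

text \<open>Two sections over a common open set have as joint image an open subset of the fibre
  product, and along it the operation is a section.\<close>

lemma stalkop_continuous:
  assumes "etale_space M S1 E1" "etale_space M S2 E2"
    and "\<And>x a b. x \<in> topspace M \<Longrightarrow> a \<in> S1 x \<Longrightarrow> b \<in> S2 x \<Longrightarrow>
      \<exists>U s t. openin M U \<and> x \<in> U \<and> s \<in> sections M E1 U \<and> s x = a \<and> t \<in> sections M E2 U \<and> t x = b \<and>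
      (\<lambda>y. g y (s y) (t y)) \<in> sections M E3 U"
  shows "continuous_map (subtopology (prod_topology E1 E2) {(a, b). fst a = fst b}) E3
      (\<lambda>((x, a), (_, b)). (x, g x a b))" (is "continuous_map ?D E3 ?g")
  unfolding continuous_map_def
proof (intro conjI allI impI)
  have tD: "topspace ?D = {((x, a), (x', b)). x' = x \<and> x \<in> topspace M \<and> a \<in> S1 x \<and> b \<in> S2 x}"
    using etale_space_topspace[OF assms(1)] etale_space_topspace[OF assms(2)] by auto
  show "?g \<in> topspace ?D \<rightarrow> topspace E3"
  proof
    fix e assume "e \<in> topspace ?D"
    then obtain x a b where e: "e = ((x, a), (x, b))" "x \<in> topspace M" "a \<in> S1 x" "b \<in> S2 x"
      unfolding tD by auto
    obtain U s t where U: "openin M U" "x \<in> U" "s x = a" "t x = b" "(\<lambda>y. g y (s y) (t y)) \<in> sections M E3 U"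
      using assms(3)[OF e(2-4)] by blast
    then have "(x, g x a b) \<in> topspace E3" using sections_iff[OF U(1), of "\<lambda>y. g y (s y) (t y)" E3] by blast
    then show "?g e \<in> topspace E3" by (simp add: e(1))
  qed
  fix V assume V: "openin E3 V"
  show "openin ?D {e \<in> topspace ?D. ?g e \<in> V}" (is "openin ?D ?P")
    unfolding openin_subopen[of _ ?P]
  proof
    fix e assume "e \<in> ?P"
    then obtain x a b where e: "e = ((x, a), (x, b))" "x \<in> topspace M" "a \<in> S1 x" "b \<in> S2 x" "(x, g x a b) \<in> V"
      unfolding tD by auto
    obtain U s t where U: "openin M U" "x \<in> U" "s \<in> sections M E1 U" "s x = a" "t \<in> sections M E2 U" "t x = b"
        "(\<lambda>y. g y (s y) (t y)) \<in> sections M E3 U"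
      using assms(3)[OF e(2-4)] by blast
    obtain W where W: "openin M W" "x \<in> W" "W \<subseteq> U" "\<And>y. y \<in> W \<Longrightarrow> (y, g y (s y) (t y)) \<in> V"
      using sections_nbhd[OF U(1,7) V U(2)] U(4,6) e(5) by blast
    have sW: "s \<in> sections M E1 W" "t \<in> sections M E2 W" using sections_restrict U(3,5) W(3) by blast+
    let ?T = "((\<lambda>y. (y, s y)) ` W \<times> (\<lambda>y. (y, t y)) ` W) \<inter> {(a, b). fst a = fst b}"
    have "openin ?D ?T"
      unfolding openin_subtopology
      using section_image_open[OF assms(1) W(1) sW(1)] section_image_open[OF assms(2) W(1) sW(2)]
      by (intro exI conjI refl) (auto simp: openin_prod_Times_iff)
    moreover have "?T \<subseteq> ?P"
      unfolding tD using W sections_mem[OF assms(1) W(1) sW(1)] sections_mem[OF assms(2) W(1) sW(2)]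
        openin_subset[OF W(1)] by auto
    moreover have "e \<in> ?T" using W(2) U(4,6) e(1) by auto
    ultimately show "\<exists>T. openin ?D T \<and> e \<in> T \<and> T \<subseteq> ?P" by blast
  qed
qed

subsection \<open>The topology generated by a family of sections\<close>

text \<open>These are the conditions under which the images of the sections form a base of a
  topology whose projection is a local homeomorphism. The last clause, agreement at a point implies
  agreement near it, is the one that makes intersections of images unions of images.\<close>

definition section_family :: "'x topology \<Rightarrow> ('x \<Rightarrow> 'u set) \<Rightarrow> ('x set \<times> ('x \<Rightarrow> 'u)) set \<Rightarrow> bool" where
  "section_family M S \<S> \<longleftrightarrow>
     (\<forall>(U, s)\<in>\<S>. openin M U \<and> (\<forall>y\<in>U. s y \<in> S y)) \<and>
     (\<forall>(U, s)\<in>\<S>. \<forall>W. openin M W \<longrightarrow> (U \<inter> W, s) \<in> \<S>) \<and>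
     (\<forall>x\<in>topspace M. \<forall>a\<in>S x. \<exists>(U, s)\<in>\<S>. x \<in> U \<and> s x = a) \<and>
     (\<forall>(U, s)\<in>\<S>. \<forall>(V, t)\<in>\<S>. \<forall>x\<in>U \<inter> V. s x = t x \<longrightarrow>
        (\<exists>W. openin M W \<and> x \<in> W \<and> (\<forall>y\<in>W \<inter> U \<inter> V. s y = t y)))"

definition gen_etale :: "('x set \<times> ('x \<Rightarrow> 'u)) set \<Rightarrow> ('x \<times> 'u) topology" where
  "gen_etale \<S> = topology_generated_by {(\<lambda>y. (y, s y)) ` U | U s. (U, s) \<in> \<S>}"

lemma gen_etale_basis:
  assumes "section_family M S \<S>" "openin (gen_etale \<S>) V" "e \<in> V"
  shows "\<exists>U s. (U, s) \<in> \<S> \<and> e \<in> (\<lambda>y. (y, s y)) ` U \<and> (\<lambda>y. (y, s y)) ` U \<subseteq> V"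
proof -
  from assms(2) have "generate_topology_on {(\<lambda>y. (y, s y)) ` U | U s. (U, s) \<in> \<S>} V"
    unfolding gen_etale_def openin_topology_generated_by_iff .
  then show ?thesis using assms(3)
  proof (induction arbitrary: e rule: generate_topology_on.induct)
    case Empty
    then show ?case by simp
  next
    case (Int A B)
    obtain U s V t where *: "(U, s) \<in> \<S>" "e \<in> (\<lambda>y. (y, s y)) ` U" "(\<lambda>y. (y, s y)) ` U \<subseteq> A"
        "(V, t) \<in> \<S>" "e \<in> (\<lambda>y. (y, t y)) ` V" "(\<lambda>y. (y, t y)) ` V \<subseteq> B"
      using Int.IH(1)[of e] Int.IH(2)[of e] Int.prems by blast
    then obtain x where x: "x \<in> U" "x \<in> V" "s x = t x" "e = (x, s x)" by auto
    have "\<forall>x\<in>U \<inter> V. s x = t x \<longrightarrow> (\<exists>W. openin M W \<and> x \<in> W \<and> (\<forall>y\<in>W \<inter> U \<inter> V. s y = t y))"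
      using assms(1) *(1,4) unfolding section_family_def by blast
    then obtain W where W: "openin M W" "x \<in> W" "\<forall>y\<in>W \<inter> U \<inter> V. s y = t y" using x by blast
    have "openin M V" using assms(1) *(4) unfolding section_family_def by blast
    then have "openin M (V \<inter> W)" using W(1) by blast
    then have "(U \<inter> (V \<inter> W), s) \<in> \<S>" using assms(1) *(1) unfolding section_family_def by blast
    moreover have "(\<lambda>y. (y, s y)) ` (U \<inter> (V \<inter> W)) \<subseteq> A \<inter> B"
      using *(3,6) W(3) by (auto simp: image_subset_iff)
    ultimately show ?case using x W(2) by blast
  next
    case (UN K)
    then show ?case by (meson Union_iff Sup_upper subset_trans)
  next
    case (Basis s)
    then show ?case by blast
  qed
qed

lemma gen_etale_open: "(U, s) \<in> \<S> \<Longrightarrow> openin (gen_etale \<S>) ((\<lambda>y. (y, s y)) ` U)"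
  unfolding gen_etale_def by (rule topology_generated_by_Basis) blast

lemma gen_etale_topspace:
  assumes "section_family M S \<S>"
  shows "topspace (gen_etale \<S>) = Sigma (topspace M) S"
proof -
  have "topspace (gen_etale \<S>) = (\<Union>(U, s)\<in>\<S>. (\<lambda>y. (y, s y)) ` U)"
    unfolding gen_etale_def topology_generated_by_topspace by auto
  also have "\<dots> = Sigma (topspace M) S"
  proof (intro equalityI subsetI)
    fix e assume "e \<in> (\<Union>(U, s)\<in>\<S>. (\<lambda>y. (y, s y)) ` U)"
    then obtain U s y where *: "(U, s) \<in> \<S>" "y \<in> U" "e = (y, s y)" by auto
    then have "openin M U" "s y \<in> S y" using assms unfolding section_family_def by blast+
    then show "e \<in> Sigma (topspace M) S" using * openin_subset by fastforce
  next
    fix e assume "e \<in> Sigma (topspace M) S"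
    then obtain x a where e: "e = (x, a)" "x \<in> topspace M" "a \<in> S x" by auto
    then have "\<exists>(U, s)\<in>\<S>. x \<in> U \<and> s x = a" using assms unfolding section_family_def by blast
    then show "e \<in> (\<Union>(U, s)\<in>\<S>. (\<lambda>y. (y, s y)) ` U)" using e by auto
  qed
  finally show ?thesis .
qed

lemma gen_etale_sections:
  assumes "section_family M S \<S>" "(U, s) \<in> \<S>"
  shows "s \<in> sections M (gen_etale \<S>) U"
proof (rule sectionsI)
  show o: "openin M U" using assms unfolding section_family_def by blast
  show "(y, s y) \<in> topspace (gen_etale \<S>)" if "y \<in> U" for y
    using openin_subset[OF gen_etale_open[OF assms(2)]] that by auto
  fix x V assume x: "x \<in> U" "openin (gen_etale \<S>) V" "(x, s x) \<in> V"
  obtain U' t where t: "(U', t) \<in> \<S>" "(x, s x) \<in> (\<lambda>y. (y, t y)) ` U'" "(\<lambda>y. (y, t y)) ` U' \<subseteq> V"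
    using gen_etale_basis[OF assms(1) x(2,3)] by blast
  then have "x \<in> U \<inter> U'" "s x = t x" using x by auto
  moreover have "\<forall>x\<in>U \<inter> U'. s x = t x \<longrightarrow> (\<exists>W. openin M W \<and> x \<in> W \<and> (\<forall>y\<in>W \<inter> U \<inter> U'. s y = t y))"
    using assms t(1) unfolding section_family_def by blast
  ultimately obtain W where W: "openin M W" "x \<in> W" "\<forall>y\<in>W \<inter> U \<inter> U'. s y = t y" by blast
  have "openin M U'" using assms(1) t(1) unfolding section_family_def by blast
  then show "\<exists>W. openin M W \<and> x \<in> W \<and> (\<forall>y\<in>W \<inter> U. (y, s y) \<in> V)"
    using W t(3) \<open>x \<in> U \<inter> U'\<close> by (intro exI[of _ "W \<inter> U'"]) auto
qed

text \<open>Over the image of a section the projection is inverted by that section. Restricting the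
  section to smaller open sets, which the family allows, gives continuity of the projection.\<close>

lemma gen_etale_space:
  assumes "section_family M S \<S>"
  shows "etale_space M S (gen_etale \<S>)"
  unfolding etale_space_def gen_etale_topspace[OF assms]
proof (intro conjI refl ballI)
  let ?E = "gen_etale \<S>"
  fix e assume "e \<in> Sigma (topspace M) S"
  then obtain x a where e: "e = (x, a)" "x \<in> topspace M" "a \<in> S x" by auto
  then have "\<exists>(U, s)\<in>\<S>. x \<in> U \<and> s x = a" using assms unfolding section_family_def by blast
  then obtain U s where U: "(U, s) \<in> \<S>" "x \<in> U" "s x = a" by blast
  have oU: "openin M U" using assms U(1) unfolding section_family_def by blast
  let ?V = "(\<lambda>y. (y, s y)) ` U"
  have fV: "fst ` ?V = U" by force
  have tV: "topspace (subtopology ?E ?V) = ?V" "topspace (subtopology M U) = U"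
    using openin_subset[OF gen_etale_open[OF U(1)]] openin_subset[OF oU] by auto
  have "homeomorphic_maps (subtopology ?E ?V) (subtopology M U) fst (\<lambda>y. (y, s y))"
    unfolding homeomorphic_maps_def tV
  proof (intro conjI)
    show "continuous_map (subtopology ?E ?V) (subtopology M U) fst"
      unfolding continuous_map_in_subtopology tV
    proof
      show "continuous_map (subtopology ?E ?V) M fst"
        unfolding continuous_map_def tV
      proof (intro conjI allI impI)
        show "fst \<in> ?V \<rightarrow> topspace M" using openin_subset[OF oU] by auto
        fix W assume W: "openin M W"
        have "{e \<in> ?V. fst e \<in> W} = (\<lambda>y. (y, s y)) ` (U \<inter> W)" by auto
        moreover have "(U \<inter> W, s) \<in> \<S>" using assms U(1) W unfolding section_family_def by blast
        ultimately show "openin (subtopology ?E ?V) {e \<in> ?V. fst e \<in> W}"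
          using gen_etale_open gen_etale_open[OF U(1)] by (auto simp: openin_open_subtopology)
      qed
    qed auto
    show "continuous_map (subtopology M U) (subtopology ?E ?V) (\<lambda>y. (y, s y))"
      using gen_etale_sections[OF assms U(1)] tV by (simp add: continuous_map_in_subtopology sections_def)
  qed auto
  then have "homeomorphic_map (subtopology ?E ?V) (subtopology M (fst ` ?V)) fst"
    unfolding fV homeomorphic_map_maps by blast
  then show "\<exists>V. openin ?E V \<and> e \<in> V \<and> openin M (fst ` V) \<and>
      homeomorphic_map (subtopology ?E V) (subtopology M (fst ` V)) fst"
    using gen_etale_open[OF U(1)] U e oU fV by (intro exI[of _ ?V]) auto
qed

section \<open>Linear combinations\<close>

text \<open>The sums in \<open>finite_type\<close> and \<open>relations_finite_type\<close> are
  indexed by an initial segment of the natural numbers; under a name of their own they can be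
  treated by induction on the number of terms.\<close>

definition lincomb :: "('r, 'u, 'z) module_scheme \<Rightarrow> nat \<Rightarrow> (nat \<Rightarrow> 'r) \<Rightarrow> (nat \<Rightarrow> 'u) \<Rightarrow> 'u" where
  "lincomb N k a s = (\<Oplus>\<^bsub>N\<^esub> i\<in>{..<k}. a i \<odot>\<^bsub>N\<^esub> s i)"

lemma (in abelian_group) minus_zero_iff: "a \<in> carrier G \<Longrightarrow> b \<in> carrier G \<Longrightarrow> a \<ominus> b = \<zero> \<longleftrightarrow> a = b"
  by (metis a_minus_def minus_equality minus_minus r_neg a_inv_closed)

context module begin

lemma lincomb_0: "lincomb M 0 a s = \<zero>\<^bsub>M\<^esub>"
  by (simp add: lincomb_def)

lemma lincomb_Suc:
  assumes "\<And>i. i < Suc k \<Longrightarrow> a i \<in> carrier R" "\<And>i. i < Suc k \<Longrightarrow> s i \<in> carrier M"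
  shows "lincomb M (Suc k) a s = lincomb M k a s \<oplus>\<^bsub>M\<^esub> a k \<odot>\<^bsub>M\<^esub> s k"
proof -
  have "(\<Oplus>\<^bsub>M\<^esub> i\<in>insert k {..<k}. a i \<odot>\<^bsub>M\<^esub> s i) = a k \<odot>\<^bsub>M\<^esub> s k \<oplus>\<^bsub>M\<^esub> (\<Oplus>\<^bsub>M\<^esub> i\<in>{..<k}. a i \<odot>\<^bsub>M\<^esub> s i)"
    by (rule M.finsum_insert) (use assms in \<open>auto simp: Pi_iff\<close>)
  moreover have "(\<Oplus>\<^bsub>M\<^esub> i\<in>{..<k}. a i \<odot>\<^bsub>M\<^esub> s i) \<in> carrier M"
    by (rule M.finsum_closed) (use assms in \<open>auto simp: Pi_iff\<close>)
  ultimately show ?thesis using assms by (simp add: lincomb_def lessThan_Suc M.a_comm)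
qed

lemma lincomb_closed:
  assumes "\<And>i. i < k \<Longrightarrow> a i \<in> carrier R" "\<And>i. i < k \<Longrightarrow> s i \<in> carrier M"
  shows "lincomb M k a s \<in> carrier M"
  unfolding lincomb_def by (rule M.finsum_closed) (use assms in \<open>auto simp: Pi_iff\<close>)

lemma lincomb_cong:
  assumes "\<And>i. i < k \<Longrightarrow> a i = b i" "\<And>i. i < k \<Longrightarrow> s i = t i"
    and "\<And>i. i < k \<Longrightarrow> b i \<in> carrier R" "\<And>i. i < k \<Longrightarrow> t i \<in> carrier M"
  shows "lincomb M k a s = lincomb M k b t"
  unfolding lincomb_def by (rule M.finsum_cong') (use assms in \<open>auto simp: Pi_iff\<close>)

lemma lincomb_append:
  assumes "\<And>i. i < k \<Longrightarrow> a i \<in> carrier R" "\<And>i. i < k \<Longrightarrow> s i \<in> carrier M"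
    and "\<And>i. i < l \<Longrightarrow> b i \<in> carrier R" "\<And>i. i < l \<Longrightarrow> t i \<in> carrier M"
  shows "lincomb M (k + l) (\<lambda>i. if i < k then a i else b (i - k)) (\<lambda>i. if i < k then s i else t (i - k)) =
    lincomb M k a s \<oplus>\<^bsub>M\<^esub> lincomb M l b t"
  using assms(3,4)
proof (induction l)
  case 0
  have "lincomb M k (\<lambda>i. if i < k then a i else b (i - k)) (\<lambda>i. if i < k then s i else t (i - k)) = lincomb M k a s"
    by (rule lincomb_cong) (use assms in auto)
  then show ?case using lincomb_closed[of k a s] assms(1,2) by (simp add: lincomb_0)
next
  case (Suc l)
  have "lincomb M (Suc (k + l)) (\<lambda>i. if i < k then a i else b (i - k)) (\<lambda>i. if i < k then s i else t (i - k)) =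
      lincomb M (k + l) (\<lambda>i. if i < k then a i else b (i - k)) (\<lambda>i. if i < k then s i else t (i - k)) \<oplus>\<^bsub>M\<^esub> b l \<odot>\<^bsub>M\<^esub> t l"
    by (subst lincomb_Suc) (use assms(1,2) Suc.prems in auto)
  also have "\<dots> = (lincomb M k a s \<oplus>\<^bsub>M\<^esub> lincomb M l b t) \<oplus>\<^bsub>M\<^esub> b l \<odot>\<^bsub>M\<^esub> t l"
    using Suc by simp
  also have "\<dots> = lincomb M k a s \<oplus>\<^bsub>M\<^esub> lincomb M (Suc l) b t"
    using Suc.prems lincomb_closed[of k a s] lincomb_closed[of l b t] assms(1,2) lincomb_Suc[of l b t]
    by (simp add: M.a_assoc)
  finally show ?case by simp
qed

lemma lincomb_smult:
  assumes "\<And>i. i < k \<Longrightarrow> a i \<in> carrier R" "\<And>i. i < k \<Longrightarrow> s i \<in> carrier M" "r \<in> carrier R"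
  shows "r \<odot>\<^bsub>M\<^esub> lincomb M k a s = lincomb M k (\<lambda>i. r \<otimes> a i) s"
  using assms(1,2)
proof (induction k)
  case 0
  then show ?case using assms(3) by (simp add: lincomb_0 smult_r_null)
next
  case (Suc k)
  then show ?case using assms(3) lincomb_closed[of k a s]
    by (simp add: lincomb_Suc smult_r_distr smult_assoc1)
qed

lemma lincomb_add:
  assumes "\<And>i. i < k \<Longrightarrow> a i \<in> carrier R" "\<And>i. i < k \<Longrightarrow> b i \<in> carrier R" "\<And>i. i < k \<Longrightarrow> s i \<in> carrier M"
  shows "lincomb M k (\<lambda>i. a i \<oplus> b i) s = lincomb M k a s \<oplus>\<^bsub>M\<^esub> lincomb M k b s"
  using assms
proof (induction k)
  case 0
  then show ?case by (simp add: lincomb_0)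
next
  case (Suc k)
  have c: "lincomb M k a s \<in> carrier M" "lincomb M k b s \<in> carrier M" "a k \<odot>\<^bsub>M\<^esub> s k \<in> carrier M" "b k \<odot>\<^bsub>M\<^esub> s k \<in> carrier M"
    using Suc.prems by (auto intro!: lincomb_closed)
  then show ?case using Suc
    by (simp add: lincomb_Suc smult_l_distr) (simp add: M.a_ac)
qed

lemma finsum_ring_Suc:
  assumes "\<And>j. j < Suc m \<Longrightarrow> f j \<in> carrier R"
  shows "(\<Oplus>j\<in>{..<Suc m}. f j) = (\<Oplus>j\<in>{..<m}. f j) \<oplus> f m"
proof -
  have "(\<Oplus>j\<in>insert m {..<m}. f j) = f m \<oplus> (\<Oplus>j\<in>{..<m}. f j)"
    by (rule R.finsum_insert) (use assms in \<open>auto simp: Pi_iff\<close>)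
  moreover have "(\<Oplus>j\<in>{..<m}. f j) \<in> carrier R"
    by (rule R.finsum_closed) (use assms in \<open>auto simp: Pi_iff\<close>)
  ultimately show ?thesis using assms by (simp add: lessThan_Suc R.a_comm)
qed

text \<open>Exchanging the order of summation makes the coefficients a matrix product. Relations
  among relations are composed in this way.\<close>

lemma lincomb_lincomb:
  assumes "\<And>j. j < m \<Longrightarrow> b j \<in> carrier R" "\<And>j i. j < m \<Longrightarrow> i < k \<Longrightarrow> r j i \<in> carrier R"
    "\<And>i. i < k \<Longrightarrow> s i \<in> carrier M"
  shows "lincomb M m b (\<lambda>j. lincomb M k (r j) s) = lincomb M k (\<lambda>i. \<Oplus>j\<in>{..<m}. b j \<otimes> r j i) s"
  using assms(1,2)
proof (induction m)
  case 0
  have "lincomb M k (\<lambda>i. \<zero>) s = \<zero>\<^bsub>M\<^esub>"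
    using assms(3) by (induction k) (simp_all add: lincomb_0 lincomb_Suc smult_l_null)
  then show ?case by (simp add: lincomb_0)
next
  case (Suc m)
  have c: "(\<Oplus>j\<in>{..<m}. b j \<otimes> r j i) \<in> carrier R" if "i < k" for i
    by (rule R.finsum_closed) (use Suc.prems that in \<open>auto simp: Pi_iff\<close>)
  have "lincomb M k (\<lambda>i. \<Oplus>j\<in>{..<Suc m}. b j \<otimes> r j i) s =
      lincomb M k (\<lambda>i. (\<Oplus>j\<in>{..<m}. b j \<otimes> r j i) \<oplus> b m \<otimes> r m i) s"
    by (rule lincomb_cong) (use Suc.prems assms(3) c in \<open>auto simp: finsum_ring_Suc\<close>)
  also have "\<dots> = lincomb M k (\<lambda>i. \<Oplus>j\<in>{..<m}. b j \<otimes> r j i) s \<oplus>\<^bsub>M\<^esub> lincomb M k (\<lambda>i. b m \<otimes> r m i) s"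
    by (rule lincomb_add) (use Suc.prems assms(3) c in auto)
  also have "lincomb M k (\<lambda>i. b m \<otimes> r m i) s = b m \<odot>\<^bsub>M\<^esub> lincomb M k (r m) s"
    by (rule lincomb_smult[symmetric]) (use Suc.prems assms(3) in auto)
  finally show ?case
    using Suc by (subst lincomb_Suc) (auto intro!: lincomb_closed assms(3))
qed

lemma lincomb_unit:
  assumes "j < m" "\<And>j. j < m \<Longrightarrow> s j \<in> carrier M"
  shows "lincomb M m (\<lambda>j'. if j = j' then \<one> else \<zero>) s = s j"
proof -
  have "lincomb M m (\<lambda>j'. if j = j' then \<one> else \<zero>) s = (\<Oplus>\<^bsub>M\<^esub> j'\<in>{..<m}. if j = j' then s j' else \<zero>\<^bsub>M\<^esub>)"
    unfolding lincomb_def by (rule M.finsum_cong') (use assms in \<open>auto simp: Pi_iff smult_l_null smult_one\<close>)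
  also have "\<dots> = s j" by (rule M.finsum_singleton) (use assms in auto)
  finally show ?thesis .
qed

lemma smult_uminus_one: "a \<in> carrier M \<Longrightarrow> (\<ominus> \<one>) \<odot>\<^bsub>M\<^esub> a = \<ominus>\<^bsub>M\<^esub> a"
  by (simp add: smult_l_minus smult_one)

end

text \<open>With the ring regarded as a module over itself, the rules for linear combinations also
  apply to the sums of products of coefficients.\<close>

definition ring_module :: "'r ring \<Rightarrow> ('r, 'r) module" where
  "ring_module R = \<lparr> carrier = carrier R, mult = mult R, one = one R, zero = zero R, add = add R, smult = mult R \<rparr>"

lemma ring_module_simps:
  "carrier (ring_module R) = carrier R" "add (ring_module R) = add R" "zero (ring_module R) = zero R"
  "smult (ring_module R) = mult R"
  by (simp_all add: ring_module_def)

lemma lincomb_ring_module: "lincomb (ring_module R) k a s = (\<Oplus>\<^bsub>R\<^esub> i\<in>{..<k}. a i \<otimes>\<^bsub>R\<^esub> s i)"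
  by (simp add: lincomb_def finsum_def finprod_def ring_module_def)

lemma module_ring_module:
  fixes R :: "'r ring"
  assumes "cring R"
  shows "module R (ring_module R)"
proof -
  interpret cring R by (rule assms)
  have "abelian_group (ring_module R)"
    by (rule abelian_groupI) (auto simp: ring_module_simps a_ac intro: bexI[of _ "\<ominus>\<^bsub>R\<^esub> x" for x] l_neg)
  then show ?thesis
    by (intro moduleI assms) (auto simp: ring_module_simps l_distr r_distr m_assoc)
qed

section \<open>Sheaves of modules\<close>

text \<open>Continuity of the ring operations is expressed through sections. In this form it is used
  for sheaves of modules and can be checked directly for germs of functions.\<close>

locale ringed =
  fixes X :: "('x, 'r) ringed_space"
  assumes oetale: "etale_space (base X) (\<lambda>x. carrier (ostalk X x)) (oetale X)"
    and ocring: "x \<in> topspace (base X) \<Longrightarrow> cring (ostalk X x)"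
    and osec_add: "openin (base X) U \<Longrightarrow> r \<in> sections (base X) (oetale X) U \<Longrightarrow> s \<in> sections (base X) (oetale X) U \<Longrightarrow>
      (\<lambda>y. r y \<oplus>\<^bsub>ostalk X y\<^esub> s y) \<in> sections (base X) (oetale X) U"
    and osec_mult: "openin (base X) U \<Longrightarrow> r \<in> sections (base X) (oetale X) U \<Longrightarrow> s \<in> sections (base X) (oetale X) U \<Longrightarrow>
      (\<lambda>y. r y \<otimes>\<^bsub>ostalk X y\<^esub> s y) \<in> sections (base X) (oetale X) U"
    and osec_zero: "openin (base X) U \<Longrightarrow> (\<lambda>y. \<zero>\<^bsub>ostalk X y\<^esub>) \<in> sections (base X) (oetale X) U"
    and osec_one: "openin (base X) U \<Longrightarrow> (\<lambda>y. \<one>\<^bsub>ostalk X y\<^esub>) \<in> sections (base X) (oetale X) U"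
begin

abbreviation "pts \<equiv> topspace (base X)"
abbreviation "opn \<equiv> openin (base X)"
abbreviation "osec \<equiv> sections (base X) (oetale X)"
abbreviation "sec A \<equiv> sections (base X) (etale A)"
abbreviation "Car A x \<equiv> carrier (stalk A x)"

lemma opn_pts: "opn U \<Longrightarrow> x \<in> U \<Longrightarrow> x \<in> pts"
  using openin_subset by blast

lemma osec_mem: "opn U \<Longrightarrow> r \<in> osec U \<Longrightarrow> y \<in> U \<Longrightarrow> r y \<in> carrier (ostalk X y)"
  using sections_mem[OF oetale] by blast

lemma osec_sum:
  fixes m :: nat
  assumes "opn U" "\<And>j. j < m \<Longrightarrow> f j \<in> osec U"
  shows "(\<lambda>y. \<Oplus>\<^bsub>ostalk X y\<^esub> j\<in>{..<m}. f j y) \<in> osec U"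
  using assms(2)
proof (induction m)
  case 0
  have "\<zero>\<^bsub>ostalk X y\<^esub> = (\<Oplus>\<^bsub>ostalk X y\<^esub> j\<in>{..<0}. f j y)" if "y \<in> U" for y
  proof -
    interpret cring "ostalk X y" using ocring opn_pts[OF assms(1) that] .
    show ?thesis by simp
  qed
  from sections_cong[OF assms(1) osec_zero[OF assms(1)] this] show ?case by simp
next
  case (Suc m)
  have *: "(\<Oplus>\<^bsub>ostalk X y\<^esub> j\<in>{..<m}. f j y) \<oplus>\<^bsub>ostalk X y\<^esub> f m y = (\<Oplus>\<^bsub>ostalk X y\<^esub> j\<in>{..<Suc m}. f j y)" if "y \<in> U" for y
  proof -
    interpret module "ostalk X y" "ring_module (ostalk X y)"
      using module_ring_module ocring opn_pts[OF assms(1) that] by blast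
    show ?thesis using finsum_ring_Suc[of m "\<lambda>j. f j y"] osec_mem[OF assms(1) Suc.prems that] by simp
  qed
  show ?case
    by (rule sections_cong[OF assms(1) osec_add[OF assms(1)] *]) (use Suc in auto)
qed

lemma msheaf_etale: "module_sheaf X A \<Longrightarrow> etale_space (base X) (Car A) (etale A)"
  by (simp add: module_sheaf_def)

lemma msheaf_module: "module_sheaf X A \<Longrightarrow> x \<in> pts \<Longrightarrow> module (ostalk X x) (stalk A x)"
  by (simp add: module_sheaf_def)

lemma sec_mem: "module_sheaf X A \<Longrightarrow> opn U \<Longrightarrow> s \<in> sec A U \<Longrightarrow> y \<in> U \<Longrightarrow> s y \<in> Car A y"
  using sections_mem[OF msheaf_etale] by blast

lemma sec_through:
  assumes "module_sheaf X A" "x \<in> pts" "a \<in> Car A x"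
  obtains U s where "opn U" "x \<in> U" "s \<in> sec A U" "s x = a"
  using etale_section_through[OF msheaf_etale[OF assms(1)] assms(2,3)] .

lemma sec_agree:
  assumes "module_sheaf X A" "opn U" "s \<in> sec A U" "opn V" "t \<in> sec A V" "x \<in> U" "x \<in> V" "s x = t x"
  obtains W where "opn W" "x \<in> W" "W \<subseteq> U" "W \<subseteq> V" "\<And>y. y \<in> W \<Longrightarrow> s y = t y"
  using sections_agree[OF msheaf_etale[OF assms(1)] assms(2-8)] by (metis le_infE)

lemma sec_add:
  assumes "module_sheaf X A" "s \<in> sec A U" "t \<in> sec A U"
  shows "(\<lambda>y. s y \<oplus>\<^bsub>stalk A y\<^esub> t y) \<in> sec A U"
  by (rule stalkop_section) (use assms in \<open>auto simp: module_sheaf_def\<close>)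

lemma sec_smult:
  assumes "module_sheaf X A" "r \<in> osec U" "s \<in> sec A U"
  shows "(\<lambda>y. r y \<odot>\<^bsub>stalk A y\<^esub> s y) \<in> sec A U"
  by (rule stalkop_section) (use assms in \<open>auto simp: module_sheaf_def\<close>)

text \<open>A sheaf of modules is only required to have continuous addition and scalar
  multiplication. A section \<open>t\<close> through the zero germ satisfies
  \<open>t + t = t\<close> at \<open>x\<close>, hence near \<open>x\<close>, and this equation
  forces \<open>t\<close> to vanish there.\<close>

lemma sec_zero:
  assumes "module_sheaf X A" "opn U"
  shows "(\<lambda>y. \<zero>\<^bsub>stalk A y\<^esub>) \<in> sec A U"
proof (rule sections_local[OF assms(2)])
  fix x assume x: "x \<in> U"
  then have xp: "x \<in> pts" using opn_pts assms(2) by blast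
  interpret module "ostalk X x" "stalk A x" by (rule msheaf_module[OF assms(1) xp])
  obtain V t where V: "opn V" "x \<in> V" "t \<in> sec A V" "t x = \<zero>\<^bsub>stalk A x\<^esub>"
    using sec_through[OF assms(1) xp M.zero_closed] by blast
  obtain W where W: "opn W" "x \<in> W" "W \<subseteq> V" "\<And>y. y \<in> W \<Longrightarrow> t y \<oplus>\<^bsub>stalk A y\<^esub> t y = t y"
    using sec_agree[OF assms(1) V(1) sec_add[OF assms(1) V(3,3)] V(1,3,2,2)] V(4) by auto
  have "t y = \<zero>\<^bsub>stalk A y\<^esub>" if "y \<in> W" for y
  proof -
    interpret y: module "ostalk X y" "stalk A y" by (rule msheaf_module[OF assms(1) opn_pts[OF W(1) that]])
    show ?thesis using W(4)[OF that] sec_mem[OF assms(1) V(1,3)] W(3) that y.M.add.r_cancel_one by auto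
  qed
  then have "(\<lambda>y. \<zero>\<^bsub>stalk A y\<^esub>) \<in> sec A W"
    by (rule sections_cong[OF W(1) sections_restrict[OF V(3) W(3)]])
  then show "\<exists>V. opn V \<and> x \<in> V \<and> (\<lambda>y. \<zero>\<^bsub>stalk A y\<^esub>) \<in> sec A V" using W by blast
qed

text \<open>For a section \<open>t\<close> through the negative of \<open>s x\<close>, the sections
  \<open>s + t\<close> and zero agree at \<open>x\<close>, hence near \<open>x\<close>, so
  \<open>t\<close> is the negative of \<open>s\<close> there.\<close>

lemma sec_minus:
  assumes "module_sheaf X A" "opn U" "s \<in> sec A U"
  shows "(\<lambda>y. \<ominus>\<^bsub>stalk A y\<^esub> s y) \<in> sec A U"
proof (rule sections_local[OF assms(2)])
  fix x assume x: "x \<in> U"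
  then have xp: "x \<in> pts" using opn_pts assms(2) by blast
  interpret module "ostalk X x" "stalk A x" by (rule msheaf_module[OF assms(1) xp])
  have sx: "s x \<in> Car A x" using sec_mem[OF assms x] .
  obtain V t where V: "opn V" "x \<in> V" "t \<in> sec A V" "t x = \<ominus>\<^bsub>stalk A x\<^esub> s x"
    using sec_through[OF assms(1) xp M.a_inv_closed[OF sx]] by blast
  have o: "opn (U \<inter> V)" using assms(2) V(1) by blast
  have st: "s \<in> sec A (U \<inter> V)" "t \<in> sec A (U \<inter> V)" using assms(3) V(3) sections_restrict by (metis inf_le1, metis inf_le2)
  have "s x \<oplus>\<^bsub>stalk A x\<^esub> t x = \<zero>\<^bsub>stalk A x\<^esub>" using V(4) sx by (simp add: M.r_neg)
  then obtain W where W: "opn W" "x \<in> W" "W \<subseteq> U \<inter> V" "\<And>y. y \<in> W \<Longrightarrow> s y \<oplus>\<^bsub>stalk A y\<^esub> t y = \<zero>\<^bsub>stalk A y\<^esub>"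
    using sec_agree[OF assms(1) o sec_add[OF assms(1) st] o sec_zero[OF assms(1) o]] x V(2) by auto
  have "t y = \<ominus>\<^bsub>stalk A y\<^esub> s y" if "y \<in> W" for y
  proof -
    interpret y: module "ostalk X y" "stalk A y" by (rule msheaf_module[OF assms(1) opn_pts[OF W(1) that]])
    have "s y \<in> Car A y" "t y \<in> Car A y" using sec_mem[OF assms(1) o st(1)] sec_mem[OF assms(1) o st(2)] W(3) that by auto
    then show ?thesis using W(4)[OF that] y.M.minus_equality y.M.a_comm by metis
  qed
  then have "(\<lambda>y. \<ominus>\<^bsub>stalk A y\<^esub> s y) \<in> sec A W"
    by (rule sections_cong[OF W(1) sections_restrict[OF st(2) W(3)]])
  then show "\<exists>V. opn V \<and> x \<in> V \<and> (\<lambda>y. \<ominus>\<^bsub>stalk A y\<^esub> s y) \<in> sec A V" using W by blast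
qed

lemma sec_diff:
  assumes "module_sheaf X A" "opn U" "s \<in> sec A U" "t \<in> sec A U"
  shows "(\<lambda>y. s y \<ominus>\<^bsub>stalk A y\<^esub> t y) \<in> sec A U"
  unfolding a_minus_def using sec_add sec_minus assms by blast

lemma sec_lincomb:
  assumes "module_sheaf X A" "opn U" "\<And>i. i < k \<Longrightarrow> r i \<in> osec U" "\<And>i. i < k \<Longrightarrow> s i \<in> sec A U"
  shows "(\<lambda>y. lincomb (stalk A y) k (\<lambda>i. r i y) (\<lambda>i. s i y)) \<in> sec A U"
  using assms(3,4)
proof (induction k)
  case 0
  show ?case
  proof (rule sections_cong[OF assms(2) sec_zero[OF assms(1,2)]])
    fix y assume "y \<in> U"
    then interpret y: module "ostalk X y" "stalk A y" using msheaf_module[OF assms(1) opn_pts[OF assms(2)]] by blast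
    show "\<zero>\<^bsub>stalk A y\<^esub> = lincomb (stalk A y) 0 (\<lambda>i. r i y) (\<lambda>i. s i y)" by (simp add: y.lincomb_0)
  qed
next
  case (Suc k)
  have *: "lincomb (stalk A y) k (\<lambda>i. r i y) (\<lambda>i. s i y) \<oplus>\<^bsub>stalk A y\<^esub> (r k y \<odot>\<^bsub>stalk A y\<^esub> s k y) =
      lincomb (stalk A y) (Suc k) (\<lambda>i. r i y) (\<lambda>i. s i y)" if y: "y \<in> U" for y
  proof -
    interpret y: module "ostalk X y" "stalk A y" by (rule msheaf_module[OF assms(1) opn_pts[OF assms(2) y]])
    show ?thesis
      by (rule y.lincomb_Suc[symmetric])
        (use osec_mem[OF assms(2) Suc.prems(1) y] sec_mem[OF assms(1,2) Suc.prems(2) y] in auto)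
  qed
  have "(\<lambda>y. lincomb (stalk A y) k (\<lambda>i. r i y) (\<lambda>i. s i y) \<oplus>\<^bsub>stalk A y\<^esub> (r k y \<odot>\<^bsub>stalk A y\<^esub> s k y)) \<in> sec A U"
    by (rule sec_add[OF assms(1) _ sec_smult[OF assms(1)]]) (use Suc in auto)
  from sections_cong[OF assms(2) this *] show ?case by simp
qed

subsection \<open>Homomorphisms on stalks\<close>

lemma hom_mem: "f \<in> sheaf_hom X A B \<Longrightarrow> x \<in> pts \<Longrightarrow> a \<in> Car A x \<Longrightarrow> f x a \<in> Car B x"
  by (auto simp: sheaf_hom_def PiE_iff Pi_iff)

lemma hom_add: "f \<in> sheaf_hom X A B \<Longrightarrow> x \<in> pts \<Longrightarrow> a \<in> Car A x \<Longrightarrow> b \<in> Car A x \<Longrightarrow>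
    f x (a \<oplus>\<^bsub>stalk A x\<^esub> b) = f x a \<oplus>\<^bsub>stalk B x\<^esub> f x b"
  by (auto simp: sheaf_hom_def)

lemma hom_smult: "f \<in> sheaf_hom X A B \<Longrightarrow> x \<in> pts \<Longrightarrow> r \<in> carrier (ostalk X x) \<Longrightarrow> a \<in> Car A x \<Longrightarrow>
    f x (r \<odot>\<^bsub>stalk A x\<^esub> a) = r \<odot>\<^bsub>stalk B x\<^esub> f x a"
  by (auto simp: sheaf_hom_def)

lemma hom_sec: "f \<in> sheaf_hom X A B \<Longrightarrow> s \<in> sec A U \<Longrightarrow> (\<lambda>y. f y (s y)) \<in> sec B U"
  using stalkmap_section by (auto simp: sheaf_hom_def)

lemma hom_ext:
  assumes "f \<in> sheaf_hom X A B" "g \<in> sheaf_hom X A B'" "\<And>x a. x \<in> pts \<Longrightarrow> a \<in> Car A x \<Longrightarrow> f x a = g x a"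
  shows "f = g"
proof (intro ext)
  fix x a show "f x a = g x a"
    using assms unfolding sheaf_hom_def by (cases "x \<in> pts"; cases "a \<in> Car A x") (auto simp: PiE_iff extensional_def)
qed

text \<open>The restriction to the stalks produces the normal form that \<open>sheaf_hom\<close>
  demands, so the candidate \<open>f\<close> may be arbitrary elsewhere. Continuity is left to be
  tested along one section through each germ.\<close>

lemma homI:
  assumes "module_sheaf X A"
    and "\<And>x a. x \<in> pts \<Longrightarrow> a \<in> Car A x \<Longrightarrow> f x a \<in> Car B x"
    and "\<And>x a b. x \<in> pts \<Longrightarrow> a \<in> Car A x \<Longrightarrow> b \<in> Car A x \<Longrightarrow> f x (a \<oplus>\<^bsub>stalk A x\<^esub> b) = f x a \<oplus>\<^bsub>stalk B x\<^esub> f x b"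
    and "\<And>x r a. x \<in> pts \<Longrightarrow> r \<in> carrier (ostalk X x) \<Longrightarrow> a \<in> Car A x \<Longrightarrow> f x (r \<odot>\<^bsub>stalk A x\<^esub> a) = r \<odot>\<^bsub>stalk B x\<^esub> f x a"
    and "\<And>x a. x \<in> pts \<Longrightarrow> a \<in> Car A x \<Longrightarrow> \<exists>U s. opn U \<and> x \<in> U \<and> s \<in> sec A U \<and> s x = a \<and> (\<lambda>y. f y (s y)) \<in> sec B U"
  shows "(\<lambda>x\<in>pts. \<lambda>a\<in>Car A x. f x a) \<in> sheaf_hom X A B"
proof -
  let ?f = "\<lambda>x\<in>pts. \<lambda>a\<in>Car A x. f x a"
  have m: "module (ostalk X x) (stalk A x)" if "x \<in> pts" for x using msheaf_module[OF assms(1) that] .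
  have "continuous_map (etale A) (etale B) (\<lambda>(x, a). (x, ?f x a))"
  proof (rule stalkmap_continuous[OF msheaf_etale[OF assms(1)]])
    fix x a assume "x \<in> pts" "a \<in> Car A x"
    then obtain U s where U: "opn U" "x \<in> U" "s \<in> sec A U" "s x = a" "(\<lambda>y. f y (s y)) \<in> sec B U"
      using assms(5) by blast
    have "(\<lambda>y. ?f y (s y)) \<in> sec B U"
      by (rule sections_cong[OF U(1,5)]) (use opn_pts[OF U(1)] sec_mem[OF assms(1) U(1,3)] in auto)
    then show "\<exists>U s. opn U \<and> x \<in> U \<and> s \<in> sec A U \<and> s x = a \<and> (\<lambda>y. ?f y (s y)) \<in> sec B U"
      using U by blast
  qed
  moreover have "a \<oplus>\<^bsub>stalk A x\<^esub> b \<in> Car A x" if "x \<in> pts" "a \<in> Car A x" "b \<in> Car A x" for x a b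
    using m[OF that(1)] that(2,3) by (meson abelian_groupE(1) module.axioms(2))
  moreover have "r \<odot>\<^bsub>stalk A x\<^esub> a \<in> Car A x" if "x \<in> pts" "a \<in> Car A x" "r \<in> carrier (ostalk X x)" for x a r
    using m[OF that(1)] that(2,3) by (simp add: module.smult_closed)
  ultimately show ?thesis using assms(2-4) unfolding sheaf_hom_def by simp
qed

end

text \<open>A morphism together with a single point, so that one interpretation provides both stalks
  as modules.\<close>

locale sheaf_morphism = ringed +
  fixes A B :: "('a, 'b, 'c) osheaf" and f :: "('a, 'c) smap" and x :: 'a
  assumes mA: "module_sheaf X A" and mB: "module_sheaf X B" and f: "f \<in> sheaf_hom X A B" and x: "x \<in> topspace (base X)"
begin

sublocale A: module "ostalk X x" "stalk A x" by (rule msheaf_module[OF mA x])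
sublocale B: module "ostalk X x" "stalk B x" by (rule msheaf_module[OF mB x])

lemma mem: "a \<in> Car A x \<Longrightarrow> f x a \<in> Car B x" by (rule hom_mem[OF f x])

lemma zero: "f x \<zero>\<^bsub>stalk A x\<^esub> = \<zero>\<^bsub>stalk B x\<^esub>"
proof -
  have "f x \<zero>\<^bsub>stalk A x\<^esub> \<oplus>\<^bsub>stalk B x\<^esub> f x \<zero>\<^bsub>stalk A x\<^esub> = f x \<zero>\<^bsub>stalk A x\<^esub>"
    using hom_add[OF f x, of "\<zero>\<^bsub>stalk A x\<^esub>" "\<zero>\<^bsub>stalk A x\<^esub>"] by simp
  then show ?thesis using mem[of "\<zero>\<^bsub>stalk A x\<^esub>"] B.M.add.r_cancel_one by simp
qed

lemma minus:
  assumes "a \<in> Car A x"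
  shows "f x (\<ominus>\<^bsub>stalk A x\<^esub> a) = \<ominus>\<^bsub>stalk B x\<^esub> f x a"
proof -
  have "f x (\<ominus>\<^bsub>stalk A x\<^esub> a) \<oplus>\<^bsub>stalk B x\<^esub> f x a = \<zero>\<^bsub>stalk B x\<^esub>"
    using hom_add[OF f x, of "\<ominus>\<^bsub>stalk A x\<^esub> a" a] assms zero by (simp add: A.M.l_neg)
  then show ?thesis using B.M.minus_equality mem assms by simp
qed

lemma diff:
  "a \<in> Car A x \<Longrightarrow> b \<in> Car A x \<Longrightarrow> f x (a \<ominus>\<^bsub>stalk A x\<^esub> b) = f x a \<ominus>\<^bsub>stalk B x\<^esub> f x b"
  by (simp add: a_minus_def hom_add[OF f x] minus)

lemma lincomb:
  assumes "\<And>i. i < k \<Longrightarrow> a i \<in> carrier (ostalk X x)" "\<And>i. i < k \<Longrightarrow> s i \<in> Car A x"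
  shows "f x (lincomb (stalk A x) k a s) = lincomb (stalk B x) k a (\<lambda>i. f x (s i))"
  using assms
proof (induction k)
  case 0
  then show ?case by (simp add: A.lincomb_0 B.lincomb_0 zero)
next
  case (Suc k)
  then show ?case
    by (simp add: A.lincomb_Suc B.lincomb_Suc mem hom_add[OF f x] A.lincomb_closed hom_smult[OF f x])
qed

lemma injI:
  assumes "\<And>a. a \<in> Car A x \<Longrightarrow> f x a = \<zero>\<^bsub>stalk B x\<^esub> \<Longrightarrow> a = \<zero>\<^bsub>stalk A x\<^esub>"
  shows "inj_on (f x) (Car A x)"
proof (rule inj_onI)
  fix a b assume *: "a \<in> Car A x" "b \<in> Car A x" "f x a = f x b"
  then have "f x (a \<ominus>\<^bsub>stalk A x\<^esub> b) = \<zero>\<^bsub>stalk B x\<^esub>" by (simp add: diff mem B.M.minus_zero_iff)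
  then have "a \<ominus>\<^bsub>stalk A x\<^esub> b = \<zero>\<^bsub>stalk A x\<^esub>" using assms * by simp
  then show "a = b" using * by (simp add: A.M.minus_zero_iff)
qed

end

lemma Pi_lessThan: "a \<in> {..<k :: nat} \<rightarrow> C \<longleftrightarrow> (\<forall>i<k. a i \<in> C)"
  by auto

context ringed begin

section \<open>Coherence\<close>

text \<open>A preimage of the germ \<open>c x\<close> spreads to a section, whose image meets
  \<open>c\<close> at \<open>x\<close> and therefore agrees with it near \<open>x\<close>.\<close>

lemma sec_lift:
  assumes "module_sheaf X B" "module_sheaf X C" "q \<in> sheaf_hom X B C"
    and surj: "\<And>x. x \<in> pts \<Longrightarrow> Car C x \<subseteq> q x ` Car B x"
    and c: "opn U" "c \<in> sec C U" "x \<in> U"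
  obtains W b where "opn W" "x \<in> W" "W \<subseteq> U" "b \<in> sec B W" "\<And>y. y \<in> W \<Longrightarrow> q y (b y) = c y"
proof -
  have xp: "x \<in> pts" using opn_pts c by blast
  obtain b0 where b0: "b0 \<in> Car B x" "q x b0 = c x"
    using surj[OF xp] sec_mem[OF assms(2) c] by (metis imageE subsetD)
  obtain V b where V: "opn V" "x \<in> V" "b \<in> sec B V" "b x = b0" using sec_through[OF assms(1) xp b0(1)] .
  obtain W where W: "opn W" "x \<in> W" "W \<subseteq> V" "W \<subseteq> U" "\<And>y. y \<in> W \<Longrightarrow> q y (b y) = c y"
    using sec_agree[OF assms(2) V(1) hom_sec[OF assms(3) V(3)] c(1,2) V(2) c(3)] V(4) b0(2) by metis
  show thesis using that[OF W(1,2,4) sections_restrict[OF V(3) W(3)] W(5)] .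
qed

text \<open>Injectivity determines the preimages pointwise. A local section through one of them has
  an image that meets \<open>t\<close>, so it consists of the preimages nearby, which makes these
  continuous.\<close>

lemma sec_preimage:
  assumes "module_sheaf X A" "module_sheaf X B" "i \<in> sheaf_hom X A B"
    and inj: "\<And>x. x \<in> pts \<Longrightarrow> inj_on (i x) (Car A x)"
    and t: "opn U" "t \<in> sec B U" "\<And>y. y \<in> U \<Longrightarrow> t y \<in> i y ` Car A y"
  obtains s where "s \<in> sec A U" "\<And>y. y \<in> U \<Longrightarrow> i y (s y) = t y"
proof -
  define s where "s y = inv_into (Car A y) (i y) (t y)" for y
  have s: "s y \<in> Car A y" "i y (s y) = t y" if "y \<in> U" for y
    using t(3)[OF that] by (auto simp: s_def inv_into_into f_inv_into_f)
  have "s \<in> sec A U"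
  proof (rule sections_local[OF t(1)])
    fix x assume x: "x \<in> U"
    then have xp: "x \<in> pts" using opn_pts t(1) by blast
    obtain V u where V: "opn V" "x \<in> V" "u \<in> sec A V" "u x = s x" using sec_through[OF assms(1) xp s(1)[OF x]] .
    obtain W where W: "opn W" "x \<in> W" "W \<subseteq> V" "W \<subseteq> U" "\<And>y. y \<in> W \<Longrightarrow> i y (u y) = t y"
      using sec_agree[OF assms(2) V(1) hom_sec[OF assms(3) V(3)] t(1,2) V(2) x] V(4) s(2)[OF x] by metis
    have "u y = s y" if "y \<in> W" for y
    proof -
      have "y \<in> U" "y \<in> V" using that W by auto
      then show ?thesis
        using inj_onD[OF inj[OF opn_pts[OF W(1) that]] _ sec_mem[OF assms(1) V(1,3)] s(1)] s(2) W(5)[OF that] by simp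
    qed
    then have "s \<in> sec A W" by (rule sections_cong[OF W(1) sections_restrict[OF V(3) W(3)]])
    then show "\<exists>V. opn V \<and> x \<in> V \<and> s \<in> sec A V" using W by blast
  qed
  then show thesis using that s(2) by blast
qed

text \<open>Finitely many local choices are brought to one neighbourhood by intersecting; all that
  \<open>P\<close> has to satisfy is stability under shrinking.\<close>

lemma finite_nbhd:
  fixes k :: nat
  assumes "opn U" "x \<in> U"
    and "\<And>i. i < k \<Longrightarrow> \<exists>W s. opn W \<and> x \<in> W \<and> W \<subseteq> U \<and> P i W s"
    and "\<And>i W W' s. P i W s \<Longrightarrow> opn W' \<Longrightarrow> W' \<subseteq> W \<Longrightarrow> P i W' s"
  shows "\<exists>W s. opn W \<and> x \<in> W \<and> W \<subseteq> U \<and> (\<forall>i<k. P i W (s i))"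
  using assms(3)
proof (induction k)
  case 0
  then show ?case using assms(1,2) by auto
next
  case (Suc k)
  obtain W s where W: "opn W" "x \<in> W" "W \<subseteq> U" "\<forall>i<k. P i W (s i)" using Suc.IH[OF Suc.prems[OF less_SucI]] by blast
  obtain V t where V: "opn V" "x \<in> V" "V \<subseteq> U" "P k V t" using Suc.prems[of k] by auto
  have o: "opn (W \<inter> V)" using W(1) V(1) by blast
  have "P i (W \<inter> V) ((s(k := t)) i)" if "i < Suc k" for i
  proof (cases "i = k")
    case True
    then show ?thesis using assms(4)[OF V(4) o] by simp
  next
    case False
    then have "P i W (s i)" using W(4) that by simp
    then show ?thesis using assms(4)[OF _ o] False by simp
  qed
  then show ?case using o W V by (intro exI[of _ "W \<inter> V"] exI[of _ "s(k := t)"]) auto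
qed

lemma finite_type_iff:
  assumes "module_sheaf X A"
  shows "finite_type X A \<longleftrightarrow> (\<forall>x\<in>pts. \<exists>U k s. opn U \<and> x \<in> U \<and> (\<forall>i<k. s i \<in> sec A U) \<and>
    (\<forall>y\<in>U. \<forall>v\<in>Car A y. \<exists>a. (\<forall>i<k. a i \<in> carrier (ostalk X y)) \<and> v = lincomb (stalk A y) k a (\<lambda>i. s i y)))"
proof -
  have *: "Car A y = {lincomb (stalk A y) k a (\<lambda>i. s i y) | a. a \<in> {..<k} \<rightarrow> carrier (ostalk X y)} \<longleftrightarrow>
      (\<forall>v\<in>Car A y. \<exists>a. (\<forall>i<k. a i \<in> carrier (ostalk X y)) \<and> v = lincomb (stalk A y) k a (\<lambda>i. s i y))"
    if "opn U" "y \<in> U" "\<forall>i<k. s i \<in> sec A U" for U k s y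
  proof -
    interpret y: module "ostalk X y" "stalk A y" by (rule msheaf_module[OF assms opn_pts[OF that(1,2)]])
    have "lincomb (stalk A y) k a (\<lambda>i. s i y) \<in> Car A y" if "a \<in> {..<k} \<rightarrow> carrier (ostalk X y)" for a
      by (rule y.lincomb_closed) (use that \<open>\<forall>i<k. s i \<in> sec A U\<close> sec_mem[OF assms \<open>opn U\<close> _ \<open>y \<in> U\<close>] in \<open>auto simp: Pi_iff\<close>)
    then show ?thesis unfolding Pi_lessThan by blast
  qed
  show ?thesis unfolding finite_type_def lincomb_def[symmetric]
    by (intro ball_cong refl iff_exI conj_cong) (rule *; assumption)
qed

text \<open>The set equality in \<open>relations_finite_type\<close> compares extensional functions.
  Here it is split into its two inclusions, for arbitrary coefficient functions.\<close>

definition rel_gen :: "('x, 'r, 'u) osheaf \<Rightarrow> nat \<Rightarrow> (nat \<Rightarrow> 'x \<Rightarrow> 'u) \<Rightarrow> 'x set \<Rightarrow> nat \<Rightarrow> (nat \<Rightarrow> nat \<Rightarrow> 'x \<Rightarrow> 'r) \<Rightarrow> bool" where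
  "rel_gen A k s V m r \<longleftrightarrow>
    (\<forall>j<m. \<forall>i<k. r j i \<in> osec V) \<and>
    (\<forall>y\<in>V. (\<forall>j<m. lincomb (stalk A y) k (\<lambda>i. r j i y) (\<lambda>i. s i y) = \<zero>\<^bsub>stalk A y\<^esub>) \<and>
       (\<forall>g. (\<forall>i<k. g i \<in> carrier (ostalk X y)) \<and> lincomb (stalk A y) k g (\<lambda>i. s i y) = \<zero>\<^bsub>stalk A y\<^esub> \<longrightarrow>
         (\<exists>b. (\<forall>j<m. b j \<in> carrier (ostalk X y)) \<and> (\<forall>i<k. g i = (\<Oplus>\<^bsub>ostalk X y\<^esub> j\<in>{..<m}. b j \<otimes>\<^bsub>ostalk X y\<^esub> r j i y)))))"

lemma lincomb_rel_zero:
  fixes m :: nat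
  assumes "module R N" "\<And>j. j < m \<Longrightarrow> b j \<in> carrier R" "\<And>j i. j < m \<Longrightarrow> i < k \<Longrightarrow> r j i \<in> carrier R"
    "\<And>i. i < k \<Longrightarrow> s i \<in> carrier N" "\<And>j. j < m \<Longrightarrow> lincomb N k (r j) s = \<zero>\<^bsub>N\<^esub>"
  shows "lincomb N k (\<lambda>i. \<Oplus>\<^bsub>R\<^esub> j\<in>{..<m}. b j \<otimes>\<^bsub>R\<^esub> r j i) s = \<zero>\<^bsub>N\<^esub>"
proof -
  interpret module R N by (rule assms(1))
  have "lincomb N k (\<lambda>i. \<Oplus>\<^bsub>R\<^esub> j\<in>{..<m}. b j \<otimes>\<^bsub>R\<^esub> r j i) s = lincomb N m b (\<lambda>j. lincomb N k (r j) s)"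
    by (rule lincomb_lincomb[symmetric]) (use assms in auto)
  also have "\<dots> = lincomb N m b (\<lambda>_. \<zero>\<^bsub>N\<^esub>)" by (rule lincomb_cong) (use assms in auto)
  also have "\<dots> = \<zero>\<^bsub>N\<^esub>" using assms(2) by (induction m) (simp_all add: lincomb_0 lincomb_Suc smult_r_null)
  finally show ?thesis .
qed

lemma relations_finite_type_iff:
  assumes "module_sheaf X A"
  shows "relations_finite_type X A \<longleftrightarrow>
    (\<forall>U k s. opn U \<and> (\<forall>i<k. s i \<in> sec A U) \<longrightarrow> (\<forall>x\<in>U. \<exists>V m r. opn V \<and> x \<in> V \<and> V \<subseteq> U \<and> rel_gen A k s V m r))"
proof -
  have *: "((\<forall>j<m. \<forall>i<k. r j i \<in> osec V) \<and>
      (\<forall>y\<in>V. {g \<in> {..<k} \<rightarrow>\<^sub>E carrier (ostalk X y). lincomb (stalk A y) k g (\<lambda>i. s i y) = \<zero>\<^bsub>stalk A y\<^esub>} =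
              {(\<lambda>i\<in>{..<k}. \<Oplus>\<^bsub>ostalk X y\<^esub> j\<in>{..<m}. b j \<otimes>\<^bsub>ostalk X y\<^esub> r j i y) | b.
                 b \<in> {..<m} \<rightarrow> carrier (ostalk X y)})) \<longleftrightarrow> rel_gen A k s V m r" (is "?O \<and> (\<forall>y\<in>V. ?L y = ?R y) \<longleftrightarrow> _")
    if U: "opn U" "\<forall>i<k. s i \<in> sec A U" "opn V" "V \<subseteq> U" for U V k m s r
  proof (cases ?O)
    case O: True
    have eq: "?L y = ?R y \<longleftrightarrow> (\<forall>j<m. lincomb (stalk A y) k (\<lambda>i. r j i y) (\<lambda>i. s i y) = \<zero>\<^bsub>stalk A y\<^esub>) \<and>
       (\<forall>g. (\<forall>i<k. g i \<in> carrier (ostalk X y)) \<and> lincomb (stalk A y) k g (\<lambda>i. s i y) = \<zero>\<^bsub>stalk A y\<^esub> \<longrightarrow>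
         (\<exists>b. (\<forall>j<m. b j \<in> carrier (ostalk X y)) \<and> (\<forall>i<k. g i = (\<Oplus>\<^bsub>ostalk X y\<^esub> j\<in>{..<m}. b j \<otimes>\<^bsub>ostalk X y\<^esub> r j i y))))"
      (is "_ \<longleftrightarrow> ?P \<and> ?Q") if y: "y \<in> V" for y
    proof -
      have yp: "y \<in> pts" using opn_pts U(3) y by blast
      interpret y: module "ostalk X y" "stalk A y" by (rule msheaf_module[OF assms yp])
      interpret r: module "ostalk X y" "ring_module (ostalk X y)" by (rule module_ring_module[OF ocring[OF yp]])
      have sc: "s i y \<in> Car A y" if "i < k" for i using sec_mem[OF assms U(1)] U(2,4) that y by blast
      have rc: "r j i y \<in> carrier (ostalk X y)" if "j < m" "i < k" for j i using O osec_mem[OF U(3) _ y] that by blast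
      have bc: "(\<Oplus>\<^bsub>ostalk X y\<^esub> j\<in>{..<m}. b j \<otimes>\<^bsub>ostalk X y\<^esub> r j i y) \<in> carrier (ostalk X y)"
        if "b \<in> {..<m} \<rightarrow> carrier (ostalk X y)" "i < k" for b i
        by (rule y.R.finsum_closed) (use that rc in \<open>auto simp: Pi_iff\<close>)
      have res: "lincomb (stalk A y) k (\<lambda>i\<in>{..<k}. g i) (\<lambda>i. s i y) = lincomb (stalk A y) k g (\<lambda>i. s i y)"
        if "\<And>i. i < k \<Longrightarrow> g i \<in> carrier (ostalk X y)" for g
        by (rule y.lincomb_cong) (use that sc in auto)
      show ?thesis
      proof
        assume e: "?L y = ?R y"
        have ?P
        proof (intro allI impI)
          fix j assume j: "j < m"
          \<comment> \<open>The unit vector at \<open>j\<close> exhibits the row \<open>r j\<close>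
            as a member of the right-hand set.\<close>
          let ?b = "\<lambda>j'. if j = j' then \<one>\<^bsub>ostalk X y\<^esub> else \<zero>\<^bsub>ostalk X y\<^esub>"
          have "(\<Oplus>\<^bsub>ostalk X y\<^esub> j'\<in>{..<m}. ?b j' \<otimes>\<^bsub>ostalk X y\<^esub> r j' i y) = r j i y" if "i < k" for i
            using r.lincomb_unit[OF j, of "\<lambda>j. r j i y"] rc that by (simp add: lincomb_ring_module ring_module_simps)
          then have e1: "(\<lambda>i\<in>{..<k}. \<Oplus>\<^bsub>ostalk X y\<^esub> j'\<in>{..<m}. ?b j' \<otimes>\<^bsub>ostalk X y\<^esub> r j' i y) = (\<lambda>i\<in>{..<k}. r j i y)" by auto
          have e2: "?b \<in> {..<m} \<rightarrow> carrier (ostalk X y)" by auto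
          have "(\<lambda>i\<in>{..<k}. r j i y) \<in> ?R y"
            by (rule CollectI, rule exI[of _ ?b], rule conjI, rule e1[symmetric], rule e2)
          then have "lincomb (stalk A y) k (\<lambda>i\<in>{..<k}. r j i y) (\<lambda>i. s i y) = \<zero>\<^bsub>stalk A y\<^esub>" using e by blast
          then show "lincomb (stalk A y) k (\<lambda>i. r j i y) (\<lambda>i. s i y) = \<zero>\<^bsub>stalk A y\<^esub>" using res[of "\<lambda>i. r j i y"] rc[OF j] by simp
        qed
        moreover have ?Q
        proof (intro allI impI, elim conjE)
          fix g assume g: "\<forall>i<k. g i \<in> carrier (ostalk X y)" "lincomb (stalk A y) k g (\<lambda>i. s i y) = \<zero>\<^bsub>stalk A y\<^esub>"
          then have "(\<lambda>i\<in>{..<k}. g i) \<in> ?L y" using res[of g] by auto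
          then obtain b where b: "(\<lambda>i\<in>{..<k}. g i) = (\<lambda>i\<in>{..<k}. \<Oplus>\<^bsub>ostalk X y\<^esub> j\<in>{..<m}. b j \<otimes>\<^bsub>ostalk X y\<^esub> r j i y)"
              "b \<in> {..<m} \<rightarrow> carrier (ostalk X y)"
            unfolding e by blast
          have "g i = (\<Oplus>\<^bsub>ostalk X y\<^esub> j\<in>{..<m}. b j \<otimes>\<^bsub>ostalk X y\<^esub> r j i y)" if "i < k" for i
            using fun_cong[OF b(1), of i] that by simp
          then show "\<exists>b. (\<forall>j<m. b j \<in> carrier (ostalk X y)) \<and> (\<forall>i<k. g i = (\<Oplus>\<^bsub>ostalk X y\<^esub> j\<in>{..<m}. b j \<otimes>\<^bsub>ostalk X y\<^esub> r j i y))"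
            using b(2) by (intro exI[of _ b]) auto
        qed
        ultimately show "?P \<and> ?Q" by blast
      next
        assume PQ: "?P \<and> ?Q"
        show "?L y = ?R y"
        proof (intro equalityI subsetI)
          fix g assume g: "g \<in> ?L y"
          then obtain b where b: "\<forall>j<m. b j \<in> carrier (ostalk X y)"
              "\<forall>i<k. g i = (\<Oplus>\<^bsub>ostalk X y\<^esub> j\<in>{..<m}. b j \<otimes>\<^bsub>ostalk X y\<^esub> r j i y)"
            using conjunct2[OF PQ, rule_format, of g] by (auto simp: PiE_iff)
          have "g = (\<lambda>i\<in>{..<k}. \<Oplus>\<^bsub>ostalk X y\<^esub> j\<in>{..<m}. b j \<otimes>\<^bsub>ostalk X y\<^esub> r j i y)"
            using g b(2) by (auto simp: PiE_iff extensional_def fun_eq_iff)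
          then show "g \<in> ?R y" using b(1) by blast
        next
          fix g assume "g \<in> ?R y"
          then obtain b where b: "g = (\<lambda>i\<in>{..<k}. \<Oplus>\<^bsub>ostalk X y\<^esub> j\<in>{..<m}. b j \<otimes>\<^bsub>ostalk X y\<^esub> r j i y)"
              "b \<in> {..<m} \<rightarrow> carrier (ostalk X y)"
            by blast
          have "lincomb (stalk A y) k (\<lambda>i. \<Oplus>\<^bsub>ostalk X y\<^esub> j\<in>{..<m}. b j \<otimes>\<^bsub>ostalk X y\<^esub> r j i y) (\<lambda>i. s i y) = \<zero>\<^bsub>stalk A y\<^esub>"
            by (rule lincomb_rel_zero[OF y.module_axioms]) (use b(2) rc sc PQ in auto)
          then show "g \<in> ?L y" unfolding b(1) using res bc[OF b(2)] by auto
        qed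
      qed
    qed
    show ?thesis unfolding rel_gen_def by (intro conj_cong refl ball_cong) (rule eq)
  next
    case False
    then show ?thesis unfolding rel_gen_def by argo
  qed
  have **: "(\<exists>V (m::nat) r. opn V \<and> x \<in> V \<and> V \<subseteq> U \<and> (\<forall>j<m. \<forall>i<k. r j i \<in> osec V) \<and>
      (\<forall>y\<in>V. {g \<in> {..<k} \<rightarrow>\<^sub>E carrier (ostalk X y). lincomb (stalk A y) k g (\<lambda>i. s i y) = \<zero>\<^bsub>stalk A y\<^esub>} =
              {(\<lambda>i\<in>{..<k}. \<Oplus>\<^bsub>ostalk X y\<^esub> j\<in>{..<m}. b j \<otimes>\<^bsub>ostalk X y\<^esub> r j i y) | b.
                 b \<in> {..<m} \<rightarrow> carrier (ostalk X y)})) \<longleftrightarrow>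
      (\<exists>V m r. opn V \<and> x \<in> V \<and> V \<subseteq> U \<and> rel_gen A k s V m r)"
    if "opn U \<and> (\<forall>i<k. s i \<in> sec A U)" for U k s x
    by (intro iff_exI conj_cong refl) (rule *[OF conjunct1[OF that] conjunct2[OF that]]; assumption)
  show ?thesis
    unfolding relations_finite_type_def lincomb_def[symmetric]
    by (intro all_cong1 imp_cong refl ball_cong **)
qed

lemma finite_type_surj:
  assumes "module_sheaf X B" "module_sheaf X C" "q \<in> sheaf_hom X B C"
    and "\<And>x. x \<in> pts \<Longrightarrow> Car C x \<subseteq> q x ` Car B x" and "finite_type X B"
  shows "finite_type X C"
  unfolding finite_type_iff[OF assms(2)]
proof
  fix x assume "x \<in> pts"
  then obtain U k s where U: "opn U" "x \<in> U" "\<forall>i<k. s i \<in> sec B U"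
      "\<forall>y\<in>U. \<forall>v\<in>Car B y. \<exists>a. (\<forall>i<k. a i \<in> carrier (ostalk X y)) \<and> v = lincomb (stalk B y) k a (\<lambda>i. s i y)"
    using assms(5) unfolding finite_type_iff[OF assms(1)] by metis
  have "\<exists>a. (\<forall>i<k. a i \<in> carrier (ostalk X y)) \<and> v = lincomb (stalk C y) k a (\<lambda>i. q y (s i y))"
    if y: "y \<in> U" "v \<in> Car C y" for y v
  proof -
    interpret q: sheaf_morphism X B C q y by unfold_locales (use assms opn_pts[OF U(1) y(1)] in auto)
    obtain w where w: "w \<in> Car B y" "v = q y w" using assms(4)[OF q.x] y(2) by blast
    then obtain a where a: "\<forall>i<k. a i \<in> carrier (ostalk X y)" "w = lincomb (stalk B y) k a (\<lambda>i. s i y)" using U(4) y(1) by metis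
    have "v = lincomb (stalk C y) k a (\<lambda>i. q y (s i y))"
      unfolding w(2) a(2) by (rule q.lincomb) (use a U(3) sec_mem[OF assms(1) U(1) _ y(1)] in auto)
    then show ?thesis using a(1) by blast
  qed
  moreover have "\<forall>i<k. (\<lambda>y. q y (s i y)) \<in> sec C U" using hom_sec[OF assms(3)] U(3) by blast
  ultimately show "\<exists>U k s. opn U \<and> x \<in> U \<and> (\<forall>i<k. s i \<in> sec C U) \<and>
    (\<forall>y\<in>U. \<forall>v\<in>Car C y. \<exists>a. (\<forall>i<k. a i \<in> carrier (ostalk X y)) \<and> v = lincomb (stalk C y) k a (\<lambda>i. s i y))"
    using U(1,2) by (intro exI[of _ U] exI[of _ k] exI[of _ "\<lambda>i y. q y (s i y)"]) blast
qed

text \<open>An injective morphism neither creates nor destroys relations.\<close>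

lemma relations_finite_type_inj:
  assumes "module_sheaf X A" "module_sheaf X B" "i \<in> sheaf_hom X A B"
    and "\<And>x. x \<in> pts \<Longrightarrow> inj_on (i x) (Car A x)" and "relations_finite_type X B"
  shows "relations_finite_type X A"
  unfolding relations_finite_type_iff[OF assms(1)]
proof (intro allI impI ballI, elim conjE)
  fix U and k :: nat and s x assume U: "opn U" "\<forall>j<k. s j \<in> sec A U" "x \<in> U"
  have is': "\<forall>j<k. (\<lambda>y. i y (s j y)) \<in> sec B U" using hom_sec[OF assms(3)] U(2) by blast
  obtain V m r where V: "opn V" "x \<in> V" "V \<subseteq> U" "rel_gen B k (\<lambda>j y. i y (s j y)) V m r"
    using assms(5)[unfolded relations_finite_type_iff[OF assms(2)], rule_format, of U k "\<lambda>j y. i y (s j y)" x] U(1,3) is' by blast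
  have "lincomb (stalk A y) k g (\<lambda>j. s j y) = \<zero>\<^bsub>stalk A y\<^esub> \<longleftrightarrow> lincomb (stalk B y) k g (\<lambda>j. i y (s j y)) = \<zero>\<^bsub>stalk B y\<^esub>"
    if y: "y \<in> V" and g: "\<forall>j<k. g j \<in> carrier (ostalk X y)" for y g
  proof -
    interpret i: sheaf_morphism X A B i y by unfold_locales (use assms opn_pts[OF V(1) y] in auto)
    have sc: "s j y \<in> Car A y" if "j < k" for j using sec_mem[OF assms(1) U(1)] U(2) that y V(3) by blast
    have e: "i y (lincomb (stalk A y) k g (\<lambda>j. s j y)) = lincomb (stalk B y) k g (\<lambda>j. i y (s j y))"
      by (rule i.lincomb) (use g sc in auto)
    have "lincomb (stalk A y) k g (\<lambda>j. s j y) \<in> Car A y" by (rule i.A.lincomb_closed) (use g sc in auto)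
    from inj_on_eq_iff[OF assms(4)[OF i.x] this i.A.M.zero_closed] show ?thesis unfolding e i.zero by simp
  qed
  moreover have "\<forall>y\<in>V. \<forall>j<m. \<forall>l<k. r j l y \<in> carrier (ostalk X y)"
    using V(1,4) osec_mem unfolding rel_gen_def by blast
  ultimately have "rel_gen A k s V m r" using V(4) unfolding rel_gen_def by auto
  then show "\<exists>V m r. opn V \<and> x \<in> V \<and> V \<subseteq> U \<and> rel_gen A k s V m r" using V by blast
qed

definition short_exact :: "('x, 'r, 'u) osheaf \<Rightarrow> ('x, 'u) smap \<Rightarrow> ('x, 'r, 'u) osheaf \<Rightarrow> ('x, 'u) smap \<Rightarrow>
    ('x, 'r, 'u) osheaf \<Rightarrow> bool" where
  "short_exact A i B q C \<longleftrightarrow> module_sheaf X A \<and> module_sheaf X B \<and> module_sheaf X C \<and>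
     i \<in> sheaf_hom X A B \<and> q \<in> sheaf_hom X B C \<and>
     (\<forall>x\<in>pts. inj_on (i x) (Car A x) \<and> i x ` Car A x = sheaf_ker B C q x \<and> q x ` Car B x = Car C x)"

lemma short_exactD:
  assumes "short_exact A i B q C"
  shows "module_sheaf X A" "module_sheaf X B" "module_sheaf X C" "i \<in> sheaf_hom X A B" "q \<in> sheaf_hom X B C"
    and "x \<in> pts \<Longrightarrow> inj_on (i x) (Car A x)"
    and "x \<in> pts \<Longrightarrow> b \<in> Car B x \<Longrightarrow> q x b = \<zero>\<^bsub>stalk C x\<^esub> \<Longrightarrow> b \<in> i x ` Car A x"
    and "x \<in> pts \<Longrightarrow> a \<in> Car A x \<Longrightarrow> q x (i x a) = \<zero>\<^bsub>stalk C x\<^esub>"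
    and "x \<in> pts \<Longrightarrow> Car C x \<subseteq> q x ` Car B x"
  using assms unfolding short_exact_def sheaf_ker_def by auto

text \<open>Generators of \<open>A\<close> together with local lifts of generators of
  \<open>C\<close> generate \<open>B\<close>: the combination of lifts with the right image in
  \<open>C\<close> is correct up to an element of \<open>A\<close>.\<close>

lemma finite_type_extension:
  assumes ex: "short_exact A i B q C" and "finite_type X A" "finite_type X C"
  shows "finite_type X B"
  unfolding finite_type_iff[OF short_exactD(2)[OF ex]]
proof
  note E = short_exactD[OF ex]
  fix x assume x: "x \<in> pts"
  obtain U1 k a where U1: "opn U1" "x \<in> U1" "\<forall>j<k. a j \<in> sec A U1"
      "\<forall>y\<in>U1. \<forall>v\<in>Car A y. \<exists>g. (\<forall>j<k. g j \<in> carrier (ostalk X y)) \<and> v = lincomb (stalk A y) k g (\<lambda>j. a j y)"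
    using bspec[OF assms(2)[unfolded finite_type_iff[OF E(1)]] x] by (elim exE conjE)
  obtain U2 l c where U2: "opn U2" "x \<in> U2" "\<forall>j<l. c j \<in> sec C U2"
      "\<forall>y\<in>U2. \<forall>v\<in>Car C y. \<exists>g. (\<forall>j<l. g j \<in> carrier (ostalk X y)) \<and> v = lincomb (stalk C y) l g (\<lambda>j. c j y)"
    using bspec[OF assms(3)[unfolded finite_type_iff[OF E(3)]] x] by (elim exE conjE)
  have "\<exists>W b. opn W \<and> x \<in> W \<and> W \<subseteq> U2 \<and> (\<forall>j<l. b j \<in> sec B W \<and> (\<forall>y\<in>W. q y (b j y) = c j y))"
  proof (rule finite_nbhd[OF U2(1,2)])
    fix j assume j: "j < l"
    from sec_lift[OF E(2,3,5,9) U2(1) U2(3)[rule_format, OF j] U2(2)]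
    show "\<exists>W s. opn W \<and> x \<in> W \<and> W \<subseteq> U2 \<and> s \<in> sec B W \<and> (\<forall>y\<in>W. q y (s y) = c j y)" by metis
  qed (use sections_restrict in blast)
  then obtain W b where W: "opn W" "x \<in> W" "W \<subseteq> U2" "\<And>j. j < l \<Longrightarrow> b j \<in> sec B W"
      "\<And>j y. j < l \<Longrightarrow> y \<in> W \<Longrightarrow> q y (b j y) = c j y"
    by blast
  let ?V = "U1 \<inter> W"
  let ?s = "\<lambda>j y. if j < k then i y (a j y) else b (j - k) y"
  have V: "opn ?V" "x \<in> ?V" using U1 W by auto
  have s: "?s j \<in> sec B ?V" if "j < k + l" for j
  proof (cases "j < k")
    case True
    then show ?thesis using sections_restrict[OF hom_sec[OF E(4)] inf_le1] U1(3) by auto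
  next
    case False
    then show ?thesis using sections_restrict[OF W(4) inf_le2, of "j - k"] that by auto
  qed
  have "\<exists>g. (\<forall>j<k + l. g j \<in> carrier (ostalk X y)) \<and> v = lincomb (stalk B y) (k + l) g (\<lambda>j. ?s j y)"
    if y: "y \<in> ?V" and v: "v \<in> Car B y" for y v
  proof -
    have yp: "y \<in> pts" using opn_pts[OF V(1) y] .
    interpret i: sheaf_morphism X A B i y by unfold_locales (use E yp in auto)
    interpret q: sheaf_morphism X B C q y by unfold_locales (use E yp in auto)
    have ac: "a j y \<in> Car A y" if "j < k" for j using sec_mem[OF E(1) U1(1)] U1(3) that y by blast
    have bc: "b j y \<in> Car B y" if "j < l" for j using sec_mem[OF E(2) W(1) W(4)[OF that]] y by blast
    obtain g where g: "\<forall>j<l. g j \<in> carrier (ostalk X y)" "q y v = lincomb (stalk C y) l g (\<lambda>j. c j y)"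
      using bspec[OF bspec[OF U2(4), of y] q.mem[OF v]] y W(3) by blast
    let ?w = "lincomb (stalk B y) l g (\<lambda>j. b j y)"
    have w: "?w \<in> Car B y" by (rule i.B.lincomb_closed) (use g bc in auto)
    have "q y ?w = lincomb (stalk C y) l g (\<lambda>j. q y (b j y))" by (rule q.lincomb) (use g bc in auto)
    also have "\<dots> = q y v"
      unfolding g(2) by (rule q.B.lincomb_cong) (use g W(5) y q.mem bc in \<open>auto simp flip: W(5)\<close>)
    finally have "q y (v \<ominus>\<^bsub>stalk B y\<^esub> ?w) = \<zero>\<^bsub>stalk C y\<^esub>"
      using v w q.mem by (simp add: q.diff q.B.M.minus_zero_iff)
    then obtain u where u: "u \<in> Car A y" "i y u = v \<ominus>\<^bsub>stalk B y\<^esub> ?w"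
      using E(7)[OF yp, of "v \<ominus>\<^bsub>stalk B y\<^esub> ?w"] v w by auto
    obtain h where h: "\<forall>j<k. h j \<in> carrier (ostalk X y)" "u = lincomb (stalk A y) k h (\<lambda>j. a j y)"
      using bspec[OF bspec[OF U1(4), of y] u(1)] y by blast
    have "i y u = lincomb (stalk B y) k h (\<lambda>j. i y (a j y))"
      unfolding h(2) by (rule i.lincomb) (use h ac in auto)
    moreover have "v = i y u \<oplus>\<^bsub>stalk B y\<^esub> ?w"
      unfolding u(2) using v w by (simp add: a_minus_def i.B.M.a_assoc i.B.M.l_neg)
    ultimately have "v = lincomb (stalk B y) k h (\<lambda>j. i y (a j y)) \<oplus>\<^bsub>stalk B y\<^esub> ?w" by simp
    also have "\<dots> = lincomb (stalk B y) (k + l) (\<lambda>j. if j < k then h j else g (j - k)) (\<lambda>j. ?s j y)"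
      by (rule i.B.lincomb_append[symmetric]) (use g h ac bc i.mem in auto)
    finally show ?thesis using g h by (intro exI[of _ "\<lambda>j. if j < k then h j else g (j - k)"]) auto
  qed
  then show "\<exists>U k s. opn U \<and> x \<in> U \<and> (\<forall>j<k. s j \<in> sec B U) \<and>
    (\<forall>y\<in>U. \<forall>v\<in>Car B y. \<exists>g. (\<forall>j<k. g j \<in> carrier (ostalk X y)) \<and> v = lincomb (stalk B y) k g (\<lambda>j. s j y))"
    by (intro exI[of _ ?V] exI[of _ "k + l"] exI[of _ ?s] conjI V allI impI ballI s)
qed

lemma osec_matrix_product:
  fixes m :: nat
  assumes "opn V" "\<And>j. j < m \<Longrightarrow> u j \<in> osec V" "\<And>j. j < m \<Longrightarrow> r j \<in> osec V"
  shows "(\<lambda>y. \<Oplus>\<^bsub>ostalk X y\<^esub> j\<in>{..<m}. u j y \<otimes>\<^bsub>ostalk X y\<^esub> r j y) \<in> osec V"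
  by (rule osec_sum[OF assms(1), of m "\<lambda>j y. u j y \<otimes>\<^bsub>ostalk X y\<^esub> r j y"]) (use osec_mult assms in blast)

text \<open>Relations are computed in two stages. Generating relations among the images in
  \<open>C\<close> turn the sections \<open>s\<close> into finitely many combinations
  \<open>t\<close> with values in the image of \<open>A\<close>, and generating relations among
  these are then found in \<open>A\<close>. A relation in \<open>B\<close> is a combination of
  relations of the first kind whose coefficients form a relation of the second kind.\<close>

lemma relations_finite_type_extension:
  assumes ex: "short_exact A i B q C" and "relations_finite_type X A" "relations_finite_type X C"
  shows "relations_finite_type X B"
  unfolding relations_finite_type_iff[OF short_exactD(2)[OF ex]]
proof (intro allI impI ballI, elim conjE)
  note E = short_exactD[OF ex]
  fix U and k :: nat and s x assume U: "opn U" "\<forall>j<k. s j \<in> sec B U" "x \<in> U"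
  have "\<forall>j<k. (\<lambda>y. q y (s j y)) \<in> sec C U" using hom_sec[OF E(5)] U(2) by blast
  then obtain V m r where V: "opn V" "x \<in> V" "V \<subseteq> U" "rel_gen C k (\<lambda>j y. q y (s j y)) V m r"
    using assms(3)[unfolded relations_finite_type_iff[OF E(3)], rule_format, of U k "\<lambda>j y. q y (s j y)" x] U by blast
  have rV: "r j l \<in> osec V" if "j < m" "l < k" for j l using V(4) that unfolding rel_gen_def by blast
  have sV: "s j \<in> sec B V" if "j < k" for j using U(2) V(3) sections_restrict that by blast
  define t where "t j y = lincomb (stalk B y) k (\<lambda>l. r j l y) (\<lambda>l. s l y)" for j y
  have t: "t j \<in> sec B V" if "j < m" for j
    unfolding t_def by (rule sec_lincomb[OF E(2) V(1)]) (use rV sV that in auto)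
  have "\<exists>z. z \<in> sec A V \<and> (\<forall>y\<in>V. i y (z y) = t j y)" if j: "j < m" for j
  proof (rule sec_preimage[OF E(1,2,4,6) V(1) t[OF j]])
    fix y assume y: "y \<in> V"
    have yp: "y \<in> pts" using opn_pts[OF V(1) y] .
    interpret q: sheaf_morphism X B C q y by unfold_locales (use E yp in auto)
    have "q y (t j y) = lincomb (stalk C y) k (\<lambda>l. r j l y) (\<lambda>l. q y (s l y))"
      unfolding t_def by (rule q.lincomb) (use osec_mem[OF V(1) rV y] j sec_mem[OF E(2) V(1) sV y] in auto)
    also have "\<dots> = \<zero>\<^bsub>stalk C y\<^esub>" using V(4) y j unfolding rel_gen_def by blast
    finally show "t j y \<in> i y ` Car A y" using E(7)[OF yp] sec_mem[OF E(2) V(1) t[OF j] y] by blast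
  qed auto
  then obtain \<tau> where \<tau>: "\<And>j. j < m \<Longrightarrow> \<tau> j \<in> sec A V" "\<And>j y. j < m \<Longrightarrow> y \<in> V \<Longrightarrow> i y (\<tau> j y) = t j y"
    by metis
  obtain W n u where W: "opn W" "x \<in> W" "W \<subseteq> V" "rel_gen A m \<tau> W n u"
    using assms(2)[unfolded relations_finite_type_iff[OF E(1)], rule_format, of V m \<tau> x] \<tau>(1) V by blast
  have uW: "u l j \<in> osec W" if "l < n" "j < m" for j l using W(4) that unfolding rel_gen_def by blast
  \<comment> \<open>The generators for \<open>B\<close> are the rows of the matrix product of the
    two stages.\<close>
  define w where "w l p y = (\<Oplus>\<^bsub>ostalk X y\<^esub> j\<in>{..<m}. u l j y \<otimes>\<^bsub>ostalk X y\<^esub> r j p y)" for l p y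
  have wW: "w l p \<in> osec W" if "l < n" "p < k" for l p
    unfolding w_def by (rule osec_matrix_product[OF W(1)]) (use uW rV sections_restrict W(3) that in blast)+
  have "rel_gen B k s W n w"
    unfolding rel_gen_def
  proof (intro conjI allI impI ballI)
    show "w l p \<in> osec W" if "l < n" "p < k" for l p using wW that .
  next
    fix y l assume y: "y \<in> W" and l: "l < n"
    have yV: "y \<in> V" using y W(3) by blast
    have yp: "y \<in> pts" using opn_pts[OF W(1) y] .
    interpret i: sheaf_morphism X A B i y by unfold_locales (use E yp in auto)
    have "lincomb (stalk B y) k (\<lambda>p. w l p y) (\<lambda>p. s p y) = lincomb (stalk B y) m (\<lambda>j. u l j y) (\<lambda>j. t j y)"
      unfolding w_def t_def
      by (rule i.B.lincomb_lincomb[symmetric])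
         (use osec_mem[OF W(1) uW y] osec_mem[OF V(1) rV yV] sec_mem[OF E(2) V(1) sV yV] l in auto)
    also have "\<dots> = lincomb (stalk B y) m (\<lambda>j. u l j y) (\<lambda>j. i y (\<tau> j y))"
      by (rule i.B.lincomb_cong)
         (use osec_mem[OF W(1) uW y] l \<tau>(2)[OF _ yV] sec_mem[OF E(2) V(1) t yV] in auto)
    also have "\<dots> = i y (lincomb (stalk A y) m (\<lambda>j. u l j y) (\<lambda>j. \<tau> j y))"
      by (rule i.lincomb[symmetric]) (use osec_mem[OF W(1) uW y] l sec_mem[OF E(1) V(1) \<tau>(1) yV] in auto)
    also have "lincomb (stalk A y) m (\<lambda>j. u l j y) (\<lambda>j. \<tau> j y) = \<zero>\<^bsub>stalk A y\<^esub>"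
      using W(4) y l unfolding rel_gen_def by blast
    finally show "lincomb (stalk B y) k (\<lambda>p. w l p y) (\<lambda>p. s p y) = \<zero>\<^bsub>stalk B y\<^esub>" using i.zero by simp
  next
    fix y g assume y: "y \<in> W" and
      "(\<forall>p<k. g p \<in> carrier (ostalk X y)) \<and> lincomb (stalk B y) k g (\<lambda>p. s p y) = \<zero>\<^bsub>stalk B y\<^esub>"
    then have g: "\<And>p. p < k \<Longrightarrow> g p \<in> carrier (ostalk X y)" "lincomb (stalk B y) k g (\<lambda>p. s p y) = \<zero>\<^bsub>stalk B y\<^esub>" by auto
    have yV: "y \<in> V" using y W(3) by blast
    have yp: "y \<in> pts" using opn_pts[OF W(1) y] .
    interpret i: sheaf_morphism X A B i y by unfold_locales (use E yp in auto)
    interpret q: sheaf_morphism X B C q y by unfold_locales (use E yp in auto)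
    interpret r: module "ostalk X y" "ring_module (ostalk X y)" by (rule module_ring_module[OF ocring[OF yp]])
    have sc: "s p y \<in> Car B y" if "p < k" for p using sec_mem[OF E(2) V(1) sV[OF that] yV] .
    have rc: "r j p y \<in> carrier (ostalk X y)" if "j < m" "p < k" for j p using osec_mem[OF V(1) rV[OF that] yV] .
    have uc: "u l j y \<in> carrier (ostalk X y)" if "l < n" "j < m" for l j using osec_mem[OF W(1) uW[OF that] y] .
    have \<tau>c: "\<tau> j y \<in> Car A y" if "j < m" for j using sec_mem[OF E(1) V(1) \<tau>(1)[OF that] yV] .
    have "lincomb (stalk C y) k g (\<lambda>p. q y (s p y)) = \<zero>\<^bsub>stalk C y\<^esub>"
      using q.lincomb[of k g "\<lambda>p. s p y"] g sc q.zero by simp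
    then obtain b where b: "\<And>j. j < m \<Longrightarrow> b j \<in> carrier (ostalk X y)"
        "\<And>p. p < k \<Longrightarrow> g p = (\<Oplus>\<^bsub>ostalk X y\<^esub> j\<in>{..<m}. b j \<otimes>\<^bsub>ostalk X y\<^esub> r j p y)"
      using V(4) yV g(1) unfolding rel_gen_def by blast
    have "i y (lincomb (stalk A y) m b (\<lambda>j. \<tau> j y)) = lincomb (stalk B y) m b (\<lambda>j. i y (\<tau> j y))"
      by (rule i.lincomb) (use b \<tau>c in auto)
    also have "\<dots> = lincomb (stalk B y) m b (\<lambda>j. t j y)"
      by (rule i.B.lincomb_cong) (use b \<tau>(2)[OF _ yV] sec_mem[OF E(2) V(1) t yV] in auto)
    also have "\<dots> = lincomb (stalk B y) k (\<lambda>p. \<Oplus>\<^bsub>ostalk X y\<^esub> j\<in>{..<m}. b j \<otimes>\<^bsub>ostalk X y\<^esub> r j p y) (\<lambda>p. s p y)"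
      unfolding t_def by (rule i.B.lincomb_lincomb) (use b rc sc in auto)
    also have "\<dots> = lincomb (stalk B y) k g (\<lambda>p. s p y)"
      by (rule i.B.lincomb_cong) (use b(2) g(1) sc in auto)
    also have "\<dots> = i y \<zero>\<^bsub>stalk A y\<^esub>" using g(2) i.zero by simp
    finally have "lincomb (stalk A y) m b (\<lambda>j. \<tau> j y) = \<zero>\<^bsub>stalk A y\<^esub>"
      using inj_onD[OF E(6)[OF yp] _ i.A.lincomb_closed] b(1) \<tau>c by auto
    then obtain c where c: "\<And>l. l < n \<Longrightarrow> c l \<in> carrier (ostalk X y)"
        "\<And>j. j < m \<Longrightarrow> b j = (\<Oplus>\<^bsub>ostalk X y\<^esub> l\<in>{..<n}. c l \<otimes>\<^bsub>ostalk X y\<^esub> u l j y)"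
      using W(4) y b(1) unfolding rel_gen_def by blast
    have "g p = (\<Oplus>\<^bsub>ostalk X y\<^esub> l\<in>{..<n}. c l \<otimes>\<^bsub>ostalk X y\<^esub> w l p y)" if p: "p < k" for p
    proof -
      have "g p = lincomb (ring_module (ostalk X y)) m b (\<lambda>j. r j p y)"
        using b(2)[OF p] by (simp add: lincomb_ring_module)
      also have "\<dots> = lincomb (ring_module (ostalk X y)) m (\<lambda>j. \<Oplus>\<^bsub>ostalk X y\<^esub> l\<in>{..<n}. c l \<otimes>\<^bsub>ostalk X y\<^esub> u l j y) (\<lambda>j. r j p y)"
        by (rule r.lincomb_cong) (use c(2) b(1) rc p in \<open>auto simp: ring_module_simps simp flip: c(2)\<close>)
      also have "\<dots> = lincomb (ring_module (ostalk X y)) n c (\<lambda>l. lincomb (ring_module (ostalk X y)) m (\<lambda>j. u l j y) (\<lambda>j. r j p y))"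
        by (rule r.lincomb_lincomb[symmetric]) (use c(1) uc rc p in \<open>auto simp: ring_module_simps\<close>)
      finally show ?thesis by (simp add: lincomb_ring_module w_def)
    qed
    then show "\<exists>b. (\<forall>l<n. b l \<in> carrier (ostalk X y)) \<and> (\<forall>p<k. g p = (\<Oplus>\<^bsub>ostalk X y\<^esub> l\<in>{..<n}. b l \<otimes>\<^bsub>ostalk X y\<^esub> w l p y))"
      using c(1) by blast
  qed
  then show "\<exists>V m r. opn V \<and> x \<in> V \<and> V \<subseteq> U \<and> rel_gen B k s V m r" using W(1-3) V(3) by (meson subset_trans)
qed

lemma coherent_extension:
  assumes "short_exact A i B q C" "coherent X A" "coherent X C"
  shows "coherent X B"
  using assms finite_type_extension relations_finite_type_extension short_exactD(2)[OF assms(1)]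
  unfolding coherent_def by blast

text \<open>Lift the given sections of \<open>C\<close> to \<open>B\<close> and append generators of
  \<open>A\<close>. A relation in \<open>C\<close> is completed, by coefficients of the appended
  sections, to a relation among the enlarged list, so generators of the latter relations yield
  generators in \<open>C\<close> when cut off after \<open>k\<close> entries.\<close>

lemma relations_finite_type_quotient:
  assumes ex: "short_exact A i B q C" and "finite_type X A" "relations_finite_type X B"
  shows "relations_finite_type X C"
  unfolding relations_finite_type_iff[OF short_exactD(3)[OF ex]]
proof (intro allI impI ballI, elim conjE)
  note E = short_exactD[OF ex]
  fix U and k :: nat and c x assume U: "opn U" "\<forall>j<k. c j \<in> sec C U" "x \<in> U"
  have x: "x \<in> pts" using opn_pts U by blast
  obtain U1 l a where U1: "opn U1" "x \<in> U1" "\<forall>j<l. a j \<in> sec A U1"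
      "\<forall>y\<in>U1. \<forall>v\<in>Car A y. \<exists>g. (\<forall>j<l. g j \<in> carrier (ostalk X y)) \<and> v = lincomb (stalk A y) l g (\<lambda>j. a j y)"
    using bspec[OF assms(2)[unfolded finite_type_iff[OF E(1)]] x] by (elim exE conjE)
  have "\<exists>W b. opn W \<and> x \<in> W \<and> W \<subseteq> U \<and> (\<forall>j<k. b j \<in> sec B W \<and> (\<forall>y\<in>W. q y (b j y) = c j y))"
  proof (rule finite_nbhd[OF U(1,3)])
    fix j assume j: "j < k"
    from sec_lift[OF E(2,3,5,9) U(1) U(2)[rule_format, OF j] U(3)]
    show "\<exists>W s. opn W \<and> x \<in> W \<and> W \<subseteq> U \<and> s \<in> sec B W \<and> (\<forall>y\<in>W. q y (s y) = c j y)" by metis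
  qed (use sections_restrict in blast)
  then obtain W b where W: "opn W" "x \<in> W" "W \<subseteq> U" "\<And>j. j < k \<Longrightarrow> b j \<in> sec B W"
      "\<And>j y. j < k \<Longrightarrow> y \<in> W \<Longrightarrow> q y (b j y) = c j y"
    by blast
  let ?V = "U1 \<inter> W"
  let ?s = "\<lambda>j y. if j < k then b j y else i y (a (j - k) y)"
  have V: "opn ?V" "x \<in> ?V" using U1 W by auto
  have s: "?s j \<in> sec B ?V" if "j < k + l" for j
  proof (cases "j < k")
    case True
    then show ?thesis using sections_restrict[OF W(4) inf_le2] by auto
  next
    case False
    then show ?thesis using sections_restrict[OF hom_sec[OF E(4)] inf_le1, of "a (j - k)"] U1(3) that by auto
  qed
  obtain N m r where N: "opn N" "x \<in> N" "N \<subseteq> ?V" "rel_gen B (k + l) ?s N m r"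
    using assms(3)[unfolded relations_finite_type_iff[OF E(2)], rule_format, of ?V "k + l" ?s x] s V by blast
  have rN: "r j p \<in> osec N" if "j < m" "p < k + l" for j p using N(4) that unfolding rel_gen_def by blast
  \<comment> \<open>The same \<open>r\<close> serves for \<open>C\<close>, read only at the indices
    below \<open>k\<close>.\<close>
  have "rel_gen C k c N m r"
    unfolding rel_gen_def
  proof (intro conjI allI impI ballI)
    show "r j p \<in> osec N" if "j < m" "p < k" for j p using rN that by simp
  next
    fix y j assume y: "y \<in> N" and j: "j < m"
    have yV: "y \<in> U1" "y \<in> W" using y N(3) by auto
    have yp: "y \<in> pts" using opn_pts[OF N(1) y] .
    interpret i: sheaf_morphism X A B i y by unfold_locales (use E yp in auto)
    interpret q: sheaf_morphism X B C q y by unfold_locales (use E yp in auto)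
    have sc: "?s p y \<in> Car B y" if "p < k + l" for p using sec_mem[OF E(2) V(1) s[OF that]] yV by blast
    have rc: "r j p y \<in> carrier (ostalk X y)" if "p < k + l" for p using osec_mem[OF N(1) rN[OF j that] y] .
    have ac: "a p y \<in> Car A y" if "p < l" for p using sec_mem[OF E(1) U1(1)] U1(3) that yV by blast
    have bc: "b p y \<in> Car B y" if "p < k" for p using sec_mem[OF E(2) W(1) W(4)[OF that] yV(2)] .
    have cc: "c p y \<in> Car C y" if "p < k" for p using sec_mem[OF E(3) U(1) U(2)[rule_format, OF that]] yV(2) W(3) by blast
    have "lincomb (stalk B y) k (\<lambda>p. r j p y) (\<lambda>p. b p y) \<oplus>\<^bsub>stalk B y\<^esub>
        lincomb (stalk B y) l (\<lambda>p. r j (k + p) y) (\<lambda>p. i y (a p y)) =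
      lincomb (stalk B y) (k + l) (\<lambda>p. if p < k then r j p y else r j (k + (p - k)) y) (\<lambda>p. ?s p y)"
      by (rule i.B.lincomb_append[symmetric]) (use rc ac bc i.mem in auto)
    also have "\<dots> = lincomb (stalk B y) (k + l) (\<lambda>p. r j p y) (\<lambda>p. ?s p y)"
      by (rule i.B.lincomb_cong) (use rc sc in auto)
    also have "\<dots> = \<zero>\<^bsub>stalk B y\<^esub>" using N(4) y j unfolding rel_gen_def by blast
    also have "lincomb (stalk B y) l (\<lambda>p. r j (k + p) y) (\<lambda>p. i y (a p y)) = i y (lincomb (stalk A y) l (\<lambda>p. r j (k + p) y) (\<lambda>p. a p y))"
      by (rule i.lincomb[symmetric]) (use rc ac in auto)
    finally have z: "lincomb (stalk B y) k (\<lambda>p. r j p y) (\<lambda>p. b p y) \<oplus>\<^bsub>stalk B y\<^esub>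
        i y (lincomb (stalk A y) l (\<lambda>p. r j (k + p) y) (\<lambda>p. a p y)) = \<zero>\<^bsub>stalk B y\<^esub>" .
    have c1: "lincomb (stalk A y) l (\<lambda>p. r j (k + p) y) (\<lambda>p. a p y) \<in> Car A y"
      by (rule i.A.lincomb_closed) (use rc ac in auto)
    have c2: "lincomb (stalk B y) k (\<lambda>p. r j p y) (\<lambda>p. b p y) \<in> Car B y"
      by (rule i.B.lincomb_closed) (use rc bc in auto)
    have "lincomb (stalk C y) k (\<lambda>p. r j p y) (\<lambda>p. c p y) = lincomb (stalk C y) k (\<lambda>p. r j p y) (\<lambda>p. q y (b p y))"
      by (rule q.B.lincomb_cong) (use rc W(5)[OF _ yV(2)] cc in auto)
    also have "\<dots> = q y (lincomb (stalk B y) k (\<lambda>p. r j p y) (\<lambda>p. b p y))"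
      by (rule q.lincomb[symmetric]) (use rc bc in auto)
    also have "\<dots> = \<zero>\<^bsub>stalk C y\<^esub>"
      using arg_cong[OF z, of "q y"] hom_add[OF E(5) yp c2 i.mem[OF c1]] E(8)[OF yp c1] q.zero q.mem[OF c2] by simp
    finally show "lincomb (stalk C y) k (\<lambda>p. r j p y) (\<lambda>p. c p y) = \<zero>\<^bsub>stalk C y\<^esub>" .
  next
    fix y g assume y: "y \<in> N" and
      "(\<forall>p<k. g p \<in> carrier (ostalk X y)) \<and> lincomb (stalk C y) k g (\<lambda>p. c p y) = \<zero>\<^bsub>stalk C y\<^esub>"
    then have g: "\<And>p. p < k \<Longrightarrow> g p \<in> carrier (ostalk X y)" "lincomb (stalk C y) k g (\<lambda>p. c p y) = \<zero>\<^bsub>stalk C y\<^esub>" by auto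
    have yV: "y \<in> U1" "y \<in> W" using y N(3) by auto
    have yp: "y \<in> pts" using opn_pts[OF N(1) y] .
    interpret i: sheaf_morphism X A B i y by unfold_locales (use E yp in auto)
    interpret q: sheaf_morphism X B C q y by unfold_locales (use E yp in auto)
    have ac: "a p y \<in> Car A y" if "p < l" for p using sec_mem[OF E(1) U1(1)] U1(3) that yV by blast
    have bc: "b p y \<in> Car B y" if "p < k" for p using sec_mem[OF E(2) W(1) W(4)[OF that] yV(2)] .
    have cc: "c p y \<in> Car C y" if "p < k" for p using sec_mem[OF E(3) U(1) U(2)[rule_format, OF that]] yV(2) W(3) by blast
    let ?v = "lincomb (stalk B y) k g (\<lambda>p. b p y)"
    have v: "?v \<in> Car B y" by (rule i.B.lincomb_closed) (use g bc in auto)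
    have "q y ?v = lincomb (stalk C y) k g (\<lambda>p. q y (b p y))" by (rule q.lincomb) (use g bc in auto)
    also have "\<dots> = lincomb (stalk C y) k g (\<lambda>p. c p y)"
      by (rule q.B.lincomb_cong) (use g(1) W(5)[OF _ yV(2)] cc in auto)
    finally have "q y (\<ominus>\<^bsub>stalk B y\<^esub> ?v) = \<zero>\<^bsub>stalk C y\<^esub>" using g(2) q.minus[OF v] by simp
    then obtain u where u: "u \<in> Car A y" "i y u = \<ominus>\<^bsub>stalk B y\<^esub> ?v"
      using E(7)[OF yp, of "\<ominus>\<^bsub>stalk B y\<^esub> ?v"] v by auto
    obtain h where h: "\<forall>p<l. h p \<in> carrier (ostalk X y)" "u = lincomb (stalk A y) l h (\<lambda>p. a p y)"
      using bspec[OF bspec[OF U1(4), of y] u(1)] yV by blast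
    have "i y u = lincomb (stalk B y) l h (\<lambda>p. i y (a p y))"
      unfolding h(2) by (rule i.lincomb) (use h ac in auto)
    then have "lincomb (stalk B y) k g (\<lambda>p. b p y) \<oplus>\<^bsub>stalk B y\<^esub> lincomb (stalk B y) l h (\<lambda>p. i y (a p y)) = \<zero>\<^bsub>stalk B y\<^esub>"
      using i.B.M.r_neg[OF v] u(2) by metis
    moreover have "lincomb (stalk B y) (k + l) (\<lambda>p. if p < k then g p else h (p - k)) (\<lambda>p. ?s p y) =
        lincomb (stalk B y) k g (\<lambda>p. b p y) \<oplus>\<^bsub>stalk B y\<^esub> lincomb (stalk B y) l h (\<lambda>p. i y (a p y))"
      by (rule i.B.lincomb_append) (use g h ac bc i.mem in auto)
    ultimately have "lincomb (stalk B y) (k + l) (\<lambda>p. if p < k then g p else h (p - k)) (\<lambda>p. ?s p y) = \<zero>\<^bsub>stalk B y\<^esub>" by simp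
    moreover have "\<forall>p<k + l. (if p < k then g p else h (p - k)) \<in> carrier (ostalk X y)" using g h by auto
    ultimately obtain d where d: "\<forall>j<m. d j \<in> carrier (ostalk X y)"
        "\<forall>p<k + l. (if p < k then g p else h (p - k)) = (\<Oplus>\<^bsub>ostalk X y\<^esub> j\<in>{..<m}. d j \<otimes>\<^bsub>ostalk X y\<^esub> r j p y)"
      using conjunct2[OF bspec[OF conjunct2[OF N(4)[unfolded rel_gen_def]] y], rule_format,
        of "\<lambda>p. if p < k then g p else h (p - k)"] by blast
    have "g p = (\<Oplus>\<^bsub>ostalk X y\<^esub> j\<in>{..<m}. d j \<otimes>\<^bsub>ostalk X y\<^esub> r j p y)" if "p < k" for p
      using d(2)[rule_format, of p] that by simp
    then show "\<exists>b. (\<forall>j<m. b j \<in> carrier (ostalk X y)) \<and> (\<forall>p<k. g p = (\<Oplus>\<^bsub>ostalk X y\<^esub> j\<in>{..<m}. b j \<otimes>\<^bsub>ostalk X y\<^esub> r j p y))"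
      using d(1) by blast
  qed
  then show "\<exists>V m r. opn V \<and> x \<in> V \<and> V \<subseteq> U \<and> rel_gen C k c V m r" using N(1-3) W(3) by blast
qed

lemma coherent_quotient:
  assumes "short_exact A i B q C" "finite_type X A" "coherent X B"
  shows "coherent X C"
  using assms finite_type_surj[OF short_exactD(2,3,5,9)[OF assms(1)]] relations_finite_type_quotient[OF assms(1,2)]
    short_exactD(3)[OF assms(1)]
  unfolding coherent_def by blast

end

section \<open>Constructions of sheaves of modules\<close>

text \<open>The module laws descend along a surjection compatible with the operations. For quotients
  the surjection takes an element to the representative of its coset.\<close>

lemma module_surj:
  assumes "module R D" "\<phi> ` carrier D = carrier N"
    and add: "\<And>a b. a \<in> carrier D \<Longrightarrow> b \<in> carrier D \<Longrightarrow> \<phi> a \<oplus>\<^bsub>N\<^esub> \<phi> b = \<phi> (a \<oplus>\<^bsub>D\<^esub> b)"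
    and smult: "\<And>r a. r \<in> carrier R \<Longrightarrow> a \<in> carrier D \<Longrightarrow> r \<odot>\<^bsub>N\<^esub> \<phi> a = \<phi> (r \<odot>\<^bsub>D\<^esub> a)"
    and zero: "\<zero>\<^bsub>N\<^esub> = \<phi> \<zero>\<^bsub>D\<^esub>"
  shows "module R N"
proof -
  interpret D: module R D by (rule assms(1))
  have rep: "\<exists>a\<in>carrier D. u = \<phi> a" if "u \<in> carrier N" for u using that assms(2) by blast
  have mem: "\<phi> a \<in> carrier N" if "a \<in> carrier D" for a using that assms(2) by blast
  have "abelian_group N"
  proof (rule abelian_groupI)
    fix u v assume "u \<in> carrier N" "v \<in> carrier N"
    then obtain a b where ab: "a \<in> carrier D" "u = \<phi> a" "b \<in> carrier D" "v = \<phi> b" using rep by blast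
    show "u \<oplus>\<^bsub>N\<^esub> v \<in> carrier N" using ab by (simp add: add mem)
    show "u \<oplus>\<^bsub>N\<^esub> v = v \<oplus>\<^bsub>N\<^esub> u" using ab by (simp add: add D.M.a_comm)
    fix w assume "w \<in> carrier N"
    then obtain c where "c \<in> carrier D" "w = \<phi> c" using rep by blast
    then show "u \<oplus>\<^bsub>N\<^esub> v \<oplus>\<^bsub>N\<^esub> w = u \<oplus>\<^bsub>N\<^esub> (v \<oplus>\<^bsub>N\<^esub> w)" using ab by (simp add: add D.M.a_assoc)
  next
    show "\<zero>\<^bsub>N\<^esub> \<in> carrier N" by (simp add: zero mem)
  next
    fix u assume "u \<in> carrier N"
    then obtain a where a: "a \<in> carrier D" "u = \<phi> a" using rep by blast
    then show "\<zero>\<^bsub>N\<^esub> \<oplus>\<^bsub>N\<^esub> u = u" by (simp add: zero add)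
    show "\<exists>v\<in>carrier N. v \<oplus>\<^bsub>N\<^esub> u = \<zero>\<^bsub>N\<^esub>"
      using a by (intro bexI[of _ "\<phi> (\<ominus>\<^bsub>D\<^esub> a)"]) (simp_all add: zero add D.M.l_neg mem)
  qed
  then show ?thesis
  proof (rule moduleI[OF D.is_cring], goal_cases)
    case (1 r u)
    then obtain a where "a \<in> carrier D" "u = \<phi> a" using rep by blast
    then show ?case using 1 by (simp add: smult mem)
  next
    case (2 r s u)
    then obtain a where "a \<in> carrier D" "u = \<phi> a" using rep by blast
    then show ?case using 2 by (simp add: smult add D.smult_l_distr)
  next
    case (3 r u v)
    then obtain a b where "a \<in> carrier D" "u = \<phi> a" "b \<in> carrier D" "v = \<phi> b" using rep by blast
    then show ?case using 3 by (simp add: smult add D.smult_r_distr)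
  next
    case (4 r s u)
    then obtain a where "a \<in> carrier D" "u = \<phi> a" using rep by blast
    then show ?case using 4 by (simp add: smult D.smult_assoc1)
  next
    case (5 u)
    then obtain a where "a \<in> carrier D" "u = \<phi> a" using rep by blast
    then show ?case by (simp add: smult)
  qed
qed

context ringed begin

lemma module_sheafI:
  fixes N :: "'x \<Rightarrow> ('r, 'u) module"
  assumes fam: "section_family (base X) (\<lambda>x. carrier (N x)) \<S>"
    and mod: "\<And>x. x \<in> pts \<Longrightarrow> module (ostalk X x) (N x)"
    and add: "\<And>U s t. (U, s) \<in> \<S> \<Longrightarrow> (U, t) \<in> \<S> \<Longrightarrow> (U, \<lambda>y. s y \<oplus>\<^bsub>N y\<^esub> t y) \<in> \<S>"
    and smult: "\<And>U r s. r \<in> osec U \<Longrightarrow> (U, s) \<in> \<S> \<Longrightarrow> (U, \<lambda>y. r y \<odot>\<^bsub>N y\<^esub> s y) \<in> \<S>"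
  shows "module_sheaf X \<lparr>stalk = N, etale = gen_etale \<S>\<rparr>"
proof -
  note et = gen_etale_space[OF fam]
  have op: "opn U" if "(U, s) \<in> \<S>" for U s using fam that unfolding section_family_def by blast
  have res: "(U \<inter> V, s) \<in> \<S>" if "(U, s) \<in> \<S>" "opn V" for U V s
    using fam that unfolding section_family_def by blast
  have thr: "\<exists>U s. (U, s) \<in> \<S> \<and> x \<in> U \<and> s x = a" if "x \<in> pts" "a \<in> carrier (N x)" for x a
    using fam that unfolding section_family_def by blast
  have "continuous_map (subtopology (prod_topology (gen_etale \<S>) (gen_etale \<S>)) {(a, b). fst a = fst b})
      (gen_etale \<S>) (\<lambda>((x, a), (_, b)). (x, a \<oplus>\<^bsub>N x\<^esub> b))"
  proof (rule stalkop_continuous[OF et et])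
    fix x a b assume x: "x \<in> pts" "a \<in> carrier (N x)" "b \<in> carrier (N x)"
    obtain U s where U: "(U, s) \<in> \<S>" "x \<in> U" "s x = a" using thr x by blast
    obtain V t where V: "(V, t) \<in> \<S>" "x \<in> V" "t x = b" using thr x by blast
    have st: "(U \<inter> V, s) \<in> \<S>" "(U \<inter> V, t) \<in> \<S>"
      using res[OF U(1) op[OF V(1)]] res[OF V(1) op[OF U(1)]] by (simp_all add: Int_commute)
    show "\<exists>U s t. opn U \<and> x \<in> U \<and> s \<in> sections (base X) (gen_etale \<S>) U \<and> s x = a \<and>
        t \<in> sections (base X) (gen_etale \<S>) U \<and> t x = b \<and> (\<lambda>y. s y \<oplus>\<^bsub>N y\<^esub> t y) \<in> sections (base X) (gen_etale \<S>) U"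
      using gen_etale_sections[OF fam st(1)] gen_etale_sections[OF fam st(2)] gen_etale_sections[OF fam add[OF st]]
        op[OF st(1)] U V by blast
  qed
  moreover have "continuous_map (subtopology (prod_topology (oetale X) (gen_etale \<S>)) {(a, b). fst a = fst b})
      (gen_etale \<S>) (\<lambda>((x, a), (_, b)). (x, a \<odot>\<^bsub>N x\<^esub> b))"
  proof (rule stalkop_continuous[OF oetale et])
    fix x r b assume x: "x \<in> pts" "r \<in> carrier (ostalk X x)" "b \<in> carrier (N x)"
    obtain U s where U: "opn U" "x \<in> U" "s \<in> osec U" "s x = r" using etale_section_through[OF oetale x(1,2)] .
    obtain V t where V: "(V, t) \<in> \<S>" "x \<in> V" "t x = b" using thr x by blast
    have t: "(V \<inter> U, t) \<in> \<S>" using res[OF V(1) U(1)] .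
    have s: "s \<in> osec (V \<inter> U)" using sections_restrict[OF U(3)] by blast
    show "\<exists>U s t. opn U \<and> x \<in> U \<and> s \<in> osec U \<and> s x = r \<and>
        t \<in> sections (base X) (gen_etale \<S>) U \<and> t x = b \<and> (\<lambda>y. s y \<odot>\<^bsub>N y\<^esub> t y) \<in> sections (base X) (gen_etale \<S>) U"
      using gen_etale_sections[OF fam t] gen_etale_sections[OF fam smult[OF s t]] s op[OF t] U V by blast
  qed
  ultimately show ?thesis using et mod unfolding module_sheaf_def by simp
qed

subsection \<open>Homomorphisms\<close>

lemma id_hom: "module_sheaf X A \<Longrightarrow> sheaf_id X A \<in> sheaf_hom X A A"
  unfolding sheaf_id_def by (rule homI) (auto elim!: sec_through)

lemma comp_hom:
  assumes "module_sheaf X A" "f \<in> sheaf_hom X A B" "g \<in> sheaf_hom X B C"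
  shows "sheaf_comp X A g f \<in> sheaf_hom X A C"
  unfolding sheaf_comp_def compose_def
proof (rule homI[OF assms(1)])
  fix x a assume xa: "x \<in> pts" "a \<in> Car A x"
  show "\<exists>U s. opn U \<and> x \<in> U \<and> s \<in> sec A U \<and> s x = a \<and> (\<lambda>y. g y (f y (s y))) \<in> sec C U"
    using sec_through[OF assms(1) xa] hom_sec[OF assms(3) hom_sec[OF assms(2)]] by metis
qed (use assms(2,3) in \<open>simp_all add: hom_mem hom_add[OF assms(2)] hom_smult[OF assms(2)] hom_add[OF assms(3)] hom_smult[OF assms(3)]\<close>)

lemma zero_hom_hom:
  assumes "module_sheaf X A" "module_sheaf X B"
  shows "zero_hom X A B \<in> sheaf_hom X A B"
  unfolding zero_hom_def
proof (rule homI[OF assms(1)])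
  fix x a assume x: "x \<in> pts"
  interpret B: module "ostalk X x" "stalk B x" by (rule msheaf_module[OF assms(2) x])
  show "\<zero>\<^bsub>stalk B x\<^esub> \<in> Car B x" "\<zero>\<^bsub>stalk B x\<^esub> = \<zero>\<^bsub>stalk B x\<^esub> \<oplus>\<^bsub>stalk B x\<^esub> \<zero>\<^bsub>stalk B x\<^esub>" by simp_all
  show "\<zero>\<^bsub>stalk B x\<^esub> = r \<odot>\<^bsub>stalk B x\<^esub> \<zero>\<^bsub>stalk B x\<^esub>" if "r \<in> carrier (ostalk X x)" for r
    using that by (simp add: B.smult_r_null)
  assume "a \<in> Car A x"
  from sec_through[OF assms(1) x this] sec_zero[OF assms(2)]
  show "\<exists>U s. opn U \<and> x \<in> U \<and> s \<in> sec A U \<and> s x = a \<and> (\<lambda>y. \<zero>\<^bsub>stalk B y\<^esub>) \<in> sec B U" by metis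
qed

lemma neg_hom:
  assumes "module_sheaf X A" "module_sheaf X B" "f \<in> sheaf_hom X A B"
  shows "(\<lambda>x\<in>pts. \<lambda>a\<in>Car A x. \<ominus>\<^bsub>stalk B x\<^esub> f x a) \<in> sheaf_hom X A B"
proof (rule homI[OF assms(1)])
  fix x a assume x: "x \<in> pts" and a: "a \<in> Car A x"
  interpret B: module "ostalk X x" "stalk B x" by (rule msheaf_module[OF assms(2) x])
  note m = hom_mem[OF assms(3) x]
  show "\<ominus>\<^bsub>stalk B x\<^esub> f x a \<in> Car B x" using m[OF a] by simp
  show "\<ominus>\<^bsub>stalk B x\<^esub> f x (a \<oplus>\<^bsub>stalk A x\<^esub> b) = \<ominus>\<^bsub>stalk B x\<^esub> f x a \<oplus>\<^bsub>stalk B x\<^esub> \<ominus>\<^bsub>stalk B x\<^esub> f x b" if "b \<in> Car A x" for b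
    using that a m by (simp add: hom_add[OF assms(3) x] B.M.minus_add)
  show "\<ominus>\<^bsub>stalk B x\<^esub> f x (r \<odot>\<^bsub>stalk A x\<^esub> a) = r \<odot>\<^bsub>stalk B x\<^esub> (\<ominus>\<^bsub>stalk B x\<^esub> f x a)" if "r \<in> carrier (ostalk X x)" for r
    using that a m by (simp add: hom_smult[OF assms(3) x] B.smult_r_minus)
  show "\<exists>U s. opn U \<and> x \<in> U \<and> s \<in> sec A U \<and> s x = a \<and> (\<lambda>y. \<ominus>\<^bsub>stalk B y\<^esub> f y (s y)) \<in> sec B U"
    using sec_through[OF assms(1) x a] sec_minus[OF assms(2) _ hom_sec[OF assms(3)]] by metis
qed

subsection \<open>Subsheaves\<close>

text \<open>The condition on local sections says that the union of the subsets is open in the total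
  space of \<open>A\<close>.\<close>

definition submodule_family :: "('x, 'r, 'u) osheaf \<Rightarrow> ('x \<Rightarrow> 'u set) \<Rightarrow> bool" where
  "submodule_family A S \<longleftrightarrow>
    (\<forall>x\<in>pts. S x \<subseteq> Car A x \<and> \<zero>\<^bsub>stalk A x\<^esub> \<in> S x \<and> (\<forall>a\<in>S x. \<forall>b\<in>S x. a \<oplus>\<^bsub>stalk A x\<^esub> b \<in> S x) \<and>
      (\<forall>r\<in>carrier (ostalk X x). \<forall>a\<in>S x. r \<odot>\<^bsub>stalk A x\<^esub> a \<in> S x) \<and>
      (\<forall>a\<in>S x. \<exists>U s. opn U \<and> x \<in> U \<and> s \<in> sec A U \<and> s x = a \<and> (\<forall>y\<in>U. s y \<in> S y)))"

text \<open>The record update keeps the zero and the operations of \<open>A\<close>, so that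
  inclusions are identities on germs.\<close>

definition subsh :: "('x, 'r, 'u) osheaf \<Rightarrow> ('x \<Rightarrow> 'u set) \<Rightarrow> ('x, 'r, 'u) osheaf" where
  "subsh A S = \<lparr> stalk = (\<lambda>x. (stalk A x)\<lparr>carrier := S x\<rparr>),
     etale = gen_etale {(U, s). opn U \<and> s \<in> sec A U \<and> (\<forall>y\<in>U. s y \<in> S y)} \<rparr>"

lemma subsh_stalk:
  "Car (subsh A S) x = S x" "\<zero>\<^bsub>stalk (subsh A S) x\<^esub> = \<zero>\<^bsub>stalk A x\<^esub>"
  "a \<oplus>\<^bsub>stalk (subsh A S) x\<^esub> b = a \<oplus>\<^bsub>stalk A x\<^esub> b" "r \<odot>\<^bsub>stalk (subsh A S) x\<^esub> a = r \<odot>\<^bsub>stalk A x\<^esub> a"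
  by (simp_all add: subsh_def)

lemma submodule_familyD:
  assumes "submodule_family A S" "x \<in> pts"
  shows "a \<in> S x \<Longrightarrow> a \<in> Car A x" "\<zero>\<^bsub>stalk A x\<^esub> \<in> S x" "a \<in> S x \<Longrightarrow> b \<in> S x \<Longrightarrow> a \<oplus>\<^bsub>stalk A x\<^esub> b \<in> S x"
    "r \<in> carrier (ostalk X x) \<Longrightarrow> a \<in> S x \<Longrightarrow> r \<odot>\<^bsub>stalk A x\<^esub> a \<in> S x"
    "a \<in> S x \<Longrightarrow> \<exists>U s. opn U \<and> x \<in> U \<and> s \<in> sec A U \<and> s x = a \<and> (\<forall>y\<in>U. s y \<in> S y)"
  using assms unfolding submodule_family_def by blast+

text \<open>Closure under negatives comes from closure under the scalar \<open>-1\<close>.\<close>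

lemma submodule_family_minus:
  assumes "module_sheaf X A" "submodule_family A S" "x \<in> pts" "a \<in> S x"
  shows "\<ominus>\<^bsub>stalk A x\<^esub> a \<in> S x"
proof -
  interpret A: module "ostalk X x" "stalk A x" by (rule msheaf_module[OF assms(1,3)])
  have "(\<ominus>\<^bsub>ostalk X x\<^esub> \<one>\<^bsub>ostalk X x\<^esub>) \<odot>\<^bsub>stalk A x\<^esub> a \<in> S x"
    using submodule_familyD(4)[OF assms(2,3)] assms(4) by simp
  then show ?thesis using A.smult_uminus_one submodule_familyD(1)[OF assms(2,3,4)] by simp
qed

lemma subsh_family:
  assumes "module_sheaf X A" "submodule_family A S"
  shows "section_family (base X) (Car (subsh A S)) {(U, s). opn U \<and> s \<in> sec A U \<and> (\<forall>y\<in>U. s y \<in> S y)}"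
  unfolding section_family_def subsh_stalk
proof (intro conjI)
  show "\<forall>(U, s)\<in>{(U, s). opn U \<and> s \<in> sec A U \<and> (\<forall>y\<in>U. s y \<in> S y)}.
       \<forall>(V, t)\<in>{(U, s). opn U \<and> s \<in> sec A U \<and> (\<forall>y\<in>U. s y \<in> S y)}. \<forall>x\<in>U \<inter> V. s x = t x \<longrightarrow>
        (\<exists>W. opn W \<and> x \<in> W \<and> (\<forall>y\<in>W \<inter> U \<inter> V. s y = t y))"
  proof clarsimp
    fix U s V t x assume "opn U" "s \<in> sec A U" "opn V" "t \<in> sec A V" "x \<in> U" "x \<in> V" "s x = t x"
    from sec_agree[OF assms(1) this] show "\<exists>W. opn W \<and> x \<in> W \<and> (\<forall>y\<in>W \<inter> U \<inter> V. s y = t y)" by (metis IntD1)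
  qed
  show "\<forall>x\<in>pts. \<forall>a\<in>S x. \<exists>(U, s)\<in>{(U, s). opn U \<and> s \<in> sec A U \<and> (\<forall>y\<in>U. s y \<in> S y)}. x \<in> U \<and> s x = a"
    using submodule_familyD(5)[OF assms(2)] by fastforce
qed (auto intro: sections_restrict)

lemma subsh_module_sheaf:
  assumes "module_sheaf X A" "submodule_family A S"
  shows "module_sheaf X (subsh A S)"
proof -
  note D = submodule_familyD[OF assms(2)]
  have "module_sheaf X \<lparr>stalk = stalk (subsh A S), etale = gen_etale {(U, s). opn U \<and> s \<in> sec A U \<and> (\<forall>y\<in>U. s y \<in> S y)}\<rparr>"
  proof (rule module_sheafI[OF subsh_family[OF assms]])
    fix x assume x: "x \<in> pts"
    interpret A: module "ostalk X x" "stalk A x" by (rule msheaf_module[OF assms(1) x])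
    note c = D(1)[OF x]
    have "abelian_group (stalk (subsh A S) x)"
    proof (rule abelian_groupI; unfold subsh_stalk)
      fix a assume a: "a \<in> S x"
      show "\<exists>b\<in>S x. b \<oplus>\<^bsub>stalk A x\<^esub> a = \<zero>\<^bsub>stalk A x\<^esub>"
        using submodule_family_minus[OF assms x a] A.M.l_neg[OF c[OF a]] by blast
    qed (use D(2,3)[OF x] c A.M.a_assoc A.M.a_comm in auto)
    then show "module (ostalk X x) (stalk (subsh A S) x)"
      by (rule moduleI[OF A.is_cring]; unfold subsh_stalk)
         (use D(2-4)[OF x] c A.smult_l_distr A.smult_r_distr A.smult_assoc1 A.smult_one in auto)
  next
    fix U s t assume "(U, s) \<in> {(U, s). opn U \<and> s \<in> sec A U \<and> (\<forall>y\<in>U. s y \<in> S y)}"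
      "(U, t) \<in> {(U, s). opn U \<and> s \<in> sec A U \<and> (\<forall>y\<in>U. s y \<in> S y)}"
    then show "(U, \<lambda>y. s y \<oplus>\<^bsub>stalk (subsh A S) y\<^esub> t y) \<in> {(U, s). opn U \<and> s \<in> sec A U \<and> (\<forall>y\<in>U. s y \<in> S y)}"
      using sec_add[OF assms(1)] D(3) opn_pts by (auto simp: subsh_stalk)
  next
    fix U r s assume "r \<in> osec U" "(U, s) \<in> {(U, s). opn U \<and> s \<in> sec A U \<and> (\<forall>y\<in>U. s y \<in> S y)}"
    then show "(U, \<lambda>y. r y \<odot>\<^bsub>stalk (subsh A S) y\<^esub> s y) \<in> {(U, s). opn U \<and> s \<in> sec A U \<and> (\<forall>y\<in>U. s y \<in> S y)}"
      using sec_smult[OF assms(1)] D(4) opn_pts osec_mem by (auto simp: subsh_stalk)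
  qed
  then show ?thesis by (simp add: subsh_def)
qed

lemma subsh_sec:
  assumes "module_sheaf X A" "submodule_family A S" "opn U" "s \<in> sec A U" "\<And>y. y \<in> U \<Longrightarrow> s y \<in> S y"
  shows "s \<in> sec (subsh A S) U"
  using gen_etale_sections[OF subsh_family[OF assms(1,2)], of U s] assms(3-5) by (simp add: subsh_def)

lemma subsh_incl:
  assumes "module_sheaf X A" "submodule_family A S"
  shows "(\<lambda>x\<in>pts. \<lambda>a\<in>S x. a) \<in> sheaf_hom X (subsh A S) A"
proof -
  have "(\<lambda>x\<in>pts. \<lambda>a\<in>Car (subsh A S) x. a) \<in> sheaf_hom X (subsh A S) A"
  proof (rule homI[OF subsh_module_sheaf[OF assms]])
    fix x a assume x: "x \<in> pts" and "a \<in> Car (subsh A S) x"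
    then have "a \<in> S x" by (simp add: subsh_stalk)
    then obtain U s where U: "opn U" "x \<in> U" "s \<in> sec A U" "s x = a" "\<forall>y\<in>U. s y \<in> S y"
      using submodule_familyD(5)[OF assms(2) x] by blast
    have "s \<in> sec (subsh A S) U" by (rule subsh_sec[OF assms U(1,3)]) (use U(5) in blast)
    then show "\<exists>U s. opn U \<and> x \<in> U \<and> s \<in> sec (subsh A S) U \<and> s x = a \<and> (\<lambda>y. s y) \<in> sec A U"
      using U by (intro exI[of _ U] exI[of _ s]) simp
  qed (use submodule_familyD(1)[OF assms(2)] in \<open>auto simp: subsh_stalk\<close>)
  then show ?thesis by (simp add: subsh_stalk)
qed

text \<open>A morphism does not record its target, so the corestriction is \<open>f\<close> itself;
  only its continuity has to be checked again.\<close>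

lemma subsh_corestrict:
  assumes "module_sheaf X A" "submodule_family A S" "module_sheaf X T" "f \<in> sheaf_hom X T A"
    "\<And>x t. x \<in> pts \<Longrightarrow> t \<in> Car T x \<Longrightarrow> f x t \<in> S x"
  shows "f \<in> sheaf_hom X T (subsh A S)"
proof -
  have h: "(\<lambda>x\<in>pts. \<lambda>a\<in>Car T x. f x a) \<in> sheaf_hom X T (subsh A S)"
  proof (rule homI[OF assms(3)])
    fix x a assume x: "x \<in> pts" "a \<in> Car T x"
    obtain U s where U: "opn U" "x \<in> U" "s \<in> sec T U" "s x = a" using sec_through[OF assms(3) x] .
    have "(\<lambda>y. f y (s y)) \<in> sec (subsh A S) U"
      by (rule subsh_sec[OF assms(1,2) U(1) hom_sec[OF assms(4) U(3)]])
         (use assms(5) opn_pts[OF U(1)] sec_mem[OF assms(3) U(1,3)] in blast)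
    then show "\<exists>U s. opn U \<and> x \<in> U \<and> s \<in> sec T U \<and> s x = a \<and> (\<lambda>y. f y (s y)) \<in> sec (subsh A S) U" using U by blast
  qed (use assms(5) hom_add[OF assms(4)] hom_smult[OF assms(4)] in \<open>auto simp: subsh_stalk\<close>)
  have "f = (\<lambda>x\<in>pts. \<lambda>a\<in>Car T x. f x a)" by (rule hom_ext[OF assms(4) h]) simp
  then show ?thesis using h by simp
qed

lemma image_family:
  assumes "module_sheaf X A" "module_sheaf X B" "f \<in> sheaf_hom X A B"
  shows "submodule_family B (\<lambda>x. f x ` Car A x)"
  unfolding submodule_family_def
proof (intro ballI conjI)
  fix x assume x: "x \<in> pts"
  interpret f: sheaf_morphism X A B f x by unfold_locales (use assms x in auto)
  show "f x ` Car A x \<subseteq> Car B x" using f.mem by blast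
  show "\<zero>\<^bsub>stalk B x\<^esub> \<in> f x ` Car A x" using f.zero by (metis f.A.M.zero_closed imageI)
  fix b assume "b \<in> f x ` Car A x"
  then obtain a where a: "a \<in> Car A x" "b = f x a" by blast
  show "r \<odot>\<^bsub>stalk B x\<^esub> b \<in> f x ` Car A x" if "r \<in> carrier (ostalk X x)" for r
    using hom_smult[OF assms(3) x that a(1)] a that f.A.smult_closed by (metis imageI)
  show "b \<oplus>\<^bsub>stalk B x\<^esub> c \<in> f x ` Car A x" if c: "c \<in> f x ` Car A x" for c
    using c a hom_add[OF assms(3) x] f.A.M.a_closed by (smt (verit) imageE imageI)
  obtain U s where U: "opn U" "x \<in> U" "s \<in> sec A U" "s x = a" using sec_through[OF assms(1) x a(1)] .
  show "\<exists>U s. opn U \<and> x \<in> U \<and> s \<in> sec B U \<and> s x = b \<and> (\<forall>y\<in>U. s y \<in> f y ` Car A y)"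
    using U a hom_sec[OF assms(3) U(3)] sec_mem[OF assms(1) U(1,3)] by (intro exI[of _ U] exI[of _ "\<lambda>y. f y (s y)"]) auto
qed

text \<open>Openness holds because a section whose image vanishes at a point has an image that
  vanishes near it.\<close>

lemma kernel_family:
  assumes "module_sheaf X A" "module_sheaf X B" "f \<in> sheaf_hom X A B"
  shows "submodule_family A (\<lambda>x. {a \<in> Car A x. f x a = \<zero>\<^bsub>stalk B x\<^esub>})"
  unfolding submodule_family_def
proof (intro ballI conjI)
  fix x assume x: "x \<in> pts"
  interpret f: sheaf_morphism X A B f x by unfold_locales (use assms x in auto)
  show "\<zero>\<^bsub>stalk A x\<^esub> \<in> {a \<in> Car A x. f x a = \<zero>\<^bsub>stalk B x\<^esub>}" using f.zero by simp
  fix a assume a: "a \<in> {a \<in> Car A x. f x a = \<zero>\<^bsub>stalk B x\<^esub>}"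
  show "r \<odot>\<^bsub>stalk A x\<^esub> a \<in> {a \<in> Car A x. f x a = \<zero>\<^bsub>stalk B x\<^esub>}" if "r \<in> carrier (ostalk X x)" for r
    using a that by (simp add: hom_smult[OF assms(3) x] f.B.smult_r_null)
  show "a \<oplus>\<^bsub>stalk A x\<^esub> b \<in> {a \<in> Car A x. f x a = \<zero>\<^bsub>stalk B x\<^esub>}" if "b \<in> {a \<in> Car A x. f x a = \<zero>\<^bsub>stalk B x\<^esub>}" for b
    using a that by (simp add: hom_add[OF assms(3) x])
  obtain U s where U: "opn U" "x \<in> U" "s \<in> sec A U" "s x = a" using sec_through[OF assms(1) x] a by blast
  obtain W where W: "opn W" "x \<in> W" "W \<subseteq> U" "\<And>y. y \<in> W \<Longrightarrow> f y (s y) = \<zero>\<^bsub>stalk B y\<^esub>"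
    using sec_agree[OF assms(2) U(1) hom_sec[OF assms(3) U(3)] U(1) sec_zero[OF assms(2) U(1)] U(2,2)] U(4) a by auto
  have "s \<in> sec A W" using sections_restrict[OF U(3) W(3)] .
  then show "\<exists>U s. opn U \<and> x \<in> U \<and> s \<in> sec A U \<and> s x = a \<and> (\<forall>y\<in>U. s y \<in> {a \<in> Car A y. f y a = \<zero>\<^bsub>stalk B y\<^esub>})"
    using W U(4) sec_mem[OF assms(1) W(1)] by blast
qed auto

end

lemma section_familyI:
  assumes "\<And>U s. (U, s) \<in> \<S> \<Longrightarrow> openin M U" "\<And>U s y. (U, s) \<in> \<S> \<Longrightarrow> y \<in> U \<Longrightarrow> s y \<in> S y"
    and "\<And>U s W. (U, s) \<in> \<S> \<Longrightarrow> openin M W \<Longrightarrow> (U \<inter> W, s) \<in> \<S>"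
    and "\<And>x a. x \<in> topspace M \<Longrightarrow> a \<in> S x \<Longrightarrow> \<exists>U s. (U, s) \<in> \<S> \<and> x \<in> U \<and> s x = a"
    and "\<And>U s V t x. (U, s) \<in> \<S> \<Longrightarrow> (V, t) \<in> \<S> \<Longrightarrow> x \<in> U \<Longrightarrow> x \<in> V \<Longrightarrow> s x = t x \<Longrightarrow>
      \<exists>W. openin M W \<and> x \<in> W \<and> (\<forall>y\<in>W \<inter> U \<inter> V. s y = t y)"
  shows "section_family M S \<S>"
proof -
  have 2: "\<exists>(U, s)\<in>\<S>. x \<in> U \<and> s x = a" if "x \<in> topspace M" "a \<in> S x" for x a
    using assms(4)[OF that] by auto
  show ?thesis
    unfolding section_family_def
    by (intro conjI ballI; clarify?; (intro conjI ballI allI impI)?) (fact assms(1-3) assms(5) 2)+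
qed

context ringed begin

subsection \<open>Quotients\<close>

text \<open>The stalks of a quotient consist of chosen representatives, so that they stay in the same type.\<close>

definition coset_rep :: "('x, 'r, 'u) osheaf \<Rightarrow> ('x \<Rightarrow> 'u set) \<Rightarrow> 'x \<Rightarrow> 'u \<Rightarrow> 'u" where
  "coset_rep A S x a = (SOME b. b \<in> Car A x \<and> a \<ominus>\<^bsub>stalk A x\<^esub> b \<in> S x)"

definition quotsh :: "('x, 'r, 'u) osheaf \<Rightarrow> ('x \<Rightarrow> 'u set) \<Rightarrow> ('x, 'r, 'u) osheaf" where
  "quotsh A S = \<lparr> stalk = (\<lambda>x. \<lparr> carrier = coset_rep A S x ` Car A x, mult = (\<lambda>_ _. undefined), one = undefined,
       zero = coset_rep A S x \<zero>\<^bsub>stalk A x\<^esub>, add = (\<lambda>u v. coset_rep A S x (u \<oplus>\<^bsub>stalk A x\<^esub> v)),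
       smult = (\<lambda>r u. coset_rep A S x (r \<odot>\<^bsub>stalk A x\<^esub> u)) \<rparr>),
     etale = gen_etale {(U, s). opn U \<and> (\<exists>a\<in>sec A U. \<forall>y\<in>U. s y = coset_rep A S y (a y))} \<rparr>"

lemma quotsh_stalk:
  "Car (quotsh A S) x = coset_rep A S x ` Car A x" "\<zero>\<^bsub>stalk (quotsh A S) x\<^esub> = coset_rep A S x \<zero>\<^bsub>stalk A x\<^esub>"
  "u \<oplus>\<^bsub>stalk (quotsh A S) x\<^esub> v = coset_rep A S x (u \<oplus>\<^bsub>stalk A x\<^esub> v)"
  "r \<odot>\<^bsub>stalk (quotsh A S) x\<^esub> u = coset_rep A S x (r \<odot>\<^bsub>stalk A x\<^esub> u)"
  by (simp_all add: quotsh_def)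

context
  fixes A :: "('x, 'r, 'u) osheaf" and S
  assumes mA: "module_sheaf X A" and S: "submodule_family A S"
begin

lemma coset_rep:
  assumes x: "x \<in> pts" and a: "a \<in> Car A x"
  shows "coset_rep A S x a \<in> Car A x" "a \<ominus>\<^bsub>stalk A x\<^esub> coset_rep A S x a \<in> S x"
proof -
  interpret A: module "ostalk X x" "stalk A x" by (rule msheaf_module[OF mA x])
  have "a \<in> Car A x \<and> a \<ominus>\<^bsub>stalk A x\<^esub> a \<in> S x"
    using a submodule_familyD(2)[OF S x] by (simp add: a_minus_def A.M.r_neg)
  then show "coset_rep A S x a \<in> Car A x" "a \<ominus>\<^bsub>stalk A x\<^esub> coset_rep A S x a \<in> S x"
    unfolding coset_rep_def by (metis (mono_tags, lifting) someI)+
qed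

lemma coset_rep_eq_iff:
  assumes x: "x \<in> pts" and a: "a \<in> Car A x" and b: "b \<in> Car A x"
  shows "coset_rep A S x a = coset_rep A S x b \<longleftrightarrow> a \<ominus>\<^bsub>stalk A x\<^esub> b \<in> S x"
proof -
  interpret A: module "ostalk X x" "stalk A x" by (rule msheaf_module[OF mA x])
  note D = submodule_familyD[OF S x] and neg = submodule_family_minus[OF mA S x]
  have diff_trans: "c \<ominus>\<^bsub>stalk A x\<^esub> e \<in> S x"
    if "c \<ominus>\<^bsub>stalk A x\<^esub> d \<in> S x" "d \<ominus>\<^bsub>stalk A x\<^esub> e \<in> S x" "c \<in> Car A x" "d \<in> Car A x" "e \<in> Car A x" for c d e
  proof -
    have "(c \<ominus>\<^bsub>stalk A x\<^esub> d) \<oplus>\<^bsub>stalk A x\<^esub> (d \<ominus>\<^bsub>stalk A x\<^esub> e) = c \<oplus>\<^bsub>stalk A x\<^esub> ((\<ominus>\<^bsub>stalk A x\<^esub> d \<oplus>\<^bsub>stalk A x\<^esub> d) \<oplus>\<^bsub>stalk A x\<^esub> \<ominus>\<^bsub>stalk A x\<^esub> e)"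
      using that(3-5) unfolding a_minus_def by (simp add: A.M.a_assoc del: A.M.l_neg A.M.r_neg)
    also have "\<dots> = c \<ominus>\<^bsub>stalk A x\<^esub> e"
      using that(3-5) by (simp add: A.M.l_neg a_minus_def)
    finally show ?thesis using D(3)[OF that(1,2)] by simp
  qed
  have diff_sym: "d \<ominus>\<^bsub>stalk A x\<^esub> c \<in> S x" if "c \<ominus>\<^bsub>stalk A x\<^esub> d \<in> S x" "c \<in> Car A x" "d \<in> Car A x" for c d
  proof -
    have "\<ominus>\<^bsub>stalk A x\<^esub> (c \<ominus>\<^bsub>stalk A x\<^esub> d) = d \<ominus>\<^bsub>stalk A x\<^esub> c"
      using that(2,3) unfolding a_minus_def by (simp add: A.M.minus_add A.M.a_comm)
    then show ?thesis using neg[OF that(1)] by simp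
  qed
  show ?thesis
  proof
    assume "coset_rep A S x a = coset_rep A S x b"
    then show "a \<ominus>\<^bsub>stalk A x\<^esub> b \<in> S x"
      using diff_trans[OF coset_rep(2)[OF x a] diff_sym[OF _ b]] coset_rep[OF x a] coset_rep[OF x b] a b by simp
  next
    assume ab: "a \<ominus>\<^bsub>stalk A x\<^esub> b \<in> S x"
    \<comment> \<open>Elements of the same coset give the choice operator the same predicate, hence
      the same representative.\<close>
    have "a \<ominus>\<^bsub>stalk A x\<^esub> c \<in> S x \<longleftrightarrow> b \<ominus>\<^bsub>stalk A x\<^esub> c \<in> S x" if "c \<in> Car A x" for c
      using diff_trans[OF ab _ a b that] diff_trans[OF diff_sym[OF ab a b] _ b a that] by blast
    then show "coset_rep A S x a = coset_rep A S x b"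
      unfolding coset_rep_def by (intro arg_cong[where f = Eps]) blast
  qed
qed

lemma coset_rep_add:
  assumes x: "x \<in> pts" and a: "a \<in> Car A x" and b: "b \<in> Car A x"
  shows "coset_rep A S x (coset_rep A S x a \<oplus>\<^bsub>stalk A x\<^esub> coset_rep A S x b) = coset_rep A S x (a \<oplus>\<^bsub>stalk A x\<^esub> b)"
proof -
  interpret A: module "ostalk X x" "stalk A x" by (rule msheaf_module[OF mA x])
  let ?a = "coset_rep A S x a" and ?b = "coset_rep A S x b"
  have c: "?a \<in> Car A x" "?b \<in> Car A x" using coset_rep x a b by auto
  have "(a \<oplus>\<^bsub>stalk A x\<^esub> b) \<ominus>\<^bsub>stalk A x\<^esub> (?a \<oplus>\<^bsub>stalk A x\<^esub> ?b) = (a \<ominus>\<^bsub>stalk A x\<^esub> ?a) \<oplus>\<^bsub>stalk A x\<^esub> (b \<ominus>\<^bsub>stalk A x\<^esub> ?b)"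
    using a b c unfolding a_minus_def by (simp add: A.M.minus_add A.M.a_ac)
  then have "(a \<oplus>\<^bsub>stalk A x\<^esub> b) \<ominus>\<^bsub>stalk A x\<^esub> (?a \<oplus>\<^bsub>stalk A x\<^esub> ?b) \<in> S x"
    using submodule_familyD(3)[OF S x coset_rep(2)[OF x a] coset_rep(2)[OF x b]] by simp
  then show ?thesis using coset_rep_eq_iff[OF x, of "a \<oplus>\<^bsub>stalk A x\<^esub> b" "?a \<oplus>\<^bsub>stalk A x\<^esub> ?b"] a b c by simp
qed

lemma coset_rep_smult:
  assumes x: "x \<in> pts" and a: "a \<in> Car A x" and r: "r \<in> carrier (ostalk X x)"
  shows "coset_rep A S x (r \<odot>\<^bsub>stalk A x\<^esub> coset_rep A S x a) = coset_rep A S x (r \<odot>\<^bsub>stalk A x\<^esub> a)"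
proof -
  interpret A: module "ostalk X x" "stalk A x" by (rule msheaf_module[OF mA x])
  let ?a = "coset_rep A S x a"
  have c: "?a \<in> Car A x" using coset_rep x a by auto
  have "(r \<odot>\<^bsub>stalk A x\<^esub> a) \<ominus>\<^bsub>stalk A x\<^esub> (r \<odot>\<^bsub>stalk A x\<^esub> ?a) = r \<odot>\<^bsub>stalk A x\<^esub> (a \<ominus>\<^bsub>stalk A x\<^esub> ?a)"
    using a c r unfolding a_minus_def by (simp add: A.smult_r_distr A.smult_r_minus)
  then have "(r \<odot>\<^bsub>stalk A x\<^esub> a) \<ominus>\<^bsub>stalk A x\<^esub> (r \<odot>\<^bsub>stalk A x\<^esub> ?a) \<in> S x"
    using submodule_familyD(4)[OF S x r coset_rep(2)[OF x a]] by simp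
  then show ?thesis using coset_rep_eq_iff[OF x, of "r \<odot>\<^bsub>stalk A x\<^esub> a" "r \<odot>\<^bsub>stalk A x\<^esub> ?a"] a c r by simp
qed

lemma quotsh_family:
  "section_family (base X) (Car (quotsh A S)) {(U, s). opn U \<and> (\<exists>a\<in>sec A U. \<forall>y\<in>U. s y = coset_rep A S y (a y))}"
  (is "section_family _ _ ?F")
  unfolding section_family_def
proof (intro conjI)
  show "\<forall>(U, s)\<in>?F. \<forall>(V, t)\<in>?F. \<forall>x\<in>U \<inter> V. s x = t x \<longrightarrow> (\<exists>W. opn W \<and> x \<in> W \<and> (\<forall>y\<in>W \<inter> U \<inter> V. s y = t y))"
  proof clarsimp
    fix U s V t x a b assume U: "opn U" "a \<in> sec A U" "\<forall>y\<in>U. s y = coset_rep A S y (a y)"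
      and V: "opn V" "b \<in> sec A V" "\<forall>y\<in>V. t y = coset_rep A S y (b y)"
      and x: "x \<in> U" "x \<in> V" "coset_rep A S x (a x) = coset_rep A S x (b x)"
    have xp: "x \<in> pts" using opn_pts U x by blast
    have o: "opn (U \<inter> V)" using U V by blast
    have ab: "a \<in> sec A (U \<inter> V)" "b \<in> sec A (U \<inter> V)" using sections_restrict[OF U(2)] sections_restrict[OF V(2)] by auto
    have "a x \<ominus>\<^bsub>stalk A x\<^esub> b x \<in> S x"
      using x(3) coset_rep_eq_iff[OF xp sec_mem[OF mA U(1,2) x(1)] sec_mem[OF mA V(1,2) x(2)]] by simp
    \<comment> \<open>The difference of \<open>a\<close> and \<open>b\<close> has its value at
      \<open>x\<close> in \<open>S\<close>. A section with values in \<open>S\<close> through this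
      value agrees with the difference near \<open>x\<close>, so the difference stays in
      \<open>S\<close> there.\<close>
    then obtain N c where N: "opn N" "x \<in> N" "c \<in> sec A N" "c x = a x \<ominus>\<^bsub>stalk A x\<^esub> b x" "\<forall>y\<in>N. c y \<in> S y"
      using submodule_familyD(5)[OF S xp] by blast
    obtain W where W: "opn W" "x \<in> W" "W \<subseteq> N" "W \<subseteq> U \<inter> V" "\<And>y. y \<in> W \<Longrightarrow> c y = a y \<ominus>\<^bsub>stalk A y\<^esub> b y"
      using sec_agree[OF mA N(1,3) o sec_diff[OF mA o ab] N(2) _ N(4)] x(1,2) by blast
    have "coset_rep A S y (a y) = coset_rep A S y (b y)" if y: "y \<in> W" for y
    proof -
      have m: "a y \<in> Car A y" "b y \<in> Car A y" using sec_mem[OF mA o ab(1)] sec_mem[OF mA o ab(2)] W(4) y by blast+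
      have "a y \<ominus>\<^bsub>stalk A y\<^esub> b y \<in> S y" unfolding W(5)[OF y, symmetric] using N(5) W(3) y by blast
      then show ?thesis using coset_rep_eq_iff[OF opn_pts[OF W(1) y] m] by simp
    qed
    then show "\<exists>W. opn W \<and> x \<in> W \<and> (\<forall>y\<in>W \<inter> U \<inter> V. coset_rep A S y (a y) = coset_rep A S y (b y))"
      using W by blast
  qed
  show "\<forall>x\<in>pts. \<forall>u\<in>Car (quotsh A S) x. \<exists>(U, s)\<in>?F. x \<in> U \<and> s x = u"
  proof (intro ballI)
    fix x u assume x: "x \<in> pts" and "u \<in> Car (quotsh A S) x"
    then obtain a where a: "a \<in> Car A x" "u = coset_rep A S x a" by (auto simp: quotsh_stalk)
    obtain U s where "opn U" "x \<in> U" "s \<in> sec A U" "s x = a" using sec_through[OF mA x a(1)] .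
    then show "\<exists>(U, s)\<in>?F. x \<in> U \<and> s x = u"
      using a(2) by (intro bexI[of _ "(U, \<lambda>y. coset_rep A S y (s y))"]) auto
  qed
  show "\<forall>(U, s)\<in>?F. opn U \<and> (\<forall>y\<in>U. s y \<in> Car (quotsh A S) y)"
    using sec_mem[OF mA] by (auto simp: quotsh_stalk)
  show "\<forall>(U, s)\<in>?F. \<forall>W. opn W \<longrightarrow> (U \<inter> W, s) \<in> ?F"
    using sections_restrict[OF _ inf_le1] by fastforce
qed

lemma quotsh_module_sheaf: "module_sheaf X (quotsh A S)"
proof -
  let ?F = "{(U, s). opn U \<and> (\<exists>a\<in>sec A U. \<forall>y\<in>U. s y = coset_rep A S y (a y))}"
  have "module_sheaf X \<lparr>stalk = stalk (quotsh A S), etale = gen_etale ?F\<rparr>"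
  proof (rule module_sheafI[OF quotsh_family])
    fix x assume x: "x \<in> pts"
    show "module (ostalk X x) (stalk (quotsh A S) x)"
      by (rule module_surj[OF msheaf_module[OF mA x], of "coset_rep A S x"])
         (simp_all add: quotsh_stalk coset_rep_add[OF x] coset_rep_smult[OF x])
  next
    fix U s t assume "(U, s) \<in> ?F" "(U, t) \<in> ?F"
    then obtain a b where ab: "opn U" "a \<in> sec A U" "b \<in> sec A U" "\<forall>y\<in>U. s y = coset_rep A S y (a y)"
        "\<forall>y\<in>U. t y = coset_rep A S y (b y)"
      by auto
    have "\<forall>y\<in>U. s y \<oplus>\<^bsub>stalk (quotsh A S) y\<^esub> t y = coset_rep A S y (a y \<oplus>\<^bsub>stalk A y\<^esub> b y)"
      using ab coset_rep_add[OF opn_pts[OF ab(1)] sec_mem[OF mA ab(1,2)] sec_mem[OF mA ab(1,3)]]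
      by (simp add: quotsh_stalk)
    then show "(U, \<lambda>y. s y \<oplus>\<^bsub>stalk (quotsh A S) y\<^esub> t y) \<in> ?F"
      unfolding mem_Collect_eq case_prod_conv
      by (intro conjI ab(1) bexI[of _ "\<lambda>y. a y \<oplus>\<^bsub>stalk A y\<^esub> b y"] sec_add[OF mA ab(2,3)])
  next
    fix U r s assume r: "r \<in> osec U" and "(U, s) \<in> ?F"
    then obtain a where a: "opn U" "a \<in> sec A U" "\<forall>y\<in>U. s y = coset_rep A S y (a y)" by auto
    have "\<forall>y\<in>U. r y \<odot>\<^bsub>stalk (quotsh A S) y\<^esub> s y = coset_rep A S y (r y \<odot>\<^bsub>stalk A y\<^esub> a y)"
      using a coset_rep_smult[OF opn_pts[OF a(1)] sec_mem[OF mA a(1,2)] osec_mem[OF a(1) r]]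
      by (simp add: quotsh_stalk)
    then show "(U, \<lambda>y. r y \<odot>\<^bsub>stalk (quotsh A S) y\<^esub> s y) \<in> ?F"
      unfolding mem_Collect_eq case_prod_conv
      by (intro conjI a(1) bexI[of _ "\<lambda>y. r y \<odot>\<^bsub>stalk A y\<^esub> a y"] sec_smult[OF mA r a(2)])
  qed
  then show ?thesis by (simp add: quotsh_def)
qed

lemma quotsh_sec: "opn U \<Longrightarrow> a \<in> sec A U \<Longrightarrow> (\<lambda>y. coset_rep A S y (a y)) \<in> sec (quotsh A S) U"
  using gen_etale_sections[OF quotsh_family, of U "\<lambda>y. coset_rep A S y (a y)"] by (auto simp: quotsh_def)

lemma quotsh_proj: "(\<lambda>x\<in>pts. \<lambda>a\<in>Car A x. coset_rep A S x a) \<in> sheaf_hom X A (quotsh A S)"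
proof (rule homI[OF mA])
  fix x a assume "x \<in> pts" "a \<in> Car A x"
  from sec_through[OF mA this] quotsh_sec
  show "\<exists>U s. opn U \<and> x \<in> U \<and> s \<in> sec A U \<and> s x = a \<and> (\<lambda>y. coset_rep A S y (s y)) \<in> sec (quotsh A S) U" by metis
qed (simp_all add: quotsh_stalk coset_rep_add coset_rep_smult)

text \<open>Germs of the quotient are elements of \<open>A\<close>, so the induced morphism is
  \<open>f\<close> restricted to representatives; passing from an element to its representative
  leaves the value of \<open>f\<close> unchanged because \<open>f\<close> vanishes on
  \<open>S\<close>.\<close>

lemma quotsh_factor:
  assumes mT: "module_sheaf X T" and f: "f \<in> sheaf_hom X A T"
    and z: "\<And>x a. x \<in> pts \<Longrightarrow> a \<in> S x \<Longrightarrow> f x a = \<zero>\<^bsub>stalk T x\<^esub>"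
  shows "(\<lambda>x\<in>pts. \<lambda>u\<in>Car (quotsh A S) x. f x u) \<in> sheaf_hom X (quotsh A S) T"
    and "\<And>x a. x \<in> pts \<Longrightarrow> a \<in> Car A x \<Longrightarrow> f x (coset_rep A S x a) = f x a"
proof -
  show e: "f x (coset_rep A S x a) = f x a" if x: "x \<in> pts" and a: "a \<in> Car A x" for x a
  proof -
    interpret f: sheaf_morphism X A T f x by unfold_locales (use mA mT f x in auto)
    have "f x a \<ominus>\<^bsub>stalk T x\<^esub> f x (coset_rep A S x a) = \<zero>\<^bsub>stalk T x\<^esub>"
      using z[OF x coset_rep(2)[OF x a]] f.diff[OF a coset_rep(1)[OF x a]] by simp
    then show ?thesis using f.B.M.minus_zero_iff f.mem a coset_rep(1)[OF x a] by simp
  qed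
  show "(\<lambda>x\<in>pts. \<lambda>u\<in>Car (quotsh A S) x. f x u) \<in> sheaf_hom X (quotsh A S) T"
  proof (rule homI[OF quotsh_module_sheaf]; unfold quotsh_stalk)
    fix x u assume x: "x \<in> pts" and "u \<in> coset_rep A S x ` Car A x"
    then obtain a where a: "a \<in> Car A x" "u = coset_rep A S x a" by blast
    interpret f: sheaf_morphism X A T f x by unfold_locales (use mA mT f x in auto)
    have uc: "u \<in> Car A x" using a coset_rep(1)[OF x] by simp
    show "f x u \<in> Car T x" using uc f.mem by blast
    show "f x (coset_rep A S x (r \<odot>\<^bsub>stalk A x\<^esub> u)) = r \<odot>\<^bsub>stalk T x\<^esub> f x u" if "r \<in> carrier (ostalk X x)" for r
      using that uc by (simp add: e[OF x] hom_smult[OF f x])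
    show "f x (coset_rep A S x (u \<oplus>\<^bsub>stalk A x\<^esub> v)) = f x u \<oplus>\<^bsub>stalk T x\<^esub> f x v"
      if "v \<in> coset_rep A S x ` Car A x" for v
    proof -
      have "v \<in> Car A x" using that coset_rep(1)[OF x] by auto
      then show ?thesis using uc by (simp add: e[OF x] hom_add[OF f x])
    qed
    obtain U s where U: "opn U" "x \<in> U" "s \<in> sec A U" "s x = a" using sec_through[OF mA x a(1)] .
    have "(\<lambda>y. f y (coset_rep A S y (s y))) \<in> sec T U"
      by (rule sections_cong[OF U(1) hom_sec[OF f U(3)]]) (use e opn_pts[OF U(1)] sec_mem[OF mA U(1,3)] in simp)
    then show "\<exists>U s. opn U \<and> x \<in> U \<and> s \<in> sec (quotsh A S) U \<and> s x = u \<and> (\<lambda>y. f y (s y)) \<in> sec T U"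
      using U a(2) quotsh_sec[OF U(1,3)] by (intro exI[of _ U] exI[of _ "\<lambda>y. coset_rep A S y (s y)"]) simp
  qed
qed

end

subsection \<open>The zero sheaf\<close>

lemma zero_sheaf_stalk:
  "Car (zero_sheaf X) x = {undefined}" "\<zero>\<^bsub>stalk (zero_sheaf X) x\<^esub> = undefined"
  "a \<oplus>\<^bsub>stalk (zero_sheaf X) x\<^esub> b = undefined" "r \<odot>\<^bsub>stalk (zero_sheaf X) x\<^esub> a = undefined"
  by (simp_all add: zero_sheaf_def)

lemma zero_sheaf_family:
  "section_family (base X) (Car (zero_sheaf X)) {(U, s). opn U \<and> (\<forall>y\<in>U. s y = undefined)}"
  unfolding section_family_def zero_sheaf_stalk
proof (intro conjI)
  show "\<forall>x\<in>pts. \<forall>a\<in>{undefined}. \<exists>(U, s)\<in>{(U, s). opn U \<and> (\<forall>y\<in>U. s y = undefined)}. x \<in> U \<and> s x = a"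
    by (auto intro!: bexI[of _ "(pts, \<lambda>_. undefined)"])
qed auto

text \<open>The zero sheaf is defined by a pullback topology. Generated by sections it falls under
  \<open>module_sheafI\<close>.\<close>

lemma zero_sheaf_etale:
  "etale (zero_sheaf X :: ('x, 'r, 'v) osheaf) = gen_etale {(U, s). opn U \<and> (\<forall>y\<in>U. s y = undefined)}"
  (is "_ = gen_etale ?F")
proof (rule topology_eq[THEN iffD2], intro allI iffI)
  fix V assume "openin (etale (zero_sheaf X :: ('x, 'r, 'v) osheaf)) V"
  then obtain U where U: "opn U" "V = fst -` U \<inter> (pts \<times> {undefined})"
    by (auto simp: zero_sheaf_def openin_pullback_topology)
  have "V = (\<lambda>y. (y, undefined)) ` U" using U openin_subset[OF U(1)] by auto
  then show "openin (gen_etale ?F) V" using gen_etale_open[of U "\<lambda>_. undefined" ?F] U(1) by simp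
next
  fix V :: "('x \<times> 'v) set" assume V: "openin (gen_etale ?F) V"
  let ?U = "{x \<in> pts. (x, undefined) \<in> V}"
  have "opn ?U"
    unfolding openin_subopen[of _ ?U]
  proof
    fix x assume "x \<in> ?U"
    then have x: "(x, undefined) \<in> V" by simp
    obtain W s where W: "(W, s) \<in> ?F" "(x, undefined) \<in> (\<lambda>y. (y, s y)) ` W" "(\<lambda>y. (y, s y)) ` W \<subseteq> V"
      using gen_etale_basis[OF zero_sheaf_family V x] by (elim exE conjE)
    have "opn W" "x \<in> W" using W(1,2) by auto
    moreover have "W \<subseteq> ?U"
    proof
      fix y assume y: "y \<in> W"
      then have "(y, s y) \<in> V" using W(3) by blast
      then show "y \<in> ?U" using y W(1) opn_pts[OF \<open>opn W\<close> y] by simp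
    qed
    ultimately show "\<exists>T. opn T \<and> x \<in> T \<and> T \<subseteq> ?U" by blast
  qed
  moreover have "V = fst -` ?U \<inter> (pts \<times> {undefined})"
    using openin_subset[OF V] gen_etale_topspace[OF zero_sheaf_family] by (auto simp: zero_sheaf_stalk)
  ultimately show "openin (etale (zero_sheaf X)) V"
    by (auto simp: zero_sheaf_def openin_pullback_topology)
qed

lemma zero_sheaf_module_sheaf: "module_sheaf X (zero_sheaf X)"
proof -
  let ?F = "{(U, s). opn U \<and> (\<forall>y\<in>U. s y = undefined)}"
  have "module_sheaf X \<lparr>stalk = stalk (zero_sheaf X), etale = gen_etale ?F\<rparr>"
  proof (rule module_sheafI[OF zero_sheaf_family])
    fix x assume x: "x \<in> pts"
    have "abelian_group (stalk (zero_sheaf X) x)" by (rule abelian_groupI) (auto simp: zero_sheaf_stalk)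
    then show "module (ostalk X x) (stalk (zero_sheaf X) x)"
      by (intro moduleI ocring[OF x]) (auto simp: zero_sheaf_stalk)
  qed (auto simp: zero_sheaf_stalk)
  moreover have "zero_sheaf X = \<lparr>stalk = stalk (zero_sheaf X), etale = etale (zero_sheaf X)\<rparr>"
    by (simp add: zero_sheaf_def)
  ultimately show ?thesis unfolding zero_sheaf_etale[symmetric] by metis
qed

lemma zero_sheaf_coherent: "coherent X (zero_sheaf X :: ('x, 'r, 'v) osheaf)"
  unfolding coherent_def
proof (intro conjI zero_sheaf_module_sheaf)
  show "finite_type X (zero_sheaf X :: ('x, 'r, 'v) osheaf)"
    unfolding finite_type_iff[OF zero_sheaf_module_sheaf]
  proof
    fix x assume x: "x \<in> pts"
    have "v = lincomb (stalk (zero_sheaf X) y) 0 a s" if "y \<in> pts" "v \<in> Car (zero_sheaf X) y" for y v a and s :: "nat \<Rightarrow> 'v"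
    proof -
      interpret module "ostalk X y" "stalk (zero_sheaf X :: ('x, 'r, 'v) osheaf) y"
        by (rule msheaf_module[OF zero_sheaf_module_sheaf that(1)])
      show ?thesis using that by (simp add: lincomb_0 zero_sheaf_stalk)
    qed
    then show "\<exists>U k s. opn U \<and> x \<in> U \<and> (\<forall>i<k. s i \<in> sec (zero_sheaf X :: ('x, 'r, 'v) osheaf) U) \<and>
      (\<forall>y\<in>U. \<forall>v\<in>Car (zero_sheaf X) y. \<exists>a. (\<forall>i<k. a i \<in> carrier (ostalk X y)) \<and>
        v = lincomb (stalk (zero_sheaf X :: ('x, 'r, 'v) osheaf) y) k a (\<lambda>i. s i y))"
      using x by (intro exI[of _ pts] exI[of _ 0]) auto
  qed
  show "relations_finite_type X (zero_sheaf X :: ('x, 'r, 'v) osheaf)"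
    unfolding relations_finite_type_iff[OF zero_sheaf_module_sheaf]
  proof (intro allI impI ballI, elim conjE)
    fix U and k :: nat and s x
    assume U: "opn U" "\<forall>i<k. s i \<in> sec (zero_sheaf X :: ('x, 'r, 'v) osheaf) U" "x \<in> U"
    \<comment> \<open>Every tuple of coefficients is a relation here, and the rows of the identity
      matrix generate all tuples.\<close>
    let ?r = "\<lambda>j i y. if j = i then \<one>\<^bsub>ostalk X y\<^esub> else \<zero>\<^bsub>ostalk X y\<^esub>"
    have "rel_gen (zero_sheaf X) k s U k ?r"
      unfolding rel_gen_def
    proof (intro conjI allI impI ballI)
      fix j i :: nat assume "j < k" "i < k"
      show "?r j i \<in> osec U" using osec_one[OF U(1)] osec_zero[OF U(1)] by (cases "j = i") simp_all
    next
      fix y j assume y: "y \<in> U" and j: "j < k"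
      interpret module "ostalk X y" "stalk (zero_sheaf X :: ('x, 'r, 'v) osheaf) y"
        by (rule msheaf_module[OF zero_sheaf_module_sheaf opn_pts[OF U(1) y]])
      have "lincomb (stalk (zero_sheaf X) y) k (\<lambda>i. ?r j i y) (\<lambda>i. s i y) \<in> Car (zero_sheaf X) y"
        by (rule lincomb_closed) (use sec_mem[OF zero_sheaf_module_sheaf U(1) _ y] U(2) in auto)
      then show "lincomb (stalk (zero_sheaf X) y) k (\<lambda>i. ?r j i y) (\<lambda>i. s i y) = \<zero>\<^bsub>stalk (zero_sheaf X) y\<^esub>"
        by (simp add: zero_sheaf_stalk)
    next
      fix y g assume y: "y \<in> U"
        and g: "(\<forall>i<k. g i \<in> carrier (ostalk X y)) \<and> lincomb (stalk (zero_sheaf X) y) k g (\<lambda>i. s i y) = \<zero>\<^bsub>stalk (zero_sheaf X) y\<^esub>"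
      interpret cring "ostalk X y" by (rule ocring[OF opn_pts[OF U(1) y]])
      have "g i = (\<Oplus>\<^bsub>ostalk X y\<^esub> j\<in>{..<k}. g j \<otimes>\<^bsub>ostalk X y\<^esub> ?r j i y)" if i: "i < k" for i
      proof -
        have "(\<Oplus>\<^bsub>ostalk X y\<^esub> j\<in>{..<k}. g j \<otimes>\<^bsub>ostalk X y\<^esub> ?r j i y) = (\<Oplus>\<^bsub>ostalk X y\<^esub> j\<in>{..<k}. if i = j then g j else \<zero>\<^bsub>ostalk X y\<^esub>)"
          by (rule finsum_cong') (use g in auto)
        also have "\<dots> = g i" by (rule finsum_singleton) (use g i in auto)
        finally show ?thesis by simp
      qed
      then show "\<exists>b. (\<forall>j<k. b j \<in> carrier (ostalk X y)) \<and> (\<forall>i<k. g i = (\<Oplus>\<^bsub>ostalk X y\<^esub> j\<in>{..<k}. b j \<otimes>\<^bsub>ostalk X y\<^esub> ?r j i y))"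
        using g by blast
    qed
    then show "\<exists>V m r. opn V \<and> x \<in> V \<and> V \<subseteq> U \<and> rel_gen (zero_sheaf X) k s V m r" using U by blast
  qed
qed

end

subsection \<open>Direct sums\<close>

text \<open>Pairs of germs are coded in the type of germs, which is possible since that type is infinite.\<close>

locale ringed_coded = ringed X for X :: "('x, 'r) ringed_space" +
  fixes pr :: "'u \<times> 'u \<Rightarrow> 'u"
  assumes inj_pr: "inj pr"
begin

definition p1 where "p1 u = fst (inv_into UNIV pr u)"
definition p2 where "p2 u = snd (inv_into UNIV pr u)"

lemma p_simps [simp]: "p1 (pr (a, b)) = a" "p2 (pr (a, b)) = b" "pr (a, b) = pr (c, d) \<longleftrightarrow> a = c \<and> b = d"
  using inj_pr by (auto simp: p1_def p2_def inj_eq)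

definition dsum :: "('x, 'r, 'u) osheaf \<Rightarrow> ('x, 'r, 'u) osheaf \<Rightarrow> ('x, 'r, 'u) osheaf" where
  "dsum A B = \<lparr> stalk = (\<lambda>x. \<lparr> carrier = pr ` (Car A x \<times> Car B x), mult = (\<lambda>_ _. undefined), one = undefined,
       zero = pr (\<zero>\<^bsub>stalk A x\<^esub>, \<zero>\<^bsub>stalk B x\<^esub>),
       add = (\<lambda>u v. pr (p1 u \<oplus>\<^bsub>stalk A x\<^esub> p1 v, p2 u \<oplus>\<^bsub>stalk B x\<^esub> p2 v)),
       smult = (\<lambda>r u. pr (r \<odot>\<^bsub>stalk A x\<^esub> p1 u, r \<odot>\<^bsub>stalk B x\<^esub> p2 u)) \<rparr>),
     etale = gen_etale {(U, s). opn U \<and> (\<exists>a\<in>sec A U. \<exists>b\<in>sec B U. \<forall>y\<in>U. s y = pr (a y, b y))} \<rparr>"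

lemma dsum_stalk:
  "Car (dsum A B) x = pr ` (Car A x \<times> Car B x)" "\<zero>\<^bsub>stalk (dsum A B) x\<^esub> = pr (\<zero>\<^bsub>stalk A x\<^esub>, \<zero>\<^bsub>stalk B x\<^esub>)"
  "u \<oplus>\<^bsub>stalk (dsum A B) x\<^esub> v = pr (p1 u \<oplus>\<^bsub>stalk A x\<^esub> p1 v, p2 u \<oplus>\<^bsub>stalk B x\<^esub> p2 v)"
  "r \<odot>\<^bsub>stalk (dsum A B) x\<^esub> u = pr (r \<odot>\<^bsub>stalk A x\<^esub> p1 u, r \<odot>\<^bsub>stalk B x\<^esub> p2 u)"
  by (simp_all add: dsum_def)

lemma dsum_family:
  assumes "module_sheaf X A" "module_sheaf X B"
  shows "section_family (base X) (Car (dsum A B))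
    {(U, s). opn U \<and> (\<exists>a\<in>sec A U. \<exists>b\<in>sec B U. \<forall>y\<in>U. s y = pr (a y, b y))}"
  (is "section_family _ _ ?F")
proof (rule section_familyI)
  show "opn U" if "(U, s) \<in> ?F" for U s using that by blast
  show "s y \<in> Car (dsum A B) y" if h: "(U, s) \<in> ?F" "y \<in> U" for U s y
  proof -
    obtain a b where *: "opn U" "a \<in> sec A U" "b \<in> sec B U" "\<forall>y\<in>U. s y = pr (a y, b y)" using h(1) by blast
    then show ?thesis using sec_mem[OF assms(1) *(1,2) that(2)] sec_mem[OF assms(2) *(1,3) that(2)] that(2)
      by (simp add: dsum_stalk)
  qed
  show "(U \<inter> W, s) \<in> ?F" if h: "(U, s) \<in> ?F" "opn W" for U s W
  proof -
    obtain a b where *: "opn U" "a \<in> sec A U" "b \<in> sec B U" "\<forall>y\<in>U. s y = pr (a y, b y)" using h(1) by blast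
    have "a \<in> sec A (U \<inter> W)" "b \<in> sec B (U \<inter> W)" "opn (U \<inter> W)"
      using sections_restrict[OF *(2) inf_le1] sections_restrict[OF *(3) inf_le1] *(1) that(2) by auto
    then show ?thesis using *(4) by blast
  qed
  fix x u assume x: "x \<in> pts" and "u \<in> Car (dsum A B) x"
  then obtain a b where a: "a \<in> Car A x" "b \<in> Car B x" "u = pr (a, b)" by (auto simp: dsum_stalk)
  obtain U s where U: "opn U" "x \<in> U" "s \<in> sec A U" "s x = a" using sec_through[OF assms(1) x a(1)] .
  obtain V t where V: "opn V" "x \<in> V" "t \<in> sec B V" "t x = b" using sec_through[OF assms(2) x a(2)] .
  have "s \<in> sec A (U \<inter> V)" "t \<in> sec B (U \<inter> V)" "opn (U \<inter> V)"
    using sections_restrict[OF U(3)] sections_restrict[OF V(3)] U(1) V(1) by auto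
  then have "(U \<inter> V, \<lambda>y. pr (s y, t y)) \<in> ?F" by blast
  then show "\<exists>U s. (U, s) \<in> ?F \<and> x \<in> U \<and> s x = u"
    using a(3) U(2,4) V(2,4) by (intro exI[of _ "U \<inter> V"] exI[of _ "\<lambda>y. pr (s y, t y)"] conjI) simp_all
next
  fix U s V t x assume "(U, s) \<in> ?F" "(V, t) \<in> ?F" and x: "x \<in> U" "x \<in> V" "s x = t x"
  then obtain a b c d where U: "opn U" "a \<in> sec A U" "b \<in> sec B U" "\<forall>y\<in>U. s y = pr (a y, b y)"
    and V: "opn V" "c \<in> sec A V" "d \<in> sec B V" "\<forall>y\<in>V. t y = pr (c y, d y)"
    by blast
  have x': "a x = c x" "b x = d x" using x U(4) V(4) by auto
  obtain W1 where W1: "opn W1" "x \<in> W1" "\<And>y. y \<in> W1 \<Longrightarrow> a y = c y"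
    using sec_agree[OF assms(1) U(1,2) V(1,2) x(1,2) x'(1)] by metis
  obtain W2 where W2: "opn W2" "x \<in> W2" "\<And>y. y \<in> W2 \<Longrightarrow> b y = d y"
    using sec_agree[OF assms(2) U(1,3) V(1,3) x(1,2) x'(2)] by metis
  show "\<exists>W. opn W \<and> x \<in> W \<and> (\<forall>y\<in>W \<inter> U \<inter> V. s y = t y)"
    using W1 W2 U(4) V(4) by (intro exI[of _ "W1 \<inter> W2"]) auto
qed

lemma dsum_module_sheaf:
  assumes "module_sheaf X A" "module_sheaf X B"
  shows "module_sheaf X (dsum A B)"
proof -
  let ?F = "{(U, s). opn U \<and> (\<exists>a\<in>sec A U. \<exists>b\<in>sec B U. \<forall>y\<in>U. s y = pr (a y, b y))}"
  have "module_sheaf X \<lparr>stalk = stalk (dsum A B), etale = gen_etale ?F\<rparr>"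
  proof (rule module_sheafI[OF dsum_family[OF assms]])
    fix x assume x: "x \<in> pts"
    interpret A: module "ostalk X x" "stalk A x" by (rule msheaf_module[OF assms(1) x])
    interpret B: module "ostalk X x" "stalk B x" by (rule msheaf_module[OF assms(2) x])
    have "abelian_group (stalk (dsum A B) x)"
    proof (rule abelian_groupI; unfold dsum_stalk)
      fix u assume "u \<in> pr ` (Car A x \<times> Car B x)"
      then obtain a b where ab: "a \<in> Car A x" "b \<in> Car B x" "u = pr (a, b)" by auto
      show "\<exists>v\<in>pr ` (Car A x \<times> Car B x). pr (p1 v \<oplus>\<^bsub>stalk A x\<^esub> p1 u, p2 v \<oplus>\<^bsub>stalk B x\<^esub> p2 u) = pr (\<zero>\<^bsub>stalk A x\<^esub>, \<zero>\<^bsub>stalk B x\<^esub>)"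
        using ab by (intro bexI[of _ "pr (\<ominus>\<^bsub>stalk A x\<^esub> a, \<ominus>\<^bsub>stalk B x\<^esub> b)"]) (auto simp: A.M.l_neg B.M.l_neg)
    qed (auto simp: A.M.a_ac B.M.a_ac)
    then show "module (ostalk X x) (stalk (dsum A B) x)"
      by (rule moduleI[OF A.is_cring]; unfold dsum_stalk)
         (auto simp: A.smult_l_distr B.smult_l_distr A.smult_r_distr B.smult_r_distr A.smult_assoc1 B.smult_assoc1)
  next
    fix U s t assume "(U, s) \<in> ?F" "(U, t) \<in> ?F"
    then obtain a b c d where *: "opn U" "a \<in> sec A U" "b \<in> sec B U" "\<forall>y\<in>U. s y = pr (a y, b y)"
        "c \<in> sec A U" "d \<in> sec B U" "\<forall>y\<in>U. t y = pr (c y, d y)"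
      by auto
    then have "\<forall>y\<in>U. s y \<oplus>\<^bsub>stalk (dsum A B) y\<^esub> t y = pr (a y \<oplus>\<^bsub>stalk A y\<^esub> c y, b y \<oplus>\<^bsub>stalk B y\<^esub> d y)"
      by (simp add: dsum_stalk)
    then show "(U, \<lambda>y. s y \<oplus>\<^bsub>stalk (dsum A B) y\<^esub> t y) \<in> ?F"
      unfolding mem_Collect_eq case_prod_conv
      by (intro conjI *(1) bexI[of _ "\<lambda>y. a y \<oplus>\<^bsub>stalk A y\<^esub> c y"] bexI[of _ "\<lambda>y. b y \<oplus>\<^bsub>stalk B y\<^esub> d y"]
          sec_add[OF assms(1) *(2,5)] sec_add[OF assms(2) *(3,6)])
  next
    fix U r s assume r: "r \<in> osec U" and "(U, s) \<in> ?F"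
    then obtain a b where *: "opn U" "a \<in> sec A U" "b \<in> sec B U" "\<forall>y\<in>U. s y = pr (a y, b y)" by auto
    then have "\<forall>y\<in>U. r y \<odot>\<^bsub>stalk (dsum A B) y\<^esub> s y = pr (r y \<odot>\<^bsub>stalk A y\<^esub> a y, r y \<odot>\<^bsub>stalk B y\<^esub> b y)"
      by (simp add: dsum_stalk)
    then show "(U, \<lambda>y. r y \<odot>\<^bsub>stalk (dsum A B) y\<^esub> s y) \<in> ?F"
      unfolding mem_Collect_eq case_prod_conv
      by (intro conjI *(1) bexI[of _ "\<lambda>y. r y \<odot>\<^bsub>stalk A y\<^esub> a y"] bexI[of _ "\<lambda>y. r y \<odot>\<^bsub>stalk B y\<^esub> b y"]
          sec_smult[OF assms(1) r *(2)] sec_smult[OF assms(2) r *(3)])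
  qed
  then show ?thesis by (simp add: dsum_def)
qed

lemma dsum_sec:
  assumes "module_sheaf X A" "module_sheaf X B" "opn U" "a \<in> sec A U" "b \<in> sec B U"
  shows "(\<lambda>y. pr (a y, b y)) \<in> sec (dsum A B) U"
  using gen_etale_sections[OF dsum_family[OF assms(1,2)], of U "\<lambda>y. pr (a y, b y)"] assms(3-5) by (auto simp: dsum_def)

lemma pair_hom:
  assumes "module_sheaf X T" "module_sheaf X A" "module_sheaf X B" "f \<in> sheaf_hom X T A" "g \<in> sheaf_hom X T B"
  shows "(\<lambda>x\<in>pts. \<lambda>t\<in>Car T x. pr (f x t, g x t)) \<in> sheaf_hom X T (dsum A B)"
proof (rule homI[OF assms(1)])
  fix x t assume x: "x \<in> pts" "t \<in> Car T x"
  from sec_through[OF assms(1) x] dsum_sec[OF assms(2,3) _ hom_sec[OF assms(4)] hom_sec[OF assms(5)]]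
  show "\<exists>U s. opn U \<and> x \<in> U \<and> s \<in> sec T U \<and> s x = t \<and> (\<lambda>y. pr (f y (s y), g y (s y))) \<in> sec (dsum A B) U" by metis
qed (use assms(4,5) in \<open>simp_all add: dsum_stalk hom_mem hom_add[OF assms(4)] hom_add[OF assms(5)]
      hom_smult[OF assms(4)] hom_smult[OF assms(5)]\<close>)

lemma copair_hom:
  assumes "module_sheaf X T" "module_sheaf X A" "module_sheaf X B" "f \<in> sheaf_hom X A T" "g \<in> sheaf_hom X B T"
  shows "(\<lambda>x\<in>pts. \<lambda>u\<in>Car (dsum A B) x. f x (p1 u) \<oplus>\<^bsub>stalk T x\<^esub> g x (p2 u)) \<in> sheaf_hom X (dsum A B) T"
proof (rule homI[OF dsum_module_sheaf[OF assms(2,3)]]; unfold dsum_stalk)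
  fix x u assume x: "x \<in> pts" and "u \<in> pr ` (Car A x \<times> Car B x)"
  then obtain a b where u: "a \<in> Car A x" "b \<in> Car B x" "u = pr (a, b)" by auto
  interpret T: module "ostalk X x" "stalk T x" by (rule msheaf_module[OF assms(1) x])
  have m: "f x a \<in> Car T x" "g x b \<in> Car T x" using hom_mem[OF assms(4) x u(1)] hom_mem[OF assms(5) x u(2)] by simp_all
  show "f x (p1 u) \<oplus>\<^bsub>stalk T x\<^esub> g x (p2 u) \<in> Car T x" using m u by simp
  show "f x (p1 (pr (r \<odot>\<^bsub>stalk A x\<^esub> p1 u, r \<odot>\<^bsub>stalk B x\<^esub> p2 u))) \<oplus>\<^bsub>stalk T x\<^esub>
      g x (p2 (pr (r \<odot>\<^bsub>stalk A x\<^esub> p1 u, r \<odot>\<^bsub>stalk B x\<^esub> p2 u))) =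
      r \<odot>\<^bsub>stalk T x\<^esub> (f x (p1 u) \<oplus>\<^bsub>stalk T x\<^esub> g x (p2 u))" if "r \<in> carrier (ostalk X x)" for r
    using u m that by (simp add: hom_smult[OF assms(4) x] hom_smult[OF assms(5) x] T.smult_r_distr)
  show "f x (p1 (pr (p1 u \<oplus>\<^bsub>stalk A x\<^esub> p1 v, p2 u \<oplus>\<^bsub>stalk B x\<^esub> p2 v))) \<oplus>\<^bsub>stalk T x\<^esub>
      g x (p2 (pr (p1 u \<oplus>\<^bsub>stalk A x\<^esub> p1 v, p2 u \<oplus>\<^bsub>stalk B x\<^esub> p2 v))) =
      (f x (p1 u) \<oplus>\<^bsub>stalk T x\<^esub> g x (p2 u)) \<oplus>\<^bsub>stalk T x\<^esub> (f x (p1 v) \<oplus>\<^bsub>stalk T x\<^esub> g x (p2 v))"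
    if h: "v \<in> pr ` (Car A x \<times> Car B x)" for v
  proof -
    obtain c d where v: "c \<in> Car A x" "d \<in> Car B x" "v = pr (c, d)" using h by auto
    have m': "f x c \<in> Car T x" "g x d \<in> Car T x" using hom_mem[OF assms(4) x v(1)] hom_mem[OF assms(5) x v(2)] by simp_all
    show ?thesis using u v m m' by (simp add: hom_add[OF assms(4) x] hom_add[OF assms(5) x] T.M.a_ac)
  qed
  obtain U s where U: "opn U" "x \<in> U" "s \<in> sec A U" "s x = a" using sec_through[OF assms(2) x u(1)] .
  obtain V t where V: "opn V" "x \<in> V" "t \<in> sec B V" "t x = b" using sec_through[OF assms(3) x u(2)] .
  have st: "s \<in> sec A (U \<inter> V)" "t \<in> sec B (U \<inter> V)" "opn (U \<inter> V)"
    using sections_restrict[OF U(3)] sections_restrict[OF V(3)] U(1) V(1) by auto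
  have "(\<lambda>y. f y (s y) \<oplus>\<^bsub>stalk T y\<^esub> g y (t y)) \<in> sec T (U \<inter> V)"
    using sec_add[OF assms(1) hom_sec[OF assms(4) st(1)] hom_sec[OF assms(5) st(2)]] .
  then show "\<exists>U s. opn U \<and> x \<in> U \<and> s \<in> sec (dsum A B) U \<and> s x = u \<and>
      (\<lambda>y. f y (p1 (s y)) \<oplus>\<^bsub>stalk T y\<^esub> g y (p2 (s y))) \<in> sec T U"
    using dsum_sec[OF assms(2,3) st(3,1,2)] st(3) U V u(3)
    by (intro exI[of _ "U \<inter> V"] exI[of _ "\<lambda>y. pr (s y, t y)"]) simp
qed

end

section \<open>The category of coherent sheaves\<close>

lemma (in abelian_group) minus_add_minus:
  assumes "a \<in> carrier G" "b \<in> carrier G" "c \<in> carrier G" "d \<in> carrier G"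
  shows "(a \<ominus> b) \<oplus> (c \<ominus> d) = (a \<oplus> c) \<ominus> (b \<oplus> d)"
  using assms unfolding a_minus_def by (simp add: minus_add a_ac)

context ringed begin

lemma comp_apply: "x \<in> pts \<Longrightarrow> a \<in> Car A x \<Longrightarrow> sheaf_comp X A g f x a = g x (f x a)"
  by (simp add: sheaf_comp_def compose_def)

lemma comp_eq_iff:
  "sheaf_comp X A g f = sheaf_comp X A g' f' \<longleftrightarrow> (\<forall>x\<in>pts. \<forall>a\<in>Car A x. g x (f x a) = g' x (f' x a))"
proof
  assume e: "sheaf_comp X A g f = sheaf_comp X A g' f'"
  show "\<forall>x\<in>pts. \<forall>a\<in>Car A x. g x (f x a) = g' x (f' x a)"
  proof (intro ballI)
    fix x a assume *: "x \<in> pts" "a \<in> Car A x"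
    show "g x (f x a) = g' x (f' x a)" using fun_cong[OF fun_cong[OF e, of x], of a] by (simp add: comp_apply *)
  qed
next
  assume "\<forall>x\<in>pts. \<forall>a\<in>Car A x. g x (f x a) = g' x (f' x a)"
  then show "sheaf_comp X A g f = sheaf_comp X A g' f'"
    by (auto simp: sheaf_comp_def compose_def fun_eq_iff)
qed

lemma comp_eq_hom_iff:
  assumes "a \<in> sheaf_hom X A C"
  shows "sheaf_comp X A g f = a \<longleftrightarrow> (\<forall>x\<in>pts. \<forall>t\<in>Car A x. g x (f x t) = a x t)"
proof -
  have "a = sheaf_comp X A a (\<lambda>x t. t)"
    using assms unfolding sheaf_hom_def sheaf_comp_def compose_def
    by (auto simp: fun_eq_iff PiE_iff extensional_def)
  then show ?thesis using comp_eq_iff[of A g f a "\<lambda>x t. t"] by simp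
qed

lemma id_apply: "x \<in> pts \<Longrightarrow> a \<in> Car A x \<Longrightarrow> sheaf_id X A x a = a"
  by (simp add: sheaf_id_def)

lemma zero_hom_apply: "x \<in> pts \<Longrightarrow> a \<in> Car A x \<Longrightarrow> zero_hom X A B x a = \<zero>\<^bsub>stalk B x\<^esub>"
  by (simp add: zero_hom_def)

text \<open>The stalk maps of \<open>h\<close> are determined by those of \<open>p\<close> and \<open>p'\<close>, and a local section through a
  value of \<open>h\<close> then agrees with the image of a local section under \<open>h\<close>.\<close>

lemma joint_mono_factor:
  assumes mT: "module_sheaf X T" and mA: "module_sheaf X A" and mB: "module_sheaf X B" and mM: "module_sheaf X M"
    and p: "p \<in> sheaf_hom X M A" and q: "q \<in> sheaf_hom X M B"
    and a: "a \<in> sheaf_hom X T A" and b: "b \<in> sheaf_hom X T B"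
    and inj: "\<And>x u. x \<in> pts \<Longrightarrow> u \<in> Car M x \<Longrightarrow> p x u = \<zero>\<^bsub>stalk A x\<^esub> \<Longrightarrow> q x u = \<zero>\<^bsub>stalk B x\<^esub> \<Longrightarrow> u = \<zero>\<^bsub>stalk M x\<^esub>"
    and ex: "\<And>x t. x \<in> pts \<Longrightarrow> t \<in> Car T x \<Longrightarrow> \<exists>u\<in>Car M x. p x u = a x t \<and> q x u = b x t"
  shows "\<exists>!h. h \<in> sheaf_hom X T M \<and> sheaf_comp X T p h = a \<and> sheaf_comp X T q h = b"
proof -
  have uni: "u = v" if x: "x \<in> pts" and uv: "u \<in> Car M x" "v \<in> Car M x" "p x u = p x v" "q x u = q x v" for x u v
  proof -
    interpret p: sheaf_morphism X M A p x by unfold_locales (use mM mA p x in auto)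
    interpret q: sheaf_morphism X M B q x by unfold_locales (use mM mB q x in auto)
    have "p x (u \<ominus>\<^bsub>stalk M x\<^esub> v) = \<zero>\<^bsub>stalk A x\<^esub>" "q x (u \<ominus>\<^bsub>stalk M x\<^esub> v) = \<zero>\<^bsub>stalk B x\<^esub>"
      using uv p.diff q.diff p.mem q.mem p.B.M.minus_zero_iff q.B.M.minus_zero_iff by simp_all
    then have "u \<ominus>\<^bsub>stalk M x\<^esub> v = \<zero>\<^bsub>stalk M x\<^esub>" using inj[OF x] uv by simp
    then show ?thesis using uv p.A.M.minus_zero_iff by simp
  qed
  define h where "h x t = (SOME u. u \<in> Car M x \<and> p x u = a x t \<and> q x u = b x t)" for x t
  have h: "h x t \<in> Car M x" "p x (h x t) = a x t" "q x (h x t) = b x t" if "x \<in> pts" "t \<in> Car T x" for x t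
    using ex[OF that] someI_ex[of "\<lambda>u. u \<in> Car M x \<and> p x u = a x t \<and> q x u = b x t"] unfolding h_def by blast+
  let ?h = "\<lambda>x\<in>pts. \<lambda>t\<in>Car T x. h x t"
  have hom: "?h \<in> sheaf_hom X T M"
  proof (rule homI[OF mT h(1)])
    fix x t assume x: "x \<in> pts" and t: "t \<in> Car T x"
    interpret T: module "ostalk X x" "stalk T x" by (rule msheaf_module[OF mT x])
    interpret M: module "ostalk X x" "stalk M x" by (rule msheaf_module[OF mM x])
    show "h x (t \<oplus>\<^bsub>stalk T x\<^esub> s) = h x t \<oplus>\<^bsub>stalk M x\<^esub> h x s" if s: "s \<in> Car T x" for s
      by (rule uni[OF x]) (use t s h[OF x] in \<open>simp_all add: hom_add[OF p x] hom_add[OF q x] hom_add[OF a x] hom_add[OF b x]\<close>)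
    show "h x (r \<odot>\<^bsub>stalk T x\<^esub> t) = r \<odot>\<^bsub>stalk M x\<^esub> h x t" if r: "r \<in> carrier (ostalk X x)" for r
      by (rule uni[OF x])
        (use t r h[OF x] in \<open>simp_all add: hom_smult[OF p x] hom_smult[OF q x] hom_smult[OF a x] hom_smult[OF b x]\<close>)
    obtain U s where U: "opn U" "x \<in> U" "s \<in> sec T U" "s x = t" using sec_through[OF mT x t] .
    obtain V v where V: "opn V" "x \<in> V" "v \<in> sec M V" "v x = h x t" using sec_through[OF mM x h(1)[OF x t]] .
    have e: "p x (v x) = a x (s x)" "q x (v x) = b x (s x)" using U(4) V(4) h[OF x t] by simp_all
    obtain W1 where W1: "opn W1" "x \<in> W1" "W1 \<subseteq> V" "W1 \<subseteq> U" "\<And>y. y \<in> W1 \<Longrightarrow> p y (v y) = a y (s y)"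
      using sec_agree[OF mA V(1) hom_sec[OF p V(3)] U(1) hom_sec[OF a U(3)] V(2) U(2) e(1)] by metis
    obtain W2 where W2: "opn W2" "x \<in> W2" "\<And>y. y \<in> W2 \<Longrightarrow> q y (v y) = b y (s y)"
      using sec_agree[OF mB V(1) hom_sec[OF q V(3)] U(1) hom_sec[OF b U(3)] V(2) U(2) e(2)] by metis
    let ?W = "W1 \<inter> W2"
    have W: "opn ?W" "x \<in> ?W" using W1 W2 by auto
    have sW: "s \<in> sec T ?W" "v \<in> sec M ?W" using sections_restrict[OF U(3), of ?W] sections_restrict[OF V(3), of ?W] W1(3,4) by blast+
    have "v y = h y (s y)" if y: "y \<in> ?W" for y
    proof -
      have yp: "y \<in> pts" using opn_pts[OF W(1) y] .
      show ?thesis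
        by (rule uni[OF yp])
          (use h[OF yp sec_mem[OF mT W(1) sW(1) y]] sec_mem[OF mM W(1) sW(2) y] W1(5) W2(3) y in simp_all)
    qed
    then have "(\<lambda>y. h y (s y)) \<in> sec M ?W" by (rule sections_cong[OF W(1) sW(2)])
    then show "\<exists>U s. opn U \<and> x \<in> U \<and> s \<in> sec T U \<and> s x = t \<and> (\<lambda>y. h y (s y)) \<in> sec M U"
      using W sW U(4) by (intro exI[of _ ?W] exI[of _ s]) simp
  qed
  show ?thesis
  proof (rule ex1I[of _ ?h])
    show "?h \<in> sheaf_hom X T M \<and> sheaf_comp X T p ?h = a \<and> sheaf_comp X T q ?h = b"
      using hom h by (simp add: comp_eq_hom_iff[OF a] comp_eq_hom_iff[OF b])
    fix g assume g: "g \<in> sheaf_hom X T M \<and> sheaf_comp X T p g = a \<and> sheaf_comp X T q g = b"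
    show "g = ?h"
    proof (rule hom_ext[OF conjunct1[OF g] hom])
      fix x t assume x: "x \<in> pts" and t: "t \<in> Car T x"
      show "g x t = ?h x t"
        by (rule uni[OF x])
          (use g x t h[OF x t] hom_mem[OF conjunct1[OF g] x t] in
            \<open>simp_all add: comp_eq_hom_iff[OF a] comp_eq_hom_iff[OF b]\<close>)
    qed
  qed
qed

text \<open>Every germ of \<open>P\<close> has the form \<open>p u + q v\<close>, and
  \<open>h\<close> must send it to \<open>a u + b v\<close>; the second hypothesis is what makes
  this well defined. Continuity follows because sums \<open>p s + q t\<close> of sections pass
  through every germ.\<close>

lemma joint_epi_factor:
  assumes mT: "module_sheaf X T" and mA: "module_sheaf X A" and mB: "module_sheaf X B" and mP: "module_sheaf X P"
    and p: "p \<in> sheaf_hom X A P" and q: "q \<in> sheaf_hom X B P"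
    and a: "a \<in> sheaf_hom X A T" and b: "b \<in> sheaf_hom X B T"
    and surj: "\<And>x w. x \<in> pts \<Longrightarrow> w \<in> Car P x \<Longrightarrow> \<exists>u\<in>Car A x. \<exists>v\<in>Car B x. w = p x u \<oplus>\<^bsub>stalk P x\<^esub> q x v"
    and wd: "\<And>x u v. x \<in> pts \<Longrightarrow> u \<in> Car A x \<Longrightarrow> v \<in> Car B x \<Longrightarrow> p x u \<oplus>\<^bsub>stalk P x\<^esub> q x v = \<zero>\<^bsub>stalk P x\<^esub> \<Longrightarrow>
      a x u \<oplus>\<^bsub>stalk T x\<^esub> b x v = \<zero>\<^bsub>stalk T x\<^esub>"
  shows "\<exists>!h. h \<in> sheaf_hom X P T \<and> sheaf_comp X A h p = a \<and> sheaf_comp X B h q = b"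
proof -
  have uni: "a x u \<oplus>\<^bsub>stalk T x\<^esub> b x v = a x u' \<oplus>\<^bsub>stalk T x\<^esub> b x v'"
    if x: "x \<in> pts" and uv: "u \<in> Car A x" "v \<in> Car B x" "u' \<in> Car A x" "v' \<in> Car B x"
      and e: "p x u \<oplus>\<^bsub>stalk P x\<^esub> q x v = p x u' \<oplus>\<^bsub>stalk P x\<^esub> q x v'" for x u v u' v'
  proof -
    interpret p: sheaf_morphism X A P p x by unfold_locales (use mA mP p x in auto)
    interpret q: sheaf_morphism X B P q x by unfold_locales (use mB mP q x in auto)
    interpret a: sheaf_morphism X A T a x by unfold_locales (use mA mT a x in auto)
    interpret b: sheaf_morphism X B T b x by unfold_locales (use mB mT b x in auto)
    have "p x (u \<ominus>\<^bsub>stalk A x\<^esub> u') \<oplus>\<^bsub>stalk P x\<^esub> q x (v \<ominus>\<^bsub>stalk B x\<^esub> v') = \<zero>\<^bsub>stalk P x\<^esub>"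
      using uv e p.mem q.mem by (simp add: p.diff q.diff p.B.M.minus_add_minus p.B.M.minus_zero_iff)
    then have "a x (u \<ominus>\<^bsub>stalk A x\<^esub> u') \<oplus>\<^bsub>stalk T x\<^esub> b x (v \<ominus>\<^bsub>stalk B x\<^esub> v') = \<zero>\<^bsub>stalk T x\<^esub>"
      using wd[OF x] uv by simp
    then show ?thesis
      using uv a.mem b.mem by (simp add: a.diff b.diff a.B.M.minus_add_minus a.B.M.minus_zero_iff)
  qed
  \<comment> \<open>The value is taken from some decomposition of \<open>w\<close>; by
    \<open>uni\<close> all decompositions give the same one.\<close>
  define h where "h x w = (SOME t. \<exists>u\<in>Car A x. \<exists>v\<in>Car B x. w = p x u \<oplus>\<^bsub>stalk P x\<^esub> q x v \<and> t = a x u \<oplus>\<^bsub>stalk T x\<^esub> b x v)" for x w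
  have h: "h x (p x u \<oplus>\<^bsub>stalk P x\<^esub> q x v) = a x u \<oplus>\<^bsub>stalk T x\<^esub> b x v" if x: "x \<in> pts" "u \<in> Car A x" "v \<in> Car B x" for x u v
  proof -
    let ?w = "p x u \<oplus>\<^bsub>stalk P x\<^esub> q x v"
    have "\<exists>u\<in>Car A x. \<exists>v\<in>Car B x. ?w = p x u \<oplus>\<^bsub>stalk P x\<^esub> q x v \<and> h x ?w = a x u \<oplus>\<^bsub>stalk T x\<^esub> b x v"
      unfolding h_def by (rule someI[where x = "a x u \<oplus>\<^bsub>stalk T x\<^esub> b x v"]) (use x in blast)
    then obtain u' v' where "u' \<in> Car A x" "v' \<in> Car B x" "?w = p x u' \<oplus>\<^bsub>stalk P x\<^esub> q x v'"
        "h x ?w = a x u' \<oplus>\<^bsub>stalk T x\<^esub> b x v'"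
      by blast
    then show ?thesis using uni[OF x(1), of u v u' v'] x by simp
  qed
  let ?h = "\<lambda>x\<in>pts. \<lambda>w\<in>Car P x. h x w"
  have hom: "?h \<in> sheaf_hom X P T"
  proof (rule homI[OF mP])
    fix x w assume x: "x \<in> pts" and w: "w \<in> Car P x"
    interpret p: sheaf_morphism X A P p x by unfold_locales (use mA mP p x in auto)
    interpret q: sheaf_morphism X B P q x by unfold_locales (use mB mP q x in auto)
    interpret a: sheaf_morphism X A T a x by unfold_locales (use mA mT a x in auto)
    interpret b: sheaf_morphism X B T b x by unfold_locales (use mB mT b x in auto)
    obtain u v where uv: "u \<in> Car A x" "v \<in> Car B x" "w = p x u \<oplus>\<^bsub>stalk P x\<^esub> q x v" using surj[OF x w] by blast
    show "h x w \<in> Car T x" using uv h[OF x] a.mem b.mem by simp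
    show "h x (r \<odot>\<^bsub>stalk P x\<^esub> w) = r \<odot>\<^bsub>stalk T x\<^esub> h x w" if r: "r \<in> carrier (ostalk X x)" for r
    proof -
      have "r \<odot>\<^bsub>stalk P x\<^esub> w = p x (r \<odot>\<^bsub>stalk A x\<^esub> u) \<oplus>\<^bsub>stalk P x\<^esub> q x (r \<odot>\<^bsub>stalk B x\<^esub> v)"
        using uv r p.mem q.mem by (simp add: hom_smult[OF p x] hom_smult[OF q x] p.B.smult_r_distr)
      then show ?thesis
        using uv r h[OF x] a.mem b.mem by (simp add: hom_smult[OF a x] hom_smult[OF b x] a.B.smult_r_distr)
    qed
    show "h x (w \<oplus>\<^bsub>stalk P x\<^esub> w') = h x w \<oplus>\<^bsub>stalk T x\<^esub> h x w'" if w': "w' \<in> Car P x" for w'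
    proof -
      obtain u' v' where uv': "u' \<in> Car A x" "v' \<in> Car B x" "w' = p x u' \<oplus>\<^bsub>stalk P x\<^esub> q x v'" using surj[OF x w'] by blast
      have "w \<oplus>\<^bsub>stalk P x\<^esub> w' = p x (u \<oplus>\<^bsub>stalk A x\<^esub> u') \<oplus>\<^bsub>stalk P x\<^esub> q x (v \<oplus>\<^bsub>stalk B x\<^esub> v')"
        using uv uv' p.mem q.mem by (simp add: hom_add[OF p x] hom_add[OF q x] p.B.M.a_ac)
      then show ?thesis
        using uv uv' h[OF x] a.mem b.mem by (simp add: hom_add[OF a x] hom_add[OF b x] a.B.M.a_ac)
    qed
    obtain U s where U: "opn U" "x \<in> U" "s \<in> sec A U" "s x = u" using sec_through[OF mA x uv(1)] .
    obtain V t where V: "opn V" "x \<in> V" "t \<in> sec B V" "t x = v" using sec_through[OF mB x uv(2)] .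
    have st: "s \<in> sec A (U \<inter> V)" "t \<in> sec B (U \<inter> V)" "opn (U \<inter> V)"
      using sections_restrict[OF U(3)] sections_restrict[OF V(3)] U(1) V(1) by auto
    have "(\<lambda>y. h y (p y (s y) \<oplus>\<^bsub>stalk P y\<^esub> q y (t y))) \<in> sec T (U \<inter> V)"
      by (rule sections_cong[OF st(3) sec_add[OF mT hom_sec[OF a st(1)] hom_sec[OF b st(2)]]])
         (use h opn_pts[OF st(3)] sec_mem[OF mA st(3,1)] sec_mem[OF mB st(3,2)] in simp)
    then show "\<exists>U s. opn U \<and> x \<in> U \<and> s \<in> sec P U \<and> s x = w \<and> (\<lambda>y. h y (s y)) \<in> sec T U"
      using sec_add[OF mP hom_sec[OF p st(1)] hom_sec[OF q st(2)]] st(3) U V uv(3)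
      by (intro exI[of _ "U \<inter> V"] exI[of _ "\<lambda>y. p y (s y) \<oplus>\<^bsub>stalk P y\<^esub> q y (t y)"]) simp
  qed
  show ?thesis
  proof (rule ex1I[of _ ?h])
    have "h x (p x u) = a x u" if x: "x \<in> pts" and u: "u \<in> Car A x" for x u
    proof -
      interpret q: sheaf_morphism X B P q x by unfold_locales (use mB mP q x in auto)
      interpret b: sheaf_morphism X B T b x by unfold_locales (use mB mT b x in auto)
      show ?thesis using h[OF x u, of "\<zero>\<^bsub>stalk B x\<^esub>"] hom_mem[OF p x u] hom_mem[OF a x u] by (simp add: q.zero b.zero)
    qed
    moreover have "h x (q x v) = b x v" if x: "x \<in> pts" and v: "v \<in> Car B x" for x v
    proof -
      interpret p: sheaf_morphism X A P p x by unfold_locales (use mA mP p x in auto)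
      interpret a: sheaf_morphism X A T a x by unfold_locales (use mA mT a x in auto)
      show ?thesis using h[OF x _ v, of "\<zero>\<^bsub>stalk A x\<^esub>"] hom_mem[OF q x v] hom_mem[OF b x v] by (simp add: p.zero a.zero)
    qed
    ultimately show "?h \<in> sheaf_hom X P T \<and> sheaf_comp X A ?h p = a \<and> sheaf_comp X B ?h q = b"
      using hom by (simp add: comp_eq_hom_iff[OF a] comp_eq_hom_iff[OF b] hom_mem[OF p] hom_mem[OF q])
    fix g assume g: "g \<in> sheaf_hom X P T \<and> sheaf_comp X A g p = a \<and> sheaf_comp X B g q = b"
    show "g = ?h"
    proof (rule hom_ext[OF conjunct1[OF g] hom])
      fix x w assume x: "x \<in> pts" and w: "w \<in> Car P x"
      obtain u v where uv: "u \<in> Car A x" "v \<in> Car B x" "w = p x u \<oplus>\<^bsub>stalk P x\<^esub> q x v" using surj[OF x w] by blast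
      have "g x w = a x u \<oplus>\<^bsub>stalk T x\<^esub> b x v"
        using g uv x hom_add[OF conjunct1[OF g] x hom_mem[OF p x uv(1)] hom_mem[OF q x uv(2)]]
        by (simp add: comp_eq_hom_iff[OF a] comp_eq_hom_iff[OF b])
      then show "g x w = ?h x w" using h[OF x uv(1,2)] uv(3) x w by simp
    qed
  qed
qed

text \<open>Since \<open>m i' = i\<close>, the map \<open>m\<close> restricts to a bijection from
  the kernel of \<open>q'\<close> to the kernel of \<open>q\<close>. Hence \<open>m\<close> and
  \<open>q'\<close> are jointly injective, and a compatible pair is reached by lifting its second
  component to \<open>M\<close> and correcting the lift by an element of \<open>G\<close>.\<close>

lemma pullback_square_ladder:
  assumes S: "short_exact G i H q F" and S': "short_exact G i' M q' K" and coh: "coherent X M"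
    and m: "m \<in> sheaf_hom X M H" and k: "k \<in> sheaf_hom X K F"
    and c1: "\<And>x g. x \<in> pts \<Longrightarrow> g \<in> Car G x \<Longrightarrow> m x (i' x g) = i x g"
    and c2: "\<And>x u. x \<in> pts \<Longrightarrow> u \<in> Car M x \<Longrightarrow> q x (m x u) = k x (q' x u)"
  shows "pullback_square X H K F q k M m q'"
  unfolding pullback_square_def
proof (intro conjI allI impI coh m short_exactD(5)[OF S'])
  note E = short_exactD[OF S] and E' = short_exactD[OF S']
  show "sheaf_comp X M q m = sheaf_comp X M k q'" using c2 by (simp add: comp_eq_iff)
  fix T a b assume T: "coherent X T \<and> a \<in> sheaf_hom X T H \<and> b \<in> sheaf_hom X T K \<and> sheaf_comp X T q a = sheaf_comp X T k b"
  then have mT: "module_sheaf X T" and a: "a \<in> sheaf_hom X T H" and b: "b \<in> sheaf_hom X T K"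
    and e: "\<And>x t. x \<in> pts \<Longrightarrow> t \<in> Car T x \<Longrightarrow> q x (a x t) = k x (b x t)"
    by (auto simp: coherent_def comp_eq_iff)
  show "\<exists>!h. h \<in> sheaf_hom X T M \<and> sheaf_comp X T m h = a \<and> sheaf_comp X T q' h = b"
  proof (rule joint_mono_factor[OF mT E(2) E'(3,2) m E'(5) a b])
    fix x u assume x: "x \<in> pts" and u: "u \<in> Car M x" "m x u = \<zero>\<^bsub>stalk H x\<^esub>" "q' x u = \<zero>\<^bsub>stalk K x\<^esub>"
    interpret i: sheaf_morphism X G H i x by unfold_locales (use E x in auto)
    interpret i': sheaf_morphism X G M i' x by unfold_locales (use E' x in auto)
    obtain g where g: "g \<in> Car G x" "u = i' x g" using E'(7)[OF x u(1,3)] by blast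
    have "i x g = i x \<zero>\<^bsub>stalk G x\<^esub>" using c1[OF x g(1)] g u(2) i.zero by simp
    then have "g = \<zero>\<^bsub>stalk G x\<^esub>" using inj_onD[OF E(6)[OF x]] g(1) by simp
    then show "u = \<zero>\<^bsub>stalk M x\<^esub>" using g(2) i'.zero by simp
  next
    fix x t assume x: "x \<in> pts" and t: "t \<in> Car T x"
    interpret q: sheaf_morphism X H F q x by unfold_locales (use E x in auto)
    interpret m: sheaf_morphism X M H m x by unfold_locales (use E E' m x in auto)
    interpret q': sheaf_morphism X M K q' x by unfold_locales (use E' x in auto)
    obtain u0 where u0: "u0 \<in> Car M x" "q' x u0 = b x t" using E'(9)[OF x] hom_mem[OF b x t] by (metis imageE subsetD)
    have at: "a x t \<in> Car H x" using hom_mem[OF a x t] .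
    have "q x (a x t \<ominus>\<^bsub>stalk H x\<^esub> m x u0) = \<zero>\<^bsub>stalk F x\<^esub>"
      using q.B.M.minus_zero_iff[OF q.mem[OF at] q.mem[OF m.mem[OF u0(1)]]] e[OF x t] c2[OF x u0(1)] u0 at m.mem
      by (simp add: q.diff)
    then obtain g where g: "g \<in> Car G x" "a x t \<ominus>\<^bsub>stalk H x\<^esub> m x u0 = i x g"
      using E(7)[OF x, of "a x t \<ominus>\<^bsub>stalk H x\<^esub> m x u0"] at m.mem[OF u0(1)] by auto
    have ig: "i' x g \<in> Car M x" using hom_mem[OF E'(4) x g(1)] .
    have "m x (u0 \<oplus>\<^bsub>stalk M x\<^esub> i' x g) = m x u0 \<oplus>\<^bsub>stalk H x\<^esub> (a x t \<ominus>\<^bsub>stalk H x\<^esub> m x u0)"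
      using u0 ig g c1[OF x g(1)] by (simp add: hom_add[OF m x])
    also have "\<dots> = a x t" using at m.mem[OF u0(1)] unfolding a_minus_def
      by (simp add: q.A.M.a_lcomm q.A.M.r_neg)
    finally have "m x (u0 \<oplus>\<^bsub>stalk M x\<^esub> i' x g) = a x t" .
    moreover have "q' x (u0 \<oplus>\<^bsub>stalk M x\<^esub> i' x g) = b x t"
      using u0 ig E'(8)[OF x g(1)] q'.mem[OF u0(1)] by (simp add: hom_add[OF E'(5) x])
    ultimately show "\<exists>u\<in>Car M x. m x u = a x t \<and> q' x u = b x t"
      using u0 ig by (intro bexI[of _ "u0 \<oplus>\<^bsub>stalk M x\<^esub> i' x g"]) simp_all
  qed
qed

text \<open>Every germ of \<open>H'\<close> has the form \<open>m u + i' v\<close> because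
  \<open>q' m = q\<close> is onto. If such a sum vanishes, then \<open>q u = 0\<close>, so
  \<open>u = i g\<close> for some \<open>g\<close> with \<open>\<alpha> g + v = 0\<close>, which
  gives compatibility.\<close>

lemma pushout_square_ladder:
  assumes S: "short_exact G i H q F" and S': "short_exact G' i' H' q' F" and coh: "coherent X H'"
    and m: "m \<in> sheaf_hom X H H'" and al: "\<alpha> \<in> sheaf_hom X G G'"
    and c1: "\<And>x g. x \<in> pts \<Longrightarrow> g \<in> Car G x \<Longrightarrow> m x (i x g) = i' x (\<alpha> x g)"
    and c2: "\<And>x u. x \<in> pts \<Longrightarrow> u \<in> Car H x \<Longrightarrow> q' x (m x u) = q x u"
  shows "pushout_square X G H G' i \<alpha> H' m i'"
  unfolding pushout_square_def
proof (intro conjI allI impI coh m short_exactD(4)[OF S'])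
  note E = short_exactD[OF S] and E' = short_exactD[OF S']
  show "sheaf_comp X G m i = sheaf_comp X G i' \<alpha>" using c1 by (simp add: comp_eq_iff)
  fix T a b assume T: "coherent X T \<and> a \<in> sheaf_hom X H T \<and> b \<in> sheaf_hom X G' T \<and> sheaf_comp X G a i = sheaf_comp X G b \<alpha>"
  then have mT: "module_sheaf X T" and a: "a \<in> sheaf_hom X H T" and b: "b \<in> sheaf_hom X G' T"
    and e: "\<And>x t. x \<in> pts \<Longrightarrow> t \<in> Car G x \<Longrightarrow> a x (i x t) = b x (\<alpha> x t)"
    by (auto simp: coherent_def comp_eq_iff)
  show "\<exists>!h. h \<in> sheaf_hom X H' T \<and> sheaf_comp X H h m = a \<and> sheaf_comp X G' h i' = b"
  proof (rule joint_epi_factor[OF mT E(2) E'(1,2) m E'(4) a b])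
    fix x w assume x: "x \<in> pts" and w: "w \<in> Car H' x"
    interpret q': sheaf_morphism X H' F q' x by unfold_locales (use E' x in auto)
    obtain u where u: "u \<in> Car H x" "q x u = q' x w" using E(9)[OF x] q'.mem[OF w] by (metis imageE subsetD)
    have mu: "m x u \<in> Car H' x" using hom_mem[OF m x u(1)] .
    have "q' x (w \<ominus>\<^bsub>stalk H' x\<^esub> m x u) = \<zero>\<^bsub>stalk F x\<^esub>"
      using w mu u c2[OF x u(1)] q'.mem by (simp add: q'.diff q'.B.M.minus_zero_iff)
    then obtain v where v: "v \<in> Car G' x" "w \<ominus>\<^bsub>stalk H' x\<^esub> m x u = i' x v"
      using E'(7)[OF x, of "w \<ominus>\<^bsub>stalk H' x\<^esub> m x u"] w mu by auto
    have "w = m x u \<oplus>\<^bsub>stalk H' x\<^esub> i' x v"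
      unfolding v(2)[symmetric] a_minus_def using w mu by (simp add: q'.A.M.a_lcomm q'.A.M.r_neg)
    then show "\<exists>u\<in>Car H x. \<exists>v\<in>Car G' x. w = m x u \<oplus>\<^bsub>stalk H' x\<^esub> i' x v" using u(1) v(1) by blast
  next
    fix x u v assume x: "x \<in> pts" and uv: "u \<in> Car H x" "v \<in> Car G' x" and z: "m x u \<oplus>\<^bsub>stalk H' x\<^esub> i' x v = \<zero>\<^bsub>stalk H' x\<^esub>"
    interpret q': sheaf_morphism X H' F q' x by unfold_locales (use E' x in auto)
    interpret i': sheaf_morphism X G' H' i' x by unfold_locales (use E' x in auto)
    interpret al: sheaf_morphism X G G' \<alpha> x by unfold_locales (use E E' al x in auto)
    interpret b: sheaf_morphism X G' T b x by unfold_locales (use E' mT b x in auto)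
    have mu: "m x u \<in> Car H' x" using hom_mem[OF m x uv(1)] .
    have "q' x (m x u \<oplus>\<^bsub>stalk H' x\<^esub> i' x v) = q' x (m x u)"
      using E'(8)[OF x uv(2)] mu i'.mem[OF uv(2)] q'.mem by (simp add: hom_add[OF E'(5) x])
    then have "q x u = \<zero>\<^bsub>stalk F x\<^esub>" using z c2[OF x uv(1)] q'.zero by simp
    then obtain g where g: "g \<in> Car G x" "u = i x g" using E(7)[OF x uv(1)] by blast
    have "i' x (\<alpha> x g \<oplus>\<^bsub>stalk G' x\<^esub> v) = i' x \<zero>\<^bsub>stalk G' x\<^esub>"
      using z c1[OF x g(1)] g al.mem uv(2) i'.zero by (simp add: hom_add[OF E'(4) x])
    then have "\<alpha> x g \<oplus>\<^bsub>stalk G' x\<^esub> v = \<zero>\<^bsub>stalk G' x\<^esub>" using inj_onD[OF E'(6)[OF x]] al.mem g(1) uv(2) by simp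
    then have "b x (\<alpha> x g) \<oplus>\<^bsub>stalk T x\<^esub> b x v = \<zero>\<^bsub>stalk T x\<^esub>"
      using hom_add[OF b x al.mem[OF g(1)] uv(2)] b.zero by simp
    then show "a x u \<oplus>\<^bsub>stalk T x\<^esub> b x v = \<zero>\<^bsub>stalk T x\<^esub>" using e[OF x g(1)] g(2) by simp
  qed
qed

text \<open>This is the short five lemma, obtained from the pullback along the identity of
  \<open>F\<close>: existence in the universal property gives a right inverse, and uniqueness makes
  it two-sided.\<close>

lemma ladder_sheaf_iso:
  assumes S: "short_exact G i H q F" and S': "short_exact G i' M q' F" and coh: "coherent X M" "coherent X H"
    and m: "m \<in> sheaf_hom X M H"
    and c1: "\<And>x g. x \<in> pts \<Longrightarrow> g \<in> Car G x \<Longrightarrow> m x (i' x g) = i x g"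
    and c2: "\<And>x u. x \<in> pts \<Longrightarrow> u \<in> Car M x \<Longrightarrow> q x (m x u) = q' x u"
  shows "sheaf_iso X M H m"
proof -
  note E = short_exactD[OF S] and E' = short_exactD[OF S']
  have id: "sheaf_id X F \<in> sheaf_hom X F F" by (rule id_hom[OF E(3)])
  have id_q: "sheaf_id X F x (q x u) = q x u" if "x \<in> pts" "u \<in> Car H x" for x u
    using that hom_mem[OF E(5)] by (simp add: id_apply)
  have id_q': "sheaf_id X F x (q' x u) = q' x u" if "x \<in> pts" "u \<in> Car M x" for x u
    using that hom_mem[OF E'(5)] by (simp add: id_apply)
  have pb: "pullback_square X H F F q (sheaf_id X F) M m q'"
    by (rule pullback_square_ladder[OF S S' coh(1) m id c1]) (simp_all add: c2 id_q')
  have "sheaf_comp X H q (sheaf_id X H) = sheaf_comp X H (sheaf_id X F) q"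
    by (simp add: comp_eq_iff id_apply id_q)
  then obtain h where h: "h \<in> sheaf_hom X H M" "sheaf_comp X H m h = sheaf_id X H" "sheaf_comp X H q' h = q"
    using pb coh(2) id_hom[OF E(2)] E(5) unfolding pullback_square_def by blast
  have mh: "m x (h x u) = u" "q' x (h x u) = q x u" if "x \<in> pts" "u \<in> Car H x" for x u
    using h(2,3) that by (simp_all add: comp_eq_hom_iff[OF id_hom[OF E(2)]] comp_eq_hom_iff[OF E(5)] id_apply)
  let ?P = "\<lambda>g. g \<in> sheaf_hom X M M \<and> sheaf_comp X M m g = m \<and> sheaf_comp X M q' g = q'"
  have "sheaf_comp X M q m = sheaf_comp X M (sheaf_id X F) q'"
    by (simp add: comp_eq_iff id_q' c2)
  then have "\<exists>!g. ?P g" using pb coh(1) m E'(5) unfolding pullback_square_def by blast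
  moreover have "?P (sheaf_id X M)"
    using id_hom[OF E'(2)] by (simp add: comp_eq_hom_iff[OF m] comp_eq_hom_iff[OF E'(5)] id_apply)
  moreover have "?P (sheaf_comp X M h m)"
    using comp_hom[OF E'(2) m h(1)] mh hom_mem[OF m] c2
    by (simp add: comp_eq_hom_iff[OF m] comp_eq_hom_iff[OF E'(5)] comp_apply)
  ultimately have "sheaf_comp X M h m = sheaf_id X M" by blast
  then show ?thesis unfolding sheaf_iso_def using m h by blast
qed

end

context ringed begin

lemma short_exactI:
  assumes "module_sheaf X A" "module_sheaf X B" "module_sheaf X C" "i \<in> sheaf_hom X A B" "q \<in> sheaf_hom X B C"
    and "\<And>x a. x \<in> pts \<Longrightarrow> a \<in> Car A x \<Longrightarrow> i x a = \<zero>\<^bsub>stalk B x\<^esub> \<Longrightarrow> a = \<zero>\<^bsub>stalk A x\<^esub>"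
    and "\<And>x a. x \<in> pts \<Longrightarrow> a \<in> Car A x \<Longrightarrow> q x (i x a) = \<zero>\<^bsub>stalk C x\<^esub>"
    and "\<And>x b. x \<in> pts \<Longrightarrow> b \<in> Car B x \<Longrightarrow> q x b = \<zero>\<^bsub>stalk C x\<^esub> \<Longrightarrow> \<exists>a\<in>Car A x. b = i x a"
    and "\<And>x c. x \<in> pts \<Longrightarrow> c \<in> Car C x \<Longrightarrow> \<exists>b\<in>Car B x. c = q x b"
  shows "short_exact A i B q C"
  unfolding short_exact_def
proof (intro conjI ballI assms(1-5))
  fix x assume x: "x \<in> pts"
  interpret i: sheaf_morphism X A B i x by unfold_locales (use assms x in auto)
  interpret q: sheaf_morphism X B C q x by unfold_locales (use assms x in auto)
  show "inj_on (i x) (Car A x)" using i.injI assms(6)[OF x] by blast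
  show "i x ` Car A x = sheaf_ker B C q x" unfolding sheaf_ker_def using assms(7,8)[OF x] i.mem by blast
  show "q x ` Car B x = Car C x" using assms(9)[OF x] q.mem by blast
qed

end

section \<open>Pullbacks, pushouts and gluings inside direct sums\<close>

context ringed_coded begin

definition inl :: "('x, 'r, 'u) osheaf \<Rightarrow> ('x, 'r, 'u) osheaf \<Rightarrow> ('x, 'u) smap" where
  "inl A B = (\<lambda>x\<in>pts. \<lambda>a\<in>Car A x. pr (a, \<zero>\<^bsub>stalk B x\<^esub>))"

definition inr :: "('x, 'r, 'u) osheaf \<Rightarrow> ('x, 'r, 'u) osheaf \<Rightarrow> ('x, 'u) smap" where
  "inr A B = (\<lambda>x\<in>pts. \<lambda>b\<in>Car B x. pr (\<zero>\<^bsub>stalk A x\<^esub>, b))"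

definition prl :: "('x, 'r, 'u) osheaf \<Rightarrow> ('x, 'r, 'u) osheaf \<Rightarrow> ('x, 'u) smap" where
  "prl A B = (\<lambda>x\<in>pts. \<lambda>u\<in>Car (dsum A B) x. p1 u)"

definition prR :: "('x, 'r, 'u) osheaf \<Rightarrow> ('x, 'r, 'u) osheaf \<Rightarrow> ('x, 'u) smap" where
  "prR A B = (\<lambda>x\<in>pts. \<lambda>u\<in>Car (dsum A B) x. p2 u)"

definition pair :: "('x, 'r, 'u) osheaf \<Rightarrow> ('x, 'u) smap \<Rightarrow> ('x, 'u) smap \<Rightarrow> ('x, 'u) smap" where
  "pair T f g = (\<lambda>x\<in>pts. \<lambda>t\<in>Car T x. pr (f x t, g x t))"

definition copair :: "('x, 'r, 'u) osheaf \<Rightarrow> ('x, 'r, 'u) osheaf \<Rightarrow> ('x, 'r, 'u) osheaf \<Rightarrow> ('x, 'u) smap \<Rightarrow> ('x, 'u) smap \<Rightarrow> ('x, 'u) smap" where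
  "copair A B T f g = (\<lambda>x\<in>pts. \<lambda>u\<in>Car (dsum A B) x. f x (p1 u) \<oplus>\<^bsub>stalk T x\<^esub> g x (p2 u))"

definition neg :: "('x, 'r, 'u) osheaf \<Rightarrow> ('x, 'r, 'u) osheaf \<Rightarrow> ('x, 'u) smap \<Rightarrow> ('x, 'u) smap" where
  "neg A B f = (\<lambda>x\<in>pts. \<lambda>a\<in>Car A x. \<ominus>\<^bsub>stalk B x\<^esub> f x a)"

lemma dsum_mem [simp]: "pr (a, b) \<in> Car (dsum A B) x \<longleftrightarrow> a \<in> Car A x \<and> b \<in> Car B x"
  by (auto simp: dsum_stalk)

lemma dsum_memE:
  assumes "u \<in> Car (dsum A B) x"
  obtains a b where "a \<in> Car A x" "b \<in> Car B x" "u = pr (a, b)"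
  using assms by (auto simp: dsum_stalk)

lemma dsum_apply:
  assumes "x \<in> pts"
  shows "a \<in> Car A x \<Longrightarrow> inl A B x a = pr (a, \<zero>\<^bsub>stalk B x\<^esub>)" "b \<in> Car B x \<Longrightarrow> inr A B x b = pr (\<zero>\<^bsub>stalk A x\<^esub>, b)"
    "a \<in> Car A x \<Longrightarrow> b \<in> Car B x \<Longrightarrow> prl A B x (pr (a, b)) = a" "a \<in> Car A x \<Longrightarrow> b \<in> Car B x \<Longrightarrow> prR A B x (pr (a, b)) = b"
    "t \<in> Car T x \<Longrightarrow> pair T f g x t = pr (f x t, g x t)"
    "a \<in> Car A x \<Longrightarrow> b \<in> Car B x \<Longrightarrow> copair A B T f g x (pr (a, b)) = f x a \<oplus>\<^bsub>stalk T x\<^esub> g x b"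
    "a \<in> Car A x \<Longrightarrow> neg A T f x a = \<ominus>\<^bsub>stalk T x\<^esub> f x a"
  using assms by (simp_all add: inl_def inr_def prl_def prR_def pair_def copair_def neg_def)

context
  fixes A B :: "('x, 'r, 'u) osheaf"
  assumes mA: "module_sheaf X A" and mB: "module_sheaf X B"
begin

lemma prl_hom: "prl A B \<in> sheaf_hom X (dsum A B) A"
  unfolding prl_def
proof (rule homI[OF dsum_module_sheaf[OF mA mB]])
  fix x u assume x: "x \<in> pts" and u: "u \<in> Car (dsum A B) x"
  then obtain a b where ab: "a \<in> Car A x" "b \<in> Car B x" "u = pr (a, b)" by (rule_tac dsum_memE)
  obtain U s where U: "opn U" "x \<in> U" "s \<in> sec A U" "s x = a" using sec_through[OF mA x ab(1)] .
  obtain V t where V: "opn V" "x \<in> V" "t \<in> sec B V" "t x = b" using sec_through[OF mB x ab(2)] .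
  have st: "s \<in> sec A (U \<inter> V)" "t \<in> sec B (U \<inter> V)" "opn (U \<inter> V)"
    using sections_restrict[OF U(3)] sections_restrict[OF V(3)] U(1) V(1) by auto
  show "\<exists>U s. opn U \<and> x \<in> U \<and> s \<in> sec (dsum A B) U \<and> s x = u \<and> (\<lambda>y. p1 (s y)) \<in> sec A U"
    using dsum_sec[OF mA mB st(3,1,2)] st U V ab(3)
    by (intro exI[of _ "U \<inter> V"] exI[of _ "\<lambda>y. pr (s y, t y)"]) simp
qed (auto simp: dsum_stalk)

lemma prR_hom: "prR A B \<in> sheaf_hom X (dsum A B) B"
  unfolding prR_def
proof (rule homI[OF dsum_module_sheaf[OF mA mB]])
  fix x u assume x: "x \<in> pts" and u: "u \<in> Car (dsum A B) x"
  then obtain a b where ab: "a \<in> Car A x" "b \<in> Car B x" "u = pr (a, b)" by (rule_tac dsum_memE)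
  obtain U s where U: "opn U" "x \<in> U" "s \<in> sec A U" "s x = a" using sec_through[OF mA x ab(1)] .
  obtain V t where V: "opn V" "x \<in> V" "t \<in> sec B V" "t x = b" using sec_through[OF mB x ab(2)] .
  have st: "s \<in> sec A (U \<inter> V)" "t \<in> sec B (U \<inter> V)" "opn (U \<inter> V)"
    using sections_restrict[OF U(3)] sections_restrict[OF V(3)] U(1) V(1) by auto
  show "\<exists>U s. opn U \<and> x \<in> U \<and> s \<in> sec (dsum A B) U \<and> s x = u \<and> (\<lambda>y. p2 (s y)) \<in> sec B U"
    using dsum_sec[OF mA mB st(3,1,2)] st U V ab(3)
    by (intro exI[of _ "U \<inter> V"] exI[of _ "\<lambda>y. pr (s y, t y)"]) simp
qed (auto simp: dsum_stalk)

lemma pair_hom': "module_sheaf X T \<Longrightarrow> f \<in> sheaf_hom X T A \<Longrightarrow> g \<in> sheaf_hom X T B \<Longrightarrow> pair T f g \<in> sheaf_hom X T (dsum A B)"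
  unfolding pair_def using pair_hom mA mB by blast

lemma copair_hom': "module_sheaf X T \<Longrightarrow> f \<in> sheaf_hom X A T \<Longrightarrow> g \<in> sheaf_hom X B T \<Longrightarrow> copair A B T f g \<in> sheaf_hom X (dsum A B) T"
  unfolding copair_def using copair_hom mA mB by blast

lemma neg_hom': "f \<in> sheaf_hom X A B \<Longrightarrow> neg A B f \<in> sheaf_hom X A B"
  unfolding neg_def using neg_hom mA mB by blast

lemma inl_hom: "inl A B \<in> sheaf_hom X A (dsum A B)"
proof -
  have "inl A B = pair A (sheaf_id X A) (zero_hom X A B)"
    by (auto simp: inl_def pair_def fun_eq_iff id_apply zero_hom_apply)
  then show ?thesis using pair_hom'[OF mA id_hom[OF mA] zero_hom_hom[OF mA mB]] by simp
qed

lemma inr_hom: "inr A B \<in> sheaf_hom X B (dsum A B)"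
proof -
  have "inr A B = pair B (zero_hom X B A) (sheaf_id X B)"
    by (auto simp: inr_def pair_def fun_eq_iff id_apply zero_hom_apply)
  then show ?thesis using pair_hom'[OF mB zero_hom_hom[OF mB mA] id_hom[OF mB]] by simp
qed

end

text \<open>\<open>M\<close> is the kernel of \<open>q - k\<close> on the direct sum of
  \<open>H\<close> and \<open>K\<close>. Its coherence follows from its being an extension of
  \<open>K\<close> by \<open>G\<close>.\<close>

lemma pullback_exists:
  fixes H :: "('x, 'r, 'u) osheaf"
  assumes S: "short_exact G i H q F" and cG: "coherent X G" and cK: "coherent X K" and k: "k \<in> sheaf_hom X K F"
  obtains i' M q' m where "coherent X M" "short_exact G i' M q' K" "m \<in> sheaf_hom X M H"
    "\<And>x g. x \<in> pts \<Longrightarrow> g \<in> Car G x \<Longrightarrow> m x (i' x g) = i x g"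
    "\<And>x u. x \<in> pts \<Longrightarrow> u \<in> Car M x \<Longrightarrow> q x (m x u) = k x (q' x u)"
proof -
  note E = short_exactD[OF S]
  have mK: "module_sheaf X K" using cK by (simp add: coherent_def)
  let ?D = "dsum H K"
  define d where "d = copair H K F q (neg K F k)"
  have mD: "module_sheaf X ?D" by (rule dsum_module_sheaf[OF E(2) mK])
  have d: "d \<in> sheaf_hom X ?D F" unfolding d_def by (rule copair_hom'[OF E(2) mK E(3,5) neg_hom'[OF mK E(3) k]])
  define S where "S x = {u \<in> Car ?D x. d x u = \<zero>\<^bsub>stalk F x\<^esub>}" for x
  have Sf: "submodule_family ?D S" unfolding S_def by (rule kernel_family[OF mD E(3) d])
  have S_iff: "pr (h, w) \<in> S x \<longleftrightarrow> h \<in> Car H x \<and> w \<in> Car K x \<and> q x h = k x w" if x: "x \<in> pts" for x h w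
  proof -
    interpret F: module "ostalk X x" "stalk F x" by (rule msheaf_module[OF E(3) x])
    show ?thesis
      using x hom_mem[OF E(5) x] hom_mem[OF k x] F.M.minus_zero_iff[of "q x h" "k x w"]
      by (auto simp: S_def d_def dsum_apply a_minus_def)
  qed
  have S_E: "\<exists>h w. u = pr (h, w) \<and> h \<in> Car H x \<and> w \<in> Car K x \<and> q x h = k x w" if "x \<in> pts" "u \<in> S x" for x u
  proof -
    have "u \<in> Car ?D x" using that by (simp add: S_def)
    then obtain h w where "u = pr (h, w)" by (rule dsum_memE)
    then show ?thesis using S_iff that by blast
  qed
  define M where "M = subsh ?D S"
  have CM: "Car M x = S x" for x by (simp add: M_def subsh_stalk)
  have mM: "module_sheaf X M" unfolding M_def by (rule subsh_module_sheaf[OF mD Sf])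
  have inc: "(\<lambda>x\<in>pts. \<lambda>a\<in>S x. a) \<in> sheaf_hom X M ?D" (is "?inc \<in> _") unfolding M_def by (rule subsh_incl[OF mD Sf])
  define m where "m = sheaf_comp X M (prl H K) ?inc"
  define q' where "q' = sheaf_comp X M (prR H K) ?inc"
  define i' where "i' = pair G i (zero_hom X G K)"
  have m: "m \<in> sheaf_hom X M H" unfolding m_def by (rule comp_hom[OF mM inc prl_hom[OF E(2) mK]])
  have q': "q' \<in> sheaf_hom X M K" unfolding q'_def by (rule comp_hom[OF mM inc prR_hom[OF E(2) mK]])
  have mq: "m x (pr (h, w)) = h" "q' x (pr (h, w)) = w" if "x \<in> pts" "pr (h, w) \<in> S x" for x h w
    using that S_iff[OF that(1)] by (simp_all add: m_def q'_def comp_apply CM dsum_apply)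
  have i'_apply: "i' x g = pr (i x g, \<zero>\<^bsub>stalk K x\<^esub>)" if "x \<in> pts" "g \<in> Car G x" for x g
    using that by (simp add: i'_def dsum_apply zero_hom_apply)
  have i'S: "i' x g \<in> S x" if x: "x \<in> pts" and g: "g \<in> Car G x" for x g
  proof -
    interpret k: sheaf_morphism X K F k x by unfold_locales (use mK E k x in auto)
    show ?thesis using g x by (simp add: i'_apply S_iff hom_mem[OF E(4)] E(8) k.zero)
  qed
  have i': "i' \<in> sheaf_hom X G M"
    unfolding M_def by (rule subsh_corestrict[OF mD Sf E(1) _ i'S])
      (simp_all add: i'_def pair_hom'[OF E(2) mK E(1,4) zero_hom_hom[OF E(1) mK]])
  have ex: "short_exact G i' M q' K"
  proof (rule short_exactI[OF E(1) mM mK i' q'])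
    fix x assume x: "x \<in> pts"
    interpret i: sheaf_morphism X G H i x by unfold_locales (use E x in auto)
    interpret q: sheaf_morphism X H F q x by unfold_locales (use E x in auto)
    interpret k: sheaf_morphism X K F k x by unfold_locales (use mK E k x in auto)
    show "g = \<zero>\<^bsub>stalk G x\<^esub>" if g: "g \<in> Car G x" "i' x g = \<zero>\<^bsub>stalk M x\<^esub>" for g
    proof -
      have "i x g = \<zero>\<^bsub>stalk H x\<^esub>" using g x by (simp add: i'_apply M_def subsh_stalk dsum_stalk)
      then show ?thesis using inj_onD[OF E(6)[OF x], of g "\<zero>\<^bsub>stalk G x\<^esub>"] g i.zero by simp
    qed
    show "q' x (i' x g) = \<zero>\<^bsub>stalk K x\<^esub>" if "g \<in> Car G x" for g
      using i'S[OF x that] mq[OF x] by (simp add: i'_apply[OF x that])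
    show "\<exists>g\<in>Car G x. u = i' x g" if u: "u \<in> Car M x" "q' x u = \<zero>\<^bsub>stalk K x\<^esub>" for u
    proof -
      obtain h w where hw: "u = pr (h, w)" "h \<in> Car H x" "w \<in> Car K x" "q x h = k x w"
        using S_E[OF x, of u] u(1) CM by blast
      have "w = \<zero>\<^bsub>stalk K x\<^esub>" using u mq[OF x, of h w] hw CM by simp
      then have "q x h = \<zero>\<^bsub>stalk F x\<^esub>" using hw k.zero by simp
      then obtain g where "g \<in> Car G x" "h = i x g" using E(7)[OF x hw(2)] by blast
      then show ?thesis using hw(1) \<open>w = _\<close> i'_apply[OF x] by auto
    qed
    show "\<exists>u\<in>Car M x. w = q' x u" if w: "w \<in> Car K x" for w
    proof -
      obtain h where h: "h \<in> Car H x" "q x h = k x w" using E(9)[OF x] k.mem[OF w] by (metis imageE subsetD)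
      then have "pr (h, w) \<in> S x" using S_iff[OF x] w by simp
      then show ?thesis using mq[OF x] CM by (intro bexI[of _ "pr (h, w)"]) auto
    qed
  qed
  have "coherent X M" by (rule coherent_extension[OF ex cG cK])
  moreover have "m x (i' x g) = i x g" if "x \<in> pts" "g \<in> Car G x" for x g
    using i'S[OF that] mq[OF that(1)] by (simp add: i'_apply[OF that])
  moreover have "q x (m x u) = k x (q' x u)" if x: "x \<in> pts" and u: "u \<in> Car M x" for x u
  proof -
    obtain h w where hw: "u = pr (h, w)" "h \<in> Car H x" "w \<in> Car K x" "q x h = k x w"
      using S_E[OF x, of u] u CM by blast
    then show ?thesis using mq[OF x, of h w] u CM by simp
  qed
  ultimately show thesis using that[OF _ ex m] by blast
qed

text \<open>\<open>M\<close> is the quotient of the direct sum of \<open>H\<close> and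
  \<open>K\<close> by the image of \<open>(i, -k)\<close>. It is coherent as an extension of
  \<open>F\<close> by \<open>K\<close>.\<close>

lemma pushout_exists:
  fixes H :: "('x, 'r, 'u) osheaf"
  assumes S: "short_exact G i H q F" and cF: "coherent X F" and cK: "coherent X K" and k: "k \<in> sheaf_hom X G K"
  obtains i' M q' m where "coherent X M" "short_exact K i' M q' F" "m \<in> sheaf_hom X H M"
    "\<And>x g. x \<in> pts \<Longrightarrow> g \<in> Car G x \<Longrightarrow> m x (i x g) = i' x (k x g)"
    "\<And>x h. x \<in> pts \<Longrightarrow> h \<in> Car H x \<Longrightarrow> q' x (m x h) = q x h"
proof -
  note E = short_exactD[OF S]
  have mK: "module_sheaf X K" using cK by (simp add: coherent_def)
  let ?D = "dsum H K"
  have mD: "module_sheaf X ?D" by (rule dsum_module_sheaf[OF E(2) mK])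
  define d where "d = pair G i (neg G K k)"
  have d: "d \<in> sheaf_hom X G ?D" unfolding d_def by (rule pair_hom'[OF E(2) mK E(1,4) neg_hom'[OF E(1) mK k]])
  have d_apply: "d x g = pr (i x g, \<ominus>\<^bsub>stalk K x\<^esub> k x g)" if "x \<in> pts" "g \<in> Car G x" for x g
    using that by (simp add: d_def dsum_apply)
  define S where "S x = d x ` Car G x" for x
  have Sf: "submodule_family ?D S" unfolding S_def by (rule image_family[OF E(1) mD d])
  define M where "M = quotsh ?D S"
  have mM: "module_sheaf X M" unfolding M_def by (rule quotsh_module_sheaf[OF mD Sf])
  let ?\<rho> = "coset_rep ?D S"
  let ?pj = "\<lambda>x\<in>pts. \<lambda>a\<in>Car ?D x. ?\<rho> x a"
  have pj: "?pj \<in> sheaf_hom X ?D M" unfolding M_def by (rule quotsh_proj[OF mD Sf])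
  define e where "e = copair H K F q (zero_hom X K F)"
  have e: "e \<in> sheaf_hom X ?D F" unfolding e_def by (rule copair_hom'[OF E(2) mK E(3,5) zero_hom_hom[OF mK E(3)]])
  have e_apply: "e x (pr (h, w)) = q x h" if "x \<in> pts" "h \<in> Car H x" "w \<in> Car K x" for x h w
  proof -
    interpret F: module "ostalk X x" "stalk F x" by (rule msheaf_module[OF E(3) that(1)])
    show ?thesis using that hom_mem[OF E(5)] by (simp add: e_def dsum_apply zero_hom_apply)
  qed
  have eS: "e x u = \<zero>\<^bsub>stalk F x\<^esub>" if x: "x \<in> pts" and u: "u \<in> S x" for x u
  proof -
    interpret K: module "ostalk X x" "stalk K x" by (rule msheaf_module[OF mK x])
    obtain g where g: "g \<in> Car G x" "u = d x g" using u by (auto simp: S_def)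
    then show ?thesis using x hom_mem[OF E(4) x] hom_mem[OF k x] E(8)[OF x] by (simp add: d_apply e_apply)
  qed
  define q' where "q' = (\<lambda>x\<in>pts. \<lambda>u\<in>Car M x. e x u)"
  have q': "q' \<in> sheaf_hom X M F" unfolding q'_def M_def by (rule quotsh_factor(1)[OF mD Sf E(3) e eS])
  have CM: "Car M x = ?\<rho> x ` Car ?D x" for x by (simp add: M_def quotsh_stalk)
  have q'_apply: "q' x (?\<rho> x u) = e x u" if "x \<in> pts" "u \<in> Car ?D x" for x u
    using that quotsh_factor(2)[OF mD Sf E(3) e eS] by (simp add: q'_def CM)
  define m where "m = sheaf_comp X H ?pj (inl H K)"
  define i' where "i' = sheaf_comp X K ?pj (inr H K)"
  have m: "m \<in> sheaf_hom X H M" unfolding m_def by (rule comp_hom[OF E(2) inl_hom[OF E(2) mK] pj])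
  have i': "i' \<in> sheaf_hom X K M" unfolding i'_def by (rule comp_hom[OF mK inr_hom[OF E(2) mK] pj])
  have z: "\<zero>\<^bsub>stalk A x\<^esub> \<in> Car A x" if "x \<in> pts" "module_sheaf X A" for A :: "('x, 'r, 'u) osheaf" and x
  proof -
    interpret A: module "ostalk X x" "stalk A x" by (rule msheaf_module[OF that(2,1)])
    show ?thesis by simp
  qed
  have m_apply: "m x h = ?\<rho> x (pr (h, \<zero>\<^bsub>stalk K x\<^esub>))" if "x \<in> pts" "h \<in> Car H x" for x h
    using that z[OF that(1) mK] by (simp add: m_def comp_apply dsum_apply)
  have i'_apply: "i' x w = ?\<rho> x (pr (\<zero>\<^bsub>stalk H x\<^esub>, w))" if "x \<in> pts" "w \<in> Car K x" for x w
    using that z[OF that(1) E(2)] by (simp add: i'_def comp_apply dsum_apply)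
  \<comment> \<open>An element of \<open>G\<close> may be moved from the first summand to the
    second: the two pairs differ by \<open>d x g\<close>.\<close>
  have rho_eq: "?\<rho> x (pr (h, w)) = ?\<rho> x (pr (h', w'))"
    if x: "x \<in> pts" and c: "h \<in> Car H x" "h' \<in> Car H x" "w \<in> Car K x" "w' \<in> Car K x" and g: "g \<in> Car G x"
      "h = h' \<oplus>\<^bsub>stalk H x\<^esub> i x g" "w' = w \<oplus>\<^bsub>stalk K x\<^esub> k x g" for x h w h' w' g
  proof -
    interpret D: module "ostalk X x" "stalk ?D x" by (rule msheaf_module[OF mD x])
    interpret H: module "ostalk X x" "stalk H x" by (rule msheaf_module[OF E(2) x])
    interpret K: module "ostalk X x" "stalk K x" by (rule msheaf_module[OF mK x])
    have ig: "i x g \<in> Car H x" "k x g \<in> Car K x" using hom_mem[OF E(4) x g(1)] hom_mem[OF k x g(1)] .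
    have dg: "d x g \<in> Car ?D x" using hom_mem[OF d x g(1)] .
    have "pr (h, w) = d x g \<oplus>\<^bsub>stalk ?D x\<^esub> pr (h', w')"
      using c ig g x by (simp add: d_apply dsum_stalk H.M.a_ac K.M.a_ac K.M.r_neg)
    then have "pr (h, w) \<ominus>\<^bsub>stalk ?D x\<^esub> pr (h', w') = d x g"
      using c dg by (simp add: a_minus_def D.M.a_assoc D.M.r_neg)
    then have "pr (h, w) \<ominus>\<^bsub>stalk ?D x\<^esub> pr (h', w') \<in> S x" using g(1) by (simp add: S_def)
    then show ?thesis using coset_rep_eq_iff[OF mD Sf x] c by simp
  qed
  have ex: "short_exact K i' M q' F"
  proof (rule short_exactI[OF mK mM E(3) i' q'])
    fix x assume x: "x \<in> pts"
    interpret D: module "ostalk X x" "stalk ?D x" by (rule msheaf_module[OF mD x])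
    interpret i: sheaf_morphism X G H i x by unfold_locales (use E x in auto)
    interpret q: sheaf_morphism X H F q x by unfold_locales (use E x in auto)
    interpret k: sheaf_morphism X G K k x by unfold_locales (use mK E k x in auto)
    show "w = \<zero>\<^bsub>stalk K x\<^esub>" if w: "w \<in> Car K x" "i' x w = \<zero>\<^bsub>stalk M x\<^esub>" for w
    proof -
      have "?\<rho> x (pr (\<zero>\<^bsub>stalk H x\<^esub>, w)) = ?\<rho> x \<zero>\<^bsub>stalk ?D x\<^esub>" using w x by (simp add: i'_apply M_def quotsh_stalk)
      then have "pr (\<zero>\<^bsub>stalk H x\<^esub>, w) \<ominus>\<^bsub>stalk ?D x\<^esub> \<zero>\<^bsub>stalk ?D x\<^esub> \<in> S x"
        using coset_rep_eq_iff[OF mD Sf x] w by simp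
      moreover have "pr (\<zero>\<^bsub>stalk H x\<^esub>, w) \<ominus>\<^bsub>stalk ?D x\<^esub> \<zero>\<^bsub>stalk ?D x\<^esub> = pr (\<zero>\<^bsub>stalk H x\<^esub>, w)"
        using w by (simp add: a_minus_def)
      ultimately obtain g where g: "g \<in> Car G x" "pr (\<zero>\<^bsub>stalk H x\<^esub>, w) = d x g" by (auto simp: S_def)
      then have e1: "i x g = \<zero>\<^bsub>stalk H x\<^esub>" and e2: "w = \<ominus>\<^bsub>stalk K x\<^esub> k x g" using x by (auto simp: d_apply)
      have "g = \<zero>\<^bsub>stalk G x\<^esub>" using inj_onD[OF E(6)[OF x], of g "\<zero>\<^bsub>stalk G x\<^esub>"] g(1) e1 i.zero by simp
      then show ?thesis using e2 k.zero by simp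
    qed
    show "q' x (i' x w) = \<zero>\<^bsub>stalk F x\<^esub>" if "w \<in> Car K x" for w
      using that x by (simp add: i'_apply q'_apply e_apply q.zero)
    show "\<exists>w\<in>Car K x. u = i' x w" if u: "u \<in> Car M x" "q' x u = \<zero>\<^bsub>stalk F x\<^esub>" for u
    proof -
      obtain h w where hw: "h \<in> Car H x" "w \<in> Car K x" "u = ?\<rho> x (pr (h, w))"
        using u(1) unfolding CM by (auto elim!: dsum_memE)
      have "q x h = \<zero>\<^bsub>stalk F x\<^esub>" using u(2) hw x by (simp add: q'_apply e_apply)
      then obtain g where g: "g \<in> Car G x" "h = i x g" using E(7)[OF x hw(1)] by blast
      have "u = i' x (w \<oplus>\<^bsub>stalk K x\<^esub> k x g)"
        unfolding hw(3) using hw g x k.mem i.mem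
        by (subst i'_apply[OF x]) (auto intro!: rho_eq[OF x, of _ _ _ _ g])
      then show ?thesis using hw(2) k.mem[OF g(1)] by blast
    qed
    show "\<exists>u\<in>Car M x. f = q' x u" if f: "f \<in> Car F x" for f
    proof -
      obtain h where h: "h \<in> Car H x" "f = q x h" using E(9)[OF x] f by blast
      have "q' x (m x h) = f" using h x by (simp add: m_apply q'_apply e_apply)
      then show ?thesis using hom_mem[OF m x h(1)] by blast
    qed
  qed
  have "coherent X M" by (rule coherent_extension[OF ex cK cF])
  moreover have "m x (i x g) = i' x (k x g)" if x: "x \<in> pts" and g: "g \<in> Car G x" for x g
  proof -
    interpret H: module "ostalk X x" "stalk H x" by (rule msheaf_module[OF E(2) x])
    interpret K: module "ostalk X x" "stalk K x" by (rule msheaf_module[OF mK x])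
    have ig: "i x g \<in> Car H x" "k x g \<in> Car K x" using hom_mem[OF E(4) x g] hom_mem[OF k x g] .
    show ?thesis using ig x g by (simp add: m_apply i'_apply) (auto intro!: rho_eq[OF x, of _ _ _ _ g])
  qed
  moreover have "q' x (m x h) = q x h" if "x \<in> pts" "h \<in> Car H x" for x h
    using that z[OF that(1) mK] by (simp add: m_apply q'_apply e_apply)
  ultimately show thesis using that[OF _ ex m] by blast
qed

text \<open>The middle term is the direct sum of \<open>H\<close> and \<open>W\<close>; its
  coherence comes from the exactness proved here, which makes it an extension of \<open>C\<close> by
  \<open>M\<close>.\<close>

lemma mono_glue_exists:
  fixes H :: "('x, 'r, 'u) osheaf"
  assumes S: "short_exact A a H q B" and S': "short_exact A a' M q' K" and cM: "coherent X M"
    and m: "m \<in> sheaf_hom X M H" and k: "k \<in> sheaf_hom X K B"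
    and c1: "\<And>x g. x \<in> pts \<Longrightarrow> g \<in> Car A x \<Longrightarrow> m x (a' x g) = a x g"
    and c2: "\<And>x u. x \<in> pts \<Longrightarrow> u \<in> Car M x \<Longrightarrow> q x (m x u) = k x (q' x u)"
    and V: "short_exact K v W y Q" and U: "short_exact B i C p Q" and cC: "coherent X C" and c: "c \<in> sheaf_hom X W C"
    and c3: "\<And>x u. x \<in> pts \<Longrightarrow> u \<in> Car K x \<Longrightarrow> c x (v x u) = i x (k x u)"
    and c4: "\<And>x u. x \<in> pts \<Longrightarrow> u \<in> Car W x \<Longrightarrow> p x (c x u) = y x u"
  obtains n P d h where "coherent X P" "short_exact M n P d C" "h \<in> sheaf_hom X H P"
    "\<And>x g. x \<in> pts \<Longrightarrow> g \<in> Car A x \<Longrightarrow> h x (a x g) = n x (a' x g)"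
    "\<And>x u. x \<in> pts \<Longrightarrow> u \<in> Car H x \<Longrightarrow> d x (h x u) = i x (q x u)"
proof -
  note E = short_exactD[OF S] and E' = short_exactD[OF S'] and EV = short_exactD[OF V] and EU = short_exactD[OF U]
  let ?P = "dsum H W"
  define n where "n = pair M m (sheaf_comp X M v q')"
  define d where "d = copair H W C (sheaf_comp X H i q) (neg W C c)"
  have n: "n \<in> sheaf_hom X M ?P"
    unfolding n_def by (rule pair_hom'[OF E(2) EV(2) E'(2) m comp_hom[OF E'(2,5) EV(4)]])
  have d: "d \<in> sheaf_hom X ?P C"
    unfolding d_def by (rule copair_hom'[OF E(2) EV(2) EU(2) comp_hom[OF E(2,5) EU(4)] neg_hom'[OF EV(2) EU(2) c]])
  have n_apply: "n x u = pr (m x u, v x (q' x u))" if "x \<in> pts" "u \<in> Car M x" for x u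
    using that by (simp add: n_def dsum_apply comp_apply)
  have d_apply: "d x (pr (h, w)) = i x (q x h) \<ominus>\<^bsub>stalk C x\<^esub> c x w" if "x \<in> pts" "h \<in> Car H x" "w \<in> Car W x" for x h w
    using that by (simp add: d_def dsum_apply comp_apply a_minus_def)
  have ex: "short_exact M n ?P d C"
  proof (rule short_exactI[OF E'(2) dsum_module_sheaf[OF E(2) EV(2)] EU(2) n d])
    fix x assume x: "x \<in> pts"
    interpret a: sheaf_morphism X A H a x by unfold_locales (use E x in auto)
    interpret q: sheaf_morphism X H B q x by unfold_locales (use E x in auto)
    interpret a': sheaf_morphism X A M a' x by unfold_locales (use E' x in auto)
    interpret q': sheaf_morphism X M K q' x by unfold_locales (use E' x in auto)
    interpret m: sheaf_morphism X M H m x by unfold_locales (use E E' m x in auto)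
    interpret k: sheaf_morphism X K B k x by unfold_locales (use E E' k x in auto)
    interpret v: sheaf_morphism X K W v x by unfold_locales (use EV x in auto)
    interpret y: sheaf_morphism X W Q y x by unfold_locales (use EV x in auto)
    interpret i: sheaf_morphism X B C i x by unfold_locales (use EU x in auto)
    interpret p: sheaf_morphism X C Q p x by unfold_locales (use EU x in auto)
    interpret c: sheaf_morphism X W C c x by unfold_locales (use EV EU c x in auto)
    show "u = \<zero>\<^bsub>stalk M x\<^esub>" if u: "u \<in> Car M x" "n x u = \<zero>\<^bsub>stalk ?P x\<^esub>" for u
    proof -
      have e: "m x u = \<zero>\<^bsub>stalk H x\<^esub>" "v x (q' x u) = \<zero>\<^bsub>stalk W x\<^esub>" using u x by (auto simp: n_apply dsum_stalk)
      have "q' x u = \<zero>\<^bsub>stalk K x\<^esub>"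
        using inj_onD[OF EV(6)[OF x], of "q' x u" "\<zero>\<^bsub>stalk K x\<^esub>"] e(2) v.zero q'.mem[OF u(1)] by simp
      then obtain g where g: "g \<in> Car A x" "u = a' x g" using E'(7)[OF x u(1)] by blast
      have "g = \<zero>\<^bsub>stalk A x\<^esub>"
        using inj_onD[OF E(6)[OF x], of g "\<zero>\<^bsub>stalk A x\<^esub>"] c1[OF x g(1)] e(1) g a.zero by simp
      then show ?thesis using g(2) a'.zero by simp
    qed
    show "d x (n x u) = \<zero>\<^bsub>stalk C x\<^esub>" if u: "u \<in> Car M x" for u
      using u x m.mem q'.mem v.mem k.mem i.mem c2[OF x u] c3[OF x q'.mem[OF u]]
        i.B.M.minus_zero_iff[OF i.mem[OF k.mem[OF q'.mem[OF u]]] i.mem[OF k.mem[OF q'.mem[OF u]]]]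
      by (simp add: n_apply d_apply)
    show "\<exists>u\<in>Car M x. b = n x u" if b: "b \<in> Car ?P x" "d x b = \<zero>\<^bsub>stalk C x\<^esub>" for b
    proof -
      obtain h w where hw: "h \<in> Car H x" "w \<in> Car W x" "b = pr (h, w)" using b(1) by (rule dsum_memE)
      \<comment> \<open>Since \<open>y w = p (c w) = p (i (q h)) = 0\<close>, the germ
        \<open>w\<close> comes from some \<open>l\<close> in \<open>K\<close>, and
        \<open>k l = q h\<close> because \<open>i\<close> is injective. So \<open>(h, l)\<close> is
        a point of the fibre product, which is lifted to \<open>M\<close>.\<close>
      have e: "i x (q x h) = c x w"
        using b(2) hw x i.B.M.minus_zero_iff[OF i.mem[OF q.mem[OF hw(1)]] c.mem[OF hw(2)]] by (simp add: d_apply)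
      have "y x w = \<zero>\<^bsub>stalk Q x\<^esub>" using c4[OF x hw(2)] e EU(8)[OF x q.mem[OF hw(1)]] by simp
      then obtain l where l: "l \<in> Car K x" "w = v x l" using EV(7)[OF x hw(2)] by blast
      have "i x (k x l) = i x (q x h)" using c3[OF x l(1)] e l(2) by simp
      then have kl: "k x l = q x h" using inj_onD[OF EU(6)[OF x]] k.mem[OF l(1)] q.mem[OF hw(1)] by blast
      obtain u0 where u0: "u0 \<in> Car M x" "q' x u0 = l" using E'(9)[OF x] l(1) by (metis imageE subsetD)
      have "q x (h \<ominus>\<^bsub>stalk H x\<^esub> m x u0) = \<zero>\<^bsub>stalk B x\<^esub>"
        using c2[OF x u0(1)] u0(2) kl hw(1) m.mem[OF u0(1)] q.B.M.minus_zero_iff[OF q.mem[OF hw(1)] q.mem[OF hw(1)]]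
        by (simp add: q.diff)
      then obtain g where g: "g \<in> Car A x" "h \<ominus>\<^bsub>stalk H x\<^esub> m x u0 = a x g"
        using E(7)[OF x, of "h \<ominus>\<^bsub>stalk H x\<^esub> m x u0"] hw(1) m.mem[OF u0(1)] by auto
      let ?u = "u0 \<oplus>\<^bsub>stalk M x\<^esub> a' x g"
      have uM: "?u \<in> Car M x" using u0(1) a'.mem[OF g(1)] by simp
      have "m x ?u = m x u0 \<oplus>\<^bsub>stalk H x\<^esub> (h \<ominus>\<^bsub>stalk H x\<^esub> m x u0)"
        using u0 a'.mem[OF g(1)] g c1[OF x g(1)] by (simp add: hom_add[OF m x])
      also have "\<dots> = h" using hw(1) m.mem[OF u0(1)] unfolding a_minus_def by (simp add: a.B.M.a_lcomm a.B.M.r_neg)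
      finally have "m x ?u = h" .
      moreover have "q' x ?u = l"
        using u0 a'.mem[OF g(1)] E'(8)[OF x g(1)] q'.mem[OF u0(1)] by (simp add: hom_add[OF E'(5) x])
      ultimately have "b = n x ?u" using hw(3) l(2) n_apply[OF x uM] by simp
      then show ?thesis using uM by blast
    qed
    show "\<exists>b\<in>Car ?P x. z = d x b" if z: "z \<in> Car C x" for z
    proof -
      obtain w where w: "w \<in> Car W x" "y x w = p x z" using EV(9)[OF x] p.mem[OF z] by (metis imageE subsetD)
      have cw: "c x w \<in> Car C x" using c.mem[OF w(1)] .
      have "p x (z \<ominus>\<^bsub>stalk C x\<^esub> c x w) = \<zero>\<^bsub>stalk Q x\<^esub>"
        using z cw w c4[OF x w(1)] y.B.M.minus_zero_iff[OF p.mem[OF z] p.mem[OF z]] by (simp add: p.diff)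
      then obtain b where b: "b \<in> Car B x" "z \<ominus>\<^bsub>stalk C x\<^esub> c x w = i x b"
        using EU(7)[OF x, of "z \<ominus>\<^bsub>stalk C x\<^esub> c x w"] z cw by auto
      obtain h where h: "h \<in> Car H x" "b = q x h" using E(9)[OF x] b(1) by blast
      have "(z \<ominus>\<^bsub>stalk C x\<^esub> c x w) \<oplus>\<^bsub>stalk C x\<^esub> c x w = z"
        using z cw by (simp add: a_minus_def i.B.M.a_assoc i.B.M.l_neg)
      then have "z = i x (q x h) \<oplus>\<^bsub>stalk C x\<^esub> c x w" unfolding b(2) h(2) by simp
      \<comment> \<open>The minus sign of \<open>c\<close> in \<open>d\<close> is compensated by
        taking the negative of \<open>w\<close>.\<close>
      then have "z = d x (pr (h, \<ominus>\<^bsub>stalk W x\<^esub> w))"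
        using h(1) w(1) cw x by (simp add: d_apply c.minus a_minus_def)
      then show ?thesis using h(1) w(1) by (intro bexI[of _ "pr (h, \<ominus>\<^bsub>stalk W x\<^esub> w)"]) simp_all
    qed
  qed
  have cP: "coherent X ?P" by (rule coherent_extension[OF ex cM cC])
  show thesis
  proof (rule that[OF cP ex inl_hom[OF E(2) EV(2)]])
    fix x assume x: "x \<in> pts"
    interpret v: sheaf_morphism X K W v x by unfold_locales (use EV x in auto)
    interpret c: sheaf_morphism X W C c x by unfold_locales (use EV EU c x in auto)
    show "inl H W x (a x g) = n x (a' x g)" if g: "g \<in> Car A x" for g
      using x g hom_mem[OF E(4) x g] hom_mem[OF E'(4) x g] c1[OF x g] E'(8)[OF x g] v.zero
      by (simp add: dsum_apply n_apply)
    show "d x (inl H W x u) = i x (q x u)" if u: "u \<in> Car H x" for u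
      using x u hom_mem[OF E(5) x u] hom_mem[OF EU(4) x] by (simp add: dsum_apply d_apply c.zero a_minus_def)
  qed
qed

text \<open>Here \<open>P\<close> is again the direct sum of \<open>H\<close> and \<open>W\<close>,
  with \<open>d = (q i, c)\<close>, \<open>n = m - q' v\<close> and \<open>h\<close> the projection
  to \<open>H\<close>. Now \<open>C\<close> is the fibre product of \<open>B\<close> and
  \<open>W\<close> over \<open>K\<close>, and \<open>M\<close> the amalgamated sum of
  \<open>H\<close> and \<open>K\<close> over \<open>B\<close>.\<close>

lemma epi_glue_exists:
  fixes H :: "('x, 'r, 'u) osheaf"
  assumes S: "short_exact B q H a A" and S': "short_exact K q' M a' A" and cM: "coherent X M"
    and m: "m \<in> sheaf_hom X H M" and k: "k \<in> sheaf_hom X B K"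
    and c1: "\<And>x u. x \<in> pts \<Longrightarrow> u \<in> Car H x \<Longrightarrow> a' x (m x u) = a x u"
    and c2: "\<And>x u. x \<in> pts \<Longrightarrow> u \<in> Car B x \<Longrightarrow> m x (q x u) = q' x (k x u)"
    and V: "short_exact Q y W v K" and U: "short_exact Q p C i B" and cC: "coherent X C" and c: "c \<in> sheaf_hom X C W"
    and c3: "\<And>x u. x \<in> pts \<Longrightarrow> u \<in> Car C x \<Longrightarrow> v x (c x u) = k x (i x u)"
    and c4: "\<And>x u. x \<in> pts \<Longrightarrow> u \<in> Car Q x \<Longrightarrow> c x (p x u) = y x u"
  obtains n P d h where "coherent X P" "short_exact C d P n M" "h \<in> sheaf_hom X P H"
    "\<And>x u. x \<in> pts \<Longrightarrow> u \<in> Car P x \<Longrightarrow> a x (h x u) = a' x (n x u)"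
    "\<And>x u. x \<in> pts \<Longrightarrow> u \<in> Car C x \<Longrightarrow> h x (d x u) = q x (i x u)"
proof -
  note E = short_exactD[OF S] and E' = short_exactD[OF S'] and EV = short_exactD[OF V] and EU = short_exactD[OF U]
  let ?P = "dsum H W"
  define d where "d = pair C (sheaf_comp X C q i) c"
  define n where "n = copair H W M m (neg W M (sheaf_comp X W q' v))"
  have d: "d \<in> sheaf_hom X C ?P"
    unfolding d_def by (rule pair_hom'[OF E(2) EV(2) EU(2) comp_hom[OF EU(2,5) E(4)] c])
  have n: "n \<in> sheaf_hom X ?P M"
    unfolding n_def by (rule copair_hom'[OF E(2) EV(2) E'(2) m neg_hom'[OF EV(2) E'(2) comp_hom[OF EV(2,5) E'(4)]]])
  have d_apply: "d x u = pr (q x (i x u), c x u)" if "x \<in> pts" "u \<in> Car C x" for x u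
    using that by (simp add: d_def dsum_apply comp_apply)
  have n_apply: "n x (pr (h, w)) = m x h \<ominus>\<^bsub>stalk M x\<^esub> q' x (v x w)" if "x \<in> pts" "h \<in> Car H x" "w \<in> Car W x" for x h w
    using that by (simp add: n_def dsum_apply comp_apply a_minus_def)
  have ex: "short_exact C d ?P n M"
  proof (rule short_exactI[OF EU(2) dsum_module_sheaf[OF E(2) EV(2)] E'(2) d n])
    fix x assume x: "x \<in> pts"
    interpret q: sheaf_morphism X B H q x by unfold_locales (use E x in auto)
    interpret a: sheaf_morphism X H A a x by unfold_locales (use E x in auto)
    interpret q': sheaf_morphism X K M q' x by unfold_locales (use E' x in auto)
    interpret a': sheaf_morphism X M A a' x by unfold_locales (use E' x in auto)
    interpret m: sheaf_morphism X H M m x by unfold_locales (use E E' m x in auto)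
    interpret k: sheaf_morphism X B K k x by unfold_locales (use E E' k x in auto)
    interpret y: sheaf_morphism X Q W y x by unfold_locales (use EV x in auto)
    interpret v: sheaf_morphism X W K v x by unfold_locales (use EV x in auto)
    interpret p: sheaf_morphism X Q C p x by unfold_locales (use EU x in auto)
    interpret i: sheaf_morphism X C B i x by unfold_locales (use EU x in auto)
    interpret c: sheaf_morphism X C W c x by unfold_locales (use EV EU c x in auto)
    show "u = \<zero>\<^bsub>stalk C x\<^esub>" if u: "u \<in> Car C x" "d x u = \<zero>\<^bsub>stalk ?P x\<^esub>" for u
    proof -
      have e: "q x (i x u) = \<zero>\<^bsub>stalk H x\<^esub>" "c x u = \<zero>\<^bsub>stalk W x\<^esub>" using u x by (auto simp: d_apply dsum_stalk)
      have "i x u = \<zero>\<^bsub>stalk B x\<^esub>"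
        using inj_onD[OF E(6)[OF x], of "i x u" "\<zero>\<^bsub>stalk B x\<^esub>"] e(1) q.zero i.mem[OF u(1)] by simp
      then obtain g where g: "g \<in> Car Q x" "u = p x g" using EU(7)[OF x u(1)] by blast
      have "g = \<zero>\<^bsub>stalk Q x\<^esub>"
        using inj_onD[OF EV(6)[OF x], of g "\<zero>\<^bsub>stalk Q x\<^esub>"] c4[OF x g(1)] e(2) g y.zero by simp
      then show ?thesis using g(2) p.zero by simp
    qed
    show "n x (d x u) = \<zero>\<^bsub>stalk M x\<^esub>" if u: "u \<in> Car C x" for u
    proof -
      have "q' x (k x (i x u)) \<in> Car M x" using q'.mem k.mem i.mem u by blast
      then show ?thesis
        using u x q.mem i.mem c.mem c2[OF x i.mem[OF u]] c3[OF x u] q'.B.M.minus_zero_iff by (simp add: n_apply d_apply)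
    qed
    show "\<exists>u\<in>Car C x. b = d x u" if b: "b \<in> Car ?P x" "n x b = \<zero>\<^bsub>stalk M x\<^esub>" for b
    proof -
      obtain h w where hw: "h \<in> Car H x" "w \<in> Car W x" "b = pr (h, w)" using b(1) by (rule dsum_memE)
      have e: "m x h = q' x (v x w)"
        using b(2) hw x q'.B.M.minus_zero_iff[OF m.mem[OF hw(1)] q'.mem[OF v.mem[OF hw(2)]]] by (simp add: n_apply)
      have "a x h = \<zero>\<^bsub>stalk A x\<^esub>" using c1[OF x hw(1)] e E'(8)[OF x v.mem[OF hw(2)]] by simp
      then obtain l where l: "l \<in> Car B x" "h = q x l" using E(7)[OF x hw(1)] by blast
      have "q' x (k x l) = q' x (v x w)" using c2[OF x l(1)] e l(2) by simp
      then have kl: "k x l = v x w" using inj_onD[OF E'(6)[OF x]] k.mem[OF l(1)] v.mem[OF hw(2)] by blast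
      obtain u0 where u0: "u0 \<in> Car C x" "i x u0 = l" using EU(9)[OF x] l(1) by (metis imageE subsetD)
      have "v x (w \<ominus>\<^bsub>stalk W x\<^esub> c x u0) = \<zero>\<^bsub>stalk K x\<^esub>"
        using c3[OF x u0(1)] u0(2) kl hw(2) c.mem[OF u0(1)] q'.A.M.minus_zero_iff[OF v.mem[OF hw(2)] v.mem[OF hw(2)]]
        by (simp add: v.diff)
      then obtain g where g: "g \<in> Car Q x" "w \<ominus>\<^bsub>stalk W x\<^esub> c x u0 = y x g"
        using EV(7)[OF x, of "w \<ominus>\<^bsub>stalk W x\<^esub> c x u0"] hw(2) c.mem[OF u0(1)] by auto
      let ?u = "u0 \<oplus>\<^bsub>stalk C x\<^esub> p x g"
      have uC: "?u \<in> Car C x" using u0(1) p.mem[OF g(1)] by simp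
      have "c x ?u = c x u0 \<oplus>\<^bsub>stalk W x\<^esub> (w \<ominus>\<^bsub>stalk W x\<^esub> c x u0)"
        using u0 p.mem[OF g(1)] g c4[OF x g(1)] by (simp add: hom_add[OF c x])
      also have "\<dots> = w" using hw(2) c.mem[OF u0(1)] unfolding a_minus_def by (simp add: y.B.M.a_lcomm y.B.M.r_neg)
      finally have "c x ?u = w" .
      moreover have "i x ?u = l"
        using u0 p.mem[OF g(1)] EU(8)[OF x g(1)] i.mem[OF u0(1)] by (simp add: hom_add[OF EU(5) x])
      ultimately have "b = d x ?u" using hw(3) l(2) d_apply[OF x uC] by simp
      then show ?thesis using uC by blast
    qed
    show "\<exists>b\<in>Car ?P x. z = n x b" if z: "z \<in> Car M x" for z
    proof -
      obtain h where h: "h \<in> Car H x" "a x h = a' x z" using E(9)[OF x] a'.mem[OF z] by (metis imageE subsetD)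
      have mh: "m x h \<in> Car M x" using m.mem[OF h(1)] .
      have "a' x (m x h \<ominus>\<^bsub>stalk M x\<^esub> z) = \<zero>\<^bsub>stalk A x\<^esub>"
        using z mh h c1[OF x h(1)] a.B.M.minus_zero_iff[OF a'.mem[OF z] a'.mem[OF z]] by (simp add: a'.diff)
      then obtain l where l: "l \<in> Car K x" "m x h \<ominus>\<^bsub>stalk M x\<^esub> z = q' x l"
        using E'(7)[OF x, of "m x h \<ominus>\<^bsub>stalk M x\<^esub> z"] z mh by auto
      obtain w where w: "w \<in> Car W x" "l = v x w" using EV(9)[OF x] l(1) by blast
      have "m x h \<ominus>\<^bsub>stalk M x\<^esub> (m x h \<ominus>\<^bsub>stalk M x\<^esub> z) = z"
        using mh z unfolding a_minus_def by (simp add: q'.B.M.minus_add q'.B.M.r_neg q'.B.M.a_assoc[symmetric])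
      then have "z = n x (pr (h, w))" using h w l x by (simp add: n_apply)
      then show ?thesis using h(1) w(1) by (intro bexI[of _ "pr (h, w)"]) simp_all
    qed
  qed
  have cP: "coherent X ?P" by (rule coherent_extension[OF ex cC cM])
  show thesis
  proof (rule that[OF cP ex prl_hom[OF E(2) EV(2)]])
    fix x assume x: "x \<in> pts"
    interpret a': sheaf_morphism X M A a' x by unfold_locales (use E' x in auto)
    show "prl H W x (d x u) = q x (i x u)" if u: "u \<in> Car C x" for u
      using x u hom_mem[OF E(4) x] hom_mem[OF EU(5) x u] hom_mem[OF c x u] by (simp add: dsum_apply d_apply)
    show "a x (prl H W x u) = a' x (n x u)" if u: "u \<in> Car ?P x" for u
    proof -
      obtain h w where hw: "h \<in> Car H x" "w \<in> Car W x" "u = pr (h, w)" using u by (rule dsum_memE)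
      have vw: "v x w \<in> Car K x" "q' x (v x w) \<in> Car M x" using hom_mem[OF EV(5) x hw(2)] hom_mem[OF E'(4) x] by blast+
      have "a' x (m x h \<ominus>\<^bsub>stalk M x\<^esub> q' x (v x w)) = a x h \<ominus>\<^bsub>stalk A x\<^esub> \<zero>\<^bsub>stalk A x\<^esub>"
        using vw hom_mem[OF m x hw(1)] E'(8)[OF x vw(1)] c1[OF x hw(1)] by (simp add: a'.diff)
      also have "\<dots> = a x h" using hom_mem[OF E(5) x hw(1)] by (simp add: a_minus_def)
      finally show ?thesis using x hw by (simp add: dsum_apply n_apply)
    qed
  qed
qed

end

context exact_cat_dual begin

lemma pushout_weq:
  assumes "weq F G w0 w0'" "word F G w0" "word F G' w" "wmor a (idm F) w0 w"
    "word F G' w'" "wmor a (idm F) w0' w'"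
  shows "weq F G' w w'"
  using op_weq_flips[OF op.pullback_weq[OF weq_flips[OF assms(1)] word_flips[OF assms(2)] word_flips[OF assms(3)]
      wmor_flips[OF assms(4)] word_flips[OF assms(5)] wmor_flips[OF assms(6)]]]
  by (simp add: flips_flips)

end

section \<open>Coherent sheaves as an instance of the abstract setting\<close>

context ringed_coded begin

abbreviation zs :: "('x, 'r, 'u) osheaf" where "zs \<equiv> zero_sheaf X"

text \<open>An arrow carries its source, which \<^const>\<open>sheaf_comp\<close> needs.\<close>

definition arr :: "('x, 'r, 'u) osheaf \<Rightarrow> ('x, 'r, 'u) osheaf \<Rightarrow> (('x, 'r, 'u) osheaf \<times> ('x, 'u) smap) set" where
  "arr A B = {f. fst f = A \<and> coherent X A \<and> coherent X B \<and> snd f \<in> sheaf_hom X A B}"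

definition acmp :: "('x, 'r, 'u) osheaf \<times> ('x, 'u) smap \<Rightarrow> ('x, 'r, 'u) osheaf \<times> ('x, 'u) smap \<Rightarrow>
    ('x, 'r, 'u) osheaf \<times> ('x, 'u) smap" where
  "acmp g f = (fst f, sheaf_comp X (fst f) (snd g) (snd f))"

definition aid :: "('x, 'r, 'u) osheaf \<Rightarrow> ('x, 'r, 'u) osheaf \<times> ('x, 'u) smap" where
  "aid A = (A, sheaf_id X A)"

definition azt :: "('x, 'r, 'u) osheaf \<Rightarrow> ('x, 'r, 'u) osheaf \<times> ('x, 'u) smap" where
  "azt A = (A, zero_hom X A zs)"

definition azf :: "('x, 'r, 'u) osheaf \<Rightarrow> ('x, 'r, 'u) osheaf \<times> ('x, 'u) smap" where
  "azf A = (zs, zero_hom X zs A)"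

definition ases :: "('x, 'r, 'u) osheaf \<times> (('x, 'r, 'u) osheaf \<times> ('x, 'u) smap) \<times> ('x, 'r, 'u) osheaf \<times>
    (('x, 'r, 'u) osheaf \<times> ('x, 'u) smap) \<times> ('x, 'r, 'u) osheaf \<Rightarrow> bool" where
  "ases = (\<lambda>(G, i, H, q, F). fst i = G \<and> fst q = H \<and> coherent X G \<and> coherent X H \<and> coherent X F \<and>
     short_exact G (snd i) H (snd q) F)"

lemma coherent_msheaf: "coherent X A \<Longrightarrow> module_sheaf X A"
  by (simp add: coherent_def)

lemma msheaf_zero_mem:
  assumes "module_sheaf X A" "x \<in> pts"
  shows "\<zero>\<^bsub>stalk A x\<^esub> \<in> Car A x"
proof -
  interpret A: module "ostalk X x" "stalk A x" by (rule msheaf_module[OF assms])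
  show ?thesis by simp
qed

lemma arr_iff: "f \<in> arr A B \<longleftrightarrow> fst f = A \<and> coherent X A \<and> coherent X B \<and> snd f \<in> sheaf_hom X A B"
  by (simp add: arr_def)

lemma ases_iff: "ases (G, i, H, q, F) \<longleftrightarrow> fst i = G \<and> fst q = H \<and> coherent X G \<and> coherent X H \<and> coherent X F \<and>
     short_exact G (snd i) H (snd q) F"
  by (simp add: ases_def)

lemma asesD:
  assumes "ases (G, i, H, q, F)"
  shows "i = (G, snd i)" "q = (H, snd q)" "coherent X G" "coherent X H" "coherent X F" "short_exact G (snd i) H (snd q) F"
  using assms by (auto simp: ases_iff prod_eq_iff)

lemma alad_iff:
  assumes "ases (G, i, H, q, F)" "ases (G', i', H', q', F')"
  shows "ladder arr acmp a m c (G, i, H, q, F) (G', i', H', q', F') \<longleftrightarrow>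
    a \<in> arr G G' \<and> m \<in> arr H H' \<and> c \<in> arr F F' \<and>
    (\<forall>x\<in>pts. \<forall>g\<in>Car G x. snd m x (snd i x g) = snd i' x (snd a x g)) \<and>
    (\<forall>x\<in>pts. \<forall>h\<in>Car H x. snd q' x (snd m x h) = snd c x (snd q x h))"
  using assms unfolding ases_iff by (simp add: ladder_def acmp_def arr_iff comp_eq_iff conj_ac cong: conj_cong)

lemma aid_arr: "coherent X A \<Longrightarrow> aid A \<in> arr A A"
  by (simp add: arr_iff aid_def id_hom coherent_msheaf)

lemma aid_apply: "x \<in> pts \<Longrightarrow> a \<in> Car A x \<Longrightarrow> snd (aid A) x a = a"
  by (simp add: aid_def id_apply)

text \<open>The universal property of the cokernel is the case of \<open>joint_epi_factor\<close> in
  which the second source is the zero sheaf.\<close>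

lemma cokernel_factor:
  assumes S: "short_exact G i H q (F :: ('x, 'r, 'u) osheaf)" and mT: "module_sheaf X T" and f: "f \<in> sheaf_hom X H T"
    and z: "\<And>x g. x \<in> pts \<Longrightarrow> g \<in> Car G x \<Longrightarrow> f x (i x g) = \<zero>\<^bsub>stalk T x\<^esub>"
  obtains h where "h \<in> sheaf_hom X F T" "\<And>x u. x \<in> pts \<Longrightarrow> u \<in> Car H x \<Longrightarrow> h x (q x u) = f x u"
proof -
  note E = short_exactD[OF S]
  let ?Z = "zero_sheaf X :: ('x, 'r, 'u) osheaf"
  note mZ = zero_sheaf_module_sheaf
  have "\<exists>!h. h \<in> sheaf_hom X F T \<and> sheaf_comp X H h q = f \<and> sheaf_comp X ?Z h (zero_hom X ?Z F) = zero_hom X ?Z T"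
  proof (rule joint_epi_factor[OF mT E(2) mZ E(3,5) zero_hom_hom[OF mZ E(3)] f zero_hom_hom[OF mZ mT]])
    fix x assume x: "x \<in> pts"
    interpret q: sheaf_morphism X H F q x by unfold_locales (use E x in auto)
    interpret f: sheaf_morphism X H T f x by unfold_locales (use E mT f x in auto)
    show "\<exists>u\<in>Car H x. \<exists>v\<in>Car ?Z x. w = q x u \<oplus>\<^bsub>stalk F x\<^esub> zero_hom X ?Z F x v" if w: "w \<in> Car F x" for w
    proof -
      obtain u where "u \<in> Car H x" "w = q x u" using E(9)[OF x] w by blast
      then show ?thesis using x w by (intro bexI[of _ u] bexI[of _ undefined]) (simp_all add: zero_hom_apply zero_sheaf_stalk)
    qed
    show "f x u \<oplus>\<^bsub>stalk T x\<^esub> zero_hom X ?Z T x v = \<zero>\<^bsub>stalk T x\<^esub>"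
      if u: "u \<in> Car H x" "v \<in> Car ?Z x" "q x u \<oplus>\<^bsub>stalk F x\<^esub> zero_hom X ?Z F x v = \<zero>\<^bsub>stalk F x\<^esub>" for u v
    proof -
      have "q x u = \<zero>\<^bsub>stalk F x\<^esub>" using u x q.mem[OF u(1)] by (simp add: zero_hom_apply)
      then obtain g where "g \<in> Car G x" "u = i x g" using E(7)[OF x u(1)] by blast
      then show ?thesis using z[OF x] u x by (simp add: zero_hom_apply)
    qed
  qed
  then obtain h where "h \<in> sheaf_hom X F T" "sheaf_comp X H h q = f" by blast
  then show thesis using that by (simp add: comp_eq_hom_iff[OF f])
qed

lemma exact_cat_sheaves: "exact_cat (coherent X) arr acmp aid zs azt azf ases"
proof (rule exact_cat.intro)
  show "f \<in> arr A B \<Longrightarrow> coherent X A \<and> coherent X B" for f A B by (simp add: arr_iff)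
  show "f \<in> arr A B \<Longrightarrow> g \<in> arr B C \<Longrightarrow> acmp g f \<in> arr A C" for f g A B C
    by (auto simp: arr_iff acmp_def intro: comp_hom coherent_msheaf)
  show "f \<in> arr A B \<Longrightarrow> g \<in> arr B C \<Longrightarrow> h \<in> arr C D \<Longrightarrow> acmp (acmp h g) f = acmp h (acmp g f)" for f g h A B C D
    by (auto simp: arr_iff acmp_def comp_eq_iff comp_apply hom_mem)
  show "coherent X A \<Longrightarrow> aid A \<in> arr A A" for A by (rule aid_arr)
  show "f \<in> arr A B \<Longrightarrow> acmp f (aid A) = f" for f A B
    by (auto simp: arr_iff acmp_def aid_def prod_eq_iff comp_eq_hom_iff id_apply)
  show "f \<in> arr A B \<Longrightarrow> acmp (aid B) f = f" for f A B
    by (auto simp: arr_iff acmp_def aid_def prod_eq_iff comp_eq_hom_iff id_apply hom_mem)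
  show "coherent X zs" by (rule zero_sheaf_coherent)
  show "coherent X A \<Longrightarrow> azt A \<in> arr A zs" for A
    by (simp add: arr_iff azt_def zero_sheaf_coherent zero_hom_hom coherent_msheaf)
  show "coherent X A \<Longrightarrow> azf A \<in> arr zs A" for A
    by (simp add: arr_iff azf_def zero_sheaf_coherent zero_hom_hom coherent_msheaf)
  show "f = azt A" if f: "f \<in> arr A zs" for f A
  proof -
    have "snd f = zero_hom X A zs"
      by (rule hom_ext[of _ A zs _ zs])
        (use f zero_hom_hom[OF coherent_msheaf zero_sheaf_module_sheaf] hom_mem[of "snd f" A zs] in
          \<open>auto simp: arr_iff zero_hom_apply zero_sheaf_stalk\<close>)
    then show ?thesis using f by (simp add: arr_iff azt_def prod_eq_iff)
  qed
  show "f = azf A" if f: "f \<in> arr zs A" for f A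
  proof -
    have mA: "module_sheaf X A" using f by (simp add: arr_iff coherent_msheaf)
    have fh: "snd f \<in> sheaf_hom X zs A" using f by (simp add: arr_iff)
    have "snd f = zero_hom X zs A"
    proof (rule hom_ext[OF fh zero_hom_hom[OF zero_sheaf_module_sheaf mA]])
      fix x and a :: 'u assume x: "x \<in> pts" "a \<in> Car zs x"
      interpret f: sheaf_morphism X zs A "snd f" x
        by unfold_locales (use zero_sheaf_module_sheaf mA fh x in auto)
      show "snd f x a = zero_hom X zs A x a" using f.zero x by (simp add: zero_hom_apply zero_sheaf_stalk)
    qed
    then show ?thesis using f by (simp add: arr_iff azf_def prod_eq_iff)
  qed
  show "i \<in> arr G H \<and> q \<in> arr H F \<and> acmp q i = acmp (azf F) (azt G)" if S: "ases (G, i, H, q, F)" for G i H q F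
  proof -
    note D = asesD[OF S] and E = short_exactD[OF asesD(6)[OF S]]
    have "acmp q i = acmp (azf F) (azt G)"
      unfolding acmp_def azf_def azt_def using D(1,2) E(8)
      by (auto simp: prod_eq_iff comp_eq_iff zero_hom_apply zero_sheaf_stalk ases_iff)
    then show ?thesis using S E(4,5) by (auto simp: ases_iff arr_iff)
  qed
  show "ases (A, aid A, A, azt A, zs)" if A: "coherent X A" for A
  proof -
    have "short_exact A (sheaf_id X A) A (zero_hom X A zs) zs"
      by (rule short_exactI) (use A id_hom zero_hom_hom zero_sheaf_module_sheaf coherent_msheaf in
          \<open>auto simp: id_apply zero_hom_apply zero_sheaf_stalk intro: msheaf_zero_mem[OF coherent_msheaf]\<close>)
    then show ?thesis using A by (simp add: ases_iff aid_def azt_def zero_sheaf_coherent)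
  qed
  show "ases (zs, azf A, A, aid A, A)" if A: "coherent X A" for A
  proof -
    have "short_exact zs (zero_hom X zs A) A (sheaf_id X A) A"
      by (rule short_exactI) (use A id_hom zero_hom_hom zero_sheaf_module_sheaf coherent_msheaf in
          \<open>auto simp: id_apply zero_hom_apply zero_sheaf_stalk simp: id_apply[OF _ msheaf_zero_mem[OF coherent_msheaf]] intro: msheaf_zero_mem[OF coherent_msheaf]\<close>)
    then show ?thesis using A by (simp add: ases_iff aid_def azf_def zero_sheaf_coherent)
  qed
  show "\<exists>i' M q' m. ases (G, i', M, q', K) \<and> ladder arr acmp (aid G) m k (G, i', M, q', K) (G, i, H, q, F)"
    if S: "ases (G, i, H, q, F)" and k: "k \<in> arr K F" for G i H q F k K
  proof -
    note D = asesD[OF S]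
    have cK: "coherent X K" and k': "snd k \<in> sheaf_hom X K F" using k by (auto simp: arr_iff)
    obtain i' M q' m where M: "coherent X M" "short_exact G i' M q' K" "m \<in> sheaf_hom X M H"
      "\<And>x g. x \<in> pts \<Longrightarrow> g \<in> Car G x \<Longrightarrow> m x (i' x g) = snd i x g"
      "\<And>x u. x \<in> pts \<Longrightarrow> u \<in> Car M x \<Longrightarrow> snd q x (m x u) = snd k x (q' x u)"
      using pullback_exists[OF D(6,3) cK k'] by metis
    have S': "ases (G, (G, i'), M, (M, q'), K)" using M D cK by (simp add: ases_iff)
    have "ladder arr acmp (aid G) (M, m) k (G, (G, i'), M, (M, q'), K) (G, i, H, q, F)"
      unfolding alad_iff[OF S' S] using M D k aid_arr by (auto simp: aid_apply arr_iff)
    then show ?thesis using S' by blast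
  qed
  show "\<exists>i' M q' m. ases (K, q', M, i', G) \<and> ladder arr acmp k m (aid G) (F, q, H, i, G) (K, q', M, i', G)"
    if S: "ases (F, q, H, i, G)" and k: "k \<in> arr F K" for G i H q F k K
  proof -
    note D = asesD[OF S]
    have cK: "coherent X K" and k': "snd k \<in> sheaf_hom X F K" using k by (auto simp: arr_iff)
    obtain q' M i' m where M: "coherent X M" "short_exact K q' M i' G" "m \<in> sheaf_hom X H M"
      "\<And>x g. x \<in> pts \<Longrightarrow> g \<in> Car F x \<Longrightarrow> m x (snd q x g) = q' x (snd k x g)"
      "\<And>x u. x \<in> pts \<Longrightarrow> u \<in> Car H x \<Longrightarrow> i' x (m x u) = snd i x u"
      using pushout_exists[OF D(6,5) cK k'] by metis
    have S': "ases (K, (K, q'), M, (M, i'), G)" using M D cK by (simp add: ases_iff)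
    have "ladder arr acmp k (H, m) (aid G) (F, q, H, i, G) (K, (K, q'), M, (M, i'), G)"
      unfolding alad_iff[OF S S'] using M D k aid_arr hom_mem[OF short_exactD(5)[OF D(6)]] by (auto simp: aid_apply arr_iff)
    then show ?thesis using S' by blast
  qed
  show "\<exists>u. ladder arr acmp a u (aid K) (A, t, L, l, K) (G, i', M, q', K) \<and> acmp m u = x"
    if S: "ases (G, i, H, q, F)" and S': "ases (G, i', M, q', K)"
      and lad: "ladder arr acmp (aid G) m k (G, i', M, q', K) (G, i, H, q, F)"
      and T: "ases (A, t, L, l, K)" and lad2: "ladder arr acmp a x k (A, t, L, l, K) (G, i, H, q, F)"
    for G i H q F i' M q' K m k A t L l a x
  proof -
    note D = asesD[OF S] and D' = asesD[OF S'] and DT = asesD[OF T]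
    note L1 = lad[unfolded alad_iff[OF S' S]] and L2 = lad2[unfolded alad_iff[OF T S]]
    have hm: "snd m \<in> sheaf_hom X M H" "snd k \<in> sheaf_hom X K F" "snd x \<in> sheaf_hom X L H" "snd a \<in> sheaf_hom X A G"
      using L1 L2 by (auto simp: arr_iff)
    have pb: "pullback_square X H K F (snd q) (snd k) M (snd m) (snd q')"
      by (rule pullback_square_ladder[OF D(6) D'(6,4) hm(1,2)]) (use L1 in \<open>auto simp: aid_apply\<close>)
    note EL = short_exactD[OF DT(6)] and E' = short_exactD[OF D'(6)] and E = short_exactD[OF D(6)]
    have "sheaf_comp X L (snd q) (snd x) = sheaf_comp X L (snd k) (snd l)" using L2 by (simp add: comp_eq_iff)
    then obtain u where u: "u \<in> sheaf_hom X L M" "sheaf_comp X L (snd m) u = snd x" "sheaf_comp X L (snd q') u = snd l"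
      using pb DT(4) hm(3) EL(5) unfolding pullback_square_def by blast
    have mu: "snd m y (u y w) = snd x y w" "snd q' y (u y w) = snd l y w" if "y \<in> pts" "w \<in> Car L y" for y w
      using u(2,3) that by (simp_all add: comp_eq_hom_iff[OF hm(3)] comp_eq_hom_iff[OF EL(5)])
    let ?f = "sheaf_comp X A u (snd t)" and ?g = "sheaf_comp X A (snd i') (snd a)"
    have fg: "?f \<in> sheaf_hom X A M" "?g \<in> sheaf_hom X A M" using comp_hom[OF EL(1,4) u(1)] comp_hom[OF EL(1) hm(4) E'(4)] .
    \<comment> \<open>The left square of the ladder commutes because \<open>u t\<close> and
      \<open>i' a\<close> have the same composites with \<open>m\<close> and with \<open>q'\<close>,
      and a map into the pullback is determined by these.\<close>
    let ?P = "\<lambda>h. h \<in> sheaf_hom X A M \<and> sheaf_comp X A (snd m) h = sheaf_comp X A (snd x) (snd t) \<and>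
      sheaf_comp X A (snd q') h = sheaf_comp X A (snd l) (snd t)"
    have "sheaf_comp X A (snd q) (sheaf_comp X A (snd x) (snd t)) = sheaf_comp X A (snd k) (sheaf_comp X A (snd l) (snd t))"
    proof -
      have "snd q y (snd x y w) = snd k y (snd l y w)" if "y \<in> pts" "w \<in> Car L y" for y w using L2 that by blast
      then show ?thesis using hom_mem[OF EL(4)] by (simp add: comp_eq_iff comp_apply)
    qed
    then have "\<exists>!h. ?P h"
      using pb DT(3) comp_hom[OF EL(1,4) hm(3)] comp_hom[OF EL(1,4,5)] unfolding pullback_square_def by blast
    moreover have "?P ?f" using fg mu hom_mem[OF EL(4)] by (simp add: comp_eq_iff comp_apply)
    moreover have "?P ?g"
    proof (intro conjI fg)
      have "snd m y (snd i' y (snd a y w)) = snd x y (snd t y w)" if y: "y \<in> pts" "w \<in> Car A y" for y w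
      proof -
        have aw: "snd a y w \<in> Car G y" using hom_mem[OF hm(4) y] .
        have "snd m y (snd i' y (snd a y w)) = snd i y (snd (aid G) y (snd a y w))" using L1 y(1) aw by blast
        also have "\<dots> = snd i y (snd a y w)" using aid_apply[OF y(1) aw] by simp
        also have "\<dots> = snd x y (snd t y w)" using L2 y by simp
        finally show ?thesis .
      qed
      then show "sheaf_comp X A (snd m) ?g = sheaf_comp X A (snd x) (snd t)"
        by (simp add: comp_eq_iff comp_apply)
      have "snd q' y (snd i' y (snd a y w)) = snd l y (snd t y w)" if y: "y \<in> pts" "w \<in> Car A y" for y w
        using E'(8)[OF y(1) hom_mem[OF hm(4) y]] EL(8)[OF y] by simp
      then show "sheaf_comp X A (snd q') ?g = sheaf_comp X A (snd l) (snd t)"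
        by (simp add: comp_eq_iff comp_apply)
    qed
    ultimately have "?f = ?g" by blast
    then have "ladder arr acmp a (L, u) (aid K) (A, t, L, l, K) (G, i', M, q', K)"
      unfolding alad_iff[OF T S'] using L2 DT D' u(1) mu hom_mem[OF EL(5)] aid_arr
      by (auto simp: arr_iff comp_eq_iff aid_apply)
    moreover have "acmp m (L, u) = x" using u(2) L2 by (simp add: acmp_def arr_iff prod_eq_iff)
    ultimately show ?thesis by blast
  qed
  show "\<exists>u. ladder arr acmp (aid K) u a (K, q', M, i', G) (K, l, L, t, A) \<and> acmp u m = x"
    if S: "ases (F, q, H, i, G)" and S': "ases (K, q', M, i', G)"
      and lad: "ladder arr acmp k m (aid G) (F, q, H, i, G) (K, q', M, i', G)"
      and T: "ases (K, l, L, t, A)" and lad2: "ladder arr acmp k x a (F, q, H, i, G) (K, l, L, t, A)"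
    for G i H q F i' M q' K m k A t L l a x
  proof -
    note D = asesD[OF S] and D' = asesD[OF S'] and DT = asesD[OF T]
    note L1 = lad[unfolded alad_iff[OF S S']] and L2 = lad2[unfolded alad_iff[OF S T]]
    have hm: "snd m \<in> sheaf_hom X H M" "snd k \<in> sheaf_hom X F K" "snd x \<in> sheaf_hom X H L" "snd a \<in> sheaf_hom X G A"
      using L1 L2 by (auto simp: arr_iff)
    note EL = short_exactD[OF DT(6)] and E' = short_exactD[OF D'(6)] and E = short_exactD[OF D(6)]
    have po: "pushout_square X F H K (snd q) (snd k) M (snd m) (snd q')"
      by (rule pushout_square_ladder[OF D(6) D'(6,4) hm(1,2)]) (use L1 hom_mem[OF E(5)] in \<open>auto simp: aid_apply\<close>)
    have "sheaf_comp X F (snd x) (snd q) = sheaf_comp X F (snd l) (snd k)" using L2 by (simp add: comp_eq_iff)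
    then obtain u where u: "u \<in> sheaf_hom X M L" "sheaf_comp X H u (snd m) = snd x" "sheaf_comp X K u (snd q') = snd l"
      using po DT(4) hm(3) EL(4) unfolding pushout_square_def by blast
    have mu: "y \<in> pts \<Longrightarrow> w \<in> Car H y \<Longrightarrow> u y (snd m y w) = snd x y w"
      "y \<in> pts \<Longrightarrow> w \<in> Car K y \<Longrightarrow> u y (snd q' y w) = snd l y w" for y w
      using u(2,3) by (simp_all add: comp_eq_hom_iff[OF hm(3)] comp_eq_hom_iff[OF EL(4)])
    let ?f = "sheaf_comp X M (snd t) u" and ?g = "sheaf_comp X M (snd a) (snd i')"
    have fg: "?f \<in> sheaf_hom X M A" "?g \<in> sheaf_hom X M A" using comp_hom[OF E'(2) u(1) EL(5)] comp_hom[OF E'(2,5) hm(4)] .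
    \<comment> \<open>Dually, \<open>t u\<close> and \<open>a i'\<close> agree after composition
      with \<open>m\<close> and with \<open>q'\<close>, which determine a map out of the
      pushout.\<close>
    let ?P = "\<lambda>h. h \<in> sheaf_hom X M A \<and> sheaf_comp X H h (snd m) = sheaf_comp X H (snd t) (snd x) \<and>
      sheaf_comp X K h (snd q') = sheaf_comp X K (snd t) (snd l)"
    have "sheaf_comp X F (sheaf_comp X H (snd t) (snd x)) (snd q) = sheaf_comp X F (sheaf_comp X K (snd t) (snd l)) (snd k)"
    proof -
      have "snd x y (snd q y w) = snd l y (snd k y w)" if "y \<in> pts" "w \<in> Car F y" for y w using L2 that by blast
      then show ?thesis using hom_mem[OF E(4)] hom_mem[OF hm(2)] by (simp add: comp_eq_iff comp_apply)
    qed
    then have "\<exists>!h. ?P h"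
      using po DT(5) comp_hom[OF E(2) hm(3) EL(5)] comp_hom[OF EL(1,4,5)] unfolding pushout_square_def by blast
    moreover have "?P ?f" using fg mu hom_mem[OF hm(1)] hom_mem[OF E'(4)] by (simp add: comp_eq_iff comp_apply)
    moreover have "?P ?g"
    proof (intro conjI fg)
      have "snd a y (snd i' y (snd m y w)) = snd t y (snd x y w)" if y: "y \<in> pts" "w \<in> Car H y" for y w
        using L1 L2 y hom_mem[OF E(5) y] by (auto simp: aid_apply)
      then show "sheaf_comp X H ?g (snd m) = sheaf_comp X H (snd t) (snd x)"
        using hom_mem[OF hm(1)] by (simp add: comp_eq_iff comp_apply)
      have "snd a y (snd i' y (snd q' y w)) = snd t y (snd l y w)" if y: "y \<in> pts" "w \<in> Car K y" for y w
      proof -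
        interpret a: sheaf_morphism X G A "snd a" y by unfold_locales (use E EL hm y in auto)
        show ?thesis using E'(8)[OF y] EL(8)[OF y] a.zero by simp
      qed
      then show "sheaf_comp X K ?g (snd q') = sheaf_comp X K (snd t) (snd l)"
        using hom_mem[OF E'(4)] by (simp add: comp_eq_iff comp_apply)
    qed
    ultimately have "?f = ?g" by blast
    then have "ladder arr acmp (aid K) (M, u) a (K, q', M, i', G) (K, l, L, t, A)"
      unfolding alad_iff[OF S' T] using L2 DT D' u(1) mu aid_arr
      by (auto simp: arr_iff comp_eq_iff aid_apply)
    moreover have "acmp (M, u) m = x" using u(2) L1 L2 by (simp add: acmp_def arr_iff prod_eq_iff)
    ultimately show ?thesis by blast
  qed
  show "\<exists>n P d h. ases (M, n, P, d, C) \<and> ladder arr acmp a' h i (A, a, H, q, B) (M, n, P, d, C)"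
    if S: "ases (A, a, H, q, B)" and S': "ases (A, a', M, q', K)"
      and lad: "ladder arr acmp (aid A) m k (A, a', M, q', K) (A, a, H, q, B)"
      and V: "ases (K, v, W, w, Q)" and U: "ases (B, i, C, p, Q)"
      and lad2: "ladder arr acmp k c (aid Q) (K, v, W, w, Q) (B, i, C, p, Q)"
    for A a H q B a' M q' K m k v W w Q i C p c
  proof -
    note D = asesD[OF S] and D' = asesD[OF S'] and DV = asesD[OF V] and DU = asesD[OF U]
    note L1 = lad[unfolded alad_iff[OF S' S]] and L2 = lad2[unfolded alad_iff[OF V U]]
    have hm: "snd m \<in> sheaf_hom X M H" "snd k \<in> sheaf_hom X K B" "snd c \<in> sheaf_hom X W C"
      using L1 L2 by (auto simp: arr_iff)
    have c1: "\<And>x g. x \<in> pts \<Longrightarrow> g \<in> Car A x \<Longrightarrow> snd m x (snd a' x g) = snd a x g"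
      and c2: "\<And>x u. x \<in> pts \<Longrightarrow> u \<in> Car M x \<Longrightarrow> snd q x (snd m x u) = snd k x (snd q' x u)"
      using L1 by (simp_all add: aid_apply)
    have c3: "\<And>x u. x \<in> pts \<Longrightarrow> u \<in> Car K x \<Longrightarrow> snd c x (snd v x u) = snd i x (snd k x u)"
      and c4: "\<And>x u. x \<in> pts \<Longrightarrow> u \<in> Car W x \<Longrightarrow> snd p x (snd c x u) = snd w x u"
      using L2 hom_mem[OF short_exactD(5)[OF DV(6)]] by (simp_all add: aid_apply)
    have "\<exists>n P d h. coherent X P \<and>
      short_exact M n P d C \<and>
      h \<in> sheaf_hom X H P \<and>
      (\<forall>x\<in>pts. \<forall>g\<in>Car A x. h x (snd a x g) = n x (snd a' x g)) \<and>
      (\<forall>x\<in>pts. \<forall>u\<in>Car H x. d x (h x u) = snd i x (snd q x u))"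
    proof (rule mono_glue_exists[OF D(6) D'(6,4) hm(1,2) _ _ DV(6) DU(6,4) hm(3)], fact c1, fact c2, fact c3, fact c4, goal_cases)
      case (1 n P d h)
      then show ?case by (intro exI[of _ n] exI[of _ P] exI[of _ d] exI[of _ h]) simp
    qed
    then obtain n P d h where P: "coherent X P" "short_exact M n P d C" "h \<in> sheaf_hom X H P"
      "\<And>x g. x \<in> pts \<Longrightarrow> g \<in> Car A x \<Longrightarrow> h x (snd a x g) = n x (snd a' x g)"
      "\<And>x u. x \<in> pts \<Longrightarrow> u \<in> Car H x \<Longrightarrow> d x (h x u) = snd i x (snd q x u)"
      by (elim exE conjE) auto
    have N: "ases (M, (M, n), P, (P, d), C)" using P D' DU by (simp add: ases_iff)
    have "ladder arr acmp a' (H, h) i (A, a, H, q, B) (M, (M, n), P, (P, d), C)"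
      unfolding alad_iff[OF S N] using P D D' DU S' U short_exactD(4)[OF D'(6)] short_exactD(4)[OF DU(6)]
      by (auto simp: arr_iff ases_iff)
    then show ?thesis using N by blast
  qed
  show "\<exists>n P d h. ases (C, d, P, n, M) \<and> ladder arr acmp i h a' (C, d, P, n, M) (B, q, H, a, A)"
    if S: "ases (B, q, H, a, A)" and S': "ases (K, q', M, a', A)"
      and lad: "ladder arr acmp k m (aid A) (B, q, H, a, A) (K, q', M, a', A)"
      and V: "ases (Q, w, W, v, K)" and U: "ases (Q, p, C, i, B)"
      and lad2: "ladder arr acmp (aid Q) c k (Q, p, C, i, B) (Q, w, W, v, K)"
    for A a H q B a' M q' K m k v W w Q i C p c
  proof -
    note D = asesD[OF S] and D' = asesD[OF S'] and DV = asesD[OF V] and DU = asesD[OF U]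
    note L1 = lad[unfolded alad_iff[OF S S']] and L2 = lad2[unfolded alad_iff[OF U V]]
    have hm: "snd m \<in> sheaf_hom X H M" "snd k \<in> sheaf_hom X B K" "snd c \<in> sheaf_hom X C W"
      using L1 L2 by (auto simp: arr_iff)
    have c1: "\<And>x u. x \<in> pts \<Longrightarrow> u \<in> Car H x \<Longrightarrow> snd a' x (snd m x u) = snd a x u"
      and c2: "\<And>x u. x \<in> pts \<Longrightarrow> u \<in> Car B x \<Longrightarrow> snd m x (snd q x u) = snd q' x (snd k x u)"
      using L1 hom_mem[OF short_exactD(5)[OF D(6)]] by (simp_all add: aid_apply)
    have c3: "\<And>x u. x \<in> pts \<Longrightarrow> u \<in> Car C x \<Longrightarrow> snd v x (snd c x u) = snd k x (snd i x u)"
      and c4: "\<And>x u. x \<in> pts \<Longrightarrow> u \<in> Car Q x \<Longrightarrow> snd c x (snd p x u) = snd w x u"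
      using L2 by (simp_all add: aid_apply)
    have "\<exists>n P d h. coherent X P \<and>
      short_exact C d P n M \<and>
      h \<in> sheaf_hom X P H \<and>
      (\<forall>x\<in>pts. \<forall>u\<in>Car P x. snd a x (h x u) = snd a' x (n x u)) \<and>
      (\<forall>x\<in>pts. \<forall>u\<in>Car C x. h x (d x u) = snd q x (snd i x u))"
    proof (rule epi_glue_exists[OF D(6) D'(6,4) hm(1,2) _ _ DV(6) DU(6,4) hm(3)], fact c1, fact c2, fact c3, fact c4, goal_cases)
      case (1 n P d h)
      then show ?case by (intro exI[of _ n] exI[of _ P] exI[of _ d] exI[of _ h]) simp
    qed
    then obtain n P d h where P: "coherent X P" "short_exact C d P n M" "h \<in> sheaf_hom X P H"
      "\<And>x u. x \<in> pts \<Longrightarrow> u \<in> Car P x \<Longrightarrow> snd a x (h x u) = snd a' x (n x u)"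
      "\<And>x u. x \<in> pts \<Longrightarrow> u \<in> Car C x \<Longrightarrow> h x (d x u) = snd q x (snd i x u)"
      by (elim exE conjE) auto
    have N: "ases (C, (C, d), P, (P, n), M)" using P D' DU by (simp add: ases_iff)
    have "ladder arr acmp i (P, h) a' (C, (C, d), P, (P, n), M) (B, q, H, a, A)"
      unfolding alad_iff[OF N S] using P D D' DU S' U short_exactD(5)[OF D'(6)] short_exactD(5)[OF DU(6)]
      by (auto simp: arr_iff ases_iff)
    then show ?thesis using N by blast
  qed
qed

end

section \<open>Yoneda extensions\<close>

lemma equivclp_map:
  assumes "equivclp r x y" "\<And>x y. r x y \<Longrightarrow> s (f x) (f y)"
  shows "equivclp s (f x) (f y)"
  using assms(1)
proof (induction rule: equivclp_induct)
  case base
  then show ?case by simp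
next
  case (step y z)
  then have "s (f y) (f z) \<or> s (f z) (f y)" using assms(2) by blast
  then show ?case by (rule equivclp_into_equivclp[OF step(3)])
qed

text \<open>The splices on the two sides of \<open>T\<close> alter its first and its last map. These
  are different maps because \<open>T\<close> has at least two, and an object of \<open>T\<close>
  remains between them.\<close>

lemma yoneda_assoc:
  assumes "length (objs T) \<ge> 3" "length (maps T) \<ge> 2"
  shows "yoneda X (yoneda X S T) E = yoneda X S (yoneda X T E)"
proof -
  obtain a b c os where o: "objs T = a # b # c # os"
    using assms(1) by (metis Suc_le_length_iff numeral_3_eq_3)
  obtain f g ms where m: "maps T = f # g # ms" using assms(2) by (metis Suc_le_length_iff numeral_2_eq_2)
  show ?thesis unfolding yoneda_def o m by (simp add: butlast_append)
qed

text \<open>The strict bound is the form from which \<open>All_less_Suc2\<close> can split off the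
  first map.\<close>

lemma is_extn_alt:
  "is_extn X p F G E \<longleftrightarrow>
     p \<ge> 1 \<and> length (objs E) = p + 2 \<and> length (maps E) = p + 1 \<and> hd (objs E) = G \<and> last (objs E) = F \<and>
     (\<forall>A\<in>set (objs E). coherent X A) \<and>
     (\<forall>i<Suc p. maps E ! i \<in> sheaf_hom X (objs E ! i) (objs E ! Suc i)) \<and>
     (\<forall>x\<in>topspace (base X).
        inj_on (hd (maps E) x) (carrier (stalk G x)) \<and>
        (\<forall>i<p. (maps E ! i) x ` carrier (stalk (objs E ! i) x) =
                 sheaf_ker (objs E ! Suc i) (objs E ! Suc (Suc i)) (maps E ! Suc i) x) \<and>
        last (maps E) x ` carrier (stalk (objs E ! p) x) = carrier (stalk F x))"
  unfolding is_extn_def less_Suc_eq_le by (rule refl)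

lemma is_extn_unique:
  assumes "is_extn X p F G E" "is_extn X p' F' G' E"
  shows "p = p' \<and> F = F' \<and> G = G'"
  using assms by (auto simp: is_extn_def)

context ringed begin

lemma is_extn_short:
  "is_extn X 1 F G (short G i H q F) \<longleftrightarrow> coherent X G \<and> coherent X H \<and> coherent X F \<and> short_exact G i H q F"
  unfolding is_extn_alt short_exact_def coherent_def
  by (simp add: All_less_Suc2 ball_conj_distrib) blast

text \<open>The map \<open>h\<close> is \<open>f\<close> followed by \<open>j\<close>. It has the
  kernel of \<open>f\<close> because \<open>j\<close> is injective, and the image of
  \<open>j\<close> because \<open>f\<close> is onto. As an equivalence this serves both for splicing
  a word and for cutting a sequence.\<close>

lemma is_extn_splice:
  assumes S: "short_exact G i H f K" and coh: "coherent X G" "coherent X H" "coherent X K"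
    and j: "j \<in> sheaf_hom X K H1" "\<And>x. x \<in> pts \<Longrightarrow> inj_on (j x) (Car K x)"
    and h: "h \<in> sheaf_hom X H H1" "\<And>x u. x \<in> pts \<Longrightarrow> u \<in> Car H x \<Longrightarrow> h x u = j x (f x u)"
    and mH1: "module_sheaf X H1"
  shows "is_extn X (Suc (Suc p)) F G \<lparr>objs = G # H # H1 # H2 # os, maps = i # h # g # ms\<rparr> \<longleftrightarrow>
    is_extn X (Suc p) F K \<lparr>objs = K # H1 # H2 # os, maps = j # g # ms\<rparr>"
proof -
  note E = short_exactD[OF S]
  have im: "h x ` Car H x = j x ` Car K x" if x: "x \<in> pts" for x
  proof -
    have "f x ` Car H x = Car K x" using E(9)[OF x] hom_mem[OF E(5) x] by blast
    moreover have "h x ` Car H x = j x ` (f x ` Car H x)" using h(2)[OF x] by (auto simp: image_image)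
    ultimately show ?thesis by simp
  qed
  have ker: "i x ` Car G x = sheaf_ker H H1 h x" if x: "x \<in> pts" for x
  proof -
    interpret j: sheaf_morphism X K H1 j x by unfold_locales (use E mH1 j x in auto)
    have "h x u = \<zero>\<^bsub>stalk H1 x\<^esub> \<longleftrightarrow> f x u = \<zero>\<^bsub>stalk K x\<^esub>" if u: "u \<in> Car H x" for u
      using inj_on_eq_iff[OF j(2)[OF x] hom_mem[OF E(5) x u] j.A.M.zero_closed] h(2)[OF x u] j.zero by simp
    then show ?thesis using S x unfolding short_exact_def sheaf_ker_def by auto
  qed
  show ?thesis
    unfolding is_extn_alt using coh E(4,6) j h(1) im ker by (simp add: All_less_Suc2 cong: conj_cong)
qed

end

section \<open>Words of coherent sheaves and their splices\<close>

context ringed_coded begin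

sublocale cat: exact_cat_dual "coherent X" arr acmp aid zs azt azf ases
  by (rule exact_cat_dual.intro) (rule exact_cat_sheaves)

definition sext where "sext = (\<lambda>(G, i, H, q, F). short G (snd i) H (snd q) F)"

text \<open>Words are nonempty, so the value at the empty list is a dummy.\<close>

primrec yon where
  "yon [] = undefined"
| "yon (s # w) = (if w = [] then sext s else yoneda X (sext s) (yon w))"

lemma sext_simp: "sext (G, i, H, q, F) = short G (snd i) H (snd q) F"
  by (simp add: sext_def)

lemma sext_extn: "ases (G, i, H, q, F) \<Longrightarrow> is_extn X 1 F G (sext (G, i, H, q, F))"
  using asesD[of G i H q F] unfolding sext_simp is_extn_short by blast

lemma extn_shape:
  assumes "is_extn X p F G T"
  obtains H H' os j g ms where "T = \<lparr>objs = G # H # H' # os, maps = j # g # ms\<rparr>" "p = Suc (length ms)"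
    "j \<in> sheaf_hom X G H" "\<And>x. x \<in> pts \<Longrightarrow> inj_on (j x) (Car G x)" "coherent X H"
proof -
  have l: "p \<ge> 1" "length (objs T) = p + 2" "length (maps T) = p + 1" "hd (objs T) = G"
    using assms by (auto simp: is_extn_def)
  obtain G' H H' os where o: "objs T = G' # H # H' # os"
    using l by (metis Suc_le_length_iff numeral_3_eq_3 add_le_mono1 numeral_plus_one semiring_norm(3) one_plus_numeral)
  obtain j g ms where m: "maps T = j # g # ms"
    using l by (metis Suc_le_length_iff numeral_2_eq_2 add_le_mono1 one_add_one)
  have "T = \<lparr>objs = G # H # H' # os, maps = j # g # ms\<rparr>" using o m l(4) by simp
  moreover have "j \<in> sheaf_hom X G H" "\<And>x. x \<in> pts \<Longrightarrow> inj_on (j x) (Car G x)" "coherent X H"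
    using assms o m l(4) by (auto simp: is_extn_alt All_less_Suc2)
  moreover have "p = Suc (length ms)" using l(3) m by simp
  ultimately show thesis using that by blast
qed

lemma word_extn: "cat.word F G w \<Longrightarrow> is_extn X (length w) F G (yon w)"
proof (induction rule: cat.word.induct)
  case (single G i H q F)
  then show ?case using sext_extn by simp
next
  case (cons G i H q K F w)
  have ne: "w \<noteq> []" using cat.word_nonempty[OF cons.hyps(2)] .
  note D = asesD[OF cons.hyps(1)] and E = short_exactD[OF asesD(6)[OF cons.hyps(1)]]
  obtain H1 H2 os j g ms where T: "yon w = \<lparr>objs = K # H1 # H2 # os, maps = j # g # ms\<rparr>" "length w = Suc (length ms)"
      "j \<in> sheaf_hom X K H1" "\<And>x. x \<in> pts \<Longrightarrow> inj_on (j x) (Car K x)" "coherent X H1"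
    using extn_shape[OF cons.IH] by metis
  have y: "yon ((G, i, H, q, K) # w) = \<lparr>objs = G # H # H1 # H2 # os, maps = snd i # sheaf_comp X H j (snd q) # g # ms\<rparr>"
    using ne T(1) by (simp add: sext_simp yoneda_def)
  show ?case
    unfolding y list.size(4) T(2) using cons.IH[unfolded T(1,2)]
    by (simp add: is_extn_splice[OF D(6,3,4,5) T(3,4) comp_hom[OF E(2,5) T(3)] comp_apply coherent_msheaf[OF T(5)]])
qed

lemma yon_append: "cat.word K G v \<Longrightarrow> w \<noteq> [] \<Longrightarrow> yon (v @ w) = yoneda X (yon v) (yon w)"
proof (induction rule: cat.word.induct)
  case (single G i H q F)
  then show ?case by simp
next
  case (cons G i H q K F v)
  have ne: "v \<noteq> []" using cat.word_nonempty[OF cons.hyps(2)] .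
  have e: "is_extn X (length v) F K (yon v)" by (rule word_extn[OF cons.hyps(2)])
  have "yoneda X (yoneda X (sext (G, i, H, q, K)) (yon v)) (yon w) = yoneda X (sext (G, i, H, q, K)) (yoneda X (yon v) (yon w))"
    by (rule yoneda_assoc) (use e in \<open>auto simp: is_extn_def\<close>)
  then show ?case using cons ne by simp
qed

text \<open>The image is of finite type as a quotient of \<open>A\<close>, and its relations are of
  finite type because it is a subsheaf of \<open>B\<close>. The corestriction of \<open>f\<close> is
  \<open>f\<close> itself, so that composing it with the inclusion gives \<open>f\<close> back
  literally.\<close>

lemma image_factor:
  assumes "coherent X A" "coherent X B" "f \<in> sheaf_hom X A B"
  obtains K j where "coherent X K" "f \<in> sheaf_hom X A K" "j \<in> sheaf_hom X K B"
    "\<And>x. x \<in> pts \<Longrightarrow> Car K x = f x ` Car A x" "\<And>x. x \<in> pts \<Longrightarrow> inj_on (j x) (Car K x)"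
    "\<And>x a. x \<in> pts \<Longrightarrow> a \<in> Car A x \<Longrightarrow> j x (f x a) = f x a"
    "\<And>x. x \<in> pts \<Longrightarrow> \<zero>\<^bsub>stalk K x\<^esub> = \<zero>\<^bsub>stalk B x\<^esub>"
proof -
  have mA: "module_sheaf X A" and mB: "module_sheaf X B" using assms coherent_msheaf by auto
  let ?S = "\<lambda>x. f x ` Car A x"
  have S: "submodule_family B ?S" by (rule image_family[OF mA mB assms(3)])
  define K where "K = subsh B ?S"
  have CK: "Car K x = f x ` Car A x" for x by (simp add: K_def subsh_stalk)
  have mK: "module_sheaf X K" unfolding K_def by (rule subsh_module_sheaf[OF mB S])
  let ?j = "\<lambda>x\<in>pts. \<lambda>a\<in>?S x. a"
  have j: "?j \<in> sheaf_hom X K B" unfolding K_def by (rule subsh_incl[OF mB S])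
  have f: "f \<in> sheaf_hom X A K" unfolding K_def by (rule subsh_corestrict[OF mB S mA assms(3)]) simp
  have inj: "inj_on (?j x) (Car K x)" if "x \<in> pts" for x using that by (simp add: CK inj_on_def)
  have "finite_type X K"
    by (rule finite_type_surj[OF mA mK f]) (use assms(1) CK in \<open>auto simp: coherent_def\<close>)
  moreover have "relations_finite_type X K"
    by (rule relations_finite_type_inj[OF mK mB j inj]) (use assms(2) in \<open>auto simp: coherent_def\<close>)
  ultimately have "coherent X K" using mK by (simp add: coherent_def)
  then show thesis by (rule that[OF _ f j CK inj]) (auto simp: K_def subsh_stalk)
qed

text \<open>The sequence is cut at the image of its second map. The first piece is short exact, the
  rest is an extension of smaller degree, and their splice restores the second map itself, so
  equality with \<open>E\<close> holds and not merely an isomorphism.\<close>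

lemma extn_word: "is_extn X p F G E \<Longrightarrow> \<exists>w. cat.word F G w \<and> length w = p \<and> yon w = E"
proof (induction p arbitrary: G E)
  case 0
  then show ?case by (simp add: is_extn_def)
next
  case (Suc p)
  obtain H H1 os i h ms where E: "E = \<lparr>objs = G # H # H1 # os, maps = i # h # ms\<rparr>" "Suc p = Suc (length ms)"
      "i \<in> sheaf_hom X G H" "\<And>x. x \<in> pts \<Longrightarrow> inj_on (i x) (Car G x)" "coherent X H"
    by (rule extn_shape[OF Suc.prems]) blast
  show ?case
  proof (cases p)
    case 0
    then have "ms = []" "os = []" "H1 = F" using E Suc.prems by (auto simp: is_extn_def)
    then have ex: "coherent X G \<and> coherent X H \<and> coherent X F \<and> short_exact G i H h F"
      by (intro iffD1[OF is_extn_short[unfolded One_nat_def]]) (use Suc.prems 0 in \<open>simp add: E(1)\<close>)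
    let ?s = "(G, (G, i), H, (H, h), F)"
    have "ases ?s" using ex by (simp add: ases_iff)
    then show ?thesis using 0 E(1) \<open>ms = []\<close> \<open>os = []\<close> \<open>H1 = F\<close>
      by (intro exI[of _ "[?s]"]) (simp add: cat.word_single_iff sext_simp)
  next
    case (Suc p')
    obtain g ms' where ms: "ms = g # ms'" using E(2) Suc by (cases ms) auto
    obtain H2 os' where os: "os = H2 # os'" using Suc.prems E(1) Suc by (cases os) (auto simp: is_extn_def)
    have c: "coherent X G" "coherent X H1" and hh: "h \<in> sheaf_hom X H H1"
      and ker: "\<And>x. x \<in> pts \<Longrightarrow> i x ` Car G x = sheaf_ker H H1 h x"
      using Suc.prems by (auto simp: E(1) ms os is_extn_alt All_less_Suc2)
    obtain K j where K: "coherent X K" "h \<in> sheaf_hom X H K" "j \<in> sheaf_hom X K H1"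
      "\<And>x. x \<in> pts \<Longrightarrow> Car K x = h x ` Car H x" "\<And>x. x \<in> pts \<Longrightarrow> inj_on (j x) (Car K x)"
      "\<And>x a. x \<in> pts \<Longrightarrow> a \<in> Car H x \<Longrightarrow> j x (h x a) = h x a"
      "\<And>x. x \<in> pts \<Longrightarrow> \<zero>\<^bsub>stalk K x\<^esub> = \<zero>\<^bsub>stalk H1 x\<^esub>"
      by (rule image_factor[OF E(5) c(2) hh]) (rule that)
    have S: "short_exact G i H h K"
      unfolding short_exact_def using c(1) E(3,4,5) K(1,2,4,7) ker by (simp add: sheaf_ker_def coherent_msheaf)
    have "is_extn X p F K \<lparr>objs = K # H1 # os, maps = j # ms\<rparr>"
      using Suc.prems is_extn_splice[OF S c(1) E(5) K(1,3,5) hh K(6)[symmetric] coherent_msheaf[OF c(2)]]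
      unfolding E(1) ms os Suc by blast
    from Suc.IH[OF this] obtain w where w: "cat.word F K w" "length w = p" "yon w = \<lparr>objs = K # H1 # os, maps = j # ms\<rparr>" by blast
    let ?s = "(G, (G, i), H, (H, h), K)"
    have "ases ?s" using S c(1) E(5) K(1) by (simp add: ases_iff)
    then have "cat.word F G (?s # w)" using w(1) by (rule cat.word.cons)
    moreover have "sheaf_comp X H j h = h" using K(6) by (simp add: comp_eq_hom_iff[OF hh])
    then have "yon (?s # w) = E"
      using cat.word_nonempty[OF w(1)] w(3) by (simp add: sext_simp yoneda_def E(1))
    ultimately show ?thesis using w(2) by (intro exI[of _ "?s # w"]) simp
  qed
qed

text \<open>Words with the same splice share all middle terms and differ only in the objects at
  which they are cut. The middle rungs are identities, and a rung between two cut objects is the map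
  induced on cokernels. The left ends may differ by a map \<open>k\<close> because this is what the
  induction meets in the tails.\<close>

lemma yon_eq_wmor_gen:
  "cat.word F G w \<Longrightarrow> cat.word F G' w' \<Longrightarrow> k \<in> arr G G' \<Longrightarrow> objs (yon w) = G # os \<Longrightarrow> objs (yon w') = G' # os \<Longrightarrow>
    maps (yon w) = j # ms \<Longrightarrow> maps (yon w') = j' # ms \<Longrightarrow>
    (\<And>x g. x \<in> pts \<Longrightarrow> g \<in> Car G x \<Longrightarrow> j' x (snd k x g) = j x g) \<Longrightarrow> cat.wmor k (aid F) w w'"
proof (induction arbitrary: G' w' k os j ms j' rule: cat.word.induct)
  case (single G i H q F)
  have os: "os = [H, F]" using single.prems(3) by (simp add: sext_simp)
  have "length w' = 1" using single.prems(4) word_extn[OF single.prems(1)] by (simp add: os is_extn_def)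
  then obtain G2 i' H' q' F' where w': "w' = [(G2, i', H', q', F')]" by (metis One_nat_def cat.length_one_seqE)
  then have S': "ases (G', i', H', q', F)" "G2 = G'" "F' = F" using single.prems(1) by (auto simp: cat.word_single_iff)
  have e: "H' = H" "snd q' = snd q" "j = snd i" "j' = snd i'" using single.prems(3-6) by (auto simp: w' sext_simp)
  have "ladder arr acmp k (aid H) (aid F) (G, i, H, q, F) (G', i', H', q', F)"
    unfolding alad_iff[OF single.hyps S'(1)]
    using single.prems(2,7) e aid_arr asesD[OF single.hyps] hom_mem[OF short_exactD(4)[OF asesD(6)[OF single.hyps]]]
      hom_mem[OF short_exactD(5)[OF asesD(6)[OF single.hyps]]]
    by (simp add: aid_apply)
  then show ?case unfolding w' S' by (rule cat.wmor.single)
next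
  case (cons G i H q K F v)
  have ne: "v \<noteq> []" using cat.word_nonempty[OF cons.hyps(2)] .
  obtain H1 H2 os1 f g ms1 where v: "yon v = \<lparr>objs = K # H1 # H2 # os1, maps = f # g # ms1\<rparr>" "length v = Suc (length ms1)"
      "f \<in> sheaf_hom X K H1" "coherent X H1"
    using extn_shape[OF word_extn[OF cons.hyps(2)]] by metis
  have y: "yon ((G, i, H, q, K) # v) = \<lparr>objs = G # H # H1 # H2 # os1, maps = snd i # sheaf_comp X H f (snd q) # g # ms1\<rparr>"
    using ne v(1) by (simp add: sext_simp yoneda_def)
  have lw: "length w' = Suc (length v)"
    using cons.prems(5,6) word_extn[OF cons.prems(1)] unfolding y by (auto simp: is_extn_def v(2))
  then obtain G2 i' H' q' K' v' where w': "w' = (G2, i', H', q', K') # v'" "length v' = length v"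
    by (metis cat.length_Suc_seqE)
  have ne': "v' \<noteq> []" using w'(2) ne by auto
  have S': "ases (G', i', H', q', K')" "G2 = G'" "cat.word F K' v'"
    using cons.prems(1) unfolding w'(1) cat.word_cons_iff[OF ne'] by auto
  obtain H1' H2' os1' f' g' ms1' where v': "yon v' = \<lparr>objs = K' # H1' # H2' # os1', maps = f' # g' # ms1'\<rparr>"
      "f' \<in> sheaf_hom X K' H1'" "coherent X H1'"
    using extn_shape[OF word_extn[OF S'(3)]] by metis
  have y': "yon w' = \<lparr>objs = G' # H' # H1' # H2' # os1', maps = snd i' # sheaf_comp X H' f' (snd q') # g' # ms1'\<rparr>"
    using ne' v'(1) by (simp add: w'(1) S'(2) sext_simp yoneda_def)
  have e: "H' = H" "H1' = H1" "H2' = H2" "os1' = os1" "j = snd i" "j' = snd i'"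
    "sheaf_comp X H f (snd q) = sheaf_comp X H' f' (snd q')" "g' = g" "ms1' = ms1"
    using cons.prems(3-6) unfolding y y' by auto
  note D = asesD[OF cons.hyps(1)] and D' = asesD[OF S'(1)]
  note E = short_exactD[OF D(6)] and E' = short_exactD[OF D'(6)]
  have kh: "snd k \<in> sheaf_hom X G G'" using cons.prems(2) by (simp add: arr_iff)
  \<comment> \<open>By hypothesis \<open>i\<close> is \<open>k\<close> followed by
    \<open>i'\<close>, so \<open>q'\<close> kills the image of \<open>i\<close> and descends to the
    cokernel \<open>K\<close>.\<close>
  have z: "snd q' x (snd i x u) = \<zero>\<^bsub>stalk K' x\<^esub>" if "x \<in> pts" "u \<in> Car G x" for x u
    using E'(8)[OF that(1) hom_mem[OF kh that]] cons.prems(7)[OF that] by (simp add: e)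
  obtain l where l: "l \<in> sheaf_hom X K K'" "\<And>x u. x \<in> pts \<Longrightarrow> u \<in> Car H x \<Longrightarrow> l x (snd q x u) = snd q' x u"
    using cokernel_factor[OF D(6) E'(3) E'(5)[unfolded e(1)] z] by blast
  have la: "(K, l) \<in> arr K K'" using l(1) D D' by (simp add: arr_iff)
  have "cat.wmor (K, l) (aid F) v v'"
  proof (rule cons.IH[OF S'(3) la])
    show "objs (yon v) = K # H1 # H2 # os1" "objs (yon v') = K' # H1 # H2 # os1"
      "maps (yon v) = f # g # ms1" "maps (yon v') = f' # g # ms1"
      using v(1) v'(1) e by simp_all
    fix x u assume x: "x \<in> pts" and u: "u \<in> Car K x"
    then obtain w where "w \<in> Car H x" "u = snd q x w" using E(9) by blast
    moreover have "f x (snd q x w) = f' x (snd q' x w)" if "w \<in> Car H x" for w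
      using e(7) x that unfolding e(1) comp_eq_iff by blast
    ultimately show "f' x (snd (K, l) x u) = f x u" using l(2)[OF x] by simp
  qed
  moreover have "ladder arr acmp k (aid H) (K, l) (G, i, H, q, K) (G', i', H', q', K')"
    unfolding alad_iff[OF cons.hyps(1) S'(1)] using cons.prems(2,7) la aid_arr[OF D(4)] l(2) hom_mem[OF E(4)]
    by (simp add: aid_apply e)
  ultimately show ?case unfolding w'(1) S'(2) by (intro cat.wmor.cons)
qed

lemma yon_eq_wmor:
  assumes "cat.word F G w" "cat.word F G w'" "yon w = yon w'"
  shows "cat.wmor (aid G) (aid F) w w'"
proof -
  obtain H H' os j g ms where "yon w = \<lparr>objs = G # H # H' # os, maps = j # g # ms\<rparr>"
    by (rule extn_shape[OF word_extn[OF assms(1)]])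
  moreover have "coherent X G" using cat.word_obj[OF assms(1)] by simp
  ultimately show ?thesis
    using yon_eq_wmor_gen[OF assms(1,2) aid_arr, of "H # H' # os" j "g # ms" j] assms(3) by (simp add: aid_apply)
qed

lemma yon_eq_weq: "cat.word F G w \<Longrightarrow> cat.word F G w' \<Longrightarrow> yon w = yon w' \<Longrightarrow> cat.weq F G w w'"
  using yon_eq_wmor cat.weq_step by blast

section \<open>Pullback and pushout extensions as ladders\<close>

lemma ladder_pullback_short:
  assumes S': "ases (G, i', M, q', K)" and S: "ases (G, i, H, q, F)"
    and l: "ladder arr acmp (aid G) m k (G, i', M, q', K) (G, i, H, q, F)"
  shows "pullback_short X (snd k) K (sext (G, i, H, q, F)) (sext (G, i', M, q', K))"
proof -
  note D = asesD[OF S] and D' = asesD[OF S'] and L = l[unfolded alad_iff[OF S' S]]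
  have hm: "snd m \<in> sheaf_hom X M H" "snd k \<in> sheaf_hom X K F" using L by (auto simp: arr_iff)
  have "pullback_square X H K F (snd q) (snd k) M (snd m) (snd q')"
    by (rule pullback_square_ladder[OF D(6) D'(6,4) hm]) (use L in \<open>auto simp: aid_apply\<close>)
  moreover have "sheaf_comp X G (snd m) (snd i') = snd i"
    unfolding comp_eq_hom_iff[OF short_exactD(4)[OF D(6)]] using L by (simp add: aid_apply)
  ultimately show ?thesis
    unfolding pullback_short_def using sext_extn[OF S] sext_extn[OF S'] hm(2) unfolding sext_simp by blast
qed

lemma ladder_pushout_short:
  assumes S: "ases (G, i, H, q, F)" and S': "ases (K, i', M, q', F)"
    and l: "ladder arr acmp k m (aid F) (G, i, H, q, F) (K, i', M, q', F)"
  shows "pushout_short X (snd k) K (sext (G, i, H, q, F)) (sext (K, i', M, q', F))"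
proof -
  note D = asesD[OF S] and D' = asesD[OF S'] and L = l[unfolded alad_iff[OF S S']]
  have hm: "snd m \<in> sheaf_hom X H M" "snd k \<in> sheaf_hom X G K" using L by (auto simp: arr_iff)
  note q = hom_mem[OF short_exactD(5)[OF D(6)]]
  have "pushout_square X G H K (snd i) (snd k) M (snd m) (snd i')"
    by (rule pushout_square_ladder[OF D(6) D'(6,4) hm]) (use L q in \<open>auto simp: aid_apply\<close>)
  moreover have "sheaf_comp X H (snd q') (snd m) = snd q"
    unfolding comp_eq_hom_iff[OF short_exactD(5)[OF D(6)]] using L q by (simp add: aid_apply)
  ultimately show ?thesis
    unfolding pushout_short_def using sext_extn[OF S] sext_extn[OF S'] hm(2) unfolding sext_simp by blast
qed

lemma short_ases: "is_extn X 1 F G (short G i H q F) \<Longrightarrow> ases (G, (G, i), H, (H, q), F)"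
  unfolding is_extn_short by (simp add: ases_iff)

lemma pullback_short_ladder:
  assumes "pullback_short X \<gamma> K S S'"
  obtains G i H q F i' M q' m where "ases (G, i, H, q, F)" "ases (G, i', M, q', K)"
    "S = sext (G, i, H, q, F)" "S' = sext (G, i', M, q', K)" "(K, \<gamma>) \<in> arr K F"
    "ladder arr acmp (aid G) m (K, \<gamma>) (G, i', M, q', K) (G, i, H, q, F)"
proof -
  obtain G i H q F i' M q' m where *: "S = short G i H q F" "S' = short G i' M q' K"
    "is_extn X 1 F G S" "is_extn X 1 K G S'" "\<gamma> \<in> sheaf_hom X K F"
    "pullback_square X H K F q \<gamma> M m q'" "sheaf_comp X G m i' = i"
    using assms unfolding pullback_short_def by blast
  have s: "ases (G, (G, i), H, (H, q), F)" "ases (G, (G, i'), M, (M, q'), K)" using short_ases * by auto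
  have m: "m \<in> sheaf_hom X M H" "sheaf_comp X M q m = sheaf_comp X M \<gamma> q'" using *(6) by (auto simp: pullback_square_def)
  have ih: "i \<in> sheaf_hom X G H" using short_exactD(4)[OF asesD(6)[OF s(1)]] by simp
  have "ladder arr acmp (aid G) (M, m) (K, \<gamma>) (G, (G, i'), M, (M, q'), K) (G, (G, i), H, (H, q), F)"
    unfolding alad_iff[OF s(2,1)] using m asesD[OF s(1)] asesD[OF s(2)] *(5,7) aid_arr
    by (auto simp: arr_iff comp_eq_iff comp_eq_hom_iff[OF ih] aid_apply)
  then show thesis using that[OF s] * asesD[OF s(1)] asesD[OF s(2)] by (simp add: sext_simp arr_iff)
qed

lemma pushout_short_ladder:
  assumes "pushout_short X \<alpha> K S S'"
  obtains G i H q F i' M q' m where "ases (G, i, H, q, F)" "ases (K, i', M, q', F)"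
    "S = sext (G, i, H, q, F)" "S' = sext (K, i', M, q', F)" "(G, \<alpha>) \<in> arr G K"
    "ladder arr acmp (G, \<alpha>) m (aid F) (G, i, H, q, F) (K, i', M, q', F)"
proof -
  obtain G i H q F i' M q' m where *: "S = short G i H q F" "S' = short K i' M q' F"
    "is_extn X 1 F G S" "is_extn X 1 F K S'" "\<alpha> \<in> sheaf_hom X G K"
    "pushout_square X G H K i \<alpha> M m i'" "sheaf_comp X H q' m = q"
    using assms unfolding pushout_short_def by blast
  have s: "ases (G, (G, i), H, (H, q), F)" "ases (K, (K, i'), M, (M, q'), F)" using short_ases * by auto
  have m: "m \<in> sheaf_hom X H M" "sheaf_comp X G m i = sheaf_comp X G i' \<alpha>" using *(6) by (auto simp: pushout_square_def)
  have qh: "q \<in> sheaf_hom X H F" using short_exactD(5)[OF asesD(6)[OF s(1)]] by simp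
  have "ladder arr acmp (G, \<alpha>) (H, m) (aid F) (G, (G, i), H, (H, q), F) (K, (K, i'), M, (M, q'), F)"
    unfolding alad_iff[OF s] using m asesD[OF s(1)] asesD[OF s(2)] *(5,7) aid_arr hom_mem[OF qh]
    by (auto simp: arr_iff comp_eq_iff comp_eq_hom_iff[OF qh] aid_apply)
  then show thesis using that[OF s] * asesD[OF s(1)] asesD[OF s(2)] by (simp add: sext_simp arr_iff)
qed

end

context exact_cat_dual begin

lemma wstep_length: "wstep w w' \<Longrightarrow> length w = length w'"
  by (induction rule: wstep.induct) simp_all

lemma weq_refl: "weq F G w w"
  by (simp add: weq_def)

lemma pushout_word:
  assumes "word F G w" "a \<in> hom G G'"
  obtains v where "word F G' v" "wmor a (idm F) w v"
proof -
  obtain v where "op.word G' F v" "op.wmor (idm F) a v (flips w)"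
    using op.pullback_word[OF word_flips[OF assms(1)] assms(2)] by metis
  then show thesis using that op_word_flips op_wmor_flips[of "idm F" a v "flips w"] by (metis flips_flips)
qed

end

context ringed_coded begin

lemma ladder_short_iso:
  assumes S: "ases (G, i, H, q, F)" and S': "ases (G, i', H', q', F)"
    and l: "ladder arr acmp (aid G) m (aid F) (G, i, H, q, F) (G, i', H', q', F)"
  shows "short_iso X (sext (G, i, H, q, F)) (sext (G, i', H', q', F))"
proof -
  note D = asesD[OF S] and D' = asesD[OF S'] and L = l[unfolded alad_iff[OF S S']]
  have hm: "snd m \<in> sheaf_hom X H H'" using L by (auto simp: arr_iff)
  note q = hom_mem[OF short_exactD(5)[OF D(6)]]
  have "sheaf_iso X H H' (snd m)"
    by (rule ladder_sheaf_iso[OF D'(6) D(6) D(4) D'(4) hm]) (use L q in \<open>auto simp: aid_apply\<close>)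
  moreover have "sheaf_comp X G (snd m) (snd i) = snd i'"
    unfolding comp_eq_hom_iff[OF short_exactD(4)[OF D'(6)]] using L by (simp add: aid_apply)
  moreover have "sheaf_comp X H (snd q') (snd m) = snd q"
    unfolding comp_eq_hom_iff[OF short_exactD(5)[OF D(6)]] using L q by (simp add: aid_apply)
  ultimately show ?thesis
    unfolding short_iso_def using sext_extn[OF S] sext_extn[OF S'] unfolding sext_simp by blast
qed

lemma short_iso_ladder:
  assumes "short_iso X S S'"
  obtains G i H q F i' H' q' m where "ases (G, i, H, q, F)" "ases (G, i', H', q', F)"
    "S = sext (G, i, H, q, F)" "S' = sext (G, i', H', q', F)"
    "ladder arr acmp (aid G) m (aid F) (G, i, H, q, F) (G, i', H', q', F)"
proof -
  obtain G i H q F i' H' q' m where *: "S = short G i H q F" "S' = short G i' H' q' F"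
    "is_extn X 1 F G S" "is_extn X 1 F G S'" "m \<in> sheaf_hom X H H'" "sheaf_comp X G m i = i'" "sheaf_comp X H q' m = q"
    using assms unfolding short_iso_def sheaf_iso_def by blast
  have s: "ases (G, (G, i), H, (H, q), F)" "ases (G, (G, i'), H', (H', q'), F)" using short_ases * by auto
  have ih: "i' \<in> sheaf_hom X G H'" "q \<in> sheaf_hom X H F"
    using short_exactD(4)[OF asesD(6)[OF s(2)]] short_exactD(5)[OF asesD(6)[OF s(1)]] by auto
  have c: "\<forall>x\<in>pts. \<forall>t\<in>Car G x. m x (i x t) = i' x t" "\<forall>x\<in>pts. \<forall>t\<in>Car H x. q' x (m x t) = q x t"
    using *(6) *(7) comp_eq_hom_iff[OF ih(1)] comp_eq_hom_iff[OF ih(2)] by blast+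
  have "ladder arr acmp (aid G) (H, m) (aid F) (G, (G, i), H, (H, q), F) (G, (G, i'), H', (H', q'), F)"
    unfolding alad_iff[OF s] using c *(5) asesD[OF s(1)] asesD[OF s(2)] aid_arr hom_mem[OF ih(2)]
    by (auto simp: arr_iff aid_apply)
  then show thesis using that[OF s] * by (simp add: sext_simp)
qed

section \<open>Yoneda equivalence of sequences compared with equivalence of words\<close>

lemma wstep_extn: "cat.wstep w w' \<Longrightarrow> extn_step X (yon w) (yon w')"
proof (induction rule: cat.wstep.induct)
  case (iso G i H q F i' H' q' m)
  show ?case using extn_step.iso[OF ladder_short_iso[OF iso]] by simp
next
  case (switch G i' H' q' K' i H q K m b j' L' l' F j L l n)
  have "snd b \<in> sheaf_hom X K' K" using switch(3) unfolding alad_iff[OF switch(1,2)] by (simp add: arr_iff)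
  from extn_step.switch[OF sext_extn[OF switch(2)] sext_extn[OF switch(4)] this
      ladder_pullback_short[OF switch(1,2,3)] ladder_pushout_short[OF switch(4,5,6)]]
  show ?case by simp
next
  case (left w w' F K G v)
  have "is_extn X (length w) F K (yon w')" using word_extn[OF left(3)] cat.wstep_length[OF left(1)] by simp
  from extn_step.left[OF left(5) word_extn[OF left(2)] this word_extn[OF left(4)]]
  show ?case using yon_append[OF left(4)] cat.word_nonempty[OF left(2)] cat.word_nonempty[OF left(3)] by simp
next
  case (right v v' K G F w)
  have "is_extn X (length v) K G (yon v')" using word_extn[OF right(3)] cat.wstep_length[OF right(1)] by simp
  from extn_step.right[OF right(5) word_extn[OF right(2)] this word_extn[OF right(4)]]
  show ?case using yon_append[OF right(2)] yon_append[OF right(3)] cat.word_nonempty[OF right(4)] by simp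
qed

lemma yon_unique: "cat.word F G w \<Longrightarrow> is_extn X p F' G' (yon w) \<Longrightarrow> p = length w \<and> F' = F \<and> G' = G"
  using is_extn_unique word_extn by metis

text \<open>Different words can have the same splice, so a step between sequences yields only some
  pair of words over its ends. In the cases \<open>left\<close> and \<open>right\<close> a word is
  chosen for the fixed factor.\<close>

lemma extn_step_weq:
  "extn_step X E E' \<Longrightarrow> \<exists>F G w w'. cat.word F G w \<and> cat.word F G w' \<and> yon w = E \<and> yon w' = E' \<and> cat.weq F G w w'"
proof (induction rule: extn_step.induct)
  case (iso S S')
  obtain G i H q F i' H' q' m where *: "ases (G, i, H, q, F)" "ases (G, i', H', q', F)"
    "S = sext (G, i, H, q, F)" "S' = sext (G, i', H', q', F)"
    "ladder arr acmp (aid G) m (aid F) (G, i, H, q, F) (G, i', H', q', F)"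
    using short_iso_ladder[OF iso] by metis
  show ?case
    by (intro exI[of _ F] exI[of _ G] exI[of _ "[(G, i, H, q, F)]"] exI[of _ "[(G, i', H', q', F)]"] conjI
        cat.word.single cat.weq_step cat.wmor.single *(1,2)) (use *(3-5) in simp_all)
next
  case (switch K G S F K' S' \<beta> S\<beta> \<beta>S')
  obtain G1 i H q K1 i' M q' m where P: "ases (G1, i, H, q, K1)" "ases (G1, i', M, q', K')"
    "S = sext (G1, i, H, q, K1)" "S\<beta> = sext (G1, i', M, q', K')"
    "ladder arr acmp (aid G1) m (K', \<beta>) (G1, i', M, q', K') (G1, i, H, q, K1)"
    by (rule pullback_short_ladder[OF switch(4)]) (rule that)
  have "K1 = K" using is_extn_unique[OF switch(1) sext_extn[OF P(1)[folded P(3)], folded P(3)]]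
    using is_extn_unique[OF switch(1)] sext_extn[OF P(1)] P(3) by metis
  note P = P[unfolded this]
  obtain K2 j L l F2 j' N l' n where T: "ases (K2, j, L, l, F2)" "ases (K, j', N, l', F2)"
    "S' = sext (K2, j, L, l, F2)" "\<beta>S' = sext (K, j', N, l', F2)"
    "ladder arr acmp (K2, \<beta>) n (aid F2) (K2, j, L, l, F2) (K, j', N, l', F2)"
    by (rule pushout_short_ladder[OF switch(5)]) (rule that)
  have "K2 = K'" using is_extn_unique[OF switch(2)] sext_extn[OF T(1)] T(3) by metis
  note T = T[unfolded this]
  let ?w = "[(G1, i', M, q', K'), (K', j, L, l, F2)]" and ?w' = "[(G1, i, H, q, K), (K, j', N, l', F2)]"
  have w: "cat.word F2 G1 ?w" "cat.word F2 G1 ?w'" using P T by (simp_all add: cat.word_cons_iff cat.word_single_iff)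
  have "cat.wmor (aid G1) (aid F2) ?w ?w'" by (rule cat.wmor.cons[OF P(5)]) (rule cat.wmor.single[OF T(5)])
  then have "cat.weq F2 G1 ?w ?w'" by (rule cat.weq_step[OF w])
  then show ?case using w P(3,4) T(3,4)
    by (intro exI[of _ F2] exI[of _ G1] exI[of _ ?w] exI[of _ ?w']) simp
next
  case (left E E' q F K p G T)
  obtain F1 K1 w w' where w: "cat.word F1 K1 w" "cat.word F1 K1 w'" "yon w = E" "yon w' = E'" "cat.weq F1 K1 w w'"
    using left by metis
  have e: "F1 = F" "K1 = K" using yon_unique[OF w(1)] left w(3) by metis+
  note w = w[unfolded e]
  obtain v where v: "cat.word K G v" "yon v = T" using extn_word[OF left(4)] by blast
  show ?case
    by (intro exI[of _ F] exI[of _ G] exI[of _ "v @ w"] exI[of _ "v @ w'"] conjI cat.word_append[OF v(1)] w(1,2)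
        cat.weq_append_left[OF w(5) v(1)])
      (use yon_append[OF v(1)] cat.word_nonempty[OF w(1)] cat.word_nonempty[OF w(2)] w v in simp_all)
next
  case (right E E' q K G p F T)
  obtain K1 G1 w w' where w: "cat.word K1 G1 w" "cat.word K1 G1 w'" "yon w = E" "yon w' = E'" "cat.weq K1 G1 w w'"
    using right by metis
  have e: "K1 = K" "G1 = G" using yon_unique[OF w(1)] right w(3) by metis+
  note w = w[unfolded e]
  obtain v where v: "cat.word F K v" "yon v = T" using extn_word[OF right(4)] by blast
  show ?case
    by (intro exI[of _ F] exI[of _ G] exI[of _ "w @ v"] exI[of _ "w' @ v"] conjI cat.word_append[OF w(1) v(1)]
        cat.word_append[OF w(2) v(1)] cat.weq_append_right[OF w(5) v(1)])
      (use yon_append[OF w(1)] yon_append[OF w(2)] cat.word_nonempty[OF v(1)] w v in simp_all)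
qed

text \<open>Consecutive steps may choose different words over the sequence that they share;
  \<open>yon_eq_weq\<close> links these.\<close>

lemma equiv_yon:
  assumes "equivclp (extn_step X) (yon w) E" "cat.word F G w"
  shows "\<exists>u. cat.word F G u \<and> yon u = E \<and> cat.weq F G w u"
  using assms(1)
proof (induction rule: equivclp_induct)
  case base
  show ?case using assms(2) cat.weq_refl by blast
next
  case (step y z)
  obtain u where u: "cat.word F G u" "yon u = y" "cat.weq F G w u" using step.IH by blast
  obtain F1 G1 a b where a: "cat.word F1 G1 a" "cat.word F1 G1 b" "yon a = y" "yon b = z" "cat.weq F1 G1 a b"
    using step(2) extn_step_weq cat.weq_sym by metis
  have e: "F1 = F" "G1 = G" using yon_unique[OF u(1), of _ F1 G1] word_extn[OF a(1)] a(3) u(2) by metis+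
  note a = a[unfolded e]
  have "cat.weq F G u a" using yon_eq_weq[OF u(1) a(1)] u(2) a(3) by simp
  then show ?case using a cat.weq_trans[OF u(3)] cat.weq_trans by blast
qed

text \<open>This is the passage from classes of sequences to classes of words. One inclusion lifts a
  zigzag of sequences to words; for the other, morphisms of words are factored into elementary
  steps, which splice to steps between sequences.\<close>

lemma ext_class_yon:
  assumes "cat.word F G w"
  shows "ext_class X (yon w) = yon ` {u. cat.weq F G w u}"
proof (intro equalityI subsetI)
  fix E assume "E \<in> ext_class X (yon w)"
  then show "E \<in> yon ` {u. cat.weq F G w u}" using equiv_yon[OF _ assms] unfolding ext_class_def by blast
next
  fix E assume "E \<in> yon ` {u. cat.weq F G w u}"
  then obtain u where "E = yon u" "cat.weq F G w u" by blast
  then show "E \<in> ext_class X (yon w)"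
    using equivclp_map[where r = cat.wstep and s = "extn_step X" and f = yon, OF cat.weq_imp_wstep wstep_extn] unfolding ext_class_def by simp
qed

lemma ext_class_eqI:
  assumes "cat.word F G w" "cat.weq F G w u"
  shows "ext_class X (yon w) = ext_class X (yon u)"
proof -
  have "cat.word F G u" using assms cat.weq_word by blast
  moreover have "{v. cat.weq F G w v} = {v. cat.weq F G u v}"
    using assms(2) cat.weq_trans cat.weq_sym by blast
  ultimately show ?thesis using ext_class_yon assms(1) by simp
qed

lemma ext_class_eq_iff:
  assumes "cat.word F G w" "cat.word F G u"
  shows "ext_class X (yon w) = ext_class X (yon u) \<longleftrightarrow> cat.weq F G w u"
proof
  assume "ext_class X (yon w) = ext_class X (yon u)"
  then have "yon u \<in> yon ` {v. cat.weq F G w v}"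
    using ext_class_yon[OF assms(1)] ext_class_yon[OF assms(2)] cat.weq_refl by blast
  then obtain v where v: "yon v = yon u" "cat.weq F G w v" by auto
  then have "cat.weq F G v u" using yon_eq_weq assms cat.weq_word by blast
  then show "cat.weq F G w u" using v cat.weq_trans by blast
qed (rule ext_class_eqI[OF assms(1)])

section \<open>The operations on Ext in terms of words\<close>

lemma Ext_iff: "R \<in> Ext X p F G \<longleftrightarrow> (\<exists>w. cat.word F G w \<and> length w = p \<and> R = ext_class X (yon w))"
  unfolding Ext_def using extn_word word_extn by blast

text \<open>Concatenation respects the equivalence of words in both factors, so the union that
  defines \<open>ext_star\<close> is a union of copies of one class.\<close>

lemma ext_star_yon:
  assumes "cat.word K G w" "cat.word F K u"
  shows "ext_star X (ext_class X (yon w)) (ext_class X (yon u)) = ext_class X (yon (w @ u))"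
proof -
  have "ext_class X (yoneda X S T) = ext_class X (yon (w @ u))"
    if h: "S \<in> ext_class X (yon w)" "T \<in> ext_class X (yon u)" for S T
  proof -
    obtain w' u' where *: "S = yon w'" "cat.weq K G w w'" "T = yon u'" "cat.weq F K u u'"
      using h unfolding ext_class_yon[OF assms(1)] ext_class_yon[OF assms(2)] by blast
    have wd: "cat.word K G w'" "cat.word F K u'" using * assms cat.weq_word by blast+
    have "cat.weq F G (w @ u) (w' @ u')"
      using cat.weq_trans[OF cat.weq_append_right[OF *(2) assms(2)] cat.weq_append_left[OF *(4) wd(1)]] .
    from ext_class_eqI[OF cat.word_append[OF assms] this]
    show ?thesis using * yon_append[OF wd(1)] cat.word_nonempty[OF wd(2)] by simp
  qed
  moreover have "yon w \<in> ext_class X (yon w)" "yon u \<in> ext_class X (yon u)" by (simp_all add: ext_class_def)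
  ultimately show ?thesis unfolding ext_star_def by blast
qed

text \<open>The relation \<open>pullback_extn\<close> may split off the last short sequence at
  another object than \<open>w\<close> does. This is the reason for the word \<open>v\<close>, which
  has the splice of \<open>w\<close> but need not be \<open>w\<close>.\<close>

lemma pullback_extn_word:
  assumes "cat.word F G w" "pullback_extn X \<gamma> F' (yon w) E'"
  obtains v v' where "cat.word F G v" "yon v = yon w" "cat.word F' G v'" "yon v' = E'" "cat.wmor (aid G) (F', \<gamma>) v' v"
proof -
  consider "pullback_short X \<gamma> F' (yon w) E'" | G1 K F1 q S S' T where "is_extn X 1 F1 K S" "is_extn X q K G1 T"
      "pullback_short X \<gamma> F' S S'" "yon w = yoneda X T S" "E' = yoneda X T S'"
    using assms(2) unfolding pullback_extn_def by blast
  then show thesis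
  proof cases
    case 1
    obtain G1 i H q F1 i' M q' m where P: "ases (G1, i, H, q, F1)" "ases (G1, i', M, q', F')"
      "yon w = sext (G1, i, H, q, F1)" "E' = sext (G1, i', M, q', F')"
      "ladder arr acmp (aid G1) m (F', \<gamma>) (G1, i', M, q', F') (G1, i, H, q, F1)"
      by (rule pullback_short_ladder[OF 1]) (rule that)
    have e: "G1 = G" "F1 = F" using yon_unique[OF assms(1)] sext_extn[OF P(1)] P(3) by metis+
    show thesis
      by (rule that[of "[(G, i, H, q, F)]" "[(G, i', M, q', F')]"])
        (use P in \<open>simp_all add: e cat.word_single_iff cat.wmor.single\<close>)
  next
    case 2
    obtain K2 i H q F2 i' M q' m where P: "ases (K2, i, H, q, F2)" "ases (K2, i', M, q', F')"
      "S = sext (K2, i, H, q, F2)" "S' = sext (K2, i', M, q', F')"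
      "ladder arr acmp (aid K2) m (F', \<gamma>) (K2, i', M, q', F') (K2, i, H, q, F2)"
      by (rule pullback_short_ladder[OF 2(3)]) (rule that)
    have e: "K2 = K" "F2 = F1" using is_extn_unique[OF 2(1)] sext_extn[OF P(1)] P(3) by metis+
    note P = P[unfolded e]
    obtain t where t: "cat.word K G1 t" "yon t = T" using extn_word[OF 2(2)] by blast
    have w1: "cat.word F1 K [(K, i, H, q, F1)]" "cat.word F' K [(K, i', M, q', F')]" using P by (simp_all add: cat.word_single_iff)
    have y: "yon (t @ [(K, i, H, q, F1)]) = yon w" "yon (t @ [(K, i', M, q', F')]) = E'"
      using yon_append[OF t(1)] t(2) P 2 by simp_all
    have wt: "cat.word F1 G1 (t @ [(K, i, H, q, F1)])" "cat.word F' G1 (t @ [(K, i', M, q', F')])"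
      using cat.word_append[OF t(1)] w1 by blast+
    have e': "F1 = F" "G1 = G" using yon_unique[OF assms(1)] word_extn[OF wt(1)] y(1) by metis+
    have "cat.wmor (aid G1) (F', \<gamma>) (t @ [(K, i', M, q', F')]) (t @ [(K, i, H, q, F1)])"
      by (rule cat.wmor_append[OF cat.wmor_idm[OF t(1)]]) (rule cat.wmor.single[OF P(5)])
    then show thesis using that[OF _ y(1) _ y(2)] wt unfolding e' by blast
  qed
qed

lemma pushout_extn_word:
  assumes "cat.word F G w" "pushout_extn X \<alpha> G' (yon w) E'"
  obtains v v' where "cat.word F G v" "yon v = yon w" "cat.word F G' v'" "yon v' = E'" "cat.wmor (G, \<alpha>) (aid F) v v'"
proof -
  consider "pushout_short X \<alpha> G' (yon w) E'" | G1 K F1 q S S' T where "is_extn X 1 K G1 S" "is_extn X q F1 K T"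
      "pushout_short X \<alpha> G' S S'" "yon w = yoneda X S T" "E' = yoneda X S' T"
    using assms(2) unfolding pushout_extn_def by blast
  then show thesis
  proof cases
    case 1
    obtain G1 i H q F1 i' M q' m where P: "ases (G1, i, H, q, F1)" "ases (G', i', M, q', F1)"
      "yon w = sext (G1, i, H, q, F1)" "E' = sext (G', i', M, q', F1)"
      "ladder arr acmp (G1, \<alpha>) m (aid F1) (G1, i, H, q, F1) (G', i', M, q', F1)"
      by (rule pushout_short_ladder[OF 1]) (rule that)
    have e: "G1 = G" "F1 = F" using yon_unique[OF assms(1)] sext_extn[OF P(1)] P(3) by metis+
    show thesis
      by (rule that[of "[(G, i, H, q, F)]" "[(G', i', M, q', F)]"])
        (use P in \<open>simp_all add: e cat.word_single_iff cat.wmor.single\<close>)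
  next
    case 2
    obtain G2 i H q K2 i' M q' m where P: "ases (G2, i, H, q, K2)" "ases (G', i', M, q', K2)"
      "S = sext (G2, i, H, q, K2)" "S' = sext (G', i', M, q', K2)"
      "ladder arr acmp (G2, \<alpha>) m (aid K2) (G2, i, H, q, K2) (G', i', M, q', K2)"
      by (rule pushout_short_ladder[OF 2(3)]) (rule that)
    have e: "K2 = K" "G2 = G1" using is_extn_unique[OF 2(1)] sext_extn[OF P(1)] P(3) by metis+
    note P = P[unfolded e]
    obtain t where t: "cat.word F1 K t" "yon t = T" using extn_word[OF 2(2)] by blast
    have ne: "t \<noteq> []" using cat.word_nonempty[OF t(1)] .
    have y: "yon ((G1, i, H, q, K) # t) = yon w" "yon ((G', i', M, q', K) # t) = E'"
      using ne t(2) P 2 by simp_all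
    have wt: "cat.word F1 G1 ((G1, i, H, q, K) # t)" "cat.word F1 G' ((G', i', M, q', K) # t)"
      using t P ne by (simp_all add: cat.word_cons_iff)
    have e': "F1 = F" "G1 = G" using yon_unique[OF assms(1)] word_extn[OF wt(1)] y(1) by metis+
    have "cat.wmor (G1, \<alpha>) (aid F1) ((G1, i, H, q, K) # t) ((G', i', M, q', K) # t)"
      by (rule cat.wmor.cons[OF P(5) cat.wmor_idm[OF t(1)]])
    then show thesis using that[OF _ y(1) _ y(2)] wt unfolding e' by blast
  qed
qed

lemma pullback_extn_exists:
  assumes "cat.word F G w" "c \<in> arr F' F"
  shows "\<exists>E'. pullback_extn X (snd c) F' (yon w) E'"
proof -
  obtain t s where w: "w = t @ [s]" using cat.word_nonempty[OF assms(1)] by (metis rev_exhaust)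
  obtain K i H q F1 where s: "s = (K, i, H, q, F1)" by (rule prod_cases5)
  have S: "ases (K, i, H, q, F)" "F1 = F" and t: "t \<noteq> [] \<Longrightarrow> cat.word K G t"
  proof -
    have "ases (K, i, H, q, F) \<and> F1 = F \<and> (t \<noteq> [] \<longrightarrow> cat.word K G t)"
    proof (cases "t = []")
      case True
      then have "ases (K, i, H, q, F1) \<and> K = G \<and> F1 = F" using assms(1) unfolding w s True append_Nil cat.word_single_iff by blast
      then show ?thesis using True by metis
    next
      case False
      obtain K' where "cat.word K' G t" "cat.word F K' [s]"
        by (rule cat.word_appendE[OF assms(1)[unfolded w] False]) auto
      then show ?thesis by (auto simp: s cat.word_single_iff)
    qed
    then show "ases (K, i, H, q, F)" "F1 = F" "t \<noteq> [] \<Longrightarrow> cat.word K G t" by auto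
  qed
  obtain i' M q' m where P: "ases (K, i', M, q', F')" "ladder arr acmp (aid K) m c (K, i', M, q', F') (K, i, H, q, F)"
    using cat.pullback_ex[OF S(1) assms(2)] by blast
  note ps = ladder_pullback_short[OF P(1) S(1) P(2)]
  show ?thesis
  proof (cases "t = []")
    case True
    then show ?thesis using ps unfolding pullback_extn_def by (auto simp: w s S(2))
  next
    case False
    have "yon w = yoneda X (yon t) (sext (K, i, H, q, F))" using yon_append[OF t[OF False]] by (simp add: w s S(2))
    then show ?thesis using ps sext_extn[OF S(1)] word_extn[OF t[OF False]] unfolding pullback_extn_def by blast
  qed
qed

lemma pushout_extn_exists:
  assumes "cat.word F G w" "c \<in> arr G G'"
  shows "\<exists>E'. pushout_extn X (snd c) G' (yon w) E'"
proof -
  obtain s t where w: "w = s # t" using cat.word_nonempty[OF assms(1)] by (metis neq_Nil_conv)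
  obtain G1 i H q K where s: "s = (G1, i, H, q, K)" by (rule prod_cases5)
  have "ases (G1, i, H, q, K) \<and> G1 = G \<and> (t = [] \<and> K = F \<or> t \<noteq> [] \<and> cat.word F K t)"
    using assms(1) unfolding w s
  proof (cases "t = []")
    case False
    then show ?thesis using assms(1) unfolding w s cat.word_cons_iff[OF False] by blast
  qed (simp only: cat.word_single_iff, blast)
  then have S: "ases (G, i, H, q, K)" "G1 = G" and t: "t = [] \<and> K = F \<or> t \<noteq> [] \<and> cat.word F K t"
    by metis+
  obtain i' M q' m where P: "ases (G', i', M, q', K)" "ladder arr acmp c m (aid K) (G, i, H, q, K) (G', i', M, q', K)"
    using cat.pushout_ex[OF S(1) assms(2)] by blast
  note ps = ladder_pushout_short[OF S(1) P(1,2)]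
  from t show ?thesis
  proof (elim disjE conjE)
    assume "t = []"
    then show ?thesis using ps unfolding pushout_extn_def by (auto simp: w s S(2))
  next
    assume t: "t \<noteq> []" "cat.word F K t"
    have "yon w = yoneda X (sext (G, i, H, q, K)) (yon t)" using t(1) by (simp add: w s S(2))
    then show ?thesis using ps sext_extn[OF S(1)] word_extn[OF t(2)] unfolding pushout_extn_def by blast
  qed
qed

text \<open>Each choice of a representative and of a pullback gives a word over one equivalent to
  \<open>w\<close>, and \<open>pullback_weq\<close> identifies all of these. That some choice exists
  keeps the union from being empty.\<close>

lemma ext_pull_yon:
  assumes "cat.word F G w" "cat.word F' G w'" "cat.wmor (aid G) c w' w"
  shows "ext_pull X (snd c) F' (ext_class X (yon w)) = ext_class X (yon w')"
proof -
  have c: "c \<in> arr F' F" using cat.wmor_hom[OF assms(3,2,1)] by simp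
  have "ext_class X E' = ext_class X (yon w')"
    if h: "E \<in> ext_class X (yon w)" "pullback_extn X (snd c) F' E E'" for E E'
  proof -
    obtain u where u: "E = yon u" "cat.weq F G w u" using h(1) unfolding ext_class_yon[OF assms(1)] by blast
    have wu: "cat.word F G u" using u assms cat.weq_word by blast
    obtain v v' where v: "cat.word F G v" "yon v = yon u" "cat.word F' G v'" "yon v' = E'"
        "cat.wmor (aid G) (F', snd c) v' v"
      by (rule pullback_extn_word[OF wu h(2)[unfolded u(1)]]) (rule that)
    have "c = (F', snd c)" using c by (simp add: arr_iff prod_eq_iff)
    moreover have "cat.weq F G w v" using cat.weq_trans[OF u(2) yon_eq_weq[OF wu v(1)]] v(2) by simp
    ultimately have "cat.weq F' G w' v'" using cat.pullback_weq[OF _ assms(1,2,3) v(3)] v(5) by simp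
    then show ?thesis using ext_class_eqI[OF assms(2)] v(4) by simp
  qed
  moreover have "yon w \<in> ext_class X (yon w)" by (simp add: ext_class_def)
  ultimately show ?thesis unfolding ext_pull_def using pullback_extn_exists[OF assms(1) c] by blast
qed

lemma ext_push_yon:
  assumes "cat.word F G w" "cat.word F G' w'" "cat.wmor c (aid F) w w'"
  shows "ext_push X (snd c) G' (ext_class X (yon w)) = ext_class X (yon w')"
proof -
  have c: "c \<in> arr G G'" using cat.wmor_hom[OF assms(3,1,2)] by simp
  have "ext_class X E' = ext_class X (yon w')"
    if h: "E \<in> ext_class X (yon w)" "pushout_extn X (snd c) G' E E'" for E E'
  proof -
    obtain u where u: "E = yon u" "cat.weq F G w u" using h(1) unfolding ext_class_yon[OF assms(1)] by blast
    have wu: "cat.word F G u" using u assms cat.weq_word by blast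
    obtain v v' where v: "cat.word F G v" "yon v = yon u" "cat.word F G' v'" "yon v' = E'"
        "cat.wmor (G, snd c) (aid F) v v'"
      by (rule pushout_extn_word[OF wu h(2)[unfolded u(1)]]) (rule that)
    have "c = (G, snd c)" using c by (simp add: arr_iff prod_eq_iff)
    moreover have "cat.weq F G w v" using cat.weq_trans[OF u(2) yon_eq_weq[OF wu v(1)]] v(2) by simp
    ultimately have "cat.weq F G' w' v'" using cat.pushout_weq[OF _ assms(1,2,3) v(3)] v(5) by simp
    then show ?thesis using ext_class_eqI[OF assms(2)] v(4) by simp
  qed
  moreover have "yon w \<in> ext_class X (yon w)" by (simp add: ext_class_def)
  ultimately show ?thesis unfolding ext_push_def using pushout_extn_exists[OF assms(1) c] by blast
qed

section \<open>The zero class\<close>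

lemma zero_hom_comp:
  assumes "module_sheaf X A" "module_sheaf X B" "module_sheaf X C"
  shows "sheaf_comp X A (zero_hom X B C) (zero_hom X A B) = zero_hom X A C"
  unfolding comp_eq_hom_iff[OF zero_hom_hom[OF assms(1,3)]]
  using assms by (simp add: zero_hom_apply msheaf_zero_mem)

lemma yon_wtriv_tail:
  assumes "module_sheaf X F"
  shows "yon (replicate k (zs, azf zs, zs, azt zs, zs) @ [(zs, azf F, F, aid F, F)]) =
    \<lparr>objs = zs # replicate k zs @ [F, F], maps = replicate k (zero_hom X zs zs) @ [zero_hom X zs F, sheaf_id X F]\<rparr>"
proof (induction k)
  case 0
  show ?case by (simp add: sext_simp azf_def aid_def)
next
  case (Suc k)
  have "sheaf_comp X zs (hd (replicate k (zero_hom X zs zs) @ [zero_hom X zs F, sheaf_id X F])) (zero_hom X zs zs) =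
      hd (replicate k (zero_hom X zs zs) @ [zero_hom X zs F, sheaf_id X F])"
    by (cases k) (simp_all add: zero_hom_comp zero_sheaf_module_sheaf assms)
  then show ?case using Suc by (cases k) (simp_all add: sext_simp azf_def azt_def yoneda_def)
qed

text \<open>A normal form for the list of zero maps in \<open>trivial_extn\<close>, where
  neighbouring objects are paired.\<close>

lemma map2_replicate_snoc: "map2 f (replicate (Suc k) z @ [b]) (replicate k z @ [b]) = replicate k (f z z) @ [f z b]"
  by (induction k) simp_all

lemma yon_wtriv:
  assumes "coherent X F" "coherent X G"
  shows "trivial_extn X (n + 2) F G E \<longleftrightarrow> E = yon (cat.wtriv n F G)"
proof -
  note m = coherent_msheaf[OF assms(1)] coherent_msheaf[OF assms(2)] zero_sheaf_module_sheaf
  show ?thesis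
  proof (cases n)
    \<comment> \<open>The two outer sequences meet directly here, and the splice composes
      \<open>G -> 0 -> F\<close> to the zero map from \<open>G\<close> to \<open>F\<close>.\<close>
    case 0
    then show ?thesis
      using yon_wtriv_tail[OF m(1), of 0]
      by (simp add: trivial_extn_def cat.wtriv_def sext_simp yoneda_def azt_def aid_def azf_def zero_hom_comp m)
  next
    case (Suc k)
    then show ?thesis
      using yon_wtriv_tail[OF m(1), of "Suc k"] map2_replicate_snoc[of "zero_hom X" k zs F]
      by (simp add: trivial_extn_def cat.wtriv_def sext_simp yoneda_def azt_def aid_def azf_def zero_hom_comp m Let_def)
  qed
qed

lemma ext_zero_yon:
  "coherent X F \<Longrightarrow> coherent X G \<Longrightarrow> ext_zero X (n + 2) F G = ext_class X (yon (cat.wtriv n F G))"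
  by (simp add: ext_zero_def yon_wtriv[simplified])

section \<open>The two obstruction statements for Ext\<close>

lemma Ext_extends:
  assumes U: "ases (B, i, C, q, Q)" and R: "R \<in> Ext X p B G"
  shows "ext_star X R (ext_class X (sext (B, i, C, q, Q))) \<in> Ext X (p + 1) Q G"
    and "R \<in> ext_pull X (snd i) B ` Ext X p C G \<longleftrightarrow>
      ext_star X R (ext_class X (sext (B, i, C, q, Q))) = ext_zero X (p + 1) Q G"
proof -
  let ?U = "(B, i, C, q, Q)"
  obtain w where w: "cat.word B G w" "length w = p" "R = ext_class X (yon w)" using R by (auto simp: Ext_iff)
  have wU: "cat.word Q B [?U]" using U by (simp add: cat.word_single_iff)
  have s: "ext_star X R (ext_class X (sext ?U)) = ext_class X (yon (w @ [?U]))"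
    using ext_star_yon[OF w(1) wU] w(3) by simp
  have wwU: "cat.word Q G (w @ [?U])" by (rule cat.word_append[OF w(1) wU])
  show "ext_star X R (ext_class X (sext ?U)) \<in> Ext X (p + 1) Q G"
    unfolding s Ext_iff using wwU w(2) by (intro exI[of _ "w @ [?U]"]) simp
  have o: "coherent X Q" "coherent X G" using asesD[OF U] cat.word_obj[OF w(1)] by auto
  have i: "i \<in> arr B C" using cat.ses_hom[OF U] by simp
  \<comment> \<open>The index is \<open>p - 1\<close> because \<open>wtriv n\<close> represents zero
    in degree \<open>n + 2\<close>, and the degree here is \<open>p + 1\<close>.\<close>
  let ?t = "cat.wtriv (p - 1) Q G"
  have t: "cat.word Q G ?t" by (rule cat.word_wtriv[OF o])
  have "p \<ge> 1" using w(2) cat.word_nonempty[OF w(1)] by (cases w) auto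
  then have z: "ext_zero X (p + 1) Q G = ext_class X (yon ?t)" using ext_zero_yon[OF o, of "p - 1"] by simp
  have main: "ext_class X (yon (w @ [?U])) = ext_class X (yon ?t) \<longleftrightarrow> (\<exists>w0. cat.word C G w0 \<and> cat.wmor (aid G) i w w0)"
    unfolding ext_class_eq_iff[OF wwU t] using cat.extends_iff[OF w(1) U] w(2) by simp
  show "R \<in> ext_pull X (snd i) B ` Ext X p C G \<longleftrightarrow> ext_star X R (ext_class X (sext ?U)) = ext_zero X (p + 1) Q G"
    unfolding s z main
  proof
    assume "\<exists>w0. cat.word C G w0 \<and> cat.wmor (aid G) i w w0"
    then obtain w0 where w0: "cat.word C G w0" "cat.wmor (aid G) i w w0" by blast
    have "R = ext_pull X (snd i) B (ext_class X (yon w0))" using ext_pull_yon[OF w0(1) w(1) w0(2)] w(3) by simp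
    moreover have "ext_class X (yon w0) \<in> Ext X p C G"
      using w0 w(2) cat.wmor_lengths[OF w0(2)] by (auto simp: Ext_iff)
    ultimately show "R \<in> ext_pull X (snd i) B ` Ext X p C G" by blast
  next
    assume "R \<in> ext_pull X (snd i) B ` Ext X p C G"
    then obtain w0 where w0: "cat.word C G w0" "R = ext_pull X (snd i) B (ext_class X (yon w0))"
      by (auto simp: Ext_iff)
    \<comment> \<open>The pullback \<open>v\<close> of \<open>w0\<close> lies in the class of
      \<open>w\<close> but need not be \<open>w\<close>. Vanishing is a property of the class, so it
      passes from \<open>v\<close> to \<open>w\<close>, and \<open>main\<close> then extends
      \<open>w\<close> itself.\<close>
    obtain v where v: "cat.word B G v" "cat.wmor (aid G) i v w0" using cat.pullback_word[OF w0(1) i] by metis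
    have "ext_class X (yon v) = ext_class X (yon w)" using ext_pull_yon[OF w0(1) v] w0(2) w(3) by simp
    then have e: "cat.weq B G v w" using ext_class_eq_iff[OF v(1) w(1)] by simp
    have "cat.weq Q G (v @ [?U]) ?t"
      using cat.extends_iff[OF v(1) U] v(2) w0(1) cat.weq_length[OF e] w(2) by auto
    then have "cat.weq Q G (w @ [?U]) ?t"
      using cat.weq_trans[OF cat.weq_sym[OF cat.weq_append_right[OF e wU]]] by blast
    then show "\<exists>w0. cat.word C G w0 \<and> cat.wmor (aid G) i w w0"
      using main ext_class_eq_iff[OF wwU t] by simp
  qed
qed

lemma Ext_lifts:
  assumes U: "ases (B, i, C, q, Q)" and T: "T \<in> Ext X p F Q"
  shows "ext_star X (ext_class X (sext (B, i, C, q, Q))) T \<in> Ext X (p + 1) F B"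
    and "T \<in> ext_push X (snd q) Q ` Ext X p F C \<longleftrightarrow>
      ext_star X (ext_class X (sext (B, i, C, q, Q))) T = ext_zero X (p + 1) F B"
proof -
  let ?U = "(B, i, C, q, Q)"
  obtain w where w: "cat.word F Q w" "length w = p" "T = ext_class X (yon w)" using T by (auto simp: Ext_iff)
  have wU: "cat.word Q B [?U]" using U by (simp add: cat.word_single_iff)
  have s: "ext_star X (ext_class X (sext ?U)) T = ext_class X (yon (?U # w))"
    using ext_star_yon[OF wU w(1)] w(3) by simp
  have wwU: "cat.word F B (?U # w)" by (rule cat.word.cons[OF U w(1)])
  show "ext_star X (ext_class X (sext ?U)) T \<in> Ext X (p + 1) F B"
    unfolding s Ext_iff using wwU w(2) by (intro exI[of _ "?U # w"]) simp
  have o: "coherent X F" "coherent X B" using asesD[OF U] cat.word_obj[OF w(1)] by auto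
  have q: "q \<in> arr C Q" using cat.ses_hom[OF U] by simp
  let ?t = "cat.wtriv (p - 1) F B"
  have t: "cat.word F B ?t" by (rule cat.word_wtriv[OF o])
  have "p \<ge> 1" using w(2) cat.word_nonempty[OF w(1)] by (cases w) auto
  then have z: "ext_zero X (p + 1) F B = ext_class X (yon ?t)" using ext_zero_yon[OF o, of "p - 1"] by simp
  have main: "ext_class X (yon (?U # w)) = ext_class X (yon ?t) \<longleftrightarrow> (\<exists>w0. cat.word F C w0 \<and> cat.wmor q (aid F) w0 w)"
    unfolding ext_class_eq_iff[OF wwU t] using cat.lifts_iff[OF w(1) U] w(2) by simp
  show "T \<in> ext_push X (snd q) Q ` Ext X p F C \<longleftrightarrow> ext_star X (ext_class X (sext ?U)) T = ext_zero X (p + 1) F B"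
    unfolding s z main
  proof
    assume "\<exists>w0. cat.word F C w0 \<and> cat.wmor q (aid F) w0 w"
    then obtain w0 where w0: "cat.word F C w0" "cat.wmor q (aid F) w0 w" by blast
    have "T = ext_push X (snd q) Q (ext_class X (yon w0))" using ext_push_yon[OF w0(1) w(1) w0(2)] w(3) by simp
    moreover have "ext_class X (yon w0) \<in> Ext X p F C"
      using w0 w(2) cat.wmor_lengths[OF w0(2)] by (auto simp: Ext_iff)
    ultimately show "T \<in> ext_push X (snd q) Q ` Ext X p F C" by blast
  next
    assume "T \<in> ext_push X (snd q) Q ` Ext X p F C"
    then obtain w0 where w0: "cat.word F C w0" "T = ext_push X (snd q) Q (ext_class X (yon w0))"
      by (auto simp: Ext_iff)
    obtain v where v: "cat.word F Q v" "cat.wmor q (aid F) w0 v" using cat.pushout_word[OF w0(1) q] by metis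
    have "ext_class X (yon v) = ext_class X (yon w)" using ext_push_yon[OF w0(1) v] w0(2) w(3) by simp
    then have e: "cat.weq F Q v w" using ext_class_eq_iff[OF v(1) w(1)] by simp
    have "cat.weq F B (?U # v) ?t"
      using cat.lifts_iff[OF v(1) U] v(2) w0(1) cat.weq_length[OF e] w(2) by auto
    then have "cat.weq F B (?U # w) ?t"
      using cat.weq_trans[OF cat.weq_sym[OF cat.weq_append_left[OF e wU]]] by simp
    then show "\<exists>w0. cat.word F C w0 \<and> cat.wmor q (aid F) w0 w"
      using main ext_class_eq_iff[OF wwU t] by simp
  qed
qed

text \<open>The inclusion is the identity on germs, so its image is the stalk of \<open>B\<close>,
  which is the kernel of the projection. Coherence of the quotient comes from
  \<open>coherent_quotient\<close>.\<close>

lemma quotient_ases: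
  assumes "coherent X C" "coherent X B" "subsheaf X B C" "quotient_sheaf X C B Q \<pi>"
  shows "ases (B, (B, sheaf_id X B), C, (C, \<pi>), Q)"
proof -
  have "sheaf_id X B x ` Car B x = Car B x" "inj_on (sheaf_id X B x) (Car B x)" if "x \<in> pts" for x
    using that by (simp_all add: sheaf_id_def inj_on_def)
  then have S: "short_exact B (sheaf_id X B) C \<pi> Q"
    using assms coherent_msheaf[OF assms(1)] coherent_msheaf[OF assms(2)]
    unfolding short_exact_def subsheaf_def quotient_sheaf_def by simp
  moreover have "coherent X Q" using coherent_quotient[OF S _ assms(1)] assms(2) by (simp add: coherent_def)
  ultimately show ?thesis using assms(1,2) by (simp add: ases_iff)
qed

end

section \<open>The structure sheaf of a complex manifold\<close>

lemma holo_on_subset: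
  assumes "holo_on n W f" "openin (top_of_set (cspace n)) V" "V \<subseteq> W"
  shows "holo_on n V f"
  using assms continuous_on_subset unfolding holo_on_def by blast

lemma holo_on_const: "openin (top_of_set (cspace n)) W \<Longrightarrow> holo_on n W (\<lambda>_. c)"
  by (simp add: holo_on_def)

lemma holo_on_add: "holo_on n W f \<Longrightarrow> holo_on n W g \<Longrightarrow> holo_on n W (\<lambda>z. f z + g z)"
  unfolding holo_on_def by (intro conjI ballI allI impI continuous_on_add field_differentiable_add) auto

lemma holo_on_mult: "holo_on n W f \<Longrightarrow> holo_on n W g \<Longrightarrow> holo_on n W (\<lambda>z. f z * g z)"
  unfolding holo_on_def by (intro conjI ballI allI impI continuous_on_mult field_differentiable_mult) auto

lemma germ_self: "x \<in> topspace M \<Longrightarrow> f \<in> germ M x f"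
  unfolding germ_def by blast

lemma germ_eqI:
  assumes "openin M W" "x \<in> W" "\<And>y. y \<in> W \<Longrightarrow> f y = g y"
  shows "germ M x f = germ M x g"
proof -
  have "h \<in> germ M x g" if h: "h \<in> germ M x f" and W: "openin M W" "x \<in> W" "\<And>y. y \<in> W \<Longrightarrow> f y = g y" for f g h W
  proof -
    obtain V where V: "openin M V" "x \<in> V" "\<forall>y\<in>V. h y = f y" using h unfolding germ_def by blast
    then have "openin M (V \<inter> W)" "x \<in> V \<inter> W" "\<forall>y\<in>V \<inter> W. h y = g y" using W by auto
    then show ?thesis unfolding germ_def by blast
  qed
  from this[of _ f W g] this[of _ g W f] assms show ?thesis by (intro equalityI subsetI) simp_all
qed

lemma germ_eqD:
  assumes "x \<in> topspace M" "germ M x f = germ M x g"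
  shows "\<exists>W. openin M W \<and> x \<in> W \<and> (\<forall>y\<in>W. f y = g y)"
  using germ_self[OF assms(1), of f] assms(2) unfolding germ_def by auto

text \<open>Representatives agree with \<open>a\<close> and \<open>b\<close> on a common
  neighbourhood of \<open>x\<close>, so all members of the union are the same germ.\<close>

lemma germ_binop:
  assumes "x \<in> topspace M"
  shows "(\<Union>f\<in>germ M x a. \<Union>g\<in>germ M x b. germ M x (\<lambda>y. h (f y) (g y))) = germ M x (\<lambda>y. h (a y) (b y))"
proof -
  have "germ M x (\<lambda>y. h (f y) (g y)) = germ M x (\<lambda>y. h (a y) (b y))"
    if fg: "f \<in> germ M x a" "g \<in> germ M x b" for f g
  proof -
    obtain V W where "openin M V" "x \<in> V" "\<forall>y\<in>V. f y = a y" "openin M W" "x \<in> W" "\<forall>y\<in>W. g y = b y"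
      using fg unfolding germ_def by blast
    then show ?thesis by (intro germ_eqI[of M "V \<inter> W"]) auto
  qed
  then show ?thesis using germ_self[OF assms] by blast
qed

section \<open>Rings of germs of holomorphic functions\<close>

locale complex_mfd =
  fixes M :: "'x topology" and n :: nat and \<A> :: "'x chart set"
  assumes manifold: "complex_manifold M n \<A>"
begin

lemma chart_image_open:
  assumes "(U, \<phi>) \<in> \<A>" "openin M W"
  shows "openin (top_of_set (cspace n)) (\<phi> ` (U \<inter> W))"
proof -
  have c: "openin M U" "openin (top_of_set (cspace n)) (\<phi> ` U)"
      "homeomorphic_map (subtopology M U) (top_of_set (\<phi> ` U)) \<phi>"
    using manifold assms(1) unfolding complex_manifold_def by auto
  have "openin (subtopology M U) (U \<inter> W)" using assms(2) by (auto simp: openin_subtopology)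
  then have "openin (top_of_set (\<phi> ` U)) (\<phi> ` (U \<inter> W))"
    using homeomorphic_imp_open_map[OF c(3)] unfolding open_map_def by blast
  then show ?thesis using c(2) by (rule openin_trans)
qed

lemma holomorphic_restrict:
  assumes "holomorphic_fun M n \<A> W f" "openin M V" "V \<subseteq> W"
  shows "holomorphic_fun M n \<A> V f"
  unfolding holomorphic_fun_def
proof (intro conjI assms(2) ballI, clarify)
  fix U \<phi> assume c: "(U, \<phi>) \<in> \<A>"
  then have "holo_on n (\<phi> ` (U \<inter> W)) (\<lambda>z. f (inv_into U \<phi> z))" using assms(1) unfolding holomorphic_fun_def by blast
  then show "holo_on n (\<phi> ` (U \<inter> V)) (\<lambda>z. f (inv_into U \<phi> z))"
    using chart_image_open[OF c assms(2)] by (rule holo_on_subset) (use assms(3) in auto)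
qed

lemma holomorphic_const: "openin M W \<Longrightarrow> holomorphic_fun M n \<A> W (\<lambda>_. c)"
  unfolding holomorphic_fun_def using chart_image_open holo_on_const by blast

lemma holomorphic_add:
  "holomorphic_fun M n \<A> W f \<Longrightarrow> holomorphic_fun M n \<A> W g \<Longrightarrow> holomorphic_fun M n \<A> W (\<lambda>y. f y + g y)"
  unfolding holomorphic_fun_def by (fast intro: holo_on_add)

lemma holomorphic_mult:
  "holomorphic_fun M n \<A> W f \<Longrightarrow> holomorphic_fun M n \<A> W g \<Longrightarrow> holomorphic_fun M n \<A> W (\<lambda>y. f y * g y)"
  unfolding holomorphic_fun_def by (fast intro: holo_on_mult)

abbreviation "R \<equiv> germ_ring M n \<A>"

lemma germ_carrier: "holomorphic_fun M n \<A> W f \<Longrightarrow> x \<in> W \<Longrightarrow> germ M x f \<in> carrier (R x)"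
  unfolding germ_ring_def by auto

lemma germ_carrierE:
  assumes "a \<in> carrier (R x)"
  obtains W f where "a = germ M x f" "x \<in> W" "holomorphic_fun M n \<A> W f"
  using assms unfolding germ_ring_def by auto

lemma germ_carrier2E:
  assumes "a \<in> carrier (R x)" "b \<in> carrier (R x)"
  obtains W f g where "a = germ M x f" "b = germ M x g" "x \<in> W" "holomorphic_fun M n \<A> W f" "holomorphic_fun M n \<A> W g"
proof -
  obtain V f where V: "a = germ M x f" "x \<in> V" "holomorphic_fun M n \<A> V f" by (rule germ_carrierE[OF assms(1)])
  obtain W g where W: "b = germ M x g" "x \<in> W" "holomorphic_fun M n \<A> W g" by (rule germ_carrierE[OF assms(2)])
  have "openin M (V \<inter> W)" using V(3) W(3) unfolding holomorphic_fun_def by blast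
  then have "holomorphic_fun M n \<A> (V \<inter> W) f" "holomorphic_fun M n \<A> (V \<inter> W) g"
    using holomorphic_restrict[OF V(3)] holomorphic_restrict[OF W(3)] by auto
  then show thesis using that[OF V(1) W(1), of "V \<inter> W"] V(2) W(2) by simp
qed

lemma germ_ring_ops:
  assumes "x \<in> topspace M"
  shows "germ M x f \<oplus>\<^bsub>R x\<^esub> germ M x g = germ M x (\<lambda>y. f y + g y)"
    and "germ M x f \<otimes>\<^bsub>R x\<^esub> germ M x g = germ M x (\<lambda>y. f y * g y)"
    and "\<zero>\<^bsub>R x\<^esub> = germ M x (\<lambda>_. 0)" and "\<one>\<^bsub>R x\<^esub> = germ M x (\<lambda>_. 1)"
  using germ_binop[OF assms, where h = "(+)" and a = f and b = g] germ_binop[OF assms, where h = "(*)" and a = f and b = g] by (simp_all add: germ_ring_def)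

lemma germ_ring_cring:
  assumes x: "x \<in> topspace M"
  shows "cring (R x)"
proof -
  note ops = germ_ring_ops[OF x]
  have c: "germ M x (\<lambda>_. c) \<in> carrier (R x)" for c
    by (rule germ_carrier[OF holomorphic_const[OF openin_topspace] x])
  have add: "a \<oplus>\<^bsub>R x\<^esub> b \<in> carrier (R x)" and mult: "a \<otimes>\<^bsub>R x\<^esub> b \<in> carrier (R x)"
    and comm: "a \<oplus>\<^bsub>R x\<^esub> b = b \<oplus>\<^bsub>R x\<^esub> a" "a \<otimes>\<^bsub>R x\<^esub> b = b \<otimes>\<^bsub>R x\<^esub> a"
    if ab: "a \<in> carrier (R x)" "b \<in> carrier (R x)" for a b
  proof -
    obtain W f g where W: "a = germ M x f" "b = germ M x g" "x \<in> W" "holomorphic_fun M n \<A> W f" "holomorphic_fun M n \<A> W g"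
      by (rule germ_carrier2E[OF ab])
    show "a \<oplus>\<^bsub>R x\<^esub> b \<in> carrier (R x)" unfolding W ops by (rule germ_carrier[OF holomorphic_add[OF W(4,5)] W(3)])
    show "a \<otimes>\<^bsub>R x\<^esub> b \<in> carrier (R x)" unfolding W ops by (rule germ_carrier[OF holomorphic_mult[OF W(4,5)] W(3)])
    show "a \<oplus>\<^bsub>R x\<^esub> b = b \<oplus>\<^bsub>R x\<^esub> a" "a \<otimes>\<^bsub>R x\<^esub> b = b \<otimes>\<^bsub>R x\<^esub> a" unfolding W ops by (simp_all add: add.commute mult.commute)
  qed
  show ?thesis
  proof (rule cringI)
    show "abelian_group (R x)"
    proof (rule abelian_groupI)
      fix a b d assume "a \<in> carrier (R x)" "b \<in> carrier (R x)" "d \<in> carrier (R x)"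
      then show "a \<oplus>\<^bsub>R x\<^esub> b \<oplus>\<^bsub>R x\<^esub> d = a \<oplus>\<^bsub>R x\<^esub> (b \<oplus>\<^bsub>R x\<^esub> d)"
        by (elim germ_carrierE) (simp add: ops add.assoc)
    next
      fix a assume a: "a \<in> carrier (R x)"
      then obtain f where f: "a = germ M x f" by (rule germ_carrierE)
      show "\<zero>\<^bsub>R x\<^esub> \<oplus>\<^bsub>R x\<^esub> a = a" by (simp add: f ops)
      \<comment> \<open>The negative is produced as a product with a constant germ, which is covered
        by the closure properties already at hand.\<close>
      have "germ M x (\<lambda>_. -1) \<otimes>\<^bsub>R x\<^esub> a \<oplus>\<^bsub>R x\<^esub> a = \<zero>\<^bsub>R x\<^esub>" by (simp add: f ops)
      then show "\<exists>b\<in>carrier (R x). b \<oplus>\<^bsub>R x\<^esub> a = \<zero>\<^bsub>R x\<^esub>" using mult[OF c a] by blast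
    qed (use add comm c in \<open>simp_all add: ops\<close>)
    show "comm_monoid (R x)"
    proof (rule comm_monoidI)
      fix a b d assume "a \<in> carrier (R x)" "b \<in> carrier (R x)" "d \<in> carrier (R x)"
      then show "a \<otimes>\<^bsub>R x\<^esub> b \<otimes>\<^bsub>R x\<^esub> d = a \<otimes>\<^bsub>R x\<^esub> (b \<otimes>\<^bsub>R x\<^esub> d)"
        by (elim germ_carrierE) (simp add: ops mult.assoc)
    next
      fix a assume "a \<in> carrier (R x)"
      then show "\<one>\<^bsub>R x\<^esub> \<otimes>\<^bsub>R x\<^esub> a = a" by (elim germ_carrierE) (simp add: ops)
    qed (use mult comm c in \<open>simp_all add: ops\<close>)
    fix a b d assume "a \<in> carrier (R x)" "b \<in> carrier (R x)" "d \<in> carrier (R x)"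
    then show "(a \<oplus>\<^bsub>R x\<^esub> b) \<otimes>\<^bsub>R x\<^esub> d = a \<otimes>\<^bsub>R x\<^esub> d \<oplus>\<^bsub>R x\<^esub> b \<otimes>\<^bsub>R x\<^esub> d"
      by (elim germ_carrierE) (simp add: ops distrib_right)
  qed
qed

section \<open>The sheaf of germs as a structure sheaf\<close>

definition germ_sections :: "('x set \<times> ('x \<Rightarrow> ('x \<Rightarrow> complex) set)) set" where
  "germ_sections = {(W, \<lambda>y. germ M y f) | W f. holomorphic_fun M n \<A> W f}"

lemma germ_section_family: "section_family M (\<lambda>x. carrier (R x)) germ_sections"
  unfolding section_family_def germ_sections_def
proof (intro conjI ballI; clarify?; (intro conjI ballI allI impI)?)
  fix W f assume f: "holomorphic_fun M n \<A> W f"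
  then show o: "openin M W" by (simp add: holomorphic_fun_def)
  show "germ M y f \<in> carrier (R y)" if "y \<in> W" for y by (rule germ_carrier[OF f that])
  fix V assume "openin M V"
  then have "holomorphic_fun M n \<A> (W \<inter> V) f" using o by (intro holomorphic_restrict[OF f]) auto
  then show "\<exists>W' f'. (W \<inter> V, \<lambda>y. germ M y f) = (W', \<lambda>y. germ M y f') \<and> holomorphic_fun M n \<A> W' f'" by blast
next
  fix x a assume "a \<in> carrier (R x)"
  then obtain W f where "a = germ M x f" "x \<in> W" "holomorphic_fun M n \<A> W f" by (rule germ_carrierE)
  then show "\<exists>(U, s)\<in>{(W, \<lambda>y. germ M y f) |W f. holomorphic_fun M n \<A> W f}. x \<in> U \<and> s x = a" by auto
next
  fix W f V g x assume fg: "holomorphic_fun M n \<A> W f" "holomorphic_fun M n \<A> V g" and x: "x \<in> W" "x \<in> V"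
    and e: "germ M x f = germ M x g"
  have "openin M W" using fg(1) by (simp add: holomorphic_fun_def)
  then have "x \<in> topspace M" using openin_subset x(1) by blast
  obtain N where N: "openin M N" "x \<in> N" "\<forall>y\<in>N. f y = g y"
    using germ_eqD[OF \<open>x \<in> topspace M\<close> e] by (elim exE conjE)
  have "germ M y f = germ M y g" if "y \<in> N" for y by (rule germ_eqI[OF N(1) that]) (rule bspec[OF N(3)])
  then have "\<forall>y\<in>N \<inter> W \<inter> V. germ M y f = germ M y g" by simp
  then show "\<exists>N. openin M N \<and> x \<in> N \<and> (\<forall>y\<in>N \<inter> W \<inter> V. germ M y f = germ M y g)" using N(1,2) by blast
qed

abbreviation "E \<equiv> gen_etale germ_sections"

text \<open>The topology of the structure sheaf is generated by the images of
  \<open>germ_sections\<close>, which brings it under the results on generated topologies.\<close>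

lemma manifold_space_simps:
  "base (manifold_space M n \<A>) = M" "ostalk (manifold_space M n \<A>) = R" "oetale (manifold_space M n \<A>) = E"
proof -
  have iff: "(U, s) \<in> germ_sections \<longleftrightarrow> (\<exists>f. s = (\<lambda>y. germ M y f) \<and> holomorphic_fun M n \<A> U f)" for U s
    by (simp add: germ_sections_def)
  have "{(\<lambda>y. (y, germ M y f)) ` W | W f. holomorphic_fun M n \<A> W f} =
      {(\<lambda>y. (y, s y)) ` U | U s. (U, s) \<in> germ_sections}"
  proof (intro Collect_cong iffI)
    fix S assume "\<exists>W f. S = (\<lambda>y. (y, germ M y f)) ` W \<and> holomorphic_fun M n \<A> W f"
    then obtain W f where "S = (\<lambda>y. (y, germ M y f)) ` W" "holomorphic_fun M n \<A> W f" by (elim exE conjE)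
    then show "\<exists>U s. S = (\<lambda>y. (y, s y)) ` U \<and> (U, s) \<in> germ_sections"
      by (intro exI[of _ W] exI[of _ "\<lambda>y. germ M y f"]) (simp only: iff, rule conjI, rule refl, rule exI[of _ f], simp)
  next
    fix S assume "\<exists>U s. S = (\<lambda>y. (y, s y)) ` U \<and> (U, s) \<in> germ_sections"
    then obtain U s f where "S = (\<lambda>y. (y, s y)) ` U" "s = (\<lambda>y. germ M y f)" "holomorphic_fun M n \<A> U f"
      unfolding iff by (elim exE conjE)
    then show "\<exists>W f. S = (\<lambda>y. (y, germ M y f)) ` W \<and> holomorphic_fun M n \<A> W f"
      by (intro exI[of _ U] exI[of _ f]) simp
  qed
  then show "oetale (manifold_space M n \<A>) = E" by (simp add: manifold_space_def gen_etale_def)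
qed (simp_all add: manifold_space_def)

lemma germ_section: "holomorphic_fun M n \<A> W f \<Longrightarrow> (\<lambda>y. germ M y f) \<in> sections M E W"
  by (rule gen_etale_sections[OF germ_section_family]) (auto simp: germ_sections_def)

lemma section_local_germ:
  assumes "openin M U" "r \<in> sections M E U" "x \<in> U"
  obtains V f where "openin M V" "x \<in> V" "V \<subseteq> U" "holomorphic_fun M n \<A> V f" "\<And>y. y \<in> V \<Longrightarrow> r y = germ M y f"
proof -
  note es = gen_etale_space[OF germ_section_family]
  obtain W f where W: "r x = germ M x f" "x \<in> W" "holomorphic_fun M n \<A> W f"
    by (rule germ_carrierE[OF sections_mem[OF es assms]])
  have o: "openin M W" using W(3) by (simp add: holomorphic_fun_def)
  obtain V where V: "openin M V" "x \<in> V" "V \<subseteq> U \<inter> W" "\<And>y. y \<in> V \<Longrightarrow> r y = germ M y f"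
    by (rule sections_agree[OF es assms(1,2) o germ_section[OF W(3)] assms(3) W(2,1)]) (rule that)
  then show thesis using that[OF V(1,2) _ holomorphic_restrict[OF W(3) V(1)]] by blast
qed

text \<open>Locally both sections are germs of holomorphic functions on a common open set, so an
  operation on germs induced by one on functions preserves sections. It is applied to sum and
  product.\<close>

lemma section_binop:
  assumes U: "openin M U" and r: "r \<in> sections M E U" and s: "s \<in> sections M E U"
    and h: "\<And>V f g. holomorphic_fun M n \<A> V f \<Longrightarrow> holomorphic_fun M n \<A> V g \<Longrightarrow> holomorphic_fun M n \<A> V (\<lambda>y. h (f y) (g y))"
    and op: "\<And>y f g. y \<in> topspace M \<Longrightarrow> op y (germ M y f) (germ M y g) = germ M y (\<lambda>y. h (f y) (g y))"
  shows "(\<lambda>y. op y (r y) (s y)) \<in> sections M E U"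
proof (rule sections_local[OF U])
  fix x assume x: "x \<in> U"
  obtain V f where V: "openin M V" "x \<in> V" "V \<subseteq> U" "holomorphic_fun M n \<A> V f" "\<And>y. y \<in> V \<Longrightarrow> r y = germ M y f"
    by (rule section_local_germ[OF U r x]) (rule that)
  obtain W g where W: "openin M W" "x \<in> W" "W \<subseteq> U" "holomorphic_fun M n \<A> W g" "\<And>y. y \<in> W \<Longrightarrow> s y = germ M y g"
    by (rule section_local_germ[OF U s x]) (rule that)
  have o: "openin M (V \<inter> W)" using V(1) W(1) by blast
  have "holomorphic_fun M n \<A> (V \<inter> W) (\<lambda>y. h (f y) (g y))"
    by (intro h holomorphic_restrict[OF V(4) o] holomorphic_restrict[OF W(4) o]) auto
  from germ_section[OF this] have "(\<lambda>y. op y (r y) (s y)) \<in> sections M E (V \<inter> W)"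
  proof (rule sections_cong[OF o])
    fix y assume y: "y \<in> V \<inter> W"
    then have "y \<in> topspace M" using openin_subset[OF o] by blast
    then show "germ M y (\<lambda>y. h (f y) (g y)) = op y (r y) (s y)" using op V(5) W(5) y by simp
  qed
  then show "\<exists>V. openin M V \<and> x \<in> V \<and> (\<lambda>y. op y (r y) (s y)) \<in> sections M E V" using o V(2) W(2) by blast
qed

lemma section_const:
  assumes "openin M U" "\<And>y. y \<in> topspace M \<Longrightarrow> k y = germ M y (\<lambda>_. c)"
  shows "k \<in> sections M E U"
  by (rule sections_cong[OF assms(1) germ_section[OF holomorphic_const[OF assms(1), of c]]])
    (use assms(2) openin_subset[OF assms(1)] in auto)

lemma manifold_space_ringed: "ringed (manifold_space M n \<A>)"
proof (rule ringed.intro; unfold manifold_space_simps)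
  show "etale_space M (\<lambda>x. carrier (R x)) E" by (rule gen_etale_space[OF germ_section_family])
  show "cring (R x)" if "x \<in> topspace M" for x by (rule germ_ring_cring[OF that])
  fix U assume U: "openin M U"
  show "(\<lambda>y. r y \<oplus>\<^bsub>R y\<^esub> s y) \<in> sections M E U" if "r \<in> sections M E U" "s \<in> sections M E U" for r s
    by (rule section_binop[where h = "(+)" and op = "\<lambda>y. add (R y)", OF U that holomorphic_add germ_ring_ops(1)])
  show "(\<lambda>y. r y \<otimes>\<^bsub>R y\<^esub> s y) \<in> sections M E U" if "r \<in> sections M E U" "s \<in> sections M E U" for r s
    by (rule section_binop[where h = "(*)" and op = "\<lambda>y. mult (R y)", OF U that holomorphic_mult germ_ring_ops(2)])
  show "(\<lambda>y. \<zero>\<^bsub>R y\<^esub>) \<in> sections M E U" by (rule section_const[OF U germ_ring_ops(3)])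
  show "(\<lambda>y. \<one>\<^bsub>R y\<^esub>) \<in> sections M E U" by (rule section_const[OF U germ_ring_ops(4)])
qed

end

text \<open>An infinite set is equipotent to its square.\<close>

lemma inj_pairing_exists:
  assumes "infinite (UNIV :: 'u set)"
  shows "\<exists>pr :: 'u \<times> 'u \<Rightarrow> 'u. inj pr"
  using card_of_Times_same_infinite[OF assms] unfolding card_of_ordIso[symmetric] bij_betw_def by auto

theorem proposition12:
  fixes M :: "'x topology" and n :: nat and \<A> :: "'x chart set"
    and X :: "('x, ('x \<Rightarrow> complex) set) ringed_space"
    and B C Q F G :: "('x, ('x \<Rightarrow> complex) set, 'u) osheaf"
    and \<pi> :: "('x, 'u) smap" and p :: nat
    and U :: "('x, ('x \<Rightarrow> complex) set, 'u) extn set"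
  assumes "compact_kaehler_manifold M n \<A>"
    and "X = manifold_space M n \<A>"
    and "\<exists>e :: complex \<Rightarrow> 'u. inj e"
    and "coherent X C" and "coherent X B" and "subsheaf X B C"
    and "quotient_sheaf X C B Q \<pi>"
    and "U = ext_class X (short B (sheaf_id X B) C \<pi> Q)"
    and "coherent X F" and "coherent X G"
    and "p \<ge> 1"
  shows "(\<forall>R\<in>Ext X p B G.
            ext_star X R U \<in> Ext X (p + 1) Q G \<and>
            (R \<in> ext_pull X (sheaf_id X B) B ` Ext X p C G \<longleftrightarrow>
             ext_star X R U = ext_zero X (p + 1) Q G)) \<and>
         (\<forall>T\<in>Ext X p F Q.
            ext_star X U T \<in> Ext X (p + 1) F B \<and>
            (T \<in> ext_push X \<pi> Q ` Ext X p F C \<longleftrightarrow>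
             ext_star X U T = ext_zero X (p + 1) F B))"
proof -
  have "complex_mfd M n \<A>"
    using assms(1) by (simp add: complex_mfd_def compact_kaehler_manifold_def kaehler_manifold_def)
  then have X: "ringed X" unfolding assms(2) by (rule complex_mfd.manifold_space_ringed)
  \<comment> \<open>The embedded complex numbers make the type of germs infinite, so that pairs of
    germs can be coded in it and direct sums exist.\<close>
  have "infinite (UNIV :: 'u set)"
    using assms(3) finite_imageD infinite_UNIV_char_0[where 'a = complex] rev_finite_subset by blast
  then obtain pr :: "'u \<times> 'u \<Rightarrow> 'u" where "inj pr" using inj_pairing_exists by blast
  with X interpret ringed_coded X pr by (simp add: ringed_coded_def ringed_coded_axioms_def)
  note ses = quotient_ases[OF assms(4-7)]
  have "U = ext_class X (sext (B, (B, sheaf_id X B), C, (C, \<pi>), Q))"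
    by (simp add: assms(8) sext_simp)
  then show ?thesis using Ext_extends[OF ses] Ext_lifts[OF ses] by simp
qed

end
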